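(* Assume that $\dim\mathfrak{A}_1<\infty$, that $\sigma_1\subset\Delta_0$, that there is an admissible contour $\Gamma\subset D^\pm$ with $\mathcal{V}_0(B,\Gamma)<\frac14d^2(\Gamma)$, and that there is $c_0>0$ such that $$\langle K_B'(\mu)x,x\rangle\ge c_0\|x\|^2\quad\text{for any }\mu\in\Delta_0\cap\mathcal{O}_{r_0(B)}(\sigma_1)\text{ and any }x\in\mathfrak{A}_1.$$ Then, for $l=\pm1$, the operator $Z^{(l)}=A_1+X^{(l)}$ has no spectrum in the corresponding complex domain $D^l$ and, thus, all the eigenvalues of $Z^{(l)}$ are simultaneously eigenvalues of the original (not continued) Schur complement $M_1(\cdot)$ and, hence, eigenvalues of $L$.
   Context: Let $A_0$, $A_1$ be self-adjoint operators in complex Hilbert spaces $\mathfrak{A}_0$, $\mathfrak{A}_1$, with spectra $\sigma_0$, $\sigma_1$, and let $B$ be a bounded operator from $\mathfrak{A}_1$ to $\mathfrak{A}_0$. On $\mathfrak{A}_0\oplus\mathfrak{A}_1$ set $$L=\begin{pmatrix}A_0&B\\-B^*&A_1\end{pmatrix},\quad \operatorname{Dom}(L)=\operatorname{Dom}(A_0)\oplus\operatorname{Dom}(A_1).$$ $\mathcal{B}(\mathfrak{A}_1)$ denotes the bounded operators on $\mathfrak{A}_1$. Standing assumption: the whole spectrum $\sigma_0$ is absolutely continuous and equals the closure of a single interval $\Delta_0=(\mu_0^{(1)},\mu_0^{(2)})$, $-\infty\le\mu_0^{(1)}<\mu_0^{(2)}\le\infty$. The (original) Schur complement is $M_1(z)=A_1-z+B^*(A_0-z)^{-1}B$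 for $z\in\mathbb{C}\setminus\sigma_0$; a point $z\in\mathbb{C}\setminus\sigma_0$ is an eigenvalue of $M_1(\cdot)$ if $M_1(z)u=0$ for some nonzero $u$. Let $\mathsf{E}^0(\mu)=\mathsf{E}_{A_0}((-\infty,\mu))$ be the spectral function of $A_0$ and $K_B(\mu)=B^*\mathsf{E}^0(\mu)B$. It is assumed that $K_B$ is differentiable on $\Delta_0$ in operator norm and that its derivative $K_B'$ admits analytic continuation from $\Delta_0$ to a simply connected domain $D^-\subset\mathbb{C}^-$ (lower half-plane) whose boundary includes $\Delta_0$. Then $K_B'$ also continues analytically to the domain $D^+\subset\mathbb{C}^+$ symmetric to $D^-$ about the real axis, with $[K_B'(\mu)]^*=K_B'(\bar\mu)$ on $D^\pm$. If an end point $\mu_0^{(k)}$ is finite, it is assumed that $\|K_B'(\mu)\|\le C|\mu-\mu_0^{(k)}|^\gamma$ for $\mu\in D^\pm$ near $\mu_0^{(k)}$, with some $C>0$, $\gamma\in(-1,0]$. The index $l=\pm1$ in $D^l$ is identified with the sign $\pm$. A contour $\Gamma^l$ is a rectifiable Jordan curve obtained by a continuous deformation of $\Delta_0$, lying in $D^l$, with the (finite) end points fixed, oriented from $\mu_0^{(1)}$ to $\mu_0^{(2)}$. It is called admissible if $\mathcal{V}_0(B,\Gamma^l):=\int_{\Gamma^l}|d\mu|\,\|K_B'(\mu)\|<\infty$ ($|d\mu|$ is arc length). Put $d(\Gamma^l)=\operatorname{dist}(\sigma_1,\Gamma^l)$. For $Z=A_1+X$, $X\in\mathcal{B}(\mathfrak{A}_1)$,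 with spectrum not intersecting $\Gamma^l$, set $W_1(Z,\Gamma^l)=-\int_{\Gamma^l}d\mu\,K_B'(\mu)(Z-\mu)^{-1}$. For an admissible $\Gamma^l\subset D^l$ with $\mathcal{V}_0(B,\Gamma^l)<\frac14d^2(\Gamma^l)$ (by symmetry of $D^+$ and $D^-$, if such a contour exists for one value of $l$ it exists for both), the operator $X^{(l)}$ is the unique solution $X\in\mathcal{B}(\mathfrak{A}_1)$ of $X=W_1(A_1+X,\Gamma^l)$ with $\|X\|\le r_{\min}(\Gamma^l)$, where $r_{\min}(\Gamma^l)=\frac{d(\Gamma^l)}2-\sqrt{\frac{d^2(\Gamma^l)}4-\mathcal{V}_0(B,\Gamma^l)}$; for fixed $l$ it does not depend on the choice of such a contour. Further, $$r_0(B)=\inf\{r_{\min}(\Gamma^l)\,:\,\Gamma^l\subset D^l\text{ admissible},\ d^2(\Gamma^l)-4\mathcal{V}_0(B,\Gamma^l)>0\}$$ (by symmetry this does not depend on $l$). For $r\ge0$, $\mathcal{O}_r(\sigma)=\{z\in\mathbb{C}:\operatorname{dist}(z,\sigma)\le r\}$.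
   Formalization: At an infinite end point of Δ_0, the deformation to a contour must tend to infinity uniformly and have cross-cuts arbitrarily far out with arbitrarily small variation of K_B'; otherwise X^(l) can depend on the contour and the claim can fail. Bounded Δ_0 is unaffected. *)

theory Defs
  imports "HOL-Analysis.Analysis"
begin

section \<open>Complex Hilbert spaces\<close>

class complex_normed_vector = real_normed_vector +
  fixes scaleC :: "complex \<Rightarrow> 'a \<Rightarrow> 'a"  (infixr \<open>*\<^sub>C\<close> 75)
  assumes scaleC_add_right: "c *\<^sub>C (x + y) = c *\<^sub>C x + c *\<^sub>C y"
    and scaleC_add_left: "(c + d) *\<^sub>C x = c *\<^sub>C x + d *\<^sub>C x"
    and scaleC_scaleC: "c *\<^sub>C d *\<^sub>C x = (c * d) *\<^sub>C x"
    and scaleC_of_real: "complex_of_real r *\<^sub>C x = r *\<^sub>R x"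
    and norm_scaleC: "norm (c *\<^sub>C x) = cmod c * norm x"

global_interpretation complex_vector: vector_space "scaleC :: complex \<Rightarrow> 'a \<Rightarrow> 'a::complex_normed_vector"
proof
  show "1 *\<^sub>C x = x" for x :: 'a
    using scaleC_of_real[of 1 x] by simp
qed (simp_all add: scaleC_add_right scaleC_add_left scaleC_scaleC)

text \<open>The inner product \<open>cinner\<close> is linear in its first argument.\<close>

class complex_hilbert_space = complex_normed_vector + real_inner + complete_space +
  fixes cinner :: "'a \<Rightarrow> 'a \<Rightarrow> complex"
  assumes cinner_commute: "cinner x y = cnj (cinner y x)"
    and cinner_add_left: "cinner (x + y) z = cinner x z + cinner y z"
    and cinner_scaleC_left: "cinner (c *\<^sub>C x) y = c * cinner x y"
    and Re_cinner: "Re (cinner x y) = inner x y"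

instantiation complex :: complex_hilbert_space
begin
definition scaleC_complex :: "complex \<Rightarrow> complex \<Rightarrow> complex"
  where "scaleC_complex c x = c * x"
definition cinner_complex :: "complex \<Rightarrow> complex \<Rightarrow> complex"
  where "cinner_complex x y = x * cnj y"
instance
  by standard (auto simp: scaleC_complex_def cinner_complex_def algebra_simps norm_mult
      scaleR_conv_of_real inner_complex_def)
end

instantiation prod :: (complex_normed_vector, complex_normed_vector) complex_normed_vector
begin
definition scaleC_prod :: "complex \<Rightarrow> 'a \<times> 'b \<Rightarrow> 'a \<times> 'b"
  where "scaleC_prod c p = (c *\<^sub>C fst p, c *\<^sub>C snd p)"
instance
proof
  show "norm (c *\<^sub>C p) = cmod c * norm p" for c and p :: "'a \<times> 'b"
  proof -
    have "(cmod c * norm (fst p))\<^sup>2 + (cmod c * norm (snd p))\<^sup>2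
        = (cmod c)\<^sup>2 * ((norm (fst p))\<^sup>2 + (norm (snd p))\<^sup>2)"
      by (simp add: power_mult_distrib distrib_left)
    then show ?thesis
      by (simp add: scaleC_prod_def norm_prod_def norm_scaleC real_sqrt_mult)
  qed
qed (auto simp: scaleC_prod_def scaleC_add_right scaleC_add_left scaleC_scaleC scaleC_of_real
    scaleR_prod_def)
end

instantiation prod :: (complex_hilbert_space, complex_hilbert_space) complex_hilbert_space
begin
definition cinner_prod :: "'a \<times> 'b \<Rightarrow> 'a \<times> 'b \<Rightarrow> complex"
  where "cinner_prod p q = cinner (fst p) (fst q) + cinner (snd p) (snd q)"
instance
proof
  show "cinner p q = cnj (cinner q p)" for p q :: "'a \<times> 'b"
    using cinner_commute[of "fst p" "fst q"] cinner_commute[of "snd p" "snd q"]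
    by (simp add: cinner_prod_def)
qed (simp_all add: cinner_prod_def scaleC_prod_def cinner_add_left cinner_scaleC_left Re_cinner
    inner_prod_def algebra_simps)
end

lemma bounded_linear_scaleC_right:
  "bounded_linear (\<lambda>x. c *\<^sub>C x :: 'a::complex_normed_vector)"
proof
  show "c *\<^sub>C (r *\<^sub>R x) = r *\<^sub>R (c *\<^sub>C x)" for r and x :: 'a
    by (simp add: scaleC_of_real[symmetric] scaleC_scaleC mult.commute)
  show "\<exists>K. \<forall>x::'a. norm (c *\<^sub>C x) \<le> norm x * K"
    by (rule exI[of _ "cmod c"]) (simp add: norm_scaleC mult.commute)
qed (simp add: scaleC_add_right)

instantiation blinfun :: (real_normed_vector, complex_normed_vector) complex_normed_vector
begin
lift_definition scaleC_blinfun :: "complex \<Rightarrow> 'a \<Rightarrow>\<^sub>L 'b \<Rightarrow> 'a \<Rightarrow>\<^sub>L 'b"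
  is "\<lambda>c f x. c *\<^sub>C f x"
  by (rule bounded_linear_compose[OF bounded_linear_scaleC_right])
instance
proof
  show "norm (c *\<^sub>C f) = cmod c * norm f" for c and f :: "'a \<Rightarrow>\<^sub>L 'b"
  proof (cases "c = 0")
    case True
    then have "c *\<^sub>C f = 0"
      by transfer (use scaleC_of_real[of 0] in auto)
    with True show ?thesis by simp
  next
    case False
    have le: "norm (a *\<^sub>C g) \<le> cmod a * norm g" for a and g :: "'a \<Rightarrow>\<^sub>L 'b"
    proof (rule norm_blinfun_bound)
      show "norm ((a *\<^sub>C g) x) \<le> cmod a * norm g * norm x" for x
        using mult_left_mono[OF norm_blinfun[of g x], of "cmod a"]
        by (simp add: scaleC_blinfun.rep_eq norm_scaleC mult.assoc)
    qed simp
    have "f = inverse c *\<^sub>C (c *\<^sub>C f)"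
      using False
      by (intro blinfun_eqI) (simp add: scaleC_blinfun.rep_eq)
    then have "norm f \<le> cmod (inverse c) * norm (c *\<^sub>C f)"
      using le[of "inverse c" "c *\<^sub>C f"] by simp
    then have "cmod c * norm f \<le> norm (c *\<^sub>C f)"
      using False by (simp add: norm_inverse norm_divide field_simps)
    with le[of c f] show ?thesis by simp
  qed
qed (transfer; simp add: scaleC_add_right scaleC_add_left scaleC_scaleC scaleC_of_real fun_eq_iff)+
end

section \<open>Operators\<close>

text \<open>The bounded operators \<open>\<B>(H)\<close> between complex Hilbert spaces are the elements of
  \<open>'a \<Rightarrow>\<^sub>L 'b\<close>, a type of real-linear maps, that satisfy \<open>complex_linear\<close>; the norm of
  \<open>'a \<Rightarrow>\<^sub>L 'b\<close> is the operator norm.\<close>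

definition complex_linear :: "('a::complex_normed_vector \<Rightarrow>\<^sub>L 'b::complex_normed_vector) \<Rightarrow> bool"
  where "complex_linear T \<longleftrightarrow> (\<forall>c x. T (c *\<^sub>C x) = c *\<^sub>C T x)"

definition adj :: "('a::complex_hilbert_space \<Rightarrow>\<^sub>L 'b::complex_hilbert_space) \<Rightarrow> ('b \<Rightarrow>\<^sub>L 'a)"
  where "adj T = (THE S. \<forall>x y. cinner (blinfun_apply T x) y = cinner x (blinfun_apply S y))"

text \<open>An unbounded operator is given by its domain and a map whose values off the domain are
  irrelevant.  The last clause of \<open>self_adjoint\<close> says that the graphs of the operator and of its
  adjoint coincide.\<close>

definition self_adjoint :: "'a::complex_hilbert_space set \<Rightarrow> ('a \<Rightarrow> 'a) \<Rightarrow> bool"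
  where "self_adjoint domA A \<longleftrightarrow>
    complex_vector.subspace domA \<and> closure domA = UNIV \<and>
    (\<forall>x\<in>domA. \<forall>y\<in>domA. A (x + y) = A x + A y) \<and> (\<forall>c. \<forall>x\<in>domA. A (c *\<^sub>C x) = c *\<^sub>C A x) \<and>
    (\<forall>y w. (\<forall>x\<in>domA. cinner (A x) y = cinner x w) \<longleftrightarrow> y \<in> domA \<and> A y = w)"

definition resolvent_set :: "'a::complex_hilbert_space set \<Rightarrow> ('a \<Rightarrow> 'a) \<Rightarrow> complex set"
  where "resolvent_set domA A =
    {z. bij_betw (\<lambda>x. A x - z *\<^sub>C x) domA UNIV \<and>
        (\<exists>M. \<forall>x\<in>domA. norm x \<le> M * norm (A x - z *\<^sub>C x))}"

definition spectrum :: "'a::complex_hilbert_space set \<Rightarrow> ('a \<Rightarrow> 'a) \<Rightarrow> complex set"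
  where "spectrum domA A = - resolvent_set domA A"

definition resolvent :: "'a::complex_hilbert_space set \<Rightarrow> ('a \<Rightarrow> 'a) \<Rightarrow> complex \<Rightarrow> 'a \<Rightarrow> 'a"
  where "resolvent domA A z = inv_into domA (\<lambda>x. A x - z *\<^sub>C x)"

definition eigenvalue :: "'a::complex_hilbert_space set \<Rightarrow> ('a \<Rightarrow> 'a) \<Rightarrow> complex \<Rightarrow> bool"
  where "eigenvalue domA A z \<longleftrightarrow> (\<exists>u\<in>domA. u \<noteq> 0 \<and> A u = z *\<^sub>C u)"

definition block_op :: "('a::complex_hilbert_space \<Rightarrow> 'a) \<Rightarrow> ('b::complex_hilbert_space \<Rightarrow> 'b)
    \<Rightarrow> ('b \<Rightarrow>\<^sub>L 'a) \<Rightarrow> 'a \<times> 'b \<Rightarrow> 'a \<times> 'b"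
  where "block_op A0 A1 B = (\<lambda>(x, y). (A0 x + B y, A1 y - adj B x))"

definition schur_complement :: "'a::complex_hilbert_space set \<Rightarrow> ('a \<Rightarrow> 'a)
    \<Rightarrow> ('b::complex_hilbert_space \<Rightarrow> 'b) \<Rightarrow> ('b \<Rightarrow>\<^sub>L 'a) \<Rightarrow> complex \<Rightarrow> 'b \<Rightarrow> 'b"
  where "schur_complement dom0 A0 A1 B z u =
    A1 u - z *\<^sub>C u + adj B (resolvent dom0 A0 z (B u))"

definition schur_eigenvalue :: "'a::complex_hilbert_space set \<Rightarrow> ('a \<Rightarrow> 'a)
    \<Rightarrow> 'b::complex_hilbert_space set \<Rightarrow> ('b \<Rightarrow> 'b) \<Rightarrow> ('b \<Rightarrow>\<^sub>L 'a) \<Rightarrow> complex \<Rightarrow> bool"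
  where "schur_eigenvalue dom0 A0 dom1 A1 B z \<longleftrightarrow>
    z \<notin> spectrum dom0 A0 \<and> (\<exists>u\<in>dom1. u \<noteq> 0 \<and> schur_complement dom0 A0 A1 B z u = 0)"

section \<open>The spectral measure\<close>

definition scalar_measure :: "(real set \<Rightarrow> 'a::complex_hilbert_space \<Rightarrow>\<^sub>L 'a) \<Rightarrow> 'a \<Rightarrow> real measure"
  where "scalar_measure E x = measure_of UNIV (sets borel) (\<lambda>S. ennreal (Re (cinner (E S x) x)))"

text \<open>\<open>E\<close> is a projection-valued Borel measure on the line with \<open>A = \<integral> t dE(t)\<close>.  By the spectral
  theorem there is exactly one such \<open>E\<close> (up to its values on non-Borel sets) for a self-adjoint
  operator.  By polarization the quadratic form determines \<open>A\<close> on its domain.\<close>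

definition spectral_measure :: "'a::complex_hilbert_space set \<Rightarrow> ('a \<Rightarrow> 'a)
    \<Rightarrow> (real set \<Rightarrow> 'a \<Rightarrow>\<^sub>L 'a) \<Rightarrow> bool"
  where "spectral_measure domA A E \<longleftrightarrow>
    (\<forall>S\<in>sets borel. complex_linear (E S) \<and> E S o\<^sub>L E S = E S \<and>
      (\<forall>x y. cinner (E S x) y = cinner x (E S y))) \<and>
    E UNIV = id_blinfun \<and>
    (\<forall>S\<in>sets borel. \<forall>T\<in>sets borel. E (S \<inter> T) = E S o\<^sub>L E T) \<and>
    (\<forall>F x. range F \<subseteq> sets borel \<longrightarrow> disjoint_family F \<longrightarrow>
      (\<lambda>n. E (F n) x) sums E (\<Union>n::nat. F n) x) \<and>
    domA = {x. (\<integral>\<^sup>+ t. ennreal (t\<^sup>2) \<partial>scalar_measure E x) < \<infinity>} \<and>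
    (\<forall>x\<in>domA. cinner (A x) x = complex_of_real (\<integral>t. t \<partial>scalar_measure E x))"

text \<open>The absolutely continuous subspace is the whole space.\<close>

definition ac_spectrum :: "(real set \<Rightarrow> 'a::complex_hilbert_space \<Rightarrow>\<^sub>L 'a) \<Rightarrow> bool"
  where "ac_spectrum E \<longleftrightarrow> (\<forall>x. absolutely_continuous lborel (scalar_measure E x))"

definition K_op :: "(real set \<Rightarrow> 'a::complex_hilbert_space \<Rightarrow>\<^sub>L 'a)
    \<Rightarrow> ('b::complex_hilbert_space \<Rightarrow>\<^sub>L 'a) \<Rightarrow> real \<Rightarrow> 'b \<Rightarrow>\<^sub>L 'b"
  where "K_op E B \<mu> = adj B o\<^sub>L E {..<\<mu>} o\<^sub>L B"

text \<open>Analyticity (on a neighbourhood of \<open>S\<close>) of vector-valued functions; the library notion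
  \<open>analytic_on\<close> covers complex values only.\<close>

definition vector_analytic_on :: "(complex \<Rightarrow> 'c::complex_normed_vector) \<Rightarrow> complex set \<Rightarrow> bool"
  where "vector_analytic_on f S \<longleftrightarrow>
    (\<forall>z\<in>S. \<exists>e>0. \<forall>w\<in>ball z e. \<exists>T. (f has_derivative (\<lambda>h. h *\<^sub>C T)) (at w))"

section \<open>Contours\<close>

text \<open>\<open>D_side Dm l\<close> is \<open>D\<^sup>l\<close>, where \<open>Dm = D\<^sup>-\<close>.\<close>

definition D_side :: "complex set \<Rightarrow> int \<Rightarrow> complex set"
  where "D_side Dm l = (if l = 1 then cnj ` Dm else Dm)"

text \<open>Line integrals are taken over (locally) absolutely continuous parametrizations, which every
  rectifiable curve has; \<open>tangent\<close> is the almost everywhere defined derivative.  If \<open>I\<close> is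
  unbounded then only the pieces of the curve over bounded subsets of \<open>I\<close> have finite length.\<close>

definition tangent :: "(real \<Rightarrow> complex) \<Rightarrow> real set \<Rightarrow> real \<Rightarrow> complex"
  where "tangent \<gamma> I s = vector_derivative \<gamma> (at s within I)"

definition rectifiable_on :: "(real \<Rightarrow> complex) \<Rightarrow> real set \<Rightarrow> bool"
  where "rectifiable_on \<gamma> I \<longleftrightarrow>
    (\<forall>a b. tangent \<gamma> I absolutely_integrable_on (I \<inter> {a..b})) \<and>
    (\<forall>a\<in>I. \<forall>b\<in>I. a \<le> b \<longrightarrow> (tangent \<gamma> I has_integral (\<gamma> b - \<gamma> a)) {a..b})"

definition finite_variation :: "(complex \<Rightarrow> 'c::real_normed_vector) \<Rightarrow> (real \<Rightarrow> complex) \<Rightarrow> real set \<Rightarrow> bool"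
  where "finite_variation K \<gamma> I \<longleftrightarrow> (\<lambda>s. norm (K (\<gamma> s)) * cmod (tangent \<gamma> I s)) integrable_on I"

definition variation :: "(complex \<Rightarrow> 'c::real_normed_vector) \<Rightarrow> (real \<Rightarrow> complex) \<Rightarrow> real set \<Rightarrow> real"
  where "variation K \<gamma> I = integral I (\<lambda>s. norm (K (\<gamma> s)) * cmod (tangent \<gamma> I s))"

text \<open>Behaviour of a deformation \<open>H t s\<close> (\<open>t\<close> is the deformation parameter, \<open>s\<close> runs through the
  interval) when \<open>s\<close> tends along \<open>F\<close> to the end point \<open>m\<close> of the interval.  A finite end point is
  fixed.  Near an infinite end point the curves escape to infinity, and deforming the truncated
  curve sweeps cross-cuts \<open>t \<mapsto> H t s\<close> whose \<open>K\<close>-variation is not bounded away from 0.  The last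
  requirement takes the role that the growth bound on \<open>K\<close> plays at a finite end point: without it
  Cauchy's theorem fails between two curves along which \<open>K\<close> is integrable.  For instance
  \<open>K(\<mu>) = exp(\<pi>\<mu>/2 - exp(\<pi>\<mu>))\<close> satisfies \<open>K(\<mu> - 2\<i>) = - K(\<mu>)\<close>, hence has integrals of opposite
  sign over \<open>Im \<mu> = 0\<close> and \<open>Im \<mu> = -2\<close>.\<close>

definition end_condition :: "(complex \<Rightarrow> 'c::real_normed_vector) \<Rightarrow> (real \<Rightarrow> real \<Rightarrow> complex)
    \<Rightarrow> real filter \<Rightarrow> ereal \<Rightarrow> bool"
  where "end_condition K H F m \<longleftrightarrow>
    (if \<bar>m\<bar> \<noteq> \<infinity>
     then uniform_limit {0..1} (\<lambda>s t. H t s) (\<lambda>t. complex_of_real (real_of_ereal m)) F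
     else (\<forall>R. \<forall>\<^sub>F s in F. \<forall>t\<in>{0..1}. R \<le> cmod (H t s)) \<and>
          (\<forall>\<epsilon>>0. \<exists>\<^sub>F s in F. rectifiable_on (\<lambda>t. H t s) {0..1} \<and>
             finite_variation K (\<lambda>t. H t s) {0..1} \<and> variation K (\<lambda>t. H t s) {0..1} < \<epsilon>))"

text \<open>A contour is parametrized by the interval \<open>(m1, m2)\<close> from which it is obtained by a
  continuous deformation.  The filters are \<open>s \<rightarrow> m1+\<close> and \<open>s \<rightarrow> m2-\<close>, infinite end points included.\<close>

definition contour :: "(complex \<Rightarrow> 'c::real_normed_vector) \<Rightarrow> ereal \<Rightarrow> ereal \<Rightarrow> complex set
    \<Rightarrow> (real \<Rightarrow> complex) \<Rightarrow> bool"
  where "contour K m1 m2 D \<gamma> \<longleftrightarrow>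
    \<gamma> ` einterval m1 m2 \<subseteq> D \<and> inj_on \<gamma> (einterval m1 m2) \<and> rectifiable_on \<gamma> (einterval m1 m2) \<and>
    (\<exists>H. continuous_on ({0..1} \<times> einterval m1 m2) (\<lambda>(t, s). H t s) \<and>
      (\<forall>t\<in>{0..1}. \<forall>s\<in>einterval m1 m2. H t s \<in> D \<union> complex_of_real ` einterval m1 m2) \<and>
      (\<forall>s\<in>einterval m1 m2. H 0 s = complex_of_real s \<and> H 1 s = \<gamma> s) \<and>
      end_condition K H (filtermap real_of_ereal (at_right m1)) m1 \<and>
      end_condition K H (filtermap real_of_ereal (at_left m2)) m2)"

definition admissible :: "(complex \<Rightarrow> 'c::real_normed_vector) \<Rightarrow> ereal \<Rightarrow> ereal \<Rightarrow> complex set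
    \<Rightarrow> (real \<Rightarrow> complex) \<Rightarrow> bool"
  where "admissible K m1 m2 D \<gamma> \<longleftrightarrow>
    contour K m1 m2 D \<gamma> \<and> finite_variation K \<gamma> (einterval m1 m2)"

definition contour_dist :: "complex set \<Rightarrow> ereal \<Rightarrow> ereal \<Rightarrow> (real \<Rightarrow> complex) \<Rightarrow> real"
  where "contour_dist \<sigma> m1 m2 \<gamma> = setdist \<sigma> (\<gamma> ` einterval m1 m2)"

definition small_contour :: "(complex \<Rightarrow> 'c::real_normed_vector) \<Rightarrow> ereal \<Rightarrow> ereal \<Rightarrow> complex set
    \<Rightarrow> complex set \<Rightarrow> (real \<Rightarrow> complex) \<Rightarrow> bool"
  where "small_contour K m1 m2 \<sigma> D \<gamma> \<longleftrightarrow>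
    admissible K m1 m2 D \<gamma> \<and> variation K \<gamma> (einterval m1 m2) < (contour_dist \<sigma> m1 m2 \<gamma>)\<^sup>2 / 4"

definition r_min :: "(complex \<Rightarrow> 'c::real_normed_vector) \<Rightarrow> ereal \<Rightarrow> ereal \<Rightarrow> complex set
    \<Rightarrow> (real \<Rightarrow> complex) \<Rightarrow> real"
  where "r_min K m1 m2 \<sigma> \<gamma> = contour_dist \<sigma> m1 m2 \<gamma> / 2 -
    sqrt ((contour_dist \<sigma> m1 m2 \<gamma>)\<^sup>2 / 4 - variation K \<gamma> (einterval m1 m2))"

text \<open>By symmetry the two values of \<open>l\<close> give the same infimum.\<close>

definition r_zero :: "(complex \<Rightarrow> 'c::real_normed_vector) \<Rightarrow> ereal \<Rightarrow> ereal \<Rightarrow> complex set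
    \<Rightarrow> complex set \<Rightarrow> real"
  where "r_zero K m1 m2 \<sigma> Dm =
    Inf {r_min K m1 m2 \<sigma> \<gamma> | l \<gamma>. l \<in> {1, -1} \<and> small_contour K m1 m2 \<sigma> (D_side Dm l) \<gamma>}"

definition W1 :: "(complex \<Rightarrow> 'b::complex_hilbert_space \<Rightarrow>\<^sub>L 'b) \<Rightarrow> ereal \<Rightarrow> ereal
    \<Rightarrow> 'b set \<Rightarrow> ('b \<Rightarrow> 'b) \<Rightarrow> (real \<Rightarrow> complex) \<Rightarrow> 'b \<Rightarrow>\<^sub>L 'b"
  where "W1 K m1 m2 domA Z \<gamma> =
    - integral (einterval m1 m2)
        (\<lambda>s. tangent \<gamma> (einterval m1 m2) s *\<^sub>C (K (\<gamma> s) o\<^sub>L Blinfun (resolvent domA Z (\<gamma> s))))"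

definition X_op :: "(complex \<Rightarrow> 'b::complex_hilbert_space \<Rightarrow>\<^sub>L 'b) \<Rightarrow> ereal \<Rightarrow> ereal
    \<Rightarrow> 'b set \<Rightarrow> ('b \<Rightarrow> 'b) \<Rightarrow> complex set \<Rightarrow> int \<Rightarrow> 'b \<Rightarrow>\<^sub>L 'b"
  where "X_op K m1 m2 domA A1 Dm l =
    (THE X. complex_linear X \<and>
      (\<exists>\<gamma>. small_contour K m1 m2 (spectrum domA A1) (D_side Dm l) \<gamma> \<and>
        spectrum domA (\<lambda>u. A1 u + X u) \<inter> \<gamma> ` einterval m1 m2 = {} \<and>
        X = W1 K m1 m2 domA (\<lambda>u. A1 u + X u) \<gamma> \<and>
        norm X \<le> r_min K m1 m2 (spectrum domA A1) \<gamma>))"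

definition closed_nbhd :: "real \<Rightarrow> complex set \<Rightarrow> complex set"
  where "closed_nbhd r \<sigma> = {z. infdist z \<sigma> \<le> r}"

end

theory Submission
  imports Defs "HOL-Complex_Analysis.Complex_Analysis"
begin

text \<open>Let \<open>l = 1\<close>, so that \<open>D l\<close> lies in the upper half-plane, and let \<open>\<gamma>\<close> be a contour in it with
  \<open>var \<gamma> < (dst \<gamma>)\<^sup>2 / 4\<close>, where \<open>var\<close> is the variation of \<open>K'\<close> along \<open>\<gamma>\<close> and \<open>dst\<close> the distance of
  \<open>\<gamma>\<close> from the spectrum of \<open>A1\<close>.  Put \<open>F(z) = \<integral>\<^sub>\<gamma> K'(\<mu>) / (\<mu> - z) d\<mu>\<close>; this is \<open>Fop \<gamma> z\<close>.

  If \<open>X\<close> solves the fixed-point equation and \<open>(A1 + X) u = z u\<close>, then the resolvent of \<open>A1 + X\<close> at \<open>\<mu>\<close>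
  acts on \<open>u\<close> as the number \<open>1 / (z - \<mu>)\<close>, so that \<open>X u = F(z) u\<close>.  As \<open>A1\<close> is symmetric,
  \<open>Im \<langle>F(z) u, u\<rangle> = Im z \<parallel>u\<parallel>\<^sup>2\<close>, and the location of \<open>z\<close> is decided by the sign of the left side.

  For \<open>z\<close> in the lower half-plane nothing obstructs the deformation of \<open>\<gamma>\<close> back to the interval, and
  \<open>F(z)\<close> is the Cauchy transform of the density \<open>K'\<close> of \<open>B\<^sup>* E(.) B\<close>, that is
  \<open>B\<^sup>* (A0 - z)\<^sup>-\<^sup>1 B\<close>.  The density is nonnegative, so \<open>Im \<langle>F(x - \<i>\<epsilon>) u, u\<rangle>\<close> is minus a Poisson integral;
  since \<open>F\<close> is continuous off the contour, \<open>Im \<langle>F(x) u, u\<rangle> \<le> 0\<close> at real points, with strict inequality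
  where \<open>\<langle>K'(x) u, u\<rangle> > 0\<close>.  For \<open>r = rmin \<gamma>\<close> one has \<open>var \<gamma> = r (dst \<gamma> - r)\<close> and \<open>r < dst \<gamma> / 2\<close>,
  whence \<open>F(z)\<close> differs from \<open>F(Re z)\<close> by at most \<open>\<bar>Im z\<bar> var \<gamma> / (dst \<gamma> - r)\<^sup>2 < \<bar>Im z\<bar>\<close> at nonreal points
  within \<open>r\<close> of the spectrum of \<open>A1\<close>.  So an eigenvalue cannot lie in the upper half-plane, and a real one
  requires \<open>\<langle>K'(z) u, u\<rangle> = 0\<close> (\<open>fixpoint_eigenvalue\<close>).  Being within \<open>\<parallel>X\<parallel> \<le> r_zero\<close> of the spectrum of
  \<open>A1\<close>, a real eigenvalue falls under the positivity hypothesis and is excluded as well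
  (\<open>eigenvalue_in_opposite_half_plane\<close>).  For the remaining ones, in the open lower half-plane, the equation
  \<open>A1 u + F(z) u = z u\<close> says that the Schur complement annihilates \<open>u\<close> (\<open>resonance_conclusion\<close>).

  This argument concerns one contour.  Banach's theorem gives one solution for each of them
  (\<open>W_fixpoint\<close>), and \<open>X_op\<close> denotes something only because all of them agree.  That follows from the
  argument itself: once the spectrum of \<open>A1 + X\<close> is known to lie in the closed lower half-plane, pushing it
  down by \<open>\<epsilon>\<close> makes the resolvent holomorphic and bounded on the closed upper half-plane, so the integrals
  over two contours both equal one over the interval, and \<open>\<epsilon> \<rightarrow> 0\<close> (\<open>W_contour_independent\<close>).  The infimum
  \<open>r_zero\<close> runs over the contours on both sides of the axis; conjugation exchanges the sides
  (\<open>small_contour_reflect\<close>).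

  Two tools carry the rest.  The first is Cauchy's theorem for a continuous deformation with end points on
  the boundary of the domain of \<open>K'\<close>, possibly at infinity (\<open>contour_deformation\<close>).  The second is the
  representation of \<open>\<langle>(A0 - z)\<^sup>-\<^sup>1 f, f\<rangle>\<close> as the Cauchy transform of the spectral density of \<open>f\<close>
  (\<open>resolvent_form_einterval\<close>), derived from the quadratic form of \<open>A0\<close> by way of the fact that \<open>E\<close>
  commutes with \<open>A0\<close>.\<close>

section \<open>Comparison of increments and the chain rule along absolutely continuous curves\<close>

text \<open>The supremum \<open>c\<close> of the points up to which the estimate holds is again such a point, and if
  \<open>c < b\<close> the local estimate at \<open>c\<close> extends it to the right of \<open>c\<close>.\<close>

lemma increment_bound:
  fixes N :: "real \<Rightarrow> 'a::real_normed_vector" and G :: "real \<Rightarrow> real"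
  assumes "a \<le> b"
    and mono: "\<And>s s'. a \<le> s \<Longrightarrow> s \<le> s' \<Longrightarrow> s' \<le> b \<Longrightarrow> G s \<le> G s'"
    and loc: "\<And>s. s \<in> {a..b} \<Longrightarrow>
      \<exists>\<delta>>0. \<forall>s'\<in>{a..b}. \<bar>s' - s\<bar> < \<delta> \<longrightarrow> norm (N s' - N s) \<le> \<bar>G s' - G s\<bar>"
  shows "norm (N b - N a) \<le> G b - G a"
proof -
  define S where "S = {s\<in>{a..b}. norm (N s - N a) \<le> G s - G a}"
  define c where "c = Sup S"
  have aS: "a \<in> S" using \<open>a \<le> b\<close> by (simp add: S_def)
  have bdd: "bdd_above S" by (auto simp: S_def bdd_above_def)
  have c: "c \<in> {a..b}"
    using aS bdd by (auto simp: c_def S_def intro!: cSup_upper cSup_least)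
  obtain \<delta> where \<delta>: "\<delta> > 0"
    "\<And>s'. s' \<in> {a..b} \<Longrightarrow> \<bar>s' - c\<bar> < \<delta> \<Longrightarrow> norm (N s' - N c) \<le> \<bar>G s' - G c\<bar>"
    using loc[OF c] by blast
  have step: "y \<in> S" if "x \<in> S" "x \<le> y" "y \<in> {a..b}" "norm (N y - N x) \<le> \<bar>G y - G x\<bar>" for x y
  proof -
    have "norm (N y - N a) \<le> norm (N y - N x) + norm (N x - N a)"
      using norm_triangle_ineq[of "N y - N x" "N x - N a"] by simp
    also have "\<dots> \<le> (G y - G x) + (G x - G a)"
      using that mono[of x y] by (auto simp: S_def)
    finally show ?thesis using that by (simp add: S_def)
  qed
  obtain s where s: "s \<in> S" "c - \<delta> < s"
    using less_cSup_iff[of S "c - \<delta>"] aS bdd \<delta>(1) by (auto simp: c_def)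
  have "s \<le> c" using s bdd by (auto simp: c_def intro: cSup_upper)
  have sab: "s \<in> {a..b}" using s by (simp add: S_def)
  have cS: "c \<in> S"
    using step[of s c] s sab c \<delta>(2)[of s] \<open>s \<le> c\<close>
    by (simp add: norm_minus_commute abs_minus_commute)
  have "c = b"
  proof (rule ccontr)
    assume "c \<noteq> b"
    then have "c < b" using c by auto
    define y where "y = min b (c + \<delta>/2)"
    have y: "c < y" "y \<in> {a..b}" "\<bar>y - c\<bar> < \<delta>" using \<open>c < b\<close> c \<delta>(1) by (auto simp: y_def)
    then have "y \<in> S" using step[OF cS] \<delta>(2) by auto
    then have "y \<le> c" using bdd by (auto simp: c_def intro: cSup_upper)
    then show False using y by simp
  qed
  then show ?thesis using cS by (simp add: S_def)
qed

text \<open>This replaces the theorem that a function with vanishing derivative is constant when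
  increments are compared with those of an arc length or of a spectral measure instead of the length of the
  parameter interval.\<close>

corollary increment_zero:
  fixes N :: "real \<Rightarrow> 'a::real_normed_vector" and G :: "real \<Rightarrow> real"
  assumes "a \<le> b"
    and mono: "\<And>s s'. a \<le> s \<Longrightarrow> s \<le> s' \<Longrightarrow> s' \<le> b \<Longrightarrow> G s \<le> G s'"
    and loc: "\<And>\<epsilon> s. \<epsilon> > 0 \<Longrightarrow> s \<in> {a..b} \<Longrightarrow>
      \<exists>\<delta>>0. \<forall>s'\<in>{a..b}. \<bar>s' - s\<bar> < \<delta> \<longrightarrow> norm (N s' - N s) \<le> \<epsilon> * \<bar>G s' - G s\<bar>"
  shows "N b = N a"
proof -
  have "norm (N b - N a) \<le> \<epsilon> * (G b - G a)" if "\<epsilon> > 0" for \<epsilon>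
  proof -
    have "norm (N b - N a) \<le> \<epsilon> * G b - \<epsilon> * G a"
    proof (rule increment_bound[OF \<open>a \<le> b\<close>])
      show "\<epsilon> * G s \<le> \<epsilon> * G s'" if "a \<le> s" "s \<le> s'" "s' \<le> b" for s s'
        using mono[OF that] \<open>\<epsilon> > 0\<close> by simp
      show "\<exists>\<delta>>0. \<forall>s'\<in>{a..b}. \<bar>s' - s\<bar> < \<delta> \<longrightarrow> norm (N s' - N s) \<le> \<bar>\<epsilon> * G s' - \<epsilon> * G s\<bar>"
        if "s \<in> {a..b}" for s
        using loc[OF \<open>\<epsilon> > 0\<close> that] \<open>\<epsilon> > 0\<close>
        by (simp add: right_diff_distrib[symmetric] abs_mult)
    qed
    then show ?thesis by (simp add: right_diff_distrib)
  qed
  then have le: "norm (N b - N a) \<le> \<epsilon> * (G b - G a)" if "\<epsilon> > 0" for \<epsilon> using that by blast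
  have G: "0 \<le> G b - G a" using mono[of a b] \<open>a \<le> b\<close> by simp
  have "norm (N b - N a) \<le> 0"
  proof (rule field_le_epsilon)
    fix e :: real assume "e > 0"
    have "norm (N b - N a) \<le> e / (G b - G a + 1) * (G b - G a)"
      using le[of "e / (G b - G a + 1)"] \<open>e > 0\<close> G by simp
    also have "\<dots> \<le> e" using G \<open>e > 0\<close> by (simp add: field_simps)
    finally show "norm (N b - N a) \<le> 0 + e" by simp
  qed
  then show ?thesis by simp
qed

text \<open>The curve \<open>\<eta>\<close> is only absolutely continuous, and \<open>N\<close> is a primitive of \<open>h\<close>
  continued along it, so that \<open>P\<close> varies with \<open>s\<close>.  Near \<open>s\<close> both \<open>N\<close> and the indefinite integral have the
  increment \<open>h (\<eta> s) * (\<eta> s' - \<eta> s)\<close> up to a small multiple of the arc length, whence they differ by a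
  constant.\<close>

lemma chain_rule_has_integral:
  fixes \<eta> f N :: "real \<Rightarrow> complex"
  assumes "a \<le> b"
    and f: "f absolutely_integrable_on {a..b}"
    and \<eta>: "\<And>s s'. a \<le> s \<Longrightarrow> s \<le> s' \<Longrightarrow> s' \<le> b \<Longrightarrow> (f has_integral (\<eta> s' - \<eta> s)) {s..s'}"
    and h: "\<And>s. s \<in> {a..b} \<Longrightarrow> isCont h (\<eta> s)"
    and N: "\<And>s. s \<in> {a..b} \<Longrightarrow> \<exists>P. (P has_field_derivative h (\<eta> s)) (at (\<eta> s)) \<and>
       (\<exists>\<delta>>0. \<forall>s'\<in>{a..b}. \<bar>s' - s\<bar> < \<delta> \<longrightarrow> N s' - N s = P (\<eta> s') - P (\<eta> s))"
  shows "((\<lambda>s. h (\<eta> s) * f s) has_integral (N b - N a)) {a..b}"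
proof -
  have fi: "f integrable_on {a..b}" using f by (simp add: absolutely_integrable_on_def)
  have nfi: "(\<lambda>s. norm (f s)) integrable_on {a..b}" using f by (simp add: absolutely_integrable_on_def)
  have \<eta>eq: "\<eta> s = \<eta> a + integral {a..s} f" if "s \<in> {a..b}" for s
    using integral_unique[OF \<eta>[of a s]] that by simp
  have \<eta>cont: "continuous_on {a..b} \<eta>"
  proof (rule continuous_on_eq)
    show "continuous_on {a..b} (\<lambda>s. \<eta> a + integral {a..s} f)"
      by (intro continuous_on_add continuous_on_const indefinite_integral_continuous_1[OF fi])
  qed (metis \<eta>eq)
  have h\<eta>: "continuous_on {a..b} (\<lambda>s. h (\<eta> s))"
    unfolding continuous_on_eq_continuous_within
  proof
    fix s assume s: "s \<in> {a..b}"
    show "continuous (at s within {a..b}) (\<lambda>s. h (\<eta> s))"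
      by (rule continuous_within_compose3[where g = h and f = \<eta>, OF h[OF s]])
        (use \<eta>cont s in \<open>simp add: continuous_on_eq_continuous_within\<close>)
  qed
  \<comment> \<open>\<open>J\<close> is the indefinite integral and \<open>G\<close> the arc length\<close>
  define g where "g = (\<lambda>s. h (\<eta> s) * f s)"
  have gai: "g absolutely_integrable_on {a..b}"
    unfolding g_def
  proof (rule absolutely_integrable_bounded_measurable_product[OF bilinear_times _ _ _ f])
    show "(\<lambda>s. h (\<eta> s)) \<in> borel_measurable (lebesgue_on {a..b})"
      using h\<eta> by (intro continuous_imp_measurable_on_sets_lebesgue) auto
    show "bounded ((\<lambda>s. h (\<eta> s)) ` {a..b})"
      using h\<eta> by (intro compact_imp_bounded compact_continuous_image) auto
  qed auto
  have gi: "g integrable_on {a..b}" using gai by (simp add: absolutely_integrable_on_def)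
  define J where "J = (\<lambda>s. integral {a..s} g)"
  define G where "G = (\<lambda>s. integral {a..s} (\<lambda>s. norm (f s)))"
  have sub: "f integrable_on {s..s'}" "(\<lambda>s. norm (f s)) integrable_on {s..s'}" "g integrable_on {s..s'}"
    if "a \<le> s" "s' \<le> b" for s s'
    using that fi nfi gi by (auto intro: integrable_subinterval_real)
  have Gd: "G s' - G s = integral {s..s'} (\<lambda>s. norm (f s))"
    if "a \<le> s" "s \<le> s'" "s' \<le> b" for s s'
    using Henstock_Kurzweil_Integration.integral_combine[OF that(1,2) sub(2)[of a s']] that by (simp add: G_def algebra_simps)
  have Jd: "J s' - J s = integral {s..s'} g"
    if "a \<le> s" "s \<le> s'" "s' \<le> b" for s s'
    using Henstock_Kurzweil_Integration.integral_combine[OF that(1,2) sub(3)[of a s']] that by (simp add: J_def algebra_simps)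
  have \<eta>le: "norm (\<eta> s' - \<eta> s) \<le> G s' - G s" if "a \<le> s" "s \<le> s'" "s' \<le> b" for s s'
    using integral_norm_bound_integral[OF sub(1)[of s s'] sub(2)[of s s']] integral_unique[OF \<eta>[OF that]] Gd[OF that] that
    by simp
  have \<eta>le2: "norm (\<eta> s' - \<eta> s) \<le> \<bar>G s' - G s\<bar>" if "s \<in> {a..b}" "s' \<in> {a..b}" for s s'
    using \<eta>le[of s s'] \<eta>le[of s' s] that by (cases "s \<le> s'") (auto simp: norm_minus_commute)
  have key: "norm (J s' - J s - h z * (\<eta> s' - \<eta> s)) \<le> \<epsilon> * (G s' - G s)"
    if ss: "a \<le> s" "s \<le> s'" "s' \<le> b" and close: "\<And>x. x \<in> {s..s'} \<Longrightarrow> norm (h (\<eta> x) - h z) \<le> \<epsilon>" for s s' z \<epsilon>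
  proof -
    have e: "((\<lambda>x. (h (\<eta> x) - h z) * f x) has_integral (J s' - J s - h z * (\<eta> s' - \<eta> s))) {s..s'}"
    proof -
      have 1: "(g has_integral (J s' - J s)) {s..s'}"
        using sub(3)[of s s'] Jd[OF ss] ss by (simp add: has_integral_integral)
      have 2: "((\<lambda>x. h z * f x) has_integral h z * (\<eta> s' - \<eta> s)) {s..s'}"
        using \<eta>[OF ss] by (rule has_integral_mult_right)
      show ?thesis
        using has_integral_diff[OF 1 2] by (simp add: g_def left_diff_distrib)
    qed
    have "norm (integral {s..s'} (\<lambda>x. (h (\<eta> x) - h z) * f x)) \<le> integral {s..s'} (\<lambda>x. \<epsilon> * norm (f x))"
    proof (rule integral_norm_bound_integral)
      show "(\<lambda>x. (h (\<eta> x) - h z) * f x) integrable_on {s..s'}" using e by blast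
      show "(\<lambda>x. \<epsilon> * norm (f x)) integrable_on {s..s'}"
        using sub(2)[of s s'] ss by (auto intro: integrable_on_mult_right)
      show "norm ((h (\<eta> x) - h z) * f x) \<le> \<epsilon> * norm (f x)" if "x \<in> {s..s'}" for x
        using close[OF that] by (simp add: norm_mult mult_right_mono)
    qed
    then show ?thesis using integral_unique[OF e] Gd[OF ss] by simp
  qed
  have "N b - J b = N a - J a"
  proof (rule increment_zero[OF \<open>a \<le> b\<close>, where G = G and N = "\<lambda>s. N s - J s"])
    show "G s \<le> G s'" if "a \<le> s" "s \<le> s'" "s' \<le> b" for s s'
      using \<eta>le[OF that] norm_ge_zero[of "\<eta> s' - \<eta> s"] by linarith
    fix \<epsilon> s :: real assume \<epsilon>: "\<epsilon> > 0" and s: "s \<in> {a..b}"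
    obtain P \<delta>1 where P: "(P has_field_derivative h (\<eta> s)) (at (\<eta> s))" and \<delta>1: "\<delta>1 > 0"
      "\<And>s'. s' \<in> {a..b} \<Longrightarrow> \<bar>s' - s\<bar> < \<delta>1 \<Longrightarrow> N s' - N s = P (\<eta> s') - P (\<eta> s)"
      using N[OF s] by blast
    obtain r1 where r1: "r1 > 0"
      "\<And>w. norm (w - \<eta> s) < r1 \<Longrightarrow> norm (P w - P (\<eta> s) - h (\<eta> s) * (w - \<eta> s)) \<le> \<epsilon>/2 * norm (w - \<eta> s)"
      using P[unfolded has_field_derivative_def has_derivative_at_alt] \<epsilon>
      by (metis half_gt_zero)
    have "\<exists>\<delta>2>0. \<forall>s'\<in>{a..b}. \<bar>s' - s\<bar> < \<delta>2 \<longrightarrow> norm (\<eta> s' - \<eta> s) < r1"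
      using \<eta>cont s r1(1) unfolding continuous_on_iff dist_norm real_norm_def by blast
    then obtain \<delta>2 where \<delta>2: "\<delta>2 > 0" "\<And>s'. s' \<in> {a..b} \<Longrightarrow> \<bar>s' - s\<bar> < \<delta>2 \<Longrightarrow> norm (\<eta> s' - \<eta> s) < r1"
      by blast
    have "\<exists>\<delta>3>0. \<forall>s'\<in>{a..b}. \<bar>s' - s\<bar> < \<delta>3 \<longrightarrow> norm (h (\<eta> s') - h (\<eta> s)) < \<epsilon>/2"
      using h\<eta> s \<epsilon> unfolding continuous_on_iff dist_norm real_norm_def by (meson half_gt_zero)
    then obtain \<delta>3 where \<delta>3: "\<delta>3 > 0" "\<And>s'. s' \<in> {a..b} \<Longrightarrow> \<bar>s' - s\<bar> < \<delta>3 \<Longrightarrow> norm (h (\<eta> s') - h (\<eta> s)) < \<epsilon>/2"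
      by blast
    define \<delta> where "\<delta> = min \<delta>1 (min \<delta>2 \<delta>3)"
    have cl: "norm (h (\<eta> x) - h (\<eta> s)) \<le> \<epsilon>/2" if "x \<in> {a..b}" "\<bar>x - s\<bar> < \<delta>" for x
      using \<delta>3(2)[of x] that by (simp add: \<delta>_def)
    have "norm ((N s' - J s') - (N s - J s)) \<le> \<epsilon> * \<bar>G s' - G s\<bar>"
      if s': "s' \<in> {a..b}" "\<bar>s' - s\<bar> < \<delta>" for s'
    proof -
      have 1: "norm (N s' - N s - h (\<eta> s) * (\<eta> s' - \<eta> s)) \<le> \<epsilon>/2 * \<bar>G s' - G s\<bar>"
      proof -
        have "norm (N s' - N s - h (\<eta> s) * (\<eta> s' - \<eta> s)) \<le> \<epsilon>/2 * norm (\<eta> s' - \<eta> s)"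
          using r1(2)[OF \<delta>2(2)[of s']] \<delta>1(2)[of s'] s' by (simp add: \<delta>_def)
        also have "\<dots> \<le> \<epsilon>/2 * \<bar>G s' - G s\<bar>" using \<eta>le2[OF s s'(1)] \<epsilon> by (intro mult_left_mono) auto
        finally show ?thesis .
      qed
      have 2: "norm (J s' - J s - h (\<eta> s) * (\<eta> s' - \<eta> s)) \<le> \<epsilon>/2 * \<bar>G s' - G s\<bar>"
      proof (cases "s \<le> s'")
        case True
        have "norm (J s' - J s - h (\<eta> s) * (\<eta> s' - \<eta> s)) \<le> \<epsilon>/2 * (G s' - G s)"
          using True s s' by (intro key cl) auto
        also have "\<dots> \<le> \<epsilon>/2 * \<bar>G s' - G s\<bar>" using \<epsilon> by (intro mult_left_mono) auto
        finally show ?thesis .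
      next
        case False
        have "norm (J s - J s' - h (\<eta> s) * (\<eta> s - \<eta> s')) \<le> \<epsilon>/2 * (G s - G s')"
          using False s s' by (intro key cl) auto
        also have "\<dots> \<le> \<epsilon>/2 * \<bar>G s' - G s\<bar>" using \<epsilon> by (intro mult_left_mono) auto
        also have "norm (J s - J s' - h (\<eta> s) * (\<eta> s - \<eta> s')) = norm (J s' - J s - h (\<eta> s) * (\<eta> s' - \<eta> s))"
          by (subst norm_minus_cancel[symmetric]) (simp add: algebra_simps)
        finally show ?thesis .
      qed
      have "(N s' - J s') - (N s - J s) = (N s' - N s - h (\<eta> s) * (\<eta> s' - \<eta> s)) - (J s' - J s - h (\<eta> s) * (\<eta> s' - \<eta> s))"
        by simp
      then have "norm ((N s' - J s') - (N s - J s)) \<le> norm (N s' - N s - h (\<eta> s) * (\<eta> s' - \<eta> s)) + norm (J s' - J s - h (\<eta> s) * (\<eta> s' - \<eta> s))"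
        by (metis norm_triangle_ineq4)
      then show ?thesis using 1 2 by linarith
    qed
    moreover have "\<delta> > 0" using \<delta>1 \<delta>2 \<delta>3 by (simp add: \<delta>_def)
    ultimately show "\<exists>\<delta>>0. \<forall>s'\<in>{a..b}. \<bar>s' - s\<bar> < \<delta> \<longrightarrow> norm ((N s' - J s') - (N s - J s)) \<le> \<epsilon> * \<bar>G s' - G s\<bar>"
      by blast
  qed
  then have "N b - N a = integral {a..b} g" by (simp add: J_def algebra_simps)
  then show ?thesis using integrable_integral[OF gi] by (simp add: g_def)
qed

section \<open>Differentiation of indefinite integrals\<close>

text \<open>Lebesgue's differentiation theorem for the gauge integral.  A point at which
  differentiation fails by \<open>e\<close> lies in arbitrarily short intervals over which Riemann sum and integral differ
  by more than \<open>e\<close> times the length.  Vitali's covering theorem selects disjoint ones that cover almost all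
  such points; finitely many of them form a tagged partial division, and by Henstock's lemma their total
  length is small.\<close>

lemma AE_has_vector_derivative_indefinite_integral:
  fixes f F :: "real \<Rightarrow> 'a::euclidean_space"
  assumes f: "f integrable_on {a..b}"
    and F: "\<And>s s'. a \<le> s \<Longrightarrow> s \<le> s' \<Longrightarrow> s' \<le> b \<Longrightarrow> (f has_integral (F s' - F s)) {s..s'}"
  shows "negligible {x\<in>{a<..<b}. \<not> (F has_vector_derivative f x) (at x)}"
proof -
  define bad where "bad = (\<lambda>e x u v. u < v \<and> u \<le> x \<and> x \<le> v \<and> a \<le> u \<and> v \<le> b \<and>
     e * (v - u) < norm ((v - u) *\<^sub>R f x - (F v - F u)))"
  define S where "S = (\<lambda>e. {x\<in>{a<..<b}. \<forall>d>0. \<exists>u v. bad e x u v \<and> v - u < d})"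
  have neg: "negligible (S e)" if "e > 0" for e
    unfolding negligible_outer_le
  proof (intro allI impI)
    fix \<epsilon> :: real assume "\<epsilon> > 0"
    then have "e * \<epsilon> > 0" using that by simp
    have f': "f integrable_on cbox a b" using f by simp
    obtain \<gamma> where \<gamma>: "gauge \<gamma>"
      "\<And>p. p tagged_partial_division_of (cbox a b) \<Longrightarrow> \<gamma> fine p \<Longrightarrow>
         (\<Sum>(x,k)\<in>p. norm (measure lborel k *\<^sub>R f x - integral k f)) < e * \<epsilon>"
      using Henstock_lemma[OF f' \<open>e * \<epsilon> > 0\<close>] by blast
    define K where "K = {(x,u,v). x \<in> S e \<and> bad e x u v \<and> {u..v} \<subseteq> \<gamma> x}"
    define c where "c = (\<lambda>(x::real,u::real,v). (u + v)/2)"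
    define r where "r = (\<lambda>(x::real,u::real,v). (v - u)/2)"
    have ball: "cball (c (x,u,v)) (r (x,u,v)) = {u..v}" for x u v
      by (auto simp: c_def r_def cball_def dist_real_def abs_le_iff field_simps)
    have rpos: "0 < r i" if "i \<in> K" for i
      using that by (auto simp: K_def bad_def r_def)
    have cov: "\<exists>i. i \<in> K \<and> x \<in> cball (c i) (r i) \<and> r i < d" if x: "x \<in> S e" and "d > 0" for x d
    proof -
      have "open (\<gamma> x)" "x \<in> \<gamma> x" using \<gamma>(1) unfolding gauge_def by blast+
      then obtain d' where d': "d' > 0" "ball x d' \<subseteq> \<gamma> x" by (meson openE)
      have "min d d' > 0" using d' \<open>d > 0\<close> by simp
      then obtain u v where uv: "bad e x u v" "v - u < min d d'"
        using x unfolding S_def by blast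
      have "{u..v} \<subseteq> ball x d'" using uv by (auto simp: bad_def dist_real_def)
      then have "(x,u,v) \<in> K" using uv d' x by (auto simp: K_def)
      moreover have "r (x,u,v) < d" using uv by (auto simp: r_def bad_def)
      moreover have "x \<in> cball (c (x,u,v)) (r (x,u,v))"
        unfolding ball using uv by (auto simp: bad_def)
      ultimately show ?thesis by blast
    qed
    obtain C where C: "countable C" "C \<subseteq> K"
      "pairwise (\<lambda>i j. disjnt (cball (c i) (r i)) (cball (c j) (r j))) C"
      "negligible (S e - (\<Union>i\<in>C. cball (c i) (r i)))"
      by (rule Vitali_covering_theorem_cballs[of K r "S e" c]) (erule rpos, erule (1) cov, rule that)
    have fin: "measure lebesgue (\<Union>i\<in>C'. cball (c i) (r i)) \<le> \<epsilon>" if C': "C' \<subseteq> C" "finite C'" for C'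
    proof -
      define p where "p = (\<lambda>(x,u,v). (x::real, {u..v::real})) ` C'"
      have inj: "inj_on (\<lambda>(x,u,v). (x::real, {u..v::real})) C'"
      proof (rule inj_onI)
        fix i j assume ij: "i \<in> C'" "j \<in> C'" "(\<lambda>(x,u,v). (x, {u..v})) i = (\<lambda>(x,u,v). (x, {u..v})) j"
        obtain x u v x' u' v' where [simp]: "i = (x,u,v)" "j = (x',u',v')" by (metis prod.exhaust)
        have "u < v" "u' < v'" using ij C' C by (auto simp: K_def bad_def)
        then show "i = j" using ij(3) by (simp add: Icc_eq_Icc)
      qed
      have "p tagged_partial_division_of (cbox a b)"
        unfolding tagged_partial_division_of_def
      proof (intro conjI allI impI)
        show "finite p" using C' by (simp add: p_def)
        fix x k assume "(x,k) \<in> p"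
        then obtain u v where i: "(x,u,v) \<in> C'" "k = {u..v}" by (auto simp: p_def)
        then have b: "bad e x u v" using C' C by (auto simp: K_def)
        show "x \<in> k" "k \<subseteq> cbox a b" using b i by (auto simp: bad_def)
        show "\<exists>a b. k = cbox a b" using i by (metis box_real(2))
      next
        fix x k x' k' assume as: "(x,k) \<in> p \<and> (x',k') \<in> p \<and> (x,k) \<noteq> (x',k')"
        then have ne: "(x,k) \<noteq> (x',k')" by blast
        obtain u v where i: "(x,u,v) \<in> C'" "k = {u..v}" using as by (auto simp: p_def)
        obtain u' v' where i': "(x',u',v') \<in> C'" "k' = {u'..v'}" using as by (auto simp: p_def)
        have "(x,u,v) \<noteq> (x',u',v')" using ne i i' by auto
        then have "disjnt k k'"
          using C(3) C'(1) i i' ball unfolding pairwise_def by (metis subsetD)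
        then show "interior k \<inter> interior k' = {}"
          using interior_subset[of k] interior_subset[of k'] by (auto simp: disjnt_def)
      qed
      moreover have "\<gamma> fine p"
        using C' C by (auto simp: fine_def p_def K_def)
      ultimately have "(\<Sum>(x,k)\<in>p. norm (measure lborel k *\<^sub>R f x - integral k f)) < e * \<epsilon>"
        by (rule \<gamma>(2))
      then have sum1: "(\<Sum>(x,u,v)\<in>C'. norm (measure lborel {u..v} *\<^sub>R f x - integral {u..v} f)) < e * \<epsilon>"
        unfolding p_def sum.reindex[OF inj] by (simp add: o_def split_def)
      have "(\<Sum>(x,u,v)\<in>C'. e * (v - u)) \<le> (\<Sum>(x,u,v)\<in>C'. norm (measure lborel {u..v} *\<^sub>R f x - integral {u..v} f))"
      proof (rule sum_mono)
        fix i assume "i \<in> C'"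
        moreover obtain x u v where [simp]: "i = (x,u,v)" by (metis prod.exhaust)
        ultimately have b: "bad e x u v" using C' C by (auto simp: K_def)
        then have "integral {u..v} f = F v - F u"
          by (intro integral_unique F) (auto simp: bad_def)
        then show "(case i of (x,u,v) \<Rightarrow> e * (v - u)) \<le> (case i of (x,u,v) \<Rightarrow> norm (measure lborel {u..v} *\<^sub>R f x - integral {u..v} f))"
          using b by (auto simp: bad_def)
      qed
      then have "(\<Sum>(x,u,v)\<in>C'. e * (v - u)) < e * \<epsilon>" using sum1 by linarith
      moreover have "(\<Sum>(x,u,v)\<in>C'. e * (v - u)) = e * (\<Sum>(x,u,v)\<in>C'. v - u)"
        by (simp add: sum_distrib_left split_def)
      ultimately have "(\<Sum>(x,u,v)\<in>C'. v - u) < \<epsilon>" using \<open>e > 0\<close> by simp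
      moreover have "measure lebesgue (\<Union>i\<in>C'. cball (c i) (r i)) \<le> (\<Sum>i\<in>C'. measure lebesgue (cball (c i) (r i)))"
        using C' by (intro measure_UNION_le) auto
      moreover have "(\<Sum>i\<in>C'. measure lebesgue (cball (c i) (r i))) = (\<Sum>(x,u,v)\<in>C'. v - u)"
      proof (rule sum.cong[OF refl])
        fix i assume "i \<in> C'"
        moreover obtain x u v where [simp]: "i = (x,u,v)" by (metis prod.exhaust)
        ultimately have "u < v" using C' C by (auto simp: K_def bad_def)
        then show "measure lebesgue (cball (c i) (r i)) = (case i of (x,u,v) \<Rightarrow> v - u)" by (simp add: ball)
      qed
      ultimately show ?thesis by linarith
    qed
    define T where "T = (\<Union>i\<in>C. cball (c i) (r i))"
    have T: "T \<in> lmeasurable" "measure lebesgue T \<le> \<epsilon>"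
      unfolding T_def
      by (rule fmeasurable_UN_bound[OF C(1) _ fin], auto)
         (rule measure_UN_bound[OF C(1) _ fin], auto)
    have 0: "S e - T \<in> lmeasurable" "measure lebesgue (S e - T) = 0"
      using C(4) by (auto simp: T_def negligible_imp_measurable negligible_imp_measure0)
    show "\<exists>T. S e \<subseteq> T \<and> T \<in> lmeasurable \<and> measure lebesgue T \<le> \<epsilon>"
    proof (intro exI conjI)
      show "S e \<subseteq> T \<union> (S e - T)" by auto
      show "T \<union> (S e - T) \<in> lmeasurable" using T 0 by (intro fmeasurable.Un)
      show "measure lebesgue (T \<union> (S e - T)) \<le> \<epsilon>"
        using measure_Un_le[of T lebesgue "S e - T"] T 0 by (auto simp: fmeasurableD)
    qed
  qed
  have "negligible (\<Union>n. S (1 / real (Suc n)))" by (intro negligible_countable_Union) (auto intro: neg)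
  moreover have "{x\<in>{a<..<b}. \<not> (F has_vector_derivative f x) (at x)} \<subseteq> (\<Union>n. S (1 / real (Suc n)))"
  proof clarify
    fix x assume x: "x \<in> {a<..<b}" and nd: "\<not> (F has_vector_derivative f x) (at x)"
    have "\<exists>e>0. x \<in> S e"
    proof (rule ccontr)
      assume no: "\<not> (\<exists>e>0. x \<in> S e)"
      have "(F has_vector_derivative f x) (at x)"
        unfolding has_vector_derivative_def has_derivative_at_alt
      proof (intro conjI allI impI bounded_linear_scaleR_left)
        fix e :: real assume "e > 0"
        then obtain d where d: "d > 0" "\<And>u v. bad e x u v \<Longrightarrow> d \<le> v - u"
          using no x \<open>e > 0\<close> unfolding S_def by (simp add: not_less) (metis not_less)
        define d' where "d' = min d (min (x - a) (b - x))"
        have "norm (F y - F x - (y - x) *\<^sub>R f x) \<le> e * norm (y - x)" if y: "norm (y - x) < d'" for y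
        proof (cases y x rule: linorder_cases)
          case less
          then have "\<not> bad e x y x" using d(2)[of y x] y by (auto simp: d'_def)
          then show ?thesis using less y x
            by (simp add: bad_def d'_def norm_minus_commute algebra_simps)
        next
          case greater
          then have "\<not> bad e x x y" using d(2)[of x y] y by (auto simp: d'_def)
          then show ?thesis using greater y x
            by (simp add: bad_def d'_def norm_minus_commute algebra_simps)
        qed simp
        moreover have "d' > 0" using d x by (simp add: d'_def)
        ultimately show "\<exists>d>0. \<forall>y. norm (y - x) < d \<longrightarrow> norm (F y - F x - (y - x) *\<^sub>R f x) \<le> e * norm (y - x)"
          by blast
      qed
      then show False using nd by blast
    qed
    then obtain e where e: "e > 0" "x \<in> S e" by blast
    obtain n where n: "1 / real (Suc n) < e" using nat_approx_posE[OF e(1)] by blast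
    have "S e \<subseteq> S (1 / real (Suc n))"
    proof -
      have "bad (1 / real (Suc n)) x u v" if "bad e x u v" for x u v
      proof -
        have "1 / real (Suc n) * (v - u) \<le> e * (v - u)"
          using n that by (intro mult_right_mono) (auto simp: bad_def)
        then show ?thesis using that by (simp add: bad_def)
      qed
      then show ?thesis unfolding S_def by blast
    qed
    then show "x \<in> (\<Union>n. S (1 / real (Suc n)))" using e by blast
  qed
  ultimately show ?thesis by (rule negligible_subset)
qed

section \<open>Primitives along a deformation\<close>

text \<open>The integral of \<open>h\<close> along the image under \<open>H\<close> of the segment from a base point to \<open>q\<close>.  It is
  single valued because \<open>X\<close> is convex: the image of a triangle in \<open>X\<close> is null-homotopic in \<open>\<Omega>\<close>,
  which may well have holes.  As \<open>H\<close> is merely continuous, a smooth path homotopic to the image stands in for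
  it.\<close>

lemma lifted_primitive:
  fixes H :: "'x::real_normed_vector \<Rightarrow> complex"
  assumes X: "convex X" and H: "continuous_on X H" "H ` X \<subseteq> \<Omega>"
    and \<Omega>: "open \<Omega>" "h holomorphic_on \<Omega>"
  obtains \<Phi> where "\<And>q. q \<in> X \<Longrightarrow> \<exists>P. (\<forall>\<^sub>F w in nhds (H q). (P has_field_derivative h w) (at w)) \<and>
    (\<forall>\<^sub>F q' in at q within X. \<Phi> q' - \<Phi> q = P (H q') - P (H q))"
proof (cases "X = {}")
  case True
  then show ?thesis using that[of "\<lambda>_. 0"] by simp
next
  case False
  then obtain q0 where q0: "q0 \<in> X" by blast
  define \<sigma> where "\<sigma> = (\<lambda>q. H \<circ> linepath q0 q)"
  have seg: "path_image (linepath q q') \<subseteq> X" if "q \<in> X" "q' \<in> X" for q q'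
    using X that by (simp add: closed_segment_subset)
  have compose: "path (H \<circ> linepath q q')" "path_image (H \<circ> linepath q q') \<subseteq> \<Omega>" if "q \<in> X" "q' \<in> X" for q q'
  proof -
    show "path (H \<circ> linepath q q')"
      by (rule path_continuous_image[OF path_linepath continuous_on_subset[OF H(1) seg[OF that]]])
    show "path_image (H \<circ> linepath q q') \<subseteq> \<Omega>"
      using seg[OF that] H(2) by (auto simp: path_image_compose)
  qed
  \<comment> \<open>a continuous path is homotopic to a polynomial one, along which \<open>h\<close> can be integrated\<close>
  have approx: "\<exists>g. valid_path g \<and> homotopic_paths \<Omega> p g" if p: "path p" "path_image p \<subseteq> \<Omega>" for p
  proof -
    obtain e where e: "e > 0" "\<And>g. path g \<Longrightarrow> pathstart g = pathstart p \<Longrightarrow> pathfinish g = pathfinish p \<Longrightarrow>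
        (\<forall>t\<in>{0..1}. norm (g t - p t) < e) \<Longrightarrow> homotopic_paths \<Omega> p g"
      using homotopic_nearby_paths[OF p(1) \<Omega>(1) p(2)] by blast
    obtain g where "polynomial_function g" "pathstart g = pathstart p" "pathfinish g = pathfinish p"
        "\<And>t. t \<in> {0..1} \<Longrightarrow> norm (g t - p t) < e"
      using path_approx_polynomial_function[OF p(1) e(1)] by blast
    then show ?thesis
      using e(2)[of g] valid_path_polynomial_function valid_path_imp_path by blast
  qed
  have \<sigma>: "path (\<sigma> q)" "path_image (\<sigma> q) \<subseteq> \<Omega>" if "q \<in> X" for q
    using compose[OF q0 that] by (simp_all add: \<sigma>_def)
  have "\<forall>q\<in>X. \<exists>g. valid_path g \<and> homotopic_paths \<Omega> (\<sigma> q) g"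
    by (intro ballI approx \<sigma>)
  from bchoice[OF this] obtain g where "\<forall>q\<in>X. valid_path (g q) \<and> homotopic_paths \<Omega> (\<sigma> q) (g q)" by blast
  then have g: "valid_path (g q)" "homotopic_paths \<Omega> (\<sigma> q) (g q)" if "q \<in> X" for q using that by auto
  define \<Phi> where "\<Phi> = (\<lambda>q. contour_integral (g q) h)"
  show ?thesis
  proof (rule that)
    fix q assume q: "q \<in> X"
    then have "H q \<in> \<Omega>" using H(2) by blast
    then obtain r where r: "r > 0" "ball (H q) r \<subseteq> \<Omega>"
      by (rule openE[OF \<Omega>(1)])
    have hb: "h holomorphic_on ball (H q) r" using \<Omega>(2) r(2) holomorphic_on_subset by blast
    obtain P where P: "\<And>w. w \<in> ball (H q) r \<Longrightarrow> (P has_field_derivative h w) (at w)"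
      using holomorphic_convex_primitive'[OF convex_ball open_ball hb] at_within_open[OF _ open_ball]
      by metis
    have ev: "\<forall>\<^sub>F w in nhds (H q). (P has_field_derivative h w) (at w)"
      using eventually_nhds_in_open[of "ball (H q) r" "H q"] r(1) P by (auto elim: eventually_mono)
    have "\<forall>\<^sub>F q' in at q within X. H q' \<in> ball (H q) r"
    proof (rule topological_tendstoD)
      show "(H \<longlongrightarrow> H q) (at q within X)" using H(1) q unfolding continuous_on_def by blast
    qed (use r(1) in auto)
    then obtain \<delta> where \<delta>: "\<delta> > 0" "\<And>q'. q' \<in> X \<Longrightarrow> q' \<noteq> q \<Longrightarrow> dist q' q < \<delta> \<Longrightarrow> H q' \<in> ball (H q) r"
      unfolding eventually_at by blast
    have \<delta>': "H q' \<in> ball (H q) r" if "q' \<in> X" "dist q' q < \<delta>" for q'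
      using \<delta>(2)[of q'] that r(1) by (cases "q' = q") auto
    have "\<Phi> q' - \<Phi> q = P (H q') - P (H q)" if q': "q' \<in> X" "dist q' q < \<delta>" for q'
    proof -
      have "closed_segment q q' \<subseteq> X \<inter> ball q \<delta>"
        using q q' X \<delta>(1) by (intro closed_segment_subset) (auto intro: convex_Int simp: dist_commute)
      then have near: "H y \<in> ball (H q) r" if "y \<in> closed_segment q q'" for y
        using that by (intro \<delta>') (auto simp: dist_commute)
      have seg': "closed_segment (H q) (H q') \<subseteq> ball (H q) r"
        using \<delta>'[OF q'] r(1) by (intro closed_segment_subset) auto
      have 1: "homotopic_paths X (linepath q0 q +++ linepath q q') (linepath q0 q')"
      proof (rule homotopic_paths_linear)
        fix t :: real assume "t \<in> {0..1}"
        then have "(linepath q0 q +++ linepath q q') t \<in> path_image (linepath q0 q +++ linepath q q')"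
          "linepath q0 q' t \<in> path_image (linepath q0 q')" by (auto simp: path_image_def)
        then have "(linepath q0 q +++ linepath q q') t \<in> X" "linepath q0 q' t \<in> X"
          using seg[OF q0 q] seg[OF q q'(1)] seg[OF q0 q'(1)] by (auto simp: path_image_join)
        then show "closed_segment ((linepath q0 q +++ linepath q q') t) (linepath q0 q' t) \<subseteq> X"
          using X by (simp add: closed_segment_subset)
      qed auto
      have 2: "homotopic_paths \<Omega> (\<sigma> q +++ (H \<circ> linepath q q')) (\<sigma> q')"
        using homotopic_paths_continuous_image[OF 1 H(1)] H(2)
        by (auto simp: \<sigma>_def path_compose_join)
      have 3: "homotopic_paths (ball (H q) r) (H \<circ> linepath q q') (linepath (H q) (H q'))"
      proof (rule homotopic_paths_linear)
        show "path (H \<circ> linepath q q')" by (rule compose[OF q q'(1)])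
        fix t :: real assume t: "t \<in> {0..1}"
        then have "linepath q q' t \<in> closed_segment q q'" by (metis imageI linepath_image_01)
        moreover have "linepath (H q) (H q') t \<in> closed_segment (H q) (H q')" using t by (metis imageI linepath_image_01)
        ultimately show "closed_segment ((H \<circ> linepath q q') t) (linepath (H q) (H q') t) \<subseteq> ball (H q) r"
          using near seg' by (intro closed_segment_subset) auto
      qed (auto simp: pathstart_compose pathfinish_compose)
      have 3: "homotopic_paths \<Omega> (H \<circ> linepath q q') (linepath (H q) (H q'))"
        by (rule homotopic_paths_subset[OF 3 r(2)])
      have fin: "pathfinish (g q) = H q"
        using homotopic_paths_imp_pathfinish[OF g(2)[OF q]] by (simp add: \<sigma>_def pathfinish_compose)
      have 4: "homotopic_paths \<Omega> (g q +++ linepath (H q) (H q')) (g q')"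
      proof -
        have "homotopic_paths \<Omega> (g q +++ linepath (H q) (H q')) (\<sigma> q +++ (H \<circ> linepath q q'))"
          by (rule homotopic_paths_join[OF homotopic_paths_sym[OF g(2)[OF q]] homotopic_paths_sym[OF 3]])
            (simp add: fin)
        then show ?thesis using 2 g(2)[OF q'(1)] by (meson homotopic_paths_trans)
      qed
      have img: "path_image (g q) \<subseteq> \<Omega>"
        using homotopic_paths_imp_subset[OF g(2)[OF q]] by blast
      have "contour_integral (g q') h = contour_integral (g q +++ linepath (H q) (H q')) h"
        by (rule sym, rule Cauchy_theorem_homotopic_paths[OF 4 \<Omega>])
           (auto simp: g[OF q] g[OF q'(1)] fin intro!: valid_path_join)
      also have "\<dots> = contour_integral (g q) h + contour_integral (linepath (H q) (H q')) h"
        using seg' r(2) img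
        by (intro contour_integral_join contour_integrable_holomorphic_simple[OF \<Omega>(2,1)])
           (auto simp: g[OF q])
      also have "contour_integral (linepath (H q) (H q')) h = P (H q') - P (H q)"
      proof -
        have "(h has_contour_integral (P (pathfinish (linepath (H q) (H q'))) - P (pathstart (linepath (H q) (H q'))))) (linepath (H q) (H q'))"
          by (rule contour_integral_primitive[of "ball (H q) r"])
             (use P seg' in \<open>auto intro: has_field_derivative_at_within\<close>)
        then show ?thesis by (simp add: contour_integral_unique)
      qed
      finally show ?thesis by (simp add: \<Phi>_def)
    qed
    then have "\<forall>\<^sub>F q' in at q within X. \<Phi> q' - \<Phi> q = P (H q') - P (H q)"
      unfolding eventually_at using \<delta>(1) by blast
    then show "\<exists>P. (\<forall>\<^sub>F w in nhds (H q). (P has_field_derivative h w) (at w)) \<and>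
        (\<forall>\<^sub>F q' in at q within X. \<Phi> q' - \<Phi> q = P (H q') - P (H q))" using ev by blast
  qed
qed

text \<open>The map that moves \<open>(t, s)\<close> by \<open>(- u, v)\<close> and then retracts to the rectangle has a fixed point
  by Brouwer's theorem.  If \<open>u\<close> or \<open>v\<close> did not vanish there, the point would lie on a side and be moved
  outwards, against the sign conditions.\<close>

lemma poincare_miranda:
  fixes u v :: "real \<times> real \<Rightarrow> real"
  assumes ab: "a \<le> b" and u: "continuous_on ({0..1} \<times> {a..b}) u" and v: "continuous_on ({0..1} \<times> {a..b}) v"
    and u0: "\<And>s. s \<in> {a..b} \<Longrightarrow> u (0, s) < 0" and u1: "\<And>s. s \<in> {a..b} \<Longrightarrow> u (1, s) > 0"
    and va: "\<And>t. t \<in> {0..1} \<Longrightarrow> v (t, a) > 0" and vb: "\<And>t. t \<in> {0..1} \<Longrightarrow> v (t, b) < 0"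
  obtains q where "q \<in> {0..1} \<times> {a..b}" "u q = 0" "v q = 0"
proof -
  define Q where "Q = {0..1::real} \<times> {a..b}"
  define f where "f = (\<lambda>q. (max 0 (min 1 (fst q - u q)), max a (min b (snd q + v q))))"
  obtain q where q: "q \<in> Q" "f q = q"
  proof (rule brouwer[of Q f])
    show "compact Q" "convex Q" by (auto simp: Q_def intro: compact_Times convex_Times)
    show "Q \<noteq> {}" using ab by (auto simp: Q_def)
    show "continuous_on Q f"
      unfolding f_def using u v by (auto simp: Q_def intro!: continuous_intros)
    show "f \<in> Q \<rightarrow> Q" using ab by (auto simp: f_def Q_def)
  qed
  obtain t s where ts: "q = (t, s)" by fastforce
  have t: "t \<in> {0..1}" "max 0 (min 1 (t - u q)) = t" and s: "s \<in> {a..b}" "max a (min b (s + v q)) = s"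
    using q ts by (auto simp: f_def Q_def)
  have "u q = 0"
  proof (rule ccontr)
    assume "u q \<noteq> 0"
    then have "(t = 0 \<and> u q > 0) \<or> (t = 1 \<and> u q < 0)" using t by (auto simp: max_def min_def split: if_splits)
    then show False using u0[OF s(1)] u1[OF s(1)] ts by auto
  qed
  moreover have "v q = 0"
  proof (rule ccontr)
    assume "v q \<noteq> 0"
    then have "(s = a \<and> v q < 0) \<or> (s = b \<and> v q > 0)" using s by (auto simp: max_def min_def split: if_splits)
    then show False using va[OF t(1)] vb[OF t(1)] ts by auto
  qed
  ultimately show ?thesis using that q by (simp add: Q_def)
qed

text \<open>Otherwise the zero set of \<open>v\<close> is the disjoint union of two compact sets, of which one contains its
  points on the side \<open>t = 0\<close> and the other those on the side \<open>t = 1\<close>.  A function \<open>u\<close> separating them has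
  no common zero with \<open>v\<close>, contrary to \<open>poincare_miranda\<close>.\<close>

lemma level_set_connects:
  fixes v :: "real \<times> real \<Rightarrow> real"
  assumes ab: "a \<le> b" and v: "continuous_on ({0..1} \<times> {a..b}) v"
    and va: "\<And>t. t \<in> {0..1} \<Longrightarrow> v (t, a) > 0" and vb: "\<And>t. t \<in> {0..1} \<Longrightarrow> v (t, b) < 0"
  obtains K s s' where "compact K" "connected K" "K \<subseteq> {q \<in> {0..1} \<times> {a..b}. v q = 0}"
    "(0, s) \<in> K" "(1, s') \<in> K"
proof -
  define Q where "Q = {0..1::real} \<times> {a..b}"
  define C where "C = {q \<in> Q. v q = 0}"
  define L where "L = {0::real} \<times> {a..b}"
  define R where "R = {1::real} \<times> {a..b}"
  have Q: "compact Q" by (simp add: Q_def compact_Times)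
  have C: "compact C"
  proof -
    have "closedin (top_of_set Q) (Q \<inter> v -` {0})"
      using v by (intro continuous_closedin_preimage) (auto simp: Q_def)
    moreover have "Q \<inter> v -` {0} = C" by (auto simp: C_def)
    ultimately show ?thesis using Q closedin_compact by metis
  qed
  have LR: "compact L" "compact R" by (auto simp: L_def R_def intro: compact_Times)
  have "\<exists>K. connected K \<and> K \<subseteq> C \<and> \<not> disjnt K (C \<inter> L) \<and> \<not> disjnt K (C \<inter> R)"
  proof (rule ccontr)
    assume no: "\<not> ?thesis"
    have "separated_between (top_of_set C) (C \<inter> L) (C \<inter> R)"
    proof (rule cut_wire_fence_theorem)
      show "compact_space (top_of_set C)" using C by (simp add: compact_space_subtopology)
      show "Hausdorff_space (top_of_set C)" by (simp add: Hausdorff_space_subtopology)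
      show "closedin (top_of_set C) (C \<inter> L)" "closedin (top_of_set C) (C \<inter> R)"
        using LR by (auto intro!: closedin_closed_Int compact_imp_closed)
      show "disjnt D (C \<inter> L) \<or> disjnt D (C \<inter> R)" if "connectedin (top_of_set C) D" for D
        using no that by (auto simp: connectedin_subtopology)
    qed
    then obtain U V where UV: "openin (top_of_set C) U" "openin (top_of_set C) V" "U \<union> V = C" "disjnt U V"
      "C \<inter> L \<subseteq> U" "C \<inter> R \<subseteq> V"
      unfolding separated_between_def by (auto simp: topspace_subtopology)
    have "C - U = V" "C - V = U" using UV(3,4) by (auto simp: disjnt_def)
    then have "closedin (top_of_set C) U" "closedin (top_of_set C) V"
      using UV(1,2) openin_imp_subset closedin_def by (metis (no_types, lifting) Diff_subset topspace_euclidean_subtopology)+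
    then have cl: "compact U" "compact V" using C closedin_compact by blast+
    have disj: "(U \<union> L) \<inter> (V \<union> R) = {}"
      using UV by (auto simp: disjnt_def L_def R_def)
    obtain u :: "real \<times> real \<Rightarrow> real" where u: "continuous_on UNIV u"
      "\<And>q. q \<in> U \<union> L \<Longrightarrow> u q = -1" "\<And>q. q \<in> V \<union> R \<Longrightarrow> u q = 1"
      using Urysohn[of "U \<union> L" "V \<union> R" "-1::real" 1] disj cl LR
      by (metis closed_Un compact_imp_closed)
    obtain q where q: "q \<in> {0..1} \<times> {a..b}" "u q = 0" "v q = 0"
    proof (rule poincare_miranda[of a b u v])
      show "continuous_on ({0..1} \<times> {a..b}) u" using u(1) continuous_on_subset by blast
    qed (use ab v va vb u(2,3) in \<open>auto simp: L_def R_def\<close>)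
    then have "q \<in> U \<union> V" using UV(3) by (auto simp: C_def Q_def)
    then show False using u(2,3)[of q] q(2) by auto
  qed
  then obtain K where K: "connected K" "K \<subseteq> C" "\<not> disjnt K (C \<inter> L)" "\<not> disjnt K (C \<inter> R)" by blast
  have "closure K \<subseteq> C" using K(2) C by (simp add: closure_minimal compact_imp_closed)
  moreover have "compact (closure K)" using K(2) C compact_closure bounded_subset compact_imp_bounded by blast
  moreover obtain s s' where "(0, s) \<in> K" "(1, s') \<in> K"
    using K(3,4) by (auto simp: disjnt_def L_def R_def)
  then have "(0, s) \<in> closure K" "(1, s') \<in> closure K" using closure_subset by auto
  ultimately show ?thesis using that[of "closure K" s s'] K(1) by (auto simp: C_def Q_def connected_imp_connected_closure)
qed

text \<open>The image of \<open>K\<close> may run back and forth along the half circle, so there is no path whose length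
  could be estimated.  But \<open>\<Phi>\<close> minus a primitive \<open>F\<close> with respect to the angle is locally constant on the
  connected set \<open>K\<close>, hence the increment of \<open>\<Phi>\<close> is an integral over an arc of the half circle.\<close>

lemma primitive_increment_on_half_circle:
  fixes H :: "'x::metric_space \<Rightarrow> complex" and l :: real
  assumes K: "compact K" "connected K" and H: "continuous_on K H"
    and circ: "\<And>q. q \<in> K \<Longrightarrow> cmod (H q - of_real p) = r" and r: "r > 0"
    and l: "l = 1 \<or> l = -1" and half: "\<And>q. q \<in> K \<Longrightarrow> l * Im (H q) \<ge> 0"
    and h: "\<And>q. q \<in> K \<Longrightarrow> isCont h (H q)" and M: "\<And>q. q \<in> K \<Longrightarrow> cmod (h (H q)) \<le> M"
    and \<Phi>: "\<And>q. q \<in> K \<Longrightarrow> \<exists>P. (\<forall>\<^sub>F w in nhds (H q). (P has_field_derivative h w) (at w)) \<and>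
       (\<forall>\<^sub>F q' in at q within K. \<Phi> q' - \<Phi> q = P (H q') - P (H q))"
    and q: "q0 \<in> K" "q1 \<in> K"
  shows "cmod (\<Phi> q1 - \<Phi> q0) \<le> pi * r * M"
proof -
  define e where "e = (\<lambda>\<theta>. of_real p + of_real r * exp (\<i> * of_real (l * \<theta>)))"
  define \<theta> where "\<theta> = (\<lambda>q. arccos ((Re (H q) - p) / r))"
  have le: "- 1 \<le> (Re (H q) - p) / r" "(Re (H q) - p) / r \<le> 1" if "q \<in> K" for q
  proof -
    have "\<bar>Re (H q) - p\<bar> \<le> r"
      using circ[OF that] abs_Re_le_cmod[of "H q - of_real p"] by simp
    then show "- 1 \<le> (Re (H q) - p) / r" "(Re (H q) - p) / r \<le> 1" using r by (auto simp: field_simps)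
  qed
  have \<theta>: "0 \<le> \<theta> q" "\<theta> q \<le> pi" "cos (\<theta> q) = (Re (H q) - p) / r" if "q \<in> K" for q
    unfolding \<theta>_def using le[OF that] by (simp_all only: arccos_lbound arccos_ubound cos_arccos)
  have sin: "sin (\<theta> q) = l * Im (H q) / r" if "q \<in> K" for q
  proof -
    have "(sin (\<theta> q))\<^sup>2 = (l * Im (H q) / r)\<^sup>2"
    proof -
      have "(Re (H q) - p)\<^sup>2 + (Im (H q))\<^sup>2 = r\<^sup>2"
        using circ[OF that] by (simp add: cmod_power2 flip: circ[OF that])
      then have "((Re (H q) - p) / r)\<^sup>2 + (Im (H q) / r)\<^sup>2 = 1"
        using r by (simp add: power_divide flip: add_divide_distrib)
      then show ?thesis using \<theta>(3)[OF that] l sin_squared_eq[of "\<theta> q"] by (auto simp: power_divide)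
    qed
    moreover have "sin (\<theta> q) \<ge> 0" using \<theta>[OF that] by (simp add: sin_ge_zero)
    moreover have "l * Im (H q) / r \<ge> 0" using half[OF that] r by simp
    ultimately show ?thesis by (simp add: power2_eq_iff_nonneg)
  qed
  have e\<theta>: "e (\<theta> q) = H q" if "q \<in> K" for q
  proof -
    have "exp (\<i> * of_real (l * \<theta> q)) = Complex (cos (\<theta> q)) (l * sin (\<theta> q))"
      using l by (auto simp: complex_eq_iff Re_exp Im_exp)
    then show ?thesis
      using \<theta>(3)[OF that] sin[OF that] r l by (auto simp: e_def complex_eq_iff)
  qed
  have \<theta>c: "continuous_on K \<theta>"
    unfolding \<theta>_def using le H r
    by (intro continuous_on_arccos continuous_intros) (auto simp: abs_le_iff)
  have "compact (\<theta> ` K)" "connected (\<theta> ` K)"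
    using compact_continuous_image[OF \<theta>c K(1)] connected_continuous_image[OF \<theta>c K(2)] by auto
  then obtain \<alpha> \<beta> where J: "\<theta> ` K = {\<alpha>..\<beta>}" by (metis connected_compact_interval_1)
  define G where "G = (\<lambda>x. h (e x) * (\<i> * of_real (l * r) * exp (\<i> * of_real (l * x))))"
  have ed: "(e has_vector_derivative \<i> * of_real (l * r) * exp (\<i> * of_real (l * x))) (at x within S)" for x S
  proof -
    have "((\<lambda>z. of_real p + of_real r * exp (\<i> * (of_real l * z))) has_field_derivative \<i> * of_real (l * r) * exp (\<i> * of_real (l * x))) (at (of_real x))"
      by (auto intro!: derivative_eq_intros)
    from has_vector_derivative_real_field[OF this] show ?thesis
      unfolding e_def by (simp add: has_vector_derivative_at_within)
  qed
  have ec: "continuous (at x within S) e" for x S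
    using ed has_vector_derivative_continuous by blast
  have "continuous_on {\<alpha>..\<beta>} G"
    unfolding continuous_on_eq_continuous_within
  proof
    fix x assume x: "x \<in> {\<alpha>..\<beta>}"
    obtain q where q: "q \<in> K" "x = \<theta> q" using x unfolding J[symmetric] by blast
    have "isCont h (e x)" using h[OF q(1)] e\<theta>[OF q(1)] q by simp
    then have "continuous (at x within {\<alpha>..\<beta>}) (\<lambda>x. h (e x))"
      by (rule continuous_within_compose3[where g = h and f = e]) (rule ec)
    then show "continuous (at x within {\<alpha>..\<beta>}) G"
      unfolding G_def by (intro continuous_intros)
  qed
  then obtain F where F: "\<And>x. x \<in> {\<alpha>..\<beta>} \<Longrightarrow> (F has_vector_derivative G x) (at x within {\<alpha>..\<beta>})"
    using antiderivative_continuous by blast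
  \<comment> \<open>locally \<open>\<Phi>\<close> is \<open>P \<circ> H\<close> and \<open>F\<close> is \<open>P \<circ> e\<close>, each up to a constant, and \<open>e \<circ> \<theta> = H\<close>\<close>
  have "(\<lambda>q. \<Phi> q - F (\<theta> q)) constant_on K"
  proof (rule locally_constant_imp_constant[OF K(2)])
    fix q assume q: "q \<in> K"
    obtain P where P1: "\<forall>\<^sub>F w in nhds (H q). (P has_field_derivative h w) (at w)"
      and P2: "\<forall>\<^sub>F q' in at q within K. \<Phi> q' - \<Phi> q = P (H q') - P (H q)" using \<Phi>[OF q] by blast
    obtain W where W: "open W" "H q \<in> W" "\<And>w. w \<in> W \<Longrightarrow> (P has_field_derivative h w) (at w)"
      using P1 unfolding eventually_nhds by blast
    have "\<forall>\<^sub>F x in at (\<theta> q). e x \<in> W"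
      using ec[of "\<theta> q" UNIV] W e\<theta>[OF q] unfolding continuous_def
      by (metis netlimit_at topological_tendstoD)
    then obtain \<delta> where \<delta>: "\<delta> > 0" "\<And>x. dist x (\<theta> q) < \<delta> \<Longrightarrow> e x \<in> W"
      using W(2) e\<theta>[OF q] unfolding eventually_at by (metis UNIV_I)
    define Y where "Y = {\<alpha>..\<beta>} \<inter> ball (\<theta> q) \<delta>"
    have "\<exists>c. \<forall>x\<in>Y. F x - P (e x) = c"
    proof (rule has_derivative_zero_constant)
      show "convex Y" by (auto simp: Y_def intro: convex_Int)
      fix x assume x: "x \<in> Y"
      then have "e x \<in> W" using \<delta>(2)[of x] by (simp add: Y_def dist_commute)
      then have A1: "((P \<circ> e) has_vector_derivative (\<i> * of_real (l * r) * exp (\<i> * of_real (l * x))) * h (e x)) (at x within Y)"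
        using W(3)[of "e x"] ed[of x Y] by (intro field_vector_diff_chain_within) (auto intro: has_field_derivative_at_within)
      have A2: "(F has_vector_derivative G x) (at x within Y)"
        using F[of x] x by (auto simp: Y_def intro: has_vector_derivative_within_subset)
      have "((\<lambda>x. F x - (P \<circ> e) x) has_vector_derivative 0) (at x within Y)"
        using has_vector_derivative_diff[OF A2 A1] by (simp add: G_def mult.commute)
      then show "((\<lambda>x. F x - P (e x)) has_derivative (\<lambda>h. 0)) (at x within Y)"
        by (simp add: has_vector_derivative_def o_def)
    qed
    then obtain c where c: "\<And>x. x \<in> Y \<Longrightarrow> F x - P (e x) = c" by blast
    have ev\<theta>: "\<forall>\<^sub>F q' in at q within K. dist (\<theta> q') (\<theta> q) < \<delta>"
      using \<theta>c q \<delta>(1) unfolding continuous_on tendsto_iff by blast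
    have "\<forall>\<^sub>F q' in at q within K. q' \<in> K" by (simp add: eventually_at_filter)
    then have "\<forall>\<^sub>F q' in at q within K. \<Phi> q' - F (\<theta> q') = \<Phi> q - F (\<theta> q)"
      using P2 ev\<theta>
    proof eventually_elim
      case (elim q')
      have "\<theta> q \<in> Y" "\<theta> q' \<in> Y" using elim q J \<delta>(1) by (auto simp: Y_def dist_commute)
      then have "F (\<theta> q) - P (H q) = F (\<theta> q') - P (H q')" using c e\<theta>[OF q] e\<theta>[OF elim(1)] by metis
      then have "F (\<theta> q') = F (\<theta> q) - P (H q) + P (H q')" by simp
      moreover have "\<Phi> q' = \<Phi> q + P (H q') - P (H q)" using elim(2) by (simp add: algebra_simps)
      ultimately show ?case by simp
    qed
    then obtain U where U: "open U" "q \<in> U" "\<And>q'. q' \<in> U \<Longrightarrow> q' \<noteq> q \<Longrightarrow> q' \<in> K \<Longrightarrow> \<Phi> q' - F (\<theta> q') = \<Phi> q - F (\<theta> q)"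
      unfolding eventually_at_topological by blast
    show "\<exists>T. openin (top_of_set K) T \<and> q \<in> T \<and> (\<forall>x\<in>T. \<Phi> x - F (\<theta> x) = \<Phi> q - F (\<theta> q))"
      using U q by (intro exI[of _ "K \<inter> U"]) (auto simp: openin_open_Int)
  qed
  then obtain c where c: "\<And>q. q \<in> K \<Longrightarrow> \<Phi> q - F (\<theta> q) = c" unfolding constant_on_def by blast
  have "\<Phi> q1 - F (\<theta> q1) = \<Phi> q0 - F (\<theta> q0)" using c[OF q(1)] c[OF q(2)] by simp
  then have "\<Phi> q1 - \<Phi> q0 = F (\<theta> q1) - F (\<theta> q0)" by (simp add: algebra_simps)
  moreover have "cmod (F (\<theta> q1) - F (\<theta> q0)) \<le> (r * M) * norm (\<theta> q1 - \<theta> q0)"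
  proof (rule differentiable_bound[of "{\<alpha>..\<beta>}" F "\<lambda>x h. h *\<^sub>R G x"])
    show "(F has_derivative (\<lambda>h. h *\<^sub>R G x)) (at x within {\<alpha>..\<beta>})" if "x \<in> {\<alpha>..\<beta>}" for x
      using F[OF that] by (simp add: has_vector_derivative_def)
    show "onorm (\<lambda>h. h *\<^sub>R G x) \<le> r * M" if x: "x \<in> {\<alpha>..\<beta>}" for x
    proof -
      obtain q where q: "q \<in> K" "x = \<theta> q" using x unfolding J[symmetric] by blast
      have "cmod (G x) = cmod (h (e x)) * (\<bar>l\<bar> * r)"
        using r by (simp add: G_def norm_mult abs_mult)
      also have "\<dots> \<le> r * M" using M[OF q(1)] e\<theta>[OF q(1)] q l r by (auto simp: mult.commute)
      finally have "norm (h *\<^sub>R G x) \<le> r * M * norm h" for h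
        using mult_right_mono[of "cmod (G x)" "r * M" "\<bar>h\<bar>"] by (simp add: mult.commute)
      then show ?thesis by (intro onorm_le) auto
    qed
  qed (use q J in auto)
  moreover have "norm (\<theta> q1 - \<theta> q0) \<le> pi"
    using \<theta>[OF q(1)] \<theta>[OF q(2)] by (simp add: abs_le_iff)
  moreover have "r * M \<ge> 0" using M[OF q(1)] r norm_ge_zero[of "h (H q0)"] by (meson mult_nonneg_nonneg less_imp_le order_trans)
  ultimately show ?thesis
    using mult_left_mono[of "norm (\<theta> q1 - \<theta> q0)" pi "r * M"] by (simp add: mult_ac)
qed

section \<open>Cauchy's theorem for deformations of an interval\<close>

lemma continuous_mult_absolutely_integrable:
  fixes f \<phi> :: "real \<Rightarrow> complex"
  assumes f: "f absolutely_integrable_on {a..b}" and \<phi>: "continuous_on {a..b} \<phi>"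
  shows "(\<lambda>s. \<phi> s * f s) absolutely_integrable_on {a..b}"
proof (rule absolutely_integrable_bounded_measurable_product[OF bilinear_times _ _ _ f])
  show "\<phi> \<in> borel_measurable (lebesgue_on {a..b})"
    using \<phi> by (intro continuous_imp_measurable_on_sets_lebesgue) auto
  show "bounded (\<phi> ` {a..b})"
    using \<phi> by (intro compact_imp_bounded compact_continuous_image) auto
qed auto

lemma eventually_right_end:
  assumes "m1 < m2"
  shows "eventually P (filtermap real_of_ereal (at_left m2)) \<longleftrightarrow>
    (\<exists>c\<in>einterval m1 m2. \<forall>s\<in>einterval m1 m2. c < s \<longrightarrow> P s)"
proof
  assume "eventually P (filtermap real_of_ereal (at_left m2))"
  then obtain b where b: "b < m2" "\<And>y. b < y \<Longrightarrow> y < m2 \<Longrightarrow> P (real_of_ereal y)"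
    using eventually_at_left[OF assms] by (auto simp: eventually_filtermap)
  obtain c where c: "max b m1 < ereal c" "ereal c < m2"
    using ereal_dense3[of "max b m1" m2] b assms ereal_dense2 by (metis max_less_iff_conj)
  then show "\<exists>c\<in>einterval m1 m2. \<forall>s\<in>einterval m1 m2. c < s \<longrightarrow> P s"
    using b(2) by (intro bexI[of _ c]) (auto simp: einterval_def, metis less_ereal.simps(1) less_trans real_of_ereal.simps(1))
next
  assume "\<exists>c\<in>einterval m1 m2. \<forall>s\<in>einterval m1 m2. c < s \<longrightarrow> P s"
  then obtain c where c: "c \<in> einterval m1 m2" "\<And>s. s \<in> einterval m1 m2 \<Longrightarrow> c < s \<Longrightarrow> P s" by blast
  have "P (real_of_ereal y)" if y: "ereal c < y" "y < m2" for y
  proof -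
    obtain r where [simp]: "y = ereal r" using y by (cases y) auto
    show ?thesis using y c less_trans[of m1 "ereal c" y] by (auto simp: einterval_def)
  qed
  then show "eventually P (filtermap real_of_ereal (at_left m2))"
    using eventually_at_left[OF assms] c(1) by (auto simp: eventually_filtermap einterval_def)
qed

lemma eventually_left_end:
  assumes "m1 < m2"
  shows "eventually P (filtermap real_of_ereal (at_right m1)) \<longleftrightarrow>
    (\<exists>c\<in>einterval m1 m2. \<forall>s\<in>einterval m1 m2. s < c \<longrightarrow> P s)"
proof
  assume "eventually P (filtermap real_of_ereal (at_right m1))"
  then obtain b where b: "m1 < b" "\<And>y. m1 < y \<Longrightarrow> y < b \<Longrightarrow> P (real_of_ereal y)"
    using eventually_at_right[OF assms] by (auto simp: eventually_filtermap)
  obtain c where c: "m1 < ereal c" "ereal c < min b m2"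
    using b assms ereal_dense2 by (metis min_less_iff_conj)
  then show "\<exists>c\<in>einterval m1 m2. \<forall>s\<in>einterval m1 m2. s < c \<longrightarrow> P s"
    using b(2) by (intro bexI[of _ c]) (auto simp: einterval_def, metis less_ereal.simps(1) less_trans real_of_ereal.simps(1))
next
  assume "\<exists>c\<in>einterval m1 m2. \<forall>s\<in>einterval m1 m2. s < c \<longrightarrow> P s"
  then obtain c where c: "c \<in> einterval m1 m2" "\<And>s. s \<in> einterval m1 m2 \<Longrightarrow> s < c \<Longrightarrow> P s" by blast
  have "P (real_of_ereal y)" if y: "m1 < y" "y < ereal c" for y
  proof -
    obtain r where [simp]: "y = ereal r" using y by (cases y) auto
    show ?thesis using y c less_trans[of y "ereal c" m2] by (auto simp: einterval_def)
  qed
  then show "eventually P (filtermap real_of_ereal (at_right m1))"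
    using eventually_at_right[OF assms] c(1) by (auto simp: eventually_filtermap einterval_def)
qed

lemma einterval_Icc_subset: "a \<in> einterval m1 m2 \<Longrightarrow> b \<in> einterval m1 m2 \<Longrightarrow> {a..b} \<subseteq> einterval m1 m2"
  by (auto simp: einterval_def) (metis ereal_less_eq(3) less_le_trans, metis ereal_less_eq(3) le_less_trans)

lemma convex_einterval: "convex (einterval m1 m2)"
  using einterval_Icc_subset unfolding is_interval_convex_1[symmetric] is_interval_1 by fastforce

text \<open>The exhausting intervals are arbitrary, because Cauchy's theorem below truncates the two curves at
  different parameters.\<close>

lemma einterval_dominated:
  fixes g :: "real \<Rightarrow> 'n::euclidean_space"
  assumes m: "m1 < m2" and loc: "\<And>a b. {a..b} \<subseteq> einterval m1 m2 \<Longrightarrow> g integrable_on {a..b}"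
    and w: "w integrable_on einterval m1 m2" "\<And>x. x \<in> einterval m1 m2 \<Longrightarrow> norm (g x) \<le> w x"
  shows einterval_dominated_integrable: "g absolutely_integrable_on einterval m1 m2"
    and einterval_dominated_limit: "\<And>a b. (\<And>n. {a n..b n} \<subseteq> einterval m1 m2) \<Longrightarrow>
       (\<And>x. x \<in> einterval m1 m2 \<Longrightarrow> \<forall>\<^sub>F n in sequentially. x \<in> {a n..b n}) \<Longrightarrow>
       (\<lambda>n. integral {a n..b n} g) \<longlonglongrightarrow> integral (einterval m1 m2) g"
proof -
  let ?I = "einterval m1 m2"
  have *: "g integrable_on ?I \<and> (\<lambda>n. integral {a n..b n} g) \<longlonglongrightarrow> integral ?I g"
    if sub: "\<And>n. {a n..b n} \<subseteq> ?I" and ev: "\<And>x. x \<in> ?I \<Longrightarrow> \<forall>\<^sub>F n in sequentially. x \<in> {a n..b n}" for a b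
  proof -
    define f where "f = (\<lambda>n x. if x \<in> {a n..b n} then g x else 0)"
    have fi: "f n integrable_on ?I" "integral ?I (f n) = integral {a n..b n} g" for n
      using loc[OF sub[of n]] integrable_restrict_Int[of "{a n..b n}" g ?I] integral_restrict_Int[of ?I "{a n..b n}" g] sub[of n]
      by (simp_all add: f_def Int_absorb2 Int_absorb1)
    have le: "norm (f n x) \<le> w x" if "x \<in> ?I" for n x
      using w(2)[OF that] norm_ge_zero[of "g x"] by (auto simp: f_def simp del: norm_ge_zero)
    have lim: "(\<lambda>n. f n x) \<longlonglongrightarrow> g x" if "x \<in> ?I" for x
      by (rule tendsto_eventually, rule eventually_mono[OF ev[OF that]]) (simp add: f_def)
    have "g integrable_on ?I" "(\<lambda>n. integral ?I (f n)) \<longlonglongrightarrow> integral ?I g"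
      using dominated_convergence[of f ?I w g, OF fi(1) w(1) le lim] by auto
    then show ?thesis by (simp add: fi)
  qed
  obtain u v where uv: "\<And>i. m1 < ereal (v i)" "\<And>i. ereal (u i) < m2" "\<And>i. v i < u i" "?I = (\<Union>i. {v i..u i})" "incseq u" "decseq v"
    by (rule einterval_Icc_approximation[OF m]) blast
  have "x \<in> ?I \<Longrightarrow> \<forall>\<^sub>F n in sequentially. x \<in> {v n..u n}" for x
  proof -
    assume "x \<in> ?I"
    then obtain i where "x \<in> {v i..u i}" using uv(4) by auto
    then have "x \<in> {v n..u n}" if "n \<ge> i" for n
      using incseqD[OF uv(5) that] decseqD[OF uv(6) that] by auto
    then show ?thesis unfolding eventually_sequentially by blast
  qed
  moreover have "{v n..u n} \<subseteq> ?I" for n using uv(4) by blast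
  ultimately have "g integrable_on ?I" using *[of v u] by blast
  then show "g absolutely_integrable_on ?I"
    using w by (intro absolutely_integrable_integrable_bound)
  show "(\<lambda>n. integral {a n..b n} g) \<longlonglongrightarrow> integral ?I g"
    if "\<And>n. {a n..b n} \<subseteq> ?I" "\<And>x. x \<in> ?I \<Longrightarrow> \<forall>\<^sub>F n in sequentially. x \<in> {a n..b n}" for a b
    using *[OF that] by blast
qed

text \<open>An arc of radius \<open>r'\<close> on which the integrand is bounded by \<open>C r'\<^sup>g\<close> contributes an amount of the
  order of \<open>r'\<close> to the power \<open>1 + g\<close>.\<close>

lemma small_arc_radius:
  fixes C g \<epsilon> \<delta> :: real
  assumes "g > -1" "\<epsilon> > 0" "\<delta> > 0"
  obtains r where "0 < r" "r < \<delta>" "\<And>r'. 0 < r' \<Longrightarrow> r' \<le> r \<Longrightarrow> pi * r' * (C * r' powr g) < \<epsilon>"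
proof -
  define x where "x = \<epsilon> / (pi * \<bar>C\<bar> + 1)"
  have pos: "pi * \<bar>C\<bar> + 1 > 0" by (smt (verit) pi_ge_zero zero_le_mult_iff abs_ge_zero)
  have x: "x > 0" using assms pos by (simp add: x_def)
  define r where "r = min (\<delta>/2) (x powr (1/(1+g)))"
  have r: "0 < r" "r < \<delta>" using assms x by (auto simp: r_def)
  have "pi * r' * (C * r' powr g) < \<epsilon>" if r': "0 < r'" "r' \<le> r" for r'
  proof -
    have "r' powr (1+g) \<le> (x powr (1/(1+g))) powr (1+g)"
      using r' assms by (intro powr_mono2) (auto simp: r_def)
    also have "\<dots> = x" using assms x by (simp add: powr_powr)
    finally have 1: "r' powr (1+g) \<le> x" .
    have "pi * r' * (C * r' powr g) = pi * C * r' powr (1+g)"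
      using r' by (simp add: powr_add)
    also have "\<dots> \<le> pi * \<bar>C\<bar> * r' powr (1+g)"
      by (intro mult_right_mono mult_left_mono) auto
    also have "\<dots> \<le> pi * \<bar>C\<bar> * x" using 1 by (intro mult_left_mono) auto
    also have "\<dots> < (pi * \<bar>C\<bar> + 1) * x" using x by (simp add: algebra_simps)
    also have "\<dots> = \<epsilon>" using pos by (simp add: x_def)
    finally show ?thesis .
  qed
  then show ?thesis using that r by blast
qed

text \<open>Cauchy's theorem.  Let \<open>\<Phi>\<close> be the primitive of \<open>h\<close> lifted to the parameter strip of the deformation.
  Its increments along \<open>t = 0\<close> and \<open>t = 1\<close> are integrals along the interval and along \<open>\<gamma>\<close>, so it
  suffices to connect the two sides of the strip, near either end, by sets on which \<open>\<Phi>\<close> varies little.  At an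
  infinite end the cross-cuts \<open>t \<mapsto> H t s\<close> serve, some of which have small \<open>K\<close>-variation.  At a finite
  end point \<open>p\<close> a cross-cut may have infinite length; there a connected part of the level set
  \<open>\<bar>H - p\<bar> = r\<close> serves, along which \<open>\<Phi>\<close> varies by at most \<open>\<pi> r C r\<^sup>g\<close>, because \<open>H\<close> maps it into a half
  circle.\<close>

lemma contour_deformation:
  fixes h :: "complex \<Rightarrow> complex" and K :: "complex \<Rightarrow> 'c::real_normed_vector" and l :: real
  assumes m: "m1 < m2" and l: "l = 1 \<or> l = -1" and D: "D \<subseteq> {z. l * Im z > 0}"
    and \<gamma>: "contour K m1 m2 D \<gamma>" "finite_variation K \<gamma> (einterval m1 m2)"
    and \<Omega>: "open \<Omega>" "h holomorphic_on \<Omega>" "D \<union> of_real ` einterval m1 m2 \<subseteq> \<Omega>"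
    and bound: "\<And>z. z \<in> D \<union> of_real ` einterval m1 m2 \<Longrightarrow> cmod (h z) \<le> M * norm (K z)"
    and ends: "\<And>p. ereal p \<in> {m1, m2} \<Longrightarrow> \<exists>C g \<delta>. -1 < g \<and> \<delta> > 0 \<and>
      (\<forall>z\<in>D \<union> of_real ` einterval m1 m2. cmod (z - of_real p) < \<delta> \<longrightarrow> cmod (h z) \<le> C * cmod (z - of_real p) powr g)"
    and real: "(\<lambda>s. h (of_real s)) absolutely_integrable_on einterval m1 m2"
  shows contour_deformation_integrable:
      "(\<lambda>s. h (\<gamma> s) * tangent \<gamma> (einterval m1 m2) s) absolutely_integrable_on einterval m1 m2" (is ?A)
    and contour_deformation_integral:
      "integral (einterval m1 m2) (\<lambda>s. h (\<gamma> s) * tangent \<gamma> (einterval m1 m2) s)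
        = integral (einterval m1 m2) (\<lambda>s. h (of_real s))" (is ?B)
proof -
  let ?I = "einterval m1 m2"
  define S where "S = D \<union> complex_of_real ` ?I"
  define Q where "Q = {0..1::real} \<times> ?I"
  obtain H where H: "continuous_on Q (\<lambda>(t, s). H t s)" "\<And>t s. t \<in> {0..1} \<Longrightarrow> s \<in> ?I \<Longrightarrow> H t s \<in> S"
      "\<And>s. s \<in> ?I \<Longrightarrow> H 0 s = of_real s" "\<And>s. s \<in> ?I \<Longrightarrow> H 1 s = \<gamma> s"
      "end_condition K H (filtermap real_of_ereal (at_right m1)) m1"
      "end_condition K H (filtermap real_of_ereal (at_left m2)) m2"
    using \<gamma>(1) unfolding contour_def S_def Q_def by blast
  have rect: "rectifiable_on \<gamma> ?I" using \<gamma>(1) by (simp add: contour_def)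
  define HH where "HH = (\<lambda>(t, s). H t s)"
  have HH: "continuous_on Q HH" "HH ` Q \<subseteq> S" using H(1,2) by (auto simp: HH_def Q_def)
  have S\<Omega>: "S \<subseteq> \<Omega>" using \<Omega>(3) by (simp add: S_def)
  have Qc: "convex Q" unfolding Q_def by (intro convex_Times convex_einterval) auto
  obtain \<Phi> where \<Phi>: "\<And>q. q \<in> Q \<Longrightarrow> \<exists>P. (\<forall>\<^sub>F w in nhds (HH q). (P has_field_derivative h w) (at w)) \<and>
    (\<forall>\<^sub>F q' in at q within Q. \<Phi> q' - \<Phi> q = P (HH q') - P (HH q))"
    by (rule lifted_primitive[OF Qc HH(1) order_trans[OF HH(2) S\<Omega>] \<Omega>(1,2)]) blast
  have hc: "isCont h z" if "z \<in> S" for z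
    using that S\<Omega> \<Omega>(1,2) holomorphic_on_imp_continuous_on continuous_on_eq_continuous_at by blast
  \<comment> \<open>the integral of \<open>h\<close> along the image of a path in the parameter strip is an increment of \<open>\<Phi>\<close>\<close>
  have chain: "((\<lambda>x. h (HH (\<sigma> x)) * f x) has_integral (\<Phi> (\<sigma> b) - \<Phi> (\<sigma> a))) {a..b}"
    if "a \<le> b" "f absolutely_integrable_on {a..b}"
      and f: "\<And>x x'. a \<le> x \<Longrightarrow> x \<le> x' \<Longrightarrow> x' \<le> b \<Longrightarrow> (f has_integral (HH (\<sigma> x') - HH (\<sigma> x))) {x..x'}"
      and \<sigma>: "\<And>x. x \<in> {a..b} \<Longrightarrow> \<sigma> x \<in> Q"
      and iso: "\<And>x x'. x \<in> {a..b} \<Longrightarrow> x' \<in> {a..b} \<Longrightarrow> dist (\<sigma> x') (\<sigma> x) \<le> \<bar>x' - x\<bar>" for a b f \<sigma>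
  proof (rule chain_rule_has_integral[where N = "\<lambda>x. \<Phi> (\<sigma> x)" and \<eta> = "\<lambda>x. HH (\<sigma> x)"])
    fix x assume x: "x \<in> {a..b}"
    show "isCont h (HH (\<sigma> x))" using \<sigma>[OF x] HH(2) by (intro hc) auto
    obtain P where P: "\<forall>\<^sub>F w in nhds (HH (\<sigma> x)). (P has_field_derivative h w) (at w)"
      "\<forall>\<^sub>F q' in at (\<sigma> x) within Q. \<Phi> q' - \<Phi> (\<sigma> x) = P (HH q') - P (HH (\<sigma> x))"
      using \<Phi>[OF \<sigma>[OF x]] by blast
    obtain \<delta> where \<delta>: "\<delta> > 0" "\<And>q'. q' \<in> Q \<Longrightarrow> q' \<noteq> \<sigma> x \<Longrightarrow> dist q' (\<sigma> x) < \<delta> \<Longrightarrow> \<Phi> q' - \<Phi> (\<sigma> x) = P (HH q') - P (HH (\<sigma> x))"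
      using P(2) unfolding eventually_at by blast
    have "\<Phi> (\<sigma> x') - \<Phi> (\<sigma> x) = P (HH (\<sigma> x')) - P (HH (\<sigma> x))" if "x' \<in> {a..b}" "\<bar>x' - x\<bar> < \<delta>" for x'
      using \<delta>(2)[of "\<sigma> x'"] \<sigma>[of x'] iso[OF x, of x'] that by (cases "\<sigma> x' = \<sigma> x") auto
    moreover have "(P has_field_derivative h (HH (\<sigma> x))) (at (HH (\<sigma> x)))"
      using P(1) by (rule eventually_nhds_x_imp_x)
    ultimately show "\<exists>P. (P has_field_derivative h (HH (\<sigma> x))) (at (HH (\<sigma> x))) \<and>
      (\<exists>\<delta>>0. \<forall>x'\<in>{a..b}. \<bar>x' - x\<bar> < \<delta> \<longrightarrow> \<Phi> (\<sigma> x') - \<Phi> (\<sigma> x) = P (HH (\<sigma> x')) - P (HH (\<sigma> x)))"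
      using \<delta>(1) by blast
  qed (use that in auto)
  have alongG: "((\<lambda>s. h (\<gamma> s) * tangent \<gamma> ?I s) has_integral (\<Phi> (1, b) - \<Phi> (1, a))) {a..b}"
    if ab: "a \<le> b" "a \<in> ?I" "b \<in> ?I" for a b
  proof -
    have sub: "{a..b} \<subseteq> ?I" using ab einterval_Icc_subset by blast
    have "((\<lambda>s. h (HH (1, s)) * tangent \<gamma> ?I s) has_integral (\<Phi> (1, b) - \<Phi> (1, a))) {a..b}"
    proof (rule chain[of a b "tangent \<gamma> ?I" "\<lambda>s. (1, s)"])
      have "?I \<inter> {a..b} = {a..b}" using sub by auto
      then show "tangent \<gamma> ?I absolutely_integrable_on {a..b}"
        using rect unfolding rectifiable_on_def by metis
      show "(tangent \<gamma> ?I has_integral HH (1, x') - HH (1, x)) {x..x'}" if "a \<le> x" "x \<le> x'" "x' \<le> b" for x x'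
      proof -
        have "x \<in> ?I" "x' \<in> ?I" using that sub by auto
        then show ?thesis using rect that H(4) unfolding rectifiable_on_def by (simp add: HH_def)
      qed
    qed (use ab sub in \<open>auto simp: Q_def dist_Pair_Pair dist_real_def\<close>)
    then show ?thesis
      by (rule has_integral_eq[rotated]) (use sub H(4) in \<open>auto simp: HH_def\<close>)
  qed
  have alongR: "((\<lambda>s. h (of_real s)) has_integral (\<Phi> (0, b) - \<Phi> (0, a))) {a..b}"
    if ab: "a \<le> b" "a \<in> ?I" "b \<in> ?I" for a b
  proof -
    have sub: "{a..b} \<subseteq> ?I" using ab einterval_Icc_subset by blast
    have "((\<lambda>s. h (HH (0, s)) * 1) has_integral (\<Phi> (0, b) - \<Phi> (0, a))) {a..b}"
    proof (rule chain[of a b "\<lambda>_. 1" "\<lambda>s. (0, s)"])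
      show "((\<lambda>_. 1) has_integral HH (0, x') - HH (0, x)) {x..x'}" if "a \<le> x" "x \<le> x'" "x' \<le> b" for x x'
      proof -
        have "x \<in> ?I" "x' \<in> ?I" using that sub by auto
        then have "HH (0, x) = of_real x" "HH (0, x') = of_real x'" using H(3) by (auto simp: HH_def)
        then show ?thesis using has_integral_const_real[of "1::complex" x x'] that
          by (simp add: scaleR_conv_of_real)
      qed
      show "(\<lambda>_. 1::complex) absolutely_integrable_on {a..b}" by (intro absolutely_integrable_continuous_real) auto
    qed (use ab sub in \<open>auto simp: Q_def dist_Pair_Pair dist_real_def\<close>)
    then show ?thesis
      by (rule has_integral_eq[rotated]) (use sub H(3) in \<open>auto simp: HH_def\<close>)
  qed
  define M' where "M' = \<bar>M\<bar> + 1"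
  have M': "M' > 0" "\<And>z. z \<in> S \<Longrightarrow> cmod (h z) \<le> M' * norm (K z)"
  proof -
    show "M' > 0" by (simp add: M'_def)
    show "cmod (h z) \<le> M' * norm (K z)" if "z \<in> S" for z
    proof -
      have "cmod (h z) \<le> M * norm (K z)" using bound that by (simp add: S_def)
      also have "\<dots> \<le> M' * norm (K z)" by (intro mult_right_mono) (auto simp: M'_def)
      finally show ?thesis .
    qed
  qed
  have cross: "cmod (\<Phi> (1, s) - \<Phi> (0, s)) \<le> M' * variation K (\<lambda>t. H t s) {0..1}"
    if s: "s \<in> ?I" "rectifiable_on (\<lambda>t. H t s) {0..1}" "finite_variation K (\<lambda>t. H t s) {0..1}" for s
  proof -
    let ?T = "tangent (\<lambda>t. H t s) {0..1}"
    have *: "((\<lambda>t. h (HH (t, s)) * ?T t) has_integral (\<Phi> (1, s) - \<Phi> (0, s))) {0..1}"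
    proof (rule chain[of 0 1 ?T "\<lambda>t. (t, s)"])
      show "?T absolutely_integrable_on {0..1}"
        using s(2) unfolding rectifiable_on_def by (metis Int_absorb)
      show "(?T has_integral HH (x', s) - HH (x, s)) {x..x'}" if "0 \<le> x" "x \<le> x'" "x' \<le> 1" for x x'
        using s(2) that unfolding rectifiable_on_def by (simp add: HH_def)
    qed (use s in \<open>auto simp: Q_def dist_Pair_Pair dist_real_def\<close>)
    have "cmod (integral {0..1} (\<lambda>t. h (HH (t, s)) * ?T t)) \<le> integral {0..1} (\<lambda>t. M' * (norm (K (H t s)) * cmod (?T t)))"
    proof (rule integral_norm_bound_integral)
      show "(\<lambda>t. h (HH (t, s)) * ?T t) integrable_on {0..1}" using * by blast
      show "(\<lambda>t. M' * (norm (K (H t s)) * cmod (?T t))) integrable_on {0..1}"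
        using s(3) unfolding finite_variation_def by (rule integrable_on_mult_right)
      show "cmod (h (HH (t, s)) * ?T t) \<le> M' * (norm (K (H t s)) * cmod (?T t))" if "t \<in> {0..1}" for t
        using mult_right_mono[OF M'(2)[OF H(2)[OF that s(1)]], of "cmod (?T t)"]
        by (simp add: HH_def norm_mult mult.assoc)
    qed
    then show ?thesis using integral_unique[OF *] by (simp add: variation_def)
  qed
  have Sh: "l * Im z \<ge> 0" if "z \<in> S" for z using that D by (auto simp: S_def intro: less_imp_le)
  \<comment> \<open>near a finite end point \<open>p\<close> an arc of a small circle about \<open>p\<close> replaces the cross-cut\<close>
  have arc: "\<exists>s\<in>{a..b}. \<exists>s'\<in>{a..b}. cmod (\<Phi> (1, s') - \<Phi> (0, s)) \<le> pi * r * (C * r powr g)"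
    if ab: "a \<le> b" "a \<in> ?I" "b \<in> ?I" and r: "0 < r" "r < \<delta>" and sg: "\<sigma> = 1 \<or> \<sigma> = -1"
      and va: "\<And>t. t \<in> {0..1} \<Longrightarrow> \<sigma> * (cmod (H t a - of_real p) - r) > 0"
      and vb: "\<And>t. t \<in> {0..1} \<Longrightarrow> \<sigma> * (cmod (H t b - of_real p) - r) < 0"
      and growth: "\<And>z. z \<in> S \<Longrightarrow> cmod (z - of_real p) < \<delta> \<Longrightarrow> cmod (h z) \<le> C * cmod (z - of_real p) powr g"
    for a b r \<delta> \<sigma> p C g
  proof -
    have sub: "{0..1} \<times> {a..b} \<subseteq> Q" using ab einterval_Icc_subset[of a m1 m2 b] by (auto simp: Q_def)
    obtain X s s' where X: "compact X" "connected X"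
      "X \<subseteq> {q \<in> {0..1} \<times> {a..b}. \<sigma> * (cmod (HH q - of_real p) - r) = 0}" "(0, s) \<in> X" "(1, s') \<in> X"
    proof (rule level_set_connects[of a b "\<lambda>q. \<sigma> * (cmod (HH q - of_real p) - r)"])
      show "continuous_on ({0..1} \<times> {a..b}) (\<lambda>q. \<sigma> * (cmod (HH q - of_real p) - r))"
        using continuous_on_subset[OF HH(1) sub] by (intro continuous_intros)
    qed (use ab va vb in \<open>auto simp: HH_def\<close>)
    have XQ: "X \<subseteq> Q" using X(3) sub by blast
    have circ: "cmod (HH q - of_real p) = r" if "q \<in> X" for q
      using X(3) that sg by auto
    have HS: "HH q \<in> S" if "q \<in> X" for q using that XQ HH(2) by blast
    have "cmod (\<Phi> (1, s') - \<Phi> (0, s)) \<le> pi * r * (C * r powr g)"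
    proof (rule primitive_increment_on_half_circle[OF X(1,2) _ _ r(1) l])
      show "continuous_on X HH" using HH(1) XQ continuous_on_subset by blast
      show "cmod (HH q - of_real p) = r" if "q \<in> X" for q using circ[OF that] .
      show "0 \<le> l * Im (HH q)" if "q \<in> X" for q using Sh[OF HS[OF that]] .
      show "isCont h (HH q)" if "q \<in> X" for q using hc[OF HS[OF that]] .
      show "cmod (h (HH q)) \<le> C * r powr g" if "q \<in> X" for q
        using growth[OF HS[OF that]] circ[OF that] r by simp
      fix q assume q: "q \<in> X"
      have "q \<in> Q" using q XQ by blast
      then obtain P where P: "\<forall>\<^sub>F w in nhds (HH q). (P has_field_derivative h w) (at w)"
        "\<forall>\<^sub>F q' in at q within Q. \<Phi> q' - \<Phi> q = P (HH q') - P (HH q)" using \<Phi> by blast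
      have "\<forall>\<^sub>F q' in at q within X. \<Phi> q' - \<Phi> q = P (HH q') - P (HH q)"
        by (rule filter_leD[OF at_le[OF XQ] P(2)])
      then show "\<exists>P. (\<forall>\<^sub>F w in nhds (HH q). (P has_field_derivative h w) (at w)) \<and>
         (\<forall>\<^sub>F q' in at q within X. \<Phi> q' - \<Phi> q = P (HH q') - P (HH q))" using P(1) by blast
    qed (use X in auto)
    moreover have "s \<in> {a..b}" "s' \<in> {a..b}" using X by auto
    ultimately show ?thesis by blast
  qed
  \<comment> \<open>the deformation does not attain an end point \<open>p\<close>, so a circle of radius less than \<open>\<rho>\<close> about \<open>p\<close>
    separates the cross-cut at \<open>c\<close> from those close to the end\<close>
  have away: "\<exists>\<rho>>0. \<forall>t\<in>{0..1}. \<rho> \<le> cmod (H t c - of_real p)" if "c \<in> ?I" "ereal p \<in> {m1, m2}" for c p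
  proof -
    have "continuous_on {0..1} (\<lambda>t. HH (t, c))"
      by (rule continuous_on_compose2[OF HH(1)]) (use that in \<open>auto simp: Q_def intro!: continuous_intros\<close>)
    then have ct: "continuous_on {0..1} (\<lambda>t. cmod (H t c - of_real p))"
      by (auto simp: HH_def intro!: continuous_intros)
    obtain t0 where t0: "t0 \<in> {0..1}" "\<And>t. t \<in> {0..1} \<Longrightarrow> cmod (H t0 c - of_real p) \<le> cmod (H t c - of_real p)"
      using continuous_attains_inf[OF _ _ ct] by auto
    have "H t0 c \<noteq> of_real p"
      using H(2)[OF t0(1) that(1)] that(2) D by (auto simp: S_def einterval_def)
    then show ?thesis using t0(2) by (intro exI[of _ "cmod (H t0 c - of_real p)"]) auto
  qed
  have endR: "\<exists>s\<in>?I. \<exists>s'\<in>?I. c < s \<and> c < s' \<and> cmod (\<Phi> (1, s') - \<Phi> (0, s)) < \<epsilon>"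
    if c: "c \<in> ?I" and \<epsilon>: "\<epsilon> > 0" for c \<epsilon>
  proof (cases "\<bar>m2\<bar> = \<infinity>")
    case True
    have "\<epsilon> / M' > 0" using \<epsilon> M' by simp
    then have fr: "\<exists>\<^sub>F s in filtermap real_of_ereal (at_left m2). rectifiable_on (\<lambda>t. H t s) {0..1} \<and>
             finite_variation K (\<lambda>t. H t s) {0..1} \<and> variation K (\<lambda>t. H t s) {0..1} < \<epsilon> / M'"
      using H(6) True unfolding end_condition_def by presburger
    have "\<forall>\<^sub>F s in filtermap real_of_ereal (at_left m2). c < s \<and> s \<in> ?I"
    proof -
      have "\<forall>\<^sub>F s in filtermap real_of_ereal (at_left m2). s \<in> ?I"
        unfolding eventually_right_end[OF m] using c by blast
      moreover have "\<forall>\<^sub>F s in filtermap real_of_ereal (at_left m2). c < s"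
        unfolding eventually_right_end[OF m] using c by blast
      ultimately show ?thesis by eventually_elim auto
    qed
    from frequently_ex[OF frequently_eventually_frequently[OF fr this]]
    obtain s where s: "c < s" "s \<in> ?I" "rectifiable_on (\<lambda>t. H t s) {0..1}"
      "finite_variation K (\<lambda>t. H t s) {0..1}" "variation K (\<lambda>t. H t s) {0..1} < \<epsilon> / M'" by blast
    have "cmod (\<Phi> (1, s) - \<Phi> (0, s)) < \<epsilon>"
      using cross[OF s(2-4)] s(5) M'(1) by (simp add: pos_less_divide_eq mult.commute)
    then show ?thesis using s by blast
  next
    case False
    then obtain p where p: "m2 = ereal p" by (cases m2) auto
    obtain C g \<delta> where g: "-1 < g" "\<delta> > 0"
      "\<And>z. z \<in> S \<Longrightarrow> cmod (z - of_real p) < \<delta> \<Longrightarrow> cmod (h z) \<le> C * cmod (z - of_real p) powr g"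
      using ends[of p] p unfolding S_def by blast
    obtain c' where c': "c' \<in> ?I" "c < c'"
      using c p by (metis (no_types, lifting) einterval_iff ereal_less_eq(3) dense less_ereal.simps(1) less_trans)
    obtain \<rho> where \<rho>: "\<rho> > 0" "\<And>t. t \<in> {0..1} \<Longrightarrow> \<rho> \<le> cmod (H t c' - of_real p)" using away[OF c'(1), of p] p by auto
    obtain r where r: "0 < r" "r < min \<delta> \<rho>" "\<And>r'. 0 < r' \<Longrightarrow> r' \<le> r \<Longrightarrow> pi * r' * (C * r' powr g) < \<epsilon>"
      using small_arc_radius[OF g(1) \<epsilon>, of "min \<delta> \<rho>" C] g(2) \<rho>(1) by auto
    have "\<forall>\<^sub>F s in filtermap real_of_ereal (at_left m2). \<forall>t\<in>{0..1}. cmod (H t s - of_real p) < r"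
      using H(6) r(1) unfolding end_condition_def by (simp add: p uniform_limit_iff dist_norm)
    then obtain b where b: "b \<in> ?I" "\<And>s t. s \<in> ?I \<Longrightarrow> b < s \<Longrightarrow> t \<in> {0..1} \<Longrightarrow> cmod (H t s - of_real p) < r"
      unfolding eventually_right_end[OF m] by blast
    obtain d where d: "d \<in> ?I" "max b c' < d"
      using b(1) c'(1) p by (metis (no_types, lifting) einterval_iff ereal_less_eq(3) dense less_ereal.simps(1) less_trans max_def)
    obtain s s' where "s \<in> {c'..d}" "s' \<in> {c'..d}" "cmod (\<Phi> (1, s') - \<Phi> (0, s)) \<le> pi * r * (C * r powr g)"
      using arc[of c' d r \<delta> 1 p C g] d c' r \<rho>(2) b(2)[OF d(1)] g(3) by force
    then show ?thesis using r(3)[of r] r(1) c' einterval_Icc_subset[OF c'(1) d(1)]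
      by (intro bexI[of _ s] bexI[of _ s']) auto
  qed
  have endL: "\<exists>s\<in>?I. \<exists>s'\<in>?I. s < c \<and> s' < c \<and> cmod (\<Phi> (1, s') - \<Phi> (0, s)) < \<epsilon>"
    if c: "c \<in> ?I" and \<epsilon>: "\<epsilon> > 0" for c \<epsilon>
  proof (cases "\<bar>m1\<bar> = \<infinity>")
    case True
    have "\<epsilon> / M' > 0" using \<epsilon> M' by simp
    then have fr: "\<exists>\<^sub>F s in filtermap real_of_ereal (at_right m1). rectifiable_on (\<lambda>t. H t s) {0..1} \<and>
             finite_variation K (\<lambda>t. H t s) {0..1} \<and> variation K (\<lambda>t. H t s) {0..1} < \<epsilon> / M'"
      using H(5) True unfolding end_condition_def by presburger
    have "\<forall>\<^sub>F s in filtermap real_of_ereal (at_right m1). s < c \<and> s \<in> ?I"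
    proof -
      have "\<forall>\<^sub>F s in filtermap real_of_ereal (at_right m1). s \<in> ?I"
        unfolding eventually_left_end[OF m] using c by blast
      moreover have "\<forall>\<^sub>F s in filtermap real_of_ereal (at_right m1). s < c"
        unfolding eventually_left_end[OF m] using c by blast
      ultimately show ?thesis by eventually_elim auto
    qed
    from frequently_ex[OF frequently_eventually_frequently[OF fr this]]
    obtain s where s: "s < c" "s \<in> ?I" "rectifiable_on (\<lambda>t. H t s) {0..1}"
      "finite_variation K (\<lambda>t. H t s) {0..1}" "variation K (\<lambda>t. H t s) {0..1} < \<epsilon> / M'" by blast
    have "cmod (\<Phi> (1, s) - \<Phi> (0, s)) < \<epsilon>"
      using cross[OF s(2-4)] s(5) M'(1) by (simp add: pos_less_divide_eq mult.commute)
    then show ?thesis using s by blast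
  next
    case False
    then obtain p where p: "m1 = ereal p" by (cases m1) auto
    obtain C g \<delta> where g: "-1 < g" "\<delta> > 0"
      "\<And>z. z \<in> S \<Longrightarrow> cmod (z - of_real p) < \<delta> \<Longrightarrow> cmod (h z) \<le> C * cmod (z - of_real p) powr g"
      using ends[of p] p unfolding S_def by blast
    obtain c' where c': "c' \<in> ?I" "c' < c"
      using c p by (metis (no_types, lifting) einterval_iff ereal_less_eq(3) dense less_ereal.simps(1) less_trans)
    obtain \<rho> where \<rho>: "\<rho> > 0" "\<And>t. t \<in> {0..1} \<Longrightarrow> \<rho> \<le> cmod (H t c' - of_real p)" using away[OF c'(1), of p] p by auto
    obtain r where r: "0 < r" "r < min \<delta> \<rho>" "\<And>r'. 0 < r' \<Longrightarrow> r' \<le> r \<Longrightarrow> pi * r' * (C * r' powr g) < \<epsilon>"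
      using small_arc_radius[OF g(1) \<epsilon>, of "min \<delta> \<rho>" C] g(2) \<rho>(1) by auto
    have "\<forall>\<^sub>F s in filtermap real_of_ereal (at_right m1). \<forall>t\<in>{0..1}. cmod (H t s - of_real p) < r"
      using H(5) r(1) unfolding end_condition_def by (simp add: p uniform_limit_iff dist_norm)
    then obtain b where b: "b \<in> ?I" "\<And>s t. s \<in> ?I \<Longrightarrow> s < b \<Longrightarrow> t \<in> {0..1} \<Longrightarrow> cmod (H t s - of_real p) < r"
      unfolding eventually_left_end[OF m] by blast
    obtain d where d: "d \<in> ?I" "d < min b c'"
      using b(1) c'(1) p by (metis (no_types, lifting) einterval_iff ereal_less_eq(3) dense less_ereal.simps(1) less_trans min_def)
    obtain s s' where "s \<in> {d..c'}" "s' \<in> {d..c'}" "cmod (\<Phi> (1, s') - \<Phi> (0, s)) \<le> pi * r * (C * r powr g)"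
      using arc[of d c' r \<delta> "-1" p C g] d c' r \<rho>(2) b(2)[OF d(1)] g(3) by force
    then show ?thesis using r(3)[of r] r(1) c' einterval_Icc_subset[OF d(1) c'(1)]
      by (intro bexI[of _ s] bexI[of _ s']) auto
  qed
  have wint: "(\<lambda>s. M' * (norm (K (\<gamma> s)) * cmod (tangent \<gamma> ?I s))) integrable_on ?I"
    using \<gamma>(2) unfolding finite_variation_def by (rule integrable_on_mult_right)
  have \<gamma>S: "\<gamma> s \<in> S" if "s \<in> ?I" for s using H(2)[of 1 s] H(4)[OF that] that by auto
  have wbd: "cmod (h (\<gamma> s) * tangent \<gamma> ?I s) \<le> M' * (norm (K (\<gamma> s)) * cmod (tangent \<gamma> ?I s))" if "s \<in> ?I" for s
    using mult_right_mono[OF M'(2)[OF \<gamma>S[OF that]], of "cmod (tangent \<gamma> ?I s)"] by (simp add: norm_mult mult.assoc)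
  have loc: "(\<lambda>s. h (\<gamma> s) * tangent \<gamma> ?I s) integrable_on {a..b}" if "{a..b} \<subseteq> ?I" for a b
  proof (cases "a \<le> b")
    case True
    then have "a \<in> ?I" "b \<in> ?I" using that by auto
    from has_integral_integrable[OF alongG[OF True this]] show ?thesis .
  qed auto
  show ?A by (rule einterval_dominated_integrable[OF m loc wint wbd])
  have locR: "(\<lambda>s. h (of_real s)) integrable_on {a..b}" if "{a..b} \<subseteq> ?I" for a b
  proof (cases "a \<le> b")
    case True
    then have "a \<in> ?I" "b \<in> ?I" using that by auto
    from has_integral_integrable[OF alongR[OF True this]] show ?thesis .
  qed auto
  have nR: "(\<lambda>s. cmod (h (of_real s))) integrable_on ?I" using real by (simp add: absolutely_integrable_on_def)
  obtain u v where uv: "\<And>i. m1 < ereal (v i)" "\<And>i. ereal (u i) < m2" "\<And>i. v i < u i" "?I = (\<Union>i. {v i..u i})" "incseq u" "decseq v"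
    by (rule einterval_Icc_approximation[OF m]) blast
  have uvI: "u i \<in> ?I" "v i \<in> ?I" for i using uv(3)[of i] uv(4) by (auto intro: less_imp_le)
  \<comment> \<open>the connecting sets leave the two sides of the strip at different parameters, \<open>s\<close> on the
    interval and \<open>s'\<close> on \<open>\<gamma>\<close>\<close>
  have "\<forall>i. \<exists>s s'. s \<in> ?I \<and> s' \<in> ?I \<and> u i < s \<and> u i < s' \<and> cmod (\<Phi> (1, s') - \<Phi> (0, s)) < inverse (real (Suc i))"
    using endR[OF uvI(1)] by (metis inverse_Suc)
  then obtain s s' where s: "\<And>i. s i \<in> ?I" "\<And>i. s' i \<in> ?I" "\<And>i. u i < s i" "\<And>i. u i < s' i"
    "\<And>i. cmod (\<Phi> (1, s' i) - \<Phi> (0, s i)) < inverse (real (Suc i))" by metis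
  have "\<forall>i. \<exists>s s'. s \<in> ?I \<and> s' \<in> ?I \<and> s < v i \<and> s' < v i \<and> cmod (\<Phi> (1, s') - \<Phi> (0, s)) < inverse (real (Suc i))"
    using endL[OF uvI(2)] by (metis inverse_Suc)
  then obtain r r' where r: "\<And>i. r i \<in> ?I" "\<And>i. r' i \<in> ?I" "\<And>i. r i < v i" "\<And>i. r' i < v i"
    "\<And>i. cmod (\<Phi> (1, r' i) - \<Phi> (0, r i)) < inverse (real (Suc i))" by metis
  have cov: "\<forall>\<^sub>F n in sequentially. x \<in> {v n..u n}" if "x \<in> ?I" for x
  proof -
    obtain i where "x \<in> {v i..u i}" using uv(4) \<open>x \<in> ?I\<close> by auto
    then have "x \<in> {v n..u n}" if "n \<ge> i" for n
      using incseqD[OF uv(5) that] decseqD[OF uv(6) that] by auto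
    then show ?thesis unfolding eventually_sequentially by blast
  qed
  have le: "r i \<le> s i" "r' i \<le> s' i" for i
    using s(3,4)[of i] r(3,4)[of i] uv(3)[of i] by linarith+
  have "(\<lambda>n. integral {r' n..s' n} (\<lambda>s. h (\<gamma> s) * tangent \<gamma> ?I s)) \<longlonglongrightarrow> integral ?I (\<lambda>s. h (\<gamma> s) * tangent \<gamma> ?I s)"
  proof (rule einterval_dominated_limit[OF m loc wint wbd])
    show "{r' n..s' n} \<subseteq> ?I" for n using einterval_Icc_subset r(2) s(2) by blast
    show "\<forall>\<^sub>F n in sequentially. x \<in> {r' n..s' n}" if "x \<in> ?I" for x
      using cov[OF that]
    proof eventually_elim
      case (elim n)
      then show ?case using s(4)[of n] r(4)[of n] by auto
    qed
  qed
  then have lim1: "(\<lambda>n. \<Phi> (1, s' n) - \<Phi> (1, r' n)) \<longlonglongrightarrow> integral ?I (\<lambda>s. h (\<gamma> s) * tangent \<gamma> ?I s)"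
    using integral_unique[OF alongG[OF le(2) r(2) s(2)]] by simp
  have "(\<lambda>n. integral {r n..s n} (\<lambda>s. h (of_real s))) \<longlonglongrightarrow> integral ?I (\<lambda>s. h (of_real s))"
  proof (rule einterval_dominated_limit[OF m locR nR])
    show "{r n..s n} \<subseteq> ?I" for n using einterval_Icc_subset r(1) s(1) by blast
    show "\<forall>\<^sub>F n in sequentially. x \<in> {r n..s n}" if "x \<in> ?I" for x
      using cov[OF that]
    proof eventually_elim
      case (elim n)
      then show ?case using s(3)[of n] r(3)[of n] by auto
    qed
  qed auto
  then have lim0: "(\<lambda>n. \<Phi> (0, s n) - \<Phi> (0, r n)) \<longlonglongrightarrow> integral ?I (\<lambda>s. h (of_real s))"
    using integral_unique[OF alongR[OF le(1) r(1) s(1)]] by simp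
  have z1: "(\<lambda>n. \<Phi> (1, s' n) - \<Phi> (0, s n)) \<longlonglongrightarrow> 0"
    by (rule Lim_null_comparison[OF _ LIMSEQ_inverse_real_of_nat]) (use s(5) in \<open>auto intro!: always_eventually less_imp_le\<close>)
  have z2: "(\<lambda>n. \<Phi> (1, r' n) - \<Phi> (0, r n)) \<longlonglongrightarrow> 0"
    by (rule Lim_null_comparison[OF _ LIMSEQ_inverse_real_of_nat]) (use r(5) in \<open>auto intro!: always_eventually less_imp_le\<close>)
  have "(\<lambda>n. (\<Phi> (1, s' n) - \<Phi> (1, r' n)) - (\<Phi> (0, s n) - \<Phi> (0, r n))) \<longlonglongrightarrow> 0 - 0"
    using tendsto_diff[OF z1 z2] by (simp add: algebra_simps)
  from LIMSEQ_unique[OF this tendsto_diff[OF lim1 lim0]] show ?B by simp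
qed

section \<open>Complex inner products\<close>

instance complex_hilbert_space \<subseteq> banach ..

lemma cinner_add_right: "cinner x (y + z) = cinner x y + cinner x z" for x :: "'a::complex_hilbert_space"
  using cinner_commute[of x "y + z"] cinner_commute[of x y] cinner_commute[of x z]
  by (simp add: cinner_add_left)

lemma cinner_scaleC_right: "cinner x (c *\<^sub>C y) = cnj c * cinner x y" for x :: "'a::complex_hilbert_space"
  using cinner_commute[of x "c *\<^sub>C y"] cinner_commute[of x y] by (simp add: cinner_scaleC_left)

lemma cinner_self: "cinner x x = complex_of_real ((norm x)\<^sup>2)" for x :: "'a::complex_hilbert_space"
proof -
  have "Im (cinner x x) = 0" using cinner_commute[of x x] by (metis complex_cnj_cancel_iff Reals_cnj_iff complex_is_Real_iff)
  then show ?thesis by (simp add: complex_eq_iff Re_cinner power2_norm_eq_inner)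
qed

lemma scaleC_simps [simp]:
  "1 *\<^sub>C x = x" "0 *\<^sub>C x = 0" "c *\<^sub>C 0 = 0" "(- c) *\<^sub>C x = - (c *\<^sub>C x)" "c *\<^sub>C (- x) = - (c *\<^sub>C x)"
  for x :: "'a::complex_normed_vector"
  by simp_all

lemma cinner_cmod_le: "cmod (cinner x y) \<le> norm x * norm y" for x :: "'a::complex_hilbert_space"
proof (cases "cinner x y = 0")
  case False
  define c where "c = cnj (sgn (cinner x y))"
  have c: "cmod c = 1" using False by (simp add: c_def norm_sgn)
  have "c * cinner x y = (cinner x y * cnj (cinner x y)) / complex_of_real (cmod (cinner x y))"
    by (simp add: c_def sgn_eq)
  also have "\<dots> = complex_of_real (cmod (cinner x y))"
    using False by (simp add: complex_norm_square[symmetric] power2_eq_square)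
  finally have "complex_of_real (cmod (cinner x y)) = c * cinner x y" ..
  then have "cmod (cinner x y) = Re (cinner (c *\<^sub>C x) y)"
    by (metis Re_complex_of_real cinner_scaleC_left)
  also have "\<dots> = inner (c *\<^sub>C x) y" by (rule Re_cinner)
  also have "\<dots> \<le> norm (c *\<^sub>C x) * norm y" by (rule norm_cauchy_schwarz)
  finally show ?thesis by (simp add: norm_scaleC c)
qed simp

lemma bounded_bilinear_scaleC: "bounded_bilinear (\<lambda>c (x::'a::complex_normed_vector). c *\<^sub>C x)"
proof
  show "(r *\<^sub>R a) *\<^sub>C b = r *\<^sub>R (a *\<^sub>C b)" for r a and b :: 'a
    by (simp add: scaleR_conv_of_real scaleC_of_real[symmetric] scaleC_scaleC)
  show "a *\<^sub>C (r *\<^sub>R b) = r *\<^sub>R (a *\<^sub>C b)" for r a and b :: 'a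
    by (simp add: scaleC_of_real[symmetric] scaleC_scaleC mult.commute)
  show "\<exists>K. \<forall>a (b::'a). norm (a *\<^sub>C b) \<le> norm a * norm b * K"
    by (intro exI[of _ 1]) (simp add: norm_scaleC)
qed (simp_all add: scaleC_add_left scaleC_add_right)

lemma bounded_bilinear_cinner: "bounded_bilinear (cinner :: 'a::complex_hilbert_space \<Rightarrow> 'a \<Rightarrow> complex)"
proof
  show "cinner (r *\<^sub>R a) b = r *\<^sub>R cinner a b" for r and a b :: 'a
    by (metis cinner_scaleC_left scaleC_of_real scaleR_conv_of_real)
  show "cinner a (r *\<^sub>R b) = r *\<^sub>R cinner a b" for r and a b :: 'a
    by (metis cinner_scaleC_right scaleC_of_real scaleR_conv_of_real complex_cnj_complex_of_real)
  show "\<exists>K. \<forall>(a::'a) b. norm (cinner a b) \<le> norm a * norm b * K"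
    by (intro exI[of _ 1]) (simp add: cinner_cmod_le)
qed (simp_all add: cinner_add_left cinner_add_right)

interpretation cinner: bounded_bilinear "cinner :: 'a::complex_hilbert_space \<Rightarrow> 'a \<Rightarrow> complex"
  by (rule bounded_bilinear_cinner)

interpretation scaleC: bounded_bilinear "scaleC :: complex \<Rightarrow> 'a \<Rightarrow> 'a::complex_normed_vector"
  by (rule bounded_bilinear_scaleC)

lemmas cinner_simps = cinner.add_left cinner.add_right cinner.diff_left cinner.diff_right
  cinner.minus_left cinner.minus_right cinner.sum_left cinner.sum_right cinner_scaleC_left cinner_scaleC_right

lemma cinner_eq_imp_eq:
  assumes "\<And>y. cinner x y = cinner x' y" shows "x = (x' :: 'a::complex_hilbert_space)"
proof -
  have "cinner (x - x') (x - x') = 0" using assms by (simp add: cinner.diff_left)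
  then show ?thesis by (simp add: cinner_self)
qed

lemma cinner_eq_imp_eq_right:
  assumes "\<And>x. cinner x y = cinner x y'" shows "y = (y' :: 'a::complex_hilbert_space)"
  using assms cinner_eq_imp_eq[of y y'] by (metis cinner_commute)

text \<open>Linearity of a bare function; \<open>complex_linear\<close> applies to elements of the type of bounded operators,
  whereas resolvents are given as functions.\<close>

definition clin :: "('a::complex_normed_vector \<Rightarrow> 'b::complex_normed_vector) \<Rightarrow> bool"
  where "clin T \<longleftrightarrow> (\<forall>x y. T (x + y) = T x + T y) \<and> (\<forall>c x. T (c *\<^sub>C x) = c *\<^sub>C T x)"

lemma clin_simps:
  assumes "clin T"
  shows "T (x + y) = T x + T y" "T (c *\<^sub>C x) = c *\<^sub>C T x" "T 0 = 0" "T (- x) = - T x" "T (x - y) = T x - T y"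
    "T (\<Sum>i\<in>A. g i) = (\<Sum>i\<in>A. T (g i))"
proof -
  show a: "T (x + y) = T x + T y" for x y using assms by (simp add: clin_def)
  show s: "T (c *\<^sub>C x) = c *\<^sub>C T x" for c x using assms by (simp add: clin_def)
  show z: "T 0 = 0" using s[of 0 0] by simp
  show n: "T (- x) = - T x" for x using s[of "-1" x] by simp
  show "T (x - y) = T x - T y" using a[of x "- y"] n[of y] by simp
  show "T (\<Sum>i\<in>A. g i) = (\<Sum>i\<in>A. T (g i))"
    by (induction A rule: infinite_finite_induct) (simp_all add: z a)
qed

lemma complex_linear_clin: "complex_linear T \<Longrightarrow> clin (blinfun_apply T)"
  by (simp add: clin_def complex_linear_def blinfun.add_right)

section \<open>Finite-dimensional Hilbert spaces\<close>

definition onb :: "'b::complex_hilbert_space set \<Rightarrow> bool"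
  where "onb S \<longleftrightarrow> finite S \<and> (\<forall>x\<in>S. \<forall>y\<in>S. cinner x y = (if x = y then 1 else 0)) \<and>
    complex_vector.span S = UNIV"

lemma orthonormal_span_exists:
  fixes A :: "'b::complex_hilbert_space set"
  assumes "finite A"
  shows "\<exists>S. finite S \<and> (\<forall>x\<in>S. \<forall>y\<in>S. cinner x y = (if x = y then 1 else 0)) \<and> A \<subseteq> complex_vector.span S"
  using assms
proof (induction A)
  case (insert a A)
  then obtain S where S: "finite S" "\<And>x y. x \<in> S \<Longrightarrow> y \<in> S \<Longrightarrow> cinner x y = (if x = y then 1 else 0)"
    "A \<subseteq> complex_vector.span S" by blast
  define p where "p = (\<Sum>s\<in>S. cinner a s *\<^sub>C s)"
  have p: "p \<in> complex_vector.span S"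
    unfolding p_def by (intro complex_vector.span_sum complex_vector.span_scale complex_vector.span_base)
  have orth: "cinner (a - p) s = 0" if "s \<in> S" for s
  proof -
    have "cinner p s = (\<Sum>t\<in>S. if t = s then cinner a s else 0)"
      unfolding p_def cinner.sum_left using S(2) that by (intro sum.cong) (auto simp: cinner_scaleC_left)
    also have "\<dots> = cinner a s" using S(1) that by simp
    finally show ?thesis by (simp add: cinner.diff_left)
  qed
  show ?case
  proof (cases "a = p")
    case True
    then show ?thesis using S p by (intro exI[of _ S]) auto
  next
    case False
    define e where "e = complex_of_real (inverse (norm (a - p))) *\<^sub>C (a - p)"
    have e1: "cinner e e = 1"
    proof -
      have "norm e = 1" using False unfolding e_def norm_scaleC by (simp add: norm_inverse)
      then show ?thesis by (simp add: cinner_self)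
    qed
    have es: "cinner e s = 0" "cinner s e = 0" if "s \<in> S" for s
      using orth[OF that] cinner_commute[of s e] by (simp_all add: e_def cinner_scaleC_left)
    have "a = complex_of_real (norm (a - p)) *\<^sub>C e + p"
      using False by (simp add: e_def scaleC_scaleC flip: of_real_mult)
    moreover have "complex_of_real (norm (a - p)) *\<^sub>C e \<in> complex_vector.span (insert e S)"
      by (intro complex_vector.span_scale complex_vector.span_base) simp
    moreover have "complex_vector.span S \<subseteq> complex_vector.span (insert e S)"
      by (intro complex_vector.span_mono) auto
    ultimately have "insert a A \<subseteq> complex_vector.span (insert e S)"
      using p S(3) complex_vector.span_add[of "complex_of_real (norm (a - p)) *\<^sub>C e" "insert e S" p] by auto
    moreover have "e \<notin> S" using e1 es by force
    ultimately show ?thesis using S(1,2) e1 es by (intro exI[of _ "insert e S"]) auto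
  qed
qed auto

lemma onb_exists:
  assumes "\<exists>A::'b::complex_hilbert_space set. finite A \<and> complex_vector.span A = UNIV"
  obtains S :: "'b::complex_hilbert_space set" where "onb S"
proof -
  obtain A :: "'b set" where A: "finite A" "complex_vector.span A = UNIV" using assms by blast
  obtain S where S: "finite S" "\<forall>x\<in>S. \<forall>y\<in>S. cinner x y = (if x = y then 1 else 0)"
    "A \<subseteq> complex_vector.span S" using orthonormal_span_exists[OF A(1)] by blast
  have "complex_vector.span S = UNIV"
    using complex_vector.span_minimal[OF S(3) complex_vector.subspace_span] A(2) by auto
  then show ?thesis using that S by (simp add: onb_def)
qed

lemma onb_expand:
  assumes "onb S"
  shows "x = (\<Sum>s\<in>S. cinner x s *\<^sub>C s)"
proof -
  define y where "y = x - (\<Sum>s\<in>S. cinner x s *\<^sub>C s)"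
  have S: "finite S" "\<And>x y. x \<in> S \<Longrightarrow> y \<in> S \<Longrightarrow> cinner x y = (if x = y then 1 else 0)"
    "complex_vector.span S = UNIV" using assms by (auto simp: onb_def)
  have "cinner s y = 0" if "s \<in> S" for s
  proof -
    have "cinner s (\<Sum>t\<in>S. cinner x t *\<^sub>C t) = (\<Sum>t\<in>S. if t = s then cnj (cinner x s) else 0)"
      unfolding cinner.sum_right using S(2) that by (intro sum.cong) (auto simp: cinner_scaleC_right)
    also have "\<dots> = cinner s x" using S(1) that cinner_commute[of s x] by simp
    finally show ?thesis by (simp add: y_def cinner.diff_right)
  qed
  then have "S \<subseteq> {z. cinner z y = 0}" by auto
  moreover have "complex_vector.subspace {z. cinner z y = 0}"
    by (simp add: complex_vector.subspace_def cinner_simps cinner.zero_left)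
  ultimately have "complex_vector.span S \<subseteq> {z. cinner z y = 0}"
    by (rule complex_vector.span_minimal)
  then have "cinner y y = 0" using S(3) by auto
  then show ?thesis by (simp add: cinner_self y_def)
qed

lemma onb_clin_eq:
  assumes "onb S" "clin T"
  shows "T x = (\<Sum>s\<in>S. cinner x s *\<^sub>C T s)"
proof -
  have "T x = T (\<Sum>s\<in>S. cinner x s *\<^sub>C s)" using onb_expand[OF assms(1), of x] by simp
  also have "\<dots> = (\<Sum>s\<in>S. cinner x s *\<^sub>C T s)" by (simp add: clin_simps[OF assms(2)])
  finally show ?thesis .
qed

lemma onb_norm: "onb S \<Longrightarrow> s \<in> S \<Longrightarrow> norm s = 1"
proof -
  assume "onb S" "s \<in> S"
  then have "complex_of_real ((norm s)\<^sup>2) = 1" using cinner_self[of s] by (simp add: onb_def)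
  then have "(norm s)\<^sup>2 = 1" by (metis of_real_eq_1_iff)
  then show ?thesis by (simp add: power2_eq_1_iff) (smt (verit) norm_ge_zero)
qed

lemma onb_clin_bound:
  assumes "onb S" "clin T"
  shows "norm (T x) \<le> (\<Sum>s\<in>S. norm (T s)) * norm x"
proof -
  have "norm (T x) \<le> (\<Sum>s\<in>S. norm (cinner x s *\<^sub>C T s))"
    by (subst onb_clin_eq[OF assms]) (rule norm_sum)
  also have "\<dots> \<le> (\<Sum>s\<in>S. norm (T s) * norm x)"
  proof (rule sum_mono)
    fix s assume s: "s \<in> S"
    show "norm (cinner x s *\<^sub>C T s) \<le> norm (T s) * norm x"
      using mult_right_mono[OF cinner_cmod_le[of x s], of "norm (T s)"] onb_norm[OF assms(1) s]
      by (simp add: norm_scaleC mult.commute)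
  qed
  finally show ?thesis by (simp add: sum_distrib_right)
qed

lemma onb_clin_bounded_linear:
  fixes S :: "'b::complex_hilbert_space set" and T :: "'b \<Rightarrow> 'c::complex_normed_vector"
  assumes "onb S" "clin T" shows "bounded_linear T"
proof
  show "T (r *\<^sub>R x) = r *\<^sub>R T x" for r x
    using clin_simps(2)[OF assms(2), of "complex_of_real r" x] by (simp add: scaleC_of_real)
  show "\<exists>K. \<forall>x. norm (T x) \<le> norm x * K"
    using onb_clin_bound[OF assms] by (metis mult.commute)
qed (simp add: clin_simps[OF assms(2)])

lemma onb_inj_imp_surj:
  fixes S :: "'b::complex_hilbert_space set" and T :: "'b \<Rightarrow> 'b"
  assumes S: "onb S" and T: "clin T" and inj: "\<And>x. T x = 0 \<Longrightarrow> x = 0"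
  shows "bij T"
proof -
  obtain B where B: "B \<subseteq> S" "complex_vector.independent B" "S \<subseteq> complex_vector.span B"
    using complex_vector.maximal_independent_subset[of S] by metis
  have "complex_vector.span B = UNIV"
    using complex_vector.span_minimal[OF B(3) complex_vector.subspace_span] S by (auto simp: onb_def)
  moreover have "finite B" using B(1) S by (auto simp: onb_def intro: finite_subset)
  ultimately interpret fd: finite_dimensional_vector_space "scaleC :: complex \<Rightarrow> 'b \<Rightarrow> 'b" B
    using B(2) by unfold_locales auto
  have lin: "Vector_Spaces.linear scaleC scaleC T"
    using clin_simps[OF T] by unfold_locales auto
  have "inj T"
    using inj clin_simps(5)[OF T] by (metis injI eq_iff_diff_eq_0)
  then show ?thesis using fd.linear_inj_imp_surj[OF lin] by (simp add: bij_def)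
qed

text \<open>The sphere is a closed subset of the image, under the coordinate map, of a product of discs.\<close>

lemma onb_compact_sphere:
  fixes S :: "'b::complex_hilbert_space set"
  assumes S: "onb S"
  shows "compact {x::'b. norm x = 1}"
proof -
  define C where "C = {c :: 'b \<Rightarrow> complex. \<forall>s. c s \<in> cball 0 1}"
  have "compactin (product_topology (\<lambda>_::'b. euclidean) UNIV) (PiE UNIV (\<lambda>_. cball (0::complex) 1))"
    unfolding compactin_PiE by simp
  moreover have "PiE UNIV (\<lambda>_. cball (0::complex) 1) = C" by (auto simp: C_def)
  ultimately have C: "compact C"
    by (simp add: euclidean_product_topology compactin_euclidean_iff)
  define f where "f = (\<lambda>c :: 'b \<Rightarrow> complex. \<Sum>s\<in>S. c s *\<^sub>C s)"
  have "continuous_on C f"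
    unfolding f_def
    by (intro continuous_on_sum scaleC.continuous_on continuous_on_const)
       (rule continuous_on_subset[OF continuous_on_product_coordinates subset_UNIV])
  then have fC: "compact (f ` C)" using C by (rule compact_continuous_image)
  have "{x::'b. norm x = 1} \<subseteq> f ` C"
  proof
    fix x :: 'b assume x: "x \<in> {x. norm x = 1}"
    define c where "c = (\<lambda>s. if s \<in> S then cinner x s else 0)"
    have "c \<in> C"
      using cinner_cmod_le[of x] onb_norm[OF S] x by (auto simp: c_def C_def) (metis mult_1)
    moreover have "f c = x" using onb_expand[OF S, of x] by (simp add: f_def c_def)
    ultimately show "x \<in> f ` C" by blast
  qed
  moreover have "closed {x::'b. norm x = 1}" by (intro closed_Collect_eq continuous_intros)
  ultimately show ?thesis using fC compact_Int_closed[of "f ` C"] by (metis Int_absorb1 inf_commute)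
qed

definition eigenval :: "('b::complex_normed_vector \<Rightarrow> 'b) \<Rightarrow> complex \<Rightarrow> bool"
  where "eigenval T z \<longleftrightarrow> (\<exists>u. u \<noteq> 0 \<and> T u = z *\<^sub>C u)"

lemma clin_shift: "clin T \<Longrightarrow> clin (\<lambda>x. T x - z *\<^sub>C x)"
  by (auto simp: clin_def scaleC.add_right scaleC.diff_right scaleC_scaleC algebra_simps)

text \<open>A unit vector \<open>x\<close> at which \<open>\<parallel>(A - z)x\<parallel>\<close> attains its minimum \<open>m\<close> solves
  \<open>(A - z)\<^sup>*(A - z)x = m\<^sup>2x\<close>.  For symmetric \<open>A\<close> the left side is \<open>((A - Re z)\<^sup>2 + (Im z)\<^sup>2)x\<close>, so that
  \<open>(A - Re z - q)(A - Re z + q)x = 0\<close> for \<open>q\<^sup>2 = m\<^sup>2 - (Im z)\<^sup>2\<close>, and one of the factors exhibits an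
  eigenvalue at distance \<open>m\<close> from \<open>z\<close>.\<close>

lemma symmetric_nearest_eigenvalue:
  fixes A :: "'b::complex_hilbert_space \<Rightarrow> 'b" and S :: "'b set"
  assumes S: "onb S" and A: "clin A" and sym: "\<And>x y. cinner (A x) y = cinner x (A y)"
    and nz: "(u::'b) \<noteq> 0"
  obtains \<nu> :: real where "eigenval A (of_real \<nu>)" "\<And>x. cmod (z - of_real \<nu>) * norm x \<le> norm (A x - z *\<^sub>C x)"
proof -
  define T where "T = (\<lambda>x. A x - z *\<^sub>C x)"
  have T: "clin T" unfolding T_def by (rule clin_shift[OF A])
  have "continuous_on {x. norm x = 1} (\<lambda>x. norm (T x))"
    using onb_clin_bounded_linear[OF S T] by (intro continuous_intros linear_continuous_on)
  moreover have "complex_of_real (inverse (norm u)) *\<^sub>C u \<in> {x. norm x = 1}"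
    using nz by (simp add: norm_scaleC norm_inverse)
  ultimately obtain x where x: "norm x = 1" "\<And>y. norm y = 1 \<Longrightarrow> norm (T x) \<le> norm (T y)"
    using continuous_attains_inf[OF onb_compact_sphere[OF S]] by (metis (mono_tags, lifting) empty_iff mem_Collect_eq)
  define m where "m = norm (T x)"
  have min: "m * norm y \<le> norm (T y)" for y
  proof (cases "y = 0")
    case False
    define v where "v = complex_of_real (inverse (norm y)) *\<^sub>C y"
    have "norm v = 1" using False by (simp add: v_def norm_scaleC norm_inverse)
    then have "m \<le> norm (T v)" using x(2) by (simp add: m_def)
    also have "T v = complex_of_real (inverse (norm y)) *\<^sub>C T y" by (simp add: v_def clin_simps(2)[OF T])
    finally show ?thesis using False by (simp add: norm_scaleC norm_inverse norm_divide field_simps)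
  qed (simp add: clin_simps[OF T])
  define a b where "a = Re z" and "b = Im z"
  \<comment> \<open>the first variation of \<open>\<parallel>T x\<parallel>\<^sup>2 - m\<^sup>2 \<parallel>x\<parallel>\<^sup>2\<close> vanishes at the minimum\<close>
  have re0: "Re (cinner (T x) (T y)) = m\<^sup>2 * Re (cinner x y)" for y
  proof (rule ccontr)
    assume ne: "Re (cinner (T x) (T y)) \<noteq> m\<^sup>2 * Re (cinner x y)"
    define d where "d = inner (T x) (T y) - m\<^sup>2 * inner x y"
    define q where "q = (norm (T y))\<^sup>2 - m\<^sup>2 * (norm y)\<^sup>2"
    have d: "d \<noteq> 0" using ne by (simp add: d_def Re_cinner)
    have pos: "0 \<le> 2 * t * d + t\<^sup>2 * q" for t
    proof -
      have "(m * norm (x + t *\<^sub>R y))\<^sup>2 \<le> (norm (T (x + t *\<^sub>R y)))\<^sup>2"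
        using min[of "x + t *\<^sub>R y"] by (intro power_mono) (auto simp: m_def)
      moreover have "T (x + t *\<^sub>R y) = T x + t *\<^sub>R T y"
        using clin_simps(1,2)[OF T] by (metis scaleC_of_real)
      moreover have "(norm (x + t *\<^sub>R y))\<^sup>2 = (norm x)\<^sup>2 + 2 * t * inner x y + t\<^sup>2 * (norm y)\<^sup>2" for x y :: 'b
        unfolding power2_norm_eq_inner
        by (simp add: inner_add_left inner_add_right inner_commute power2_eq_square[of t] algebra_simps)
      ultimately show ?thesis
        using x(1) by (simp add: d_def q_def m_def power_mult_distrib algebra_simps)
    qed
    define n where "n = \<bar>q\<bar> + 1"
    have n: "n > 0" "q \<le> n" by (auto simp: n_def)
    define t where "t = - d / n"
    have "2 * t * d + t\<^sup>2 * q \<le> 2 * t * d + t\<^sup>2 * n"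
      using n by (intro add_left_mono mult_left_mono) auto
    also have "\<dots> = - (d\<^sup>2 / n)"
      using n(1) by (simp add: t_def power2_eq_square field_simps)
    also have "\<dots> < 0" using d n by simp
    finally show False using pos[of t] by simp
  qed
  have adjT: "cinner (T x) (T y) = cinner (A (T x) - cnj z *\<^sub>C T x) y" for y
    by (simp add: T_def cinner_simps sym)
  have "inner (A (T x) - cnj z *\<^sub>C T x - m\<^sup>2 *\<^sub>R x) y = 0" for y
    using re0[of y] unfolding adjT by (simp add: Re_cinner[symmetric] cinner_simps inner_diff_left cinner.scaleR_left)
  then have "A (T x) - cnj z *\<^sub>C T x - m\<^sup>2 *\<^sub>R x = 0" by (metis inner_eq_zero_iff)
  then have eq: "A (T x) - cnj z *\<^sub>C T x = complex_of_real (m\<^sup>2) *\<^sub>C x"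
    by (simp add: scaleC_of_real del: of_real_power)
  have TT: "A (T x) - cnj z *\<^sub>C T x = (A (A x - a *\<^sub>C x) - a *\<^sub>C (A x - a *\<^sub>C x)) + complex_of_real (b\<^sup>2) *\<^sub>C x"
  proof -
    have "z = of_real a + \<i> * of_real b" by (simp add: a_def b_def complex_eq)
    then have zc: "cnj z * z = of_real a * of_real a + of_real (b\<^sup>2)" "cnj z + z = of_real a + of_real a"
      by (simp_all add: power2_eq_square algebra_simps)
    have "A (T x) - cnj z *\<^sub>C T x = A (A x) - (cnj z + z) *\<^sub>C A x + (cnj z * z) *\<^sub>C x"
      by (simp add: T_def clin_simps[OF A] scaleC.diff_right scaleC.add_left scaleC_scaleC algebra_simps)
    also have "\<dots> = (A (A x - a *\<^sub>C x) - a *\<^sub>C (A x - a *\<^sub>C x)) + complex_of_real (b\<^sup>2) *\<^sub>C x"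
      unfolding zc scaleC.add_left clin_simps[OF A] scaleC.diff_right scaleC_scaleC by simp
    finally show ?thesis .
  qed
  define y where "y = A x - a *\<^sub>C x"
  have e1: "A y - a *\<^sub>C y = complex_of_real (m\<^sup>2 - b\<^sup>2) *\<^sub>C x"
    using eq TT by (simp add: y_def scaleC.diff_left algebra_simps)
  have "b\<^sup>2 \<le> m\<^sup>2"
  proof -
    have "cinner (A y - a *\<^sub>C y) x = cinner y y" by (simp add: y_def cinner_simps sym)
    then have "complex_of_real (m\<^sup>2 - b\<^sup>2) = complex_of_real ((norm y)\<^sup>2)"
      unfolding e1 using x(1) by (simp add: cinner_scaleC_left cinner_self)
    then have "m\<^sup>2 - b\<^sup>2 = (norm y)\<^sup>2" by (simp only: of_real_eq_iff)
    then show ?thesis by (metis diff_ge_0_iff_ge zero_le_power2)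
  qed
  define q where "q = sqrt (m\<^sup>2 - b\<^sup>2)"
  have q2: "q\<^sup>2 = m\<^sup>2 - b\<^sup>2" using \<open>b\<^sup>2 \<le> m\<^sup>2\<close> by (simp add: q_def)
  define w where "w = y + complex_of_real q *\<^sub>C x"
  \<comment> \<open>\<open>w = (A - a + q) x\<close> is an eigenvector unless it vanishes, and then \<open>x\<close> is one\<close>
  have Aw: "A w = complex_of_real (a + q) *\<^sub>C w"
  proof -
    have "A w - complex_of_real (a + q) *\<^sub>C w = (A y - a *\<^sub>C y) + q *\<^sub>C (A x - a *\<^sub>C x) - q *\<^sub>C y - (of_real q * of_real q) *\<^sub>C x"
      by (simp add: w_def clin_simps[OF A] scaleC.diff_right scaleC.add_right scaleC.add_left scaleC_scaleC algebra_simps)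
    also have "\<dots> = (complex_of_real (m\<^sup>2 - b\<^sup>2) - of_real q * of_real q) *\<^sub>C x"
      unfolding e1 by (simp add: y_def scaleC.diff_left)
    also have "complex_of_real (m\<^sup>2 - b\<^sup>2) = of_real q * of_real q"
      unfolding q2[symmetric] by (simp add: power2_eq_square)
    also have "(of_real q * of_real q - of_real q * of_real q) *\<^sub>C x = 0" by simp
    finally show ?thesis by simp
  qed
  have Ax: "A x = complex_of_real (a - q) *\<^sub>C x" if "w = 0"
    using that by (simp add: w_def y_def scaleC.diff_left algebra_simps add_eq_0_iff2)
  have "\<exists>\<nu>::real. eigenval A (of_real \<nu>) \<and> (\<nu> - a)\<^sup>2 = q\<^sup>2"
  proof (cases "w = 0")
    case True
    then show ?thesis using Ax x(1) by (intro exI[of _ "a - q"]) (auto simp: eigenval_def simp del: of_real_diff intro!: exI[of _ x])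
  next
    case False
    then show ?thesis using Aw by (intro exI[of _ "a + q"]) (auto simp: eigenval_def simp del: of_real_add)
  qed
  then obtain \<nu> :: real where \<nu>: "eigenval A (of_real \<nu>)" "(\<nu> - a)\<^sup>2 = q\<^sup>2" by blast
  have "(cmod (z - of_real \<nu>))\<^sup>2 = m\<^sup>2"
    using \<nu>(2) q2 by (simp add: cmod_power2 a_def b_def power2_commute)
  then have "cmod (z - of_real \<nu>) = m" by (simp add: m_def power2_eq_iff_nonneg)
  then show ?thesis using that \<nu>(1) min by (simp add: T_def)
qed

lemma spectrum_iff_eigenval:
  fixes S :: "'b::complex_hilbert_space set" and T :: "'b \<Rightarrow> 'b"
  assumes S: "onb S" and T: "clin T"
  shows "z \<in> spectrum UNIV T \<longleftrightarrow> eigenval T z"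
proof
  assume z: "z \<in> spectrum UNIV T"
  show "eigenval T z"
  proof (rule ccontr)
    assume no: "\<not> eigenval T z"
    have "bij (\<lambda>x. T x - z *\<^sub>C x)"
      using no by (intro onb_inj_imp_surj[OF S clin_shift[OF T]]) (auto simp: eigenval_def)
    moreover define R where "R = inv (\<lambda>x. T x - z *\<^sub>C x)"
    ultimately have R: "R (T x - z *\<^sub>C x) = x" "T (R x) - z *\<^sub>C R x = x" for x
      by (auto simp: R_def bij_def surj_f_inv_f[of "\<lambda>x. T x - z *\<^sub>C x"] inv_f_f[of "\<lambda>x. T x - z *\<^sub>C x"])
    have "clin R"
      unfolding clin_def
    proof (intro conjI allI)
      show "R (x + y) = R x + R y" for x y
        using R(1)[of "R x + R y"] R(2)[of x] R(2)[of y] by (simp add: clin_simps[OF clin_shift[OF T]])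
      show "R (c *\<^sub>C x) = c *\<^sub>C R x" for c x
        using R(1)[of "c *\<^sub>C R x"] unfolding clin_simps(2)[OF clin_shift[OF T, of z]] R(2) .
    qed
    from onb_clin_bound[OF S this] have "norm x \<le> (\<Sum>s\<in>S. norm (R s)) * norm (T x - z *\<^sub>C x)" for x
      by (metis R(1))
    then show False using z \<open>bij _\<close> by (auto simp: spectrum_def resolvent_set_def)
  qed
next
  assume "eigenval T z"
  then obtain u where u: "u \<noteq> 0" "T u = z *\<^sub>C u" by (auto simp: eigenval_def)
  have "\<not> inj (\<lambda>x. T x - z *\<^sub>C x)"
  proof
    assume "inj (\<lambda>x. T x - z *\<^sub>C x)"
    from injD[OF this, of u 0] show False using u clin_simps(3)[OF T] by simp
  qed
  then show "z \<in> spectrum UNIV T" by (auto simp: spectrum_def resolvent_set_def bij_betw_def)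
qed

text \<open>The linear map that sends an orthonormal basis to nearby vectors of \<open>V\<close> is injective, hence
  surjective, and its range lies in \<open>V\<close>.\<close>

lemma dense_subspace_finite_dim:
  fixes S V :: "'b::complex_hilbert_space set"
  assumes S: "onb S" and V: "complex_vector.subspace V" "closure V = UNIV"
  shows "V = UNIV"
proof -
  have "\<exists>v\<in>V. norm (v - s) < 1 / (real (card S) + 1)" for s
    using closure_approachable[of s V] V(2) by (auto simp: dist_norm)
  then obtain v where v: "\<And>s. v s \<in> V" "\<And>s. norm (v s - s) < 1 / (real (card S) + 1)" by metis
  define L where "L = (\<lambda>x. \<Sum>s\<in>S. cinner x s *\<^sub>C v s)"
  have L: "clin L"
    by (auto simp: clin_def L_def cinner_simps scaleC.add_left sum.distrib scaleC.sum_right scaleC_scaleC)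
  have "x = 0" if "L x = 0" for x
  proof -
    have "(\<Sum>s\<in>S. cinner x s *\<^sub>C (v s - s)) = L x - (\<Sum>s\<in>S. cinner x s *\<^sub>C s)"
      by (simp add: L_def scaleC.diff_right sum_subtractf)
    also have "\<dots> = - x" using that onb_expand[OF S, of x, symmetric] by simp
    finally have "norm x = norm (\<Sum>s\<in>S. cinner x s *\<^sub>C (v s - s))" by simp
    also have "\<dots> \<le> (\<Sum>s\<in>S. norm (cinner x s *\<^sub>C (v s - s)))" by (rule norm_sum)
    also have "\<dots> \<le> (\<Sum>s\<in>S. norm x * (1 / (real (card S) + 1)))"
    proof (rule sum_mono)
      fix s assume "s \<in> S"
      then have "cmod (cinner x s) \<le> norm x" using cinner_cmod_le[of x s] onb_norm[OF S] by simp
      then show "norm (cinner x s *\<^sub>C (v s - s)) \<le> norm x * (1 / (real (card S) + 1))"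
        unfolding norm_scaleC using v(2)[of s] by (intro mult_mono) auto
    qed
    finally have "norm x * (real (card S) + 1) \<le> norm x * real (card S)"
      by (simp add: field_simps)
    then show ?thesis by (simp add: distrib_left)
  qed
  then have "bij L" by (rule onb_inj_imp_surj[OF S L])
  moreover have "L x \<in> V" for x
    unfolding L_def using V(1) v(1) by (intro complex_vector.subspace_sum complex_vector.subspace_scale)
  ultimately show ?thesis by (metis UNIV_eq_I bij_pointE)
qed

lemma le_if_square_le:
  fixes a b :: real
  assumes "a * a \<le> b * a" "0 \<le> a" "0 \<le> b" shows "a \<le> b"
  using assms by (cases "a = 0") (auto dest: mult_right_le_imp_le)

text \<open>The description that defines \<open>adj\<close> is met by the operator that a basis of the domain of \<open>T\<close> gives
  explicitly.\<close>

lemma adj_cinner: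
  fixes S :: "'b::complex_hilbert_space set" and T :: "'b \<Rightarrow>\<^sub>L 'a::complex_hilbert_space"
  assumes S: "onb S" and T: "complex_linear T"
  shows "cinner (T x) y = cinner x (adj T y)" and "complex_linear (adj T)" and "norm (adj T) = norm T"
proof -
  define R where "R = (\<lambda>y. \<Sum>s\<in>S. cinner y (T s) *\<^sub>C s)"
  have "bounded_linear R"
    unfolding R_def by (intro bounded_linear_sum bounded_linear_compose[OF scaleC.bounded_linear_left cinner.bounded_linear_left])
  then have R: "blinfun_apply (Blinfun R) = R" by (rule bounded_linear_Blinfun_apply)
  have "cinner (T x) y = cinner x (R y)" for x y
  proof -
    have "T x = (\<Sum>s\<in>S. cinner x s *\<^sub>C T s)"
      by (rule onb_clin_eq[OF S complex_linear_clin[OF T]])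
    then have "cinner (T x) y = (\<Sum>s\<in>S. cinner x s * cinner (T s) y)"
      by (simp only: cinner_simps)
    also have "\<dots> = cinner x (R y)"
      unfolding R_def cinner.sum_right cinner_scaleC_right
      by (intro sum.cong refl) (simp add: cinner_commute[of "blinfun_apply T _" y])
    finally show ?thesis .
  qed
  then have ex: "\<forall>x y. cinner (blinfun_apply T x) y = cinner x (blinfun_apply (Blinfun R) y)" using R by simp
  have "adj T = Blinfun R"
    unfolding adj_def
  proof (rule the_equality, rule ex)
    fix R' :: "'a \<Rightarrow>\<^sub>L 'b" assume R': "\<forall>x y. cinner (blinfun_apply T x) y = cinner x (blinfun_apply R' y)"
    show "R' = Blinfun R"
    proof (rule blinfun_eqI, rule cinner_eq_imp_eq_right)
      show "cinner x (R' y) = cinner x (Blinfun R y)" for x y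
        using R'[rule_format, of x y] ex[rule_format, of x y] by simp
    qed
  qed
  then have ad: "cinner (T x) y = cinner x (adj T y)" for x y using ex by simp
  show "cinner (T x) y = cinner x (adj T y)" by (rule ad)
  show "complex_linear (adj T)"
    unfolding complex_linear_def
  proof (intro allI)
    fix c y show "adj T (c *\<^sub>C y) = c *\<^sub>C adj T y"
      by (rule cinner_eq_imp_eq_right) (simp add: ad[symmetric] cinner_scaleC_right)
  qed
  have "norm (adj T y) \<le> norm T * norm y" for y
  proof -
    have "(norm (adj T y))\<^sup>2 = cmod (cinner (T (adj T y)) y)" unfolding ad cinner_self norm_of_real by simp
    also have "\<dots> \<le> norm T * norm (adj T y) * norm y"
      using cinner_cmod_le[of "T (adj T y)" y] mult_right_mono[OF norm_blinfun[of T "adj T y"], of "norm y"] by simp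
    finally have "norm (adj T y) * norm (adj T y) \<le> (norm T * norm y) * norm (adj T y)"
      by (simp only: power2_eq_square mult_ac)
    then show ?thesis by (rule le_if_square_le) auto
  qed
  then have 1: "norm (adj T) \<le> norm T" by (intro norm_blinfun_bound) auto
  have "norm (T x) \<le> norm (adj T) * norm x" for x
  proof -
    have "(norm (T x))\<^sup>2 = cmod (cinner x (adj T (T x)))" unfolding ad[symmetric] cinner_self norm_of_real by simp
    also have "\<dots> \<le> norm x * (norm (adj T) * norm (T x))"
      using cinner_cmod_le[of x "adj T (T x)"] mult_left_mono[OF norm_blinfun[of "adj T" "T x"], of "norm x"] by simp
    finally have "norm (T x) * norm (T x) \<le> (norm (adj T) * norm x) * norm (T x)"
      by (simp only: power2_eq_square mult_ac)
    then show ?thesis by (rule le_if_square_le) auto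
  qed
  then have 2: "norm T \<le> norm (adj T)" by (intro norm_blinfun_bound) auto
  show "norm (adj T) = norm T" using 1 2 by simp
qed

section \<open>Spectral measures of self-adjoint operators\<close>

locale spectral_operator =
  fixes dom :: "'a::complex_hilbert_space set" and A :: "'a \<Rightarrow> 'a" and E :: "real set \<Rightarrow> 'a \<Rightarrow>\<^sub>L 'a"
  assumes self_adjoint: "self_adjoint dom A" and spectral_measure: "spectral_measure dom A E"
begin

abbreviation \<nu> :: "'a \<Rightarrow> real measure" where "\<nu> x \<equiv> scalar_measure E x"

lemma E_simps:
  assumes S: "S \<in> sets borel"
  shows E_clin: "clin (blinfun_apply (E S))" and E_idem: "E S (E S x) = E S x"
    and E_sym: "cinner (E S x) y = cinner x (E S y)"
proof -
  have *: "complex_linear (E S) \<and> E S o\<^sub>L E S = E S \<and> (\<forall>x y. cinner (E S x) y = cinner x (E S y))"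
    using spectral_measure S unfolding spectral_measure_def by blast
  then show "clin (blinfun_apply (E S))" "cinner (E S x) y = cinner x (E S y)"
    by (auto intro: complex_linear_clin)
  show "E S (E S x) = E S x" using * by (metis blinfun_apply_blinfun_compose)
qed

lemma E_UNIV: "E UNIV x = x"
  using spectral_measure by (simp add: spectral_measure_def)

lemma E_Int: "S \<in> sets borel \<Longrightarrow> T \<in> sets borel \<Longrightarrow> E (S \<inter> T) x = E S (E T x)"
  using spectral_measure unfolding spectral_measure_def by (metis blinfun_apply_blinfun_compose)

lemma E_sums: "range F \<subseteq> sets borel \<Longrightarrow> disjoint_family F \<Longrightarrow> (\<lambda>n. E (F n) x) sums E (\<Union>n::nat. F n) x"
  using spectral_measure unfolding spectral_measure_def by blast

lemma E_empty: "E {} x = 0"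
proof -
  have "(\<lambda>n::nat. E {} x) sums E {} x"
    using E_sums[of "\<lambda>_. {}" x] by (simp add: disjoint_family_on_def)
  then have "(\<lambda>n::nat. E {} x) \<longlonglongrightarrow> 0" using sums_summable summable_LIMSEQ_zero by blast
  then show ?thesis by (simp add: LIMSEQ_const_iff)
qed

lemma E_Un:
  assumes "S \<in> sets borel" "T \<in> sets borel" "S \<inter> T = {}"
  shows "E (S \<union> T) x = E S x + E T x"
proof -
  define F where "F = (\<lambda>n::nat. if n = 0 then S else if n = 1 then T else {})"
  have F: "range F \<subseteq> sets borel" "disjoint_family F"
    using assms by (auto simp: F_def disjoint_family_on_def)
  have "(\<Union>n. F n) = S \<union> T" by (auto simp: F_def split: if_splits)
  then have "(\<lambda>n. E (F n) x) sums E (S \<union> T) x" using E_sums[OF F] by simp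
  moreover have "(\<lambda>n. E (F n) x) sums (\<Sum>n\<in>{0, 1}. E (F n) x)"
    by (rule sums_finite) (auto simp: F_def E_empty)
  ultimately show ?thesis using sums_unique2 by (fastforce simp: F_def)
qed

lemma E_Compl: "S \<in> sets borel \<Longrightarrow> E (- S) x = x - E S x"
  using E_Un[of S "- S" x] by (simp add: E_UNIV algebra_simps)

lemma E_Compl_E: "S \<in> sets borel \<Longrightarrow> E (- S) (E S x) = 0" "S \<in> sets borel \<Longrightarrow> E S (E (- S) x) = 0"
  using E_Int[of "- S" S x] E_Int[of S "- S" x] by (simp_all add: E_empty)

lemma E_norm: "S \<in> sets borel \<Longrightarrow> cinner (E S x) x = complex_of_real ((norm (E S x))\<^sup>2)"
  by (metis E_idem E_sym cinner_self)

lemma E_norm_le: "S \<in> sets borel \<Longrightarrow> norm (E S x) \<le> norm x"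
proof -
  assume S: "S \<in> sets borel"
  have "(norm (E S x))\<^sup>2 = cmod (cinner (E S x) x)" using E_norm[OF S, of x] by (simp add: norm_power)
  also have "\<dots> \<le> norm (E S x) * norm x" by (rule cinner_cmod_le)
  finally have "norm (E S x) * norm (E S x) \<le> norm x * norm (E S x)" by (simp add: power2_eq_square mult.commute)
  then show ?thesis by (rule le_if_square_le) auto
qed

lemma scalar_measure_space [simp]: "space (\<nu> x) = UNIV" "sets (\<nu> x) = sets borel"
proof -
  have "sets borel \<subseteq> Pow (UNIV :: real set)" by simp
  then show "space (\<nu> x) = UNIV" by (simp add: scalar_measure_def space_measure_of_conv)
  have "sigma_sets UNIV (sets borel) = sets (borel :: real measure)"
    using sets.sigma_sets_eq[of "borel :: real measure"] by simp
  then show "sets (\<nu> x) = sets borel" by (simp add: scalar_measure_def)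
qed

lemma emeasure_scalar_measure:
  assumes S: "S \<in> sets borel"
  shows "emeasure (\<nu> x) S = ennreal ((norm (E S x))\<^sup>2)"
proof -
  have "emeasure (\<nu> x) S = ennreal (Re (cinner (E S x) x))"
  proof (rule emeasure_measure_of[OF scalar_measure_def])
    show "positive (sets (\<nu> x)) (\<lambda>S. ennreal (Re (cinner (E S x) x)))"
      by (simp add: positive_def E_empty cinner.zero_left)
    show "countably_additive (sets (\<nu> x)) (\<lambda>S. ennreal (Re (cinner (E S x) x)))"
    proof (rule countably_additiveI)
      fix F :: "nat \<Rightarrow> real set" assume F: "range F \<subseteq> sets (\<nu> x)" "disjoint_family F"
      have "(\<lambda>n. Re (cinner (E (F n) x) x)) sums Re (cinner (E (\<Union>n. F n) x) x)"
        using E_sums[of F x] F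
        by (intro bounded_linear.sums[OF bounded_linear_Re] bounded_linear.sums[OF cinner.bounded_linear_left]) auto
      moreover have "0 \<le> Re (cinner (E (F n) x) x)" for n
        using F E_norm[of "F n" x] by (simp add: image_subset_iff del: of_real_power)
      ultimately show "(\<Sum>i. ennreal (Re (cinner (E (F i) x) x))) = ennreal (Re (cinner (E (\<Union>n. F n) x) x))"
        by (intro suminf_ennreal_eq) auto
    qed
  qed (use S in auto)
  then show ?thesis by (simp add: E_norm[OF S] del: of_real_power)
qed

lemma finite_measure_scalar: "finite_measure (\<nu> x)"
  by (rule finite_measureI) (simp add: emeasure_scalar_measure)

lemma measure_scalar_measure: "S \<in> sets borel \<Longrightarrow> measure (\<nu> x) S = (norm (E S x))\<^sup>2"
  by (simp add: measure_def emeasure_scalar_measure)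

lemma measurable_scalar_measure [simp]: "measurable (\<nu> x) N = measurable borel N"
  by (rule measurable_cong_sets) simp_all

lemma scalar_measure_E:
  assumes S: "S \<in> sets borel"
  shows "\<nu> (E S x) = density (\<nu> x) (indicator S)"
proof (rule measure_eqI)
  fix T assume "T \<in> sets (\<nu> (E S x))"
  then have T: "T \<in> sets borel" by simp
  have "emeasure (density (\<nu> x) (indicator S)) T = (\<integral>\<^sup>+ t. indicator S t * indicator T t \<partial>\<nu> x)"
    using S T by (intro emeasure_density) (auto intro: borel_measurable_indicator)
  also have "\<dots> = emeasure (\<nu> x) (T \<inter> S)"
    using S T by (simp add: indicator_inter_arith[symmetric] Int_commute)
  finally show "emeasure (\<nu> (E S x)) T = emeasure (density (\<nu> x) (indicator S)) T"
    using S T by (simp add: emeasure_scalar_measure E_Int)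
qed simp

lemma dom_iff: "x \<in> dom \<longleftrightarrow> (\<integral>\<^sup>+ t. ennreal (t\<^sup>2) \<partial>\<nu> x) < \<infinity>"
proof -
  have "dom = {x. (\<integral>\<^sup>+ t. ennreal (t\<^sup>2) \<partial>\<nu> x) < \<infinity>}"
    using spectral_measure unfolding spectral_measure_def by blast
  then show ?thesis by blast
qed

lemma dom_subspace: "complex_vector.subspace dom" and dom_dense: "closure dom = UNIV"
  and A_add: "x \<in> dom \<Longrightarrow> y \<in> dom \<Longrightarrow> A (x + y) = A x + A y"
  and A_scaleC: "x \<in> dom \<Longrightarrow> A (c *\<^sub>C x) = c *\<^sub>C A x"
  and A_sym: "x \<in> dom \<Longrightarrow> y \<in> dom \<Longrightarrow> cinner (A x) y = cinner x (A y)"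
  using self_adjoint unfolding self_adjoint_def by blast+

lemma A_diff: "x \<in> dom \<Longrightarrow> y \<in> dom \<Longrightarrow> A (x - y) = A x - A y"
  using A_add[of x "(-1) *\<^sub>C y"] A_scaleC[of y "-1"] complex_vector.subspace_scale[OF dom_subspace, of y "-1"] by simp

lemma E_dom: "S \<in> sets borel \<Longrightarrow> x \<in> dom \<Longrightarrow> E S x \<in> dom"
proof -
  assume S: "S \<in> sets borel" and x: "x \<in> dom"
  have "(\<integral>\<^sup>+ t. ennreal (t\<^sup>2) \<partial>\<nu> (E S x)) = (\<integral>\<^sup>+ t. indicator S t * ennreal (t\<^sup>2) \<partial>\<nu> x)"
    unfolding scalar_measure_E[OF S] using S by (intro nn_integral_density) (auto intro: borel_measurable_indicator)
  also have "\<dots> \<le> (\<integral>\<^sup>+ t. ennreal (t\<^sup>2) \<partial>\<nu> x)"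
    by (intro nn_integral_mono) (auto simp: indicator_def)
  finally show ?thesis using x unfolding dom_iff by (metis le_less_trans)
qed

lemma E_dom_bounded:
  assumes S: "S \<in> sets borel" "\<And>t. t \<in> S \<Longrightarrow> \<bar>t\<bar> \<le> C"
  shows "E S x \<in> dom"
proof -
  have "(\<integral>\<^sup>+ t. ennreal (t\<^sup>2) \<partial>\<nu> (E S x)) = (\<integral>\<^sup>+ t. indicator S t * ennreal (t\<^sup>2) \<partial>\<nu> x)"
    unfolding scalar_measure_E[OF S(1)] using S by (intro nn_integral_density) (auto intro: borel_measurable_indicator)
  also have "\<dots> \<le> (\<integral>\<^sup>+ t. ennreal (C\<^sup>2) \<partial>\<nu> x)"
    using S(2) by (intro nn_integral_mono) (auto simp: indicator_def abs_le_square_iff[symmetric] intro!: ennreal_leI order_trans[OF S(2)])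
  also have "\<dots> < \<infinity>" by (simp add: emeasure_scalar_measure ennreal_mult_less_top)
  finally show ?thesis unfolding dom_iff .
qed

lemma quadratic_form: "x \<in> dom \<Longrightarrow> cinner (A x) x = complex_of_real (\<integral>t. t \<partial>\<nu> x)"
  using spectral_measure unfolding spectral_measure_def by blast

lemma integrable_id: "x \<in> dom \<Longrightarrow> integrable (\<nu> x) (\<lambda>t. t)"
proof -
  assume x: "x \<in> dom"
  interpret finite_measure "\<nu> x" by (rule finite_measure_scalar)
  have "integrable (\<nu> x) (\<lambda>t. t\<^sup>2)"
  proof (rule integrableI_bounded)
    show "(\<lambda>t. t\<^sup>2) \<in> borel_measurable (\<nu> x)" by simp
    show "(\<integral>\<^sup>+ t. ennreal (norm (t\<^sup>2)) \<partial>\<nu> x) < \<infinity>" using x unfolding dom_iff by simp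
  qed
  then have "integrable (\<nu> x) (\<lambda>t. 1 + t\<^sup>2)" by (intro Bochner_Integration.integrable_add) auto
  then show ?thesis
  proof (rule Bochner_Integration.integrable_bound)
    have "\<bar>t\<bar> \<le> 1 + t\<^sup>2" for t :: real
    proof -
      have "0 \<le> (1 - \<bar>t\<bar>)\<^sup>2" by simp
      then show ?thesis by (simp add: power2_eq_square algebra_simps)
    qed
    then show "AE t in \<nu> x. norm t \<le> norm (1 + t\<^sup>2)" by (auto simp: abs_of_nonneg)
  qed auto
qed

lemma integral_E:
  assumes S: "S \<in> sets borel"
  shows "(\<integral>t. t \<partial>\<nu> (E S x)) = (\<integral>t. indicator S t * t \<partial>\<nu> x)"
proof -
  have "\<nu> (E S x) = density (\<nu> x) (\<lambda>t. ennreal (indicator S t))"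
    unfolding scalar_measure_E[OF S] by (simp add: ennreal_indicator)
  moreover have "(\<integral>t. t \<partial>density (\<nu> x) (\<lambda>t. ennreal (indicator S t))) = (\<integral>t. indicator S t *\<^sub>R t \<partial>\<nu> x)"
    using S by (intro integral_density) (auto intro: borel_measurable_indicator)
  ultimately show ?thesis by simp
qed

lemma quadratic_form_split:
  assumes S: "S \<in> sets borel" and x: "x \<in> dom"
  shows "cinner (A x) x = cinner (A (E S x)) (E S x) + cinner (A (E (- S) x)) (E (- S) x)"
proof -
  have "(\<integral>t. t \<partial>\<nu> x) = (\<integral>t. indicator S t * t + indicator (- S) t * t \<partial>\<nu> x)"
    by (intro Bochner_Integration.integral_cong) (auto simp: indicator_def)
  also have "\<dots> = (\<integral>t. indicator S t * t \<partial>\<nu> x) + (\<integral>t. indicator (- S) t * t \<partial>\<nu> x)"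
  proof (rule Bochner_Integration.integral_add)
    have "integrable (\<nu> x) (\<lambda>t. indicator T t * t)" if "T \<in> sets borel" for T
      using integrable_real_mult_indicator[of T "\<nu> x" "\<lambda>t. t"] that integrable_id[OF x] by (simp add: mult.commute)
    then show "integrable (\<nu> x) (\<lambda>t. indicator S t * t)" "integrable (\<nu> x) (\<lambda>t. indicator (- S) t * t)"
      using S by auto
  qed
  finally have eq: "(\<integral>t. t \<partial>\<nu> x) = (\<integral>t. indicator S t * t \<partial>\<nu> x) + (\<integral>t. indicator (- S) t * t \<partial>\<nu> x)" .
  have mS: "- S \<in> sets borel" using S by auto
  show ?thesis
    unfolding quadratic_form[OF x] quadratic_form[OF E_dom[OF S x]] quadratic_form[OF E_dom[OF mS x]]
      integral_E[OF S] integral_E[OF mS] eq by simp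
qed

text \<open>The form of \<open>A\<close> is additive on \<open>E S x + E (- S) y\<close>, so the real part of the cross term vanishes for
  all \<open>y\<close>, in particular for \<open>\<i> y\<close>.  Since \<open>spectral_measure\<close> ties \<open>E\<close> to \<open>A\<close> only by way of quadratic
  forms, this is how \<open>E\<close> is seen to commute with \<open>A\<close>.\<close>

lemma cross_term_zero:
  assumes S: "S \<in> sets borel" and x: "x \<in> dom" and y: "y \<in> dom"
  shows "cinner (A (E S x)) (E (- S) y) = 0"
proof -
  have mS: "- S \<in> sets borel" using S by auto
  have Re0: "Re (cinner (A (E S x)) (E (- S) y)) = 0" if y: "y \<in> dom" for y
  proof -
    define v w where "v = E S x" and "w = E (- S) y"
    have vw: "v \<in> dom" "w \<in> dom" "v + w \<in> dom"
      using E_dom[OF S x] E_dom[OF mS y] complex_vector.subspace_add[OF dom_subspace] by (auto simp: v_def w_def)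
    have "E S (v + w) = v" "E (- S) (v + w) = w"
      using S mS E_Compl_E[OF S] by (simp_all add: v_def w_def blinfun.add_right E_idem)
    then have "cinner (A (v + w)) (v + w) = cinner (A v) v + cinner (A w) w"
      using quadratic_form_split[OF S vw(3)] by simp
    then have "cinner (A v) w + cinner (A w) v = 0"
      by (simp add: A_add[OF vw(1,2)] cinner_simps add.commute)
    moreover have "cinner (A w) v = cnj (cinner (A v) w)"
      using A_sym[OF vw(2,1)] cinner_commute[of w "A v"] by simp
    ultimately show ?thesis by (simp add: v_def w_def complex_eq_iff)
  qed
  have "Re (cinner (A (E S x)) (E (- S) (\<i> *\<^sub>C y))) = 0"
    using complex_vector.subspace_scale[OF dom_subspace y] by (intro Re0)
  then have "Im (cinner (A (E S x)) (E (- S) y)) = 0"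
    by (simp add: clin_simps[OF E_clin[OF mS]] cinner_scaleC_right)
  then show ?thesis using Re0[OF y] by (simp add: complex_eq_iff)
qed

lemma orthogonal_dom_zero:
  assumes "\<And>y. y \<in> dom \<Longrightarrow> cinner u y = 0" shows "u = 0"
proof -
  have "closed {y. cinner u y = 0}" by (intro closed_Collect_eq continuous_intros linear_continuous_on cinner.bounded_linear_right)
  then have "closure dom \<subseteq> {y. cinner u y = 0}" using assms by (intro closure_minimal) auto
  then have "cinner u u = 0" using dom_dense by auto
  then show ?thesis by (simp add: cinner_self)
qed

lemma A_E_commute:
  assumes S: "S \<in> sets borel" and x: "x \<in> dom"
  shows "A (E S x) = E S (A x)"
proof -
  have inv: "E (- S) (A (E S x)) = 0" if "S \<in> sets borel" for S
    using that by (intro orthogonal_dom_zero) (simp add: E_sym cross_term_zero x)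
  have mS: "- S \<in> sets borel" using S by auto
  have "A x = A (E S x) + A (E (- S) x)"
    using A_add[OF E_dom[OF S x] E_dom[OF mS x]] by (simp add: E_Compl[OF S])
  then have "E S (A x) = E S (A (E S x)) + E S (A (E (- S) x))" by (simp add: blinfun.add_right)
  moreover have "E S (A (E (- S) x)) = 0" using inv[OF mS] by simp
  moreover have "E S (A (E S x)) = A (E S x)" using inv[OF S] E_Compl[OF S, of "A (E S x)"] by simp
  ultimately show ?thesis by simp
qed

text \<open>On the range of \<open>E S\<close> the form of \<open>A - c\<close> is the integral of \<open>t - c\<close> over \<open>S\<close>, hence bounded by
  \<open>\<delta>\<close>.  For a symmetric operator a bound on the form bounds the norm: polarize between \<open>v\<close> and the multiple
  \<open>w\<close> of \<open>(A - c) v\<close> with \<open>\<parallel>w\<parallel> = \<parallel>v\<parallel>\<close>.\<close>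

lemma A_near_scalar_on_small_set:
  assumes S: "S \<in> sets borel" "\<And>t. t \<in> S \<Longrightarrow> \<bar>t - c\<bar> \<le> \<delta>" and v: "E S v = v" and \<delta>: "\<delta> \<ge> 0"
  shows "v \<in> dom" and "norm (A v - of_real c *\<^sub>C v) \<le> \<delta> * norm v"
proof -
  have bd: "\<bar>t\<bar> \<le> \<bar>c\<bar> + \<delta>" if "t \<in> S" for t using S(2)[OF that] by linarith
  have ran: "y \<in> dom" if "E S y = y" for y using E_dom_bounded[OF S(1) bd, of y] that by simp
  show vd: "v \<in> dom" by (rule ran[OF v])
  define T where "T = (\<lambda>y. A y - of_real c *\<^sub>C y)"
  have form: "\<bar>Re (cinner (T y) y)\<bar> \<le> \<delta> * (norm y)\<^sup>2" if y: "E S y = y" for y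
  proof -
    interpret finite_measure "\<nu> y" by (rule finite_measure_scalar)
    have yd: "y \<in> dom" by (rule ran[OF y])
    have "emeasure (\<nu> y) (- S) = 0"
      using S(1) E_Compl[OF S(1), of y] y by (simp add: emeasure_scalar_measure)
    then have ae: "AE t in \<nu> y. t \<in> S"
      using S(1) by (intro AE_I[of _ _ "- S"]) auto
    have tot: "measure (\<nu> y) UNIV = (norm y)\<^sup>2" by (simp add: measure_scalar_measure E_UNIV)
    have "Re (cinner (T y) y) = (\<integral>t. t \<partial>\<nu> y) - c * (norm y)\<^sup>2"
      by (simp add: T_def cinner_simps quadratic_form[OF yd] cinner_self del: of_real_power)
    also have "\<dots> = (\<integral>t. t - c \<partial>\<nu> y)"
      using integrable_id[OF yd] tot by (subst Bochner_Integration.integral_diff) auto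
    finally have "\<bar>Re (cinner (T y) y)\<bar> \<le> (\<integral>t. \<bar>t - c\<bar> \<partial>\<nu> y)"
      using integral_norm_bound[of "\<nu> y" "\<lambda>t. t - c"] by simp
    also have "\<dots> \<le> (\<integral>t. \<delta> \<partial>\<nu> y)"
      using integrable_id[OF yd] ae S(2) by (intro integral_mono_AE) auto
    finally show ?thesis using tot by (simp add: mult.commute)
  qed
  show "norm (A v - of_real c *\<^sub>C v) \<le> \<delta> * norm v"
  proof (cases "T v = 0 \<or> v = 0")
    case True
    then show ?thesis using \<delta> A_scaleC[OF vd, of 0] by (auto simp: T_def)
  next
    case False
    define r where "r = norm v / norm (T v)"
    define w where "w = of_real r *\<^sub>C T v"
    have "E S (T v) = T v"
      using A_E_commute[OF S(1) vd] v by (simp add: T_def blinfun.diff_right clin_simps[OF E_clin[OF S(1)]])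
    then have w: "E S w = w" by (simp add: w_def clin_simps[OF E_clin[OF S(1)]])
    have nw: "norm w = norm v" using False by (simp add: w_def norm_scaleC r_def norm_divide)
    have wd: "w \<in> dom" by (rule ran[OF w])
    have T_add: "T (v + w) = T v + T w" "T (v - w) = T v - T w"
      by (simp_all add: T_def A_add[OF vd wd] A_diff[OF vd wd] scaleC.add_right scaleC.diff_right)
    have sym: "cinner (T w) v = cnj (cinner (T v) w)"
      using A_sym[OF wd vd] cinner_commute[of w "A v"] cinner_commute[of w v] by (simp add: T_def cinner_simps)
    have "cinner (T (v + w)) (v + w) - cinner (T (v - w)) (v - w) = 2 * (cinner (T v) w + cinner (T w) v)"
      unfolding T_add by (simp add: cinner_simps algebra_simps)
    then have "Re (cinner (T (v + w)) (v + w)) - Re (cinner (T (v - w)) (v - w)) = 4 * Re (cinner (T v) w)"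
      by (simp add: sym flip: minus_complex.sel)
    moreover have "\<bar>Re (cinner (T (v + w)) (v + w))\<bar> \<le> \<delta> * (norm (v + w))\<^sup>2"
      "\<bar>Re (cinner (T (v - w)) (v - w))\<bar> \<le> \<delta> * (norm (v - w))\<^sup>2"
      using v w by (intro form; simp add: blinfun.add_right blinfun.diff_right)+
    moreover have "\<delta> * (norm (v + w))\<^sup>2 + \<delta> * (norm (v - w))\<^sup>2 = \<delta> * (4 * (norm v)\<^sup>2)"
    proof -
      have "inner w w = inner v v" using nw by (simp add: power2_norm_eq_inner[symmetric])
      then show ?thesis
        unfolding power2_norm_eq_inner distrib_left[symmetric] by (simp add: inner_add_left inner_add_right inner_diff_left inner_diff_right)
    qed
    ultimately have "4 * Re (cinner (T v) w) \<le> \<delta> * (4 * (norm v)\<^sup>2)"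
      by linarith
    moreover have "Re (cinner (T v) w) = norm v * norm (T v)"
      using False by (simp add: w_def cinner_scaleC_right cinner_self r_def power2_eq_square)
    ultimately have "norm (T v) * norm v \<le> \<delta> * norm v * norm v" by (simp add: power2_eq_square mult_ac)
    then show ?thesis using False by (simp add: T_def)
  qed
qed

section \<open>The support of the spectral measure and the form of the resolvent\<close>

text \<open>On the range of \<open>E\<close> for a short interval about \<open>p\<close> the operator \<open>A - p\<close> has small norm, but at a
  point of the resolvent set it is bounded below.\<close>

lemma E_vanishes_near_resolvent_point:
  assumes "complex_of_real p \<notin> spectrum dom A"
  obtains \<epsilon> where "\<epsilon> > 0" "\<And>x. E {p - \<epsilon><..<p + \<epsilon>} x = 0"
proof -
  obtain M where M: "\<And>x. x \<in> dom \<Longrightarrow> norm x \<le> M * norm (A x - of_real p *\<^sub>C x)"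
    using assms by (auto simp: spectrum_def resolvent_set_def)
  \<comment> \<open>chosen so that \<open>M \<epsilon> < 1\<close>\<close>
  define \<epsilon> where "\<epsilon> = 1 / (2 * (\<bar>M\<bar> + 1))"
  have \<epsilon>: "\<epsilon> > 0" by (simp add: \<epsilon>_def)
  have "E {p - \<epsilon><..<p + \<epsilon>} x = 0" for x
  proof -
    define v where "v = E {p - \<epsilon><..<p + \<epsilon>} x"
    have cl: "\<bar>t - p\<bar> \<le> \<epsilon>" if "t \<in> {p - \<epsilon><..<p + \<epsilon>}" for t using that by auto
    have Ev: "E {p - \<epsilon><..<p + \<epsilon>} v = v" by (simp add: v_def E_idem)
    have "v \<in> dom" using A_near_scalar_on_small_set(1)[OF _ cl Ev] \<epsilon> by simp
    moreover have "norm (A v - of_real p *\<^sub>C v) \<le> \<epsilon> * norm v"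
      using A_near_scalar_on_small_set(2)[OF _ cl Ev] \<epsilon> by simp
    ultimately have "norm v \<le> M * norm (A v - of_real p *\<^sub>C v)" using M by blast
    also have "\<dots> \<le> (\<bar>M\<bar> + 1) * (\<epsilon> * norm v)"
      using \<open>norm (A v - of_real p *\<^sub>C v) \<le> \<epsilon> * norm v\<close> by (intro mult_mono) auto
    also have "\<dots> = norm v / 2"
    proof -
      define n where "n = \<bar>M\<bar> + 1"
      have "n > 0" by (simp add: n_def)
      then show ?thesis unfolding \<epsilon>_def n_def[symmetric] by (simp add: field_simps)
    qed
    finally show ?thesis by (simp add: v_def)
  qed
  then show ?thesis using that \<epsilon> by blast
qed

lemma E_vanishes_off_spectrum:
  assumes U: "open U" "\<And>t. t \<in> U \<Longrightarrow> complex_of_real t \<notin> spectrum dom A"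
  shows "emeasure (\<nu> x) U = 0"
proof -
  define F where "F = {V. open V \<and> V \<subseteq> U \<and> emeasure (\<nu> x) V = 0}"
  have "\<Union>F = U"
  proof
    show "U \<subseteq> \<Union>F"
    proof
      fix t assume t: "t \<in> U"
      obtain \<epsilon> where \<epsilon>: "\<epsilon> > 0" "\<And>x. E {t - \<epsilon><..<t + \<epsilon>} x = 0"
        using E_vanishes_near_resolvent_point[OF U(2)[OF t]] by blast
      have "emeasure (\<nu> x) ({t - \<epsilon><..<t + \<epsilon>} \<inter> U) \<le> emeasure (\<nu> x) {t - \<epsilon><..<t + \<epsilon>}"
        by (intro emeasure_mono) auto
      then have "{t - \<epsilon><..<t + \<epsilon>} \<inter> U \<in> F"
        using U(1) \<epsilon> by (auto simp: F_def emeasure_scalar_measure open_Int)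
      then show "t \<in> \<Union>F" using t \<epsilon>(1) by (intro UnionI[of "{t - \<epsilon><..<t + \<epsilon>} \<inter> U"]) auto
    qed
  qed (auto simp: F_def)
  moreover obtain F' where F': "F' \<subseteq> F" "countable F'" "\<Union>F' = \<Union>F"
    by (rule Lindelof[of F]) (auto simp: F_def)
  moreover have "\<Union>F' \<in> null_sets (\<nu> x)"
  proof -
    have "(\<Union>V\<in>F'. V) \<in> null_sets (\<nu> x)"
      using F' by (intro null_sets_UN') (auto simp: F_def null_sets_def)
    then show ?thesis by simp
  qed
  ultimately show ?thesis by (simp add: null_sets_def)
qed

text \<open>The spectrum exceeds the open interval by end points only, and these carry no mass of an absolutely
  continuous measure.\<close>

lemma E_einterval_full:
  assumes \<sigma>: "spectrum dom A = closure (complex_of_real ` einterval m1 m2)" and ac: "ac_spectrum E"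
  shows "E (einterval m1 m2) x = x"
proof -
  define I where "I = einterval m1 m2"
  define U where "U = {t. ereal t < m1} \<union> {t. m2 < ereal t}"
  have U: "open U" unfolding U_def by (intro open_Un open_Collect_less continuous_intros continuous_on_ereal)
  have Ib: "I \<in> sets borel" by (simp add: I_def)
  have cl: "closure (complex_of_real ` I) \<subseteq> complex_of_real ` (- U)"
  proof (rule closure_minimal)
    show "complex_of_real ` I \<subseteq> complex_of_real ` (- U)"
      by (auto simp: I_def U_def einterval_def intro!: imageI dest: less_imp_le simp: not_less)
    have "complex_of_real ` (- U) = {z. Im z = 0} \<inter> Re -` (- U)"
      by (auto simp: image_iff complex_is_Real_iff[symmetric] intro!: bexI[of _ "Re _"] simp: complex_eq_iff)
    moreover have "closed (Re -` (- U))"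
      using U by (intro closed_vimage continuous_on_Re continuous_on_id) auto
    ultimately show "closed (complex_of_real ` (- U))"
      by (simp add: closed_Int closed_Collect_eq continuous_on_Im)
  qed
  have "emeasure (\<nu> x) U = 0"
    by (rule E_vanishes_off_spectrum[OF U]) (use \<sigma> cl in \<open>auto simp: I_def\<close>)
  moreover have "emeasure (\<nu> x) {real_of_ereal m1, real_of_ereal m2} = 0"
  proof -
    have "{real_of_ereal m1, real_of_ereal m2} \<in> null_sets lborel" by (rule finite_imp_null_set_lborel) simp
    then have "{real_of_ereal m1, real_of_ereal m2} \<in> null_sets (\<nu> x)"
      using ac unfolding ac_spectrum_def absolutely_continuous_def by blast
    then show ?thesis by (simp add: null_sets_def)
  qed
  moreover have "- I \<subseteq> U \<union> {real_of_ereal m1, real_of_ereal m2}"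
  proof
    fix t assume "t \<in> - I"
    then have "ereal t \<le> m1 \<or> m2 \<le> ereal t" by (auto simp: I_def einterval_def not_less)
    then show "t \<in> U \<union> {real_of_ereal m1, real_of_ereal m2}"
      unfolding U_def by (metis (mono_tags, lifting) Un_iff insertI1 insert_commute mem_Collect_eq order_le_less real_of_ereal.simps(1))
  qed
  ultimately have "emeasure (\<nu> x) (- I) = 0"
    using emeasure_mono[of "- I" "U \<union> {real_of_ereal m1, real_of_ereal m2}" "\<nu> x"]
      emeasure_subadditive[of U "\<nu> x" "{real_of_ereal m1, real_of_ereal m2}"] U by (simp add: borel_open)
  then have "E (- I) x = 0" using Ib by (simp add: emeasure_scalar_measure)
  then show ?thesis using E_Compl[OF Ib, of x] by (simp add: I_def)
qed

lemma resolvent_props: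
  assumes z: "z \<notin> spectrum dom A"
  shows resolvent_dom: "resolvent dom A z f \<in> dom"
    and resolvent_eq: "A (resolvent dom A z f) - z *\<^sub>C resolvent dom A z f = f"
    and resolvent_unique: "w \<in> dom \<Longrightarrow> A w - z *\<^sub>C w = f \<Longrightarrow> w = resolvent dom A z f"
proof -
  have bij: "bij_betw (\<lambda>x. A x - z *\<^sub>C x) dom UNIV" using z by (auto simp: spectrum_def resolvent_set_def)
  then show "resolvent dom A z f \<in> dom"
    unfolding resolvent_def by (metis bij_betw_def UNIV_I inv_into_into)
  show "A (resolvent dom A z f) - z *\<^sub>C resolvent dom A z f = f"
    using f_inv_into_f[of f "\<lambda>x. A x - z *\<^sub>C x" dom] bij unfolding resolvent_def by (auto simp: bij_betw_def)
  show "w = resolvent dom A z f" if "w \<in> dom" "A w - z *\<^sub>C w = f"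
    unfolding resolvent_def using that bij by (metis (no_types, lifting) bij_betw_def inv_into_f_f)
qed

lemma resolvent_clin:
  assumes z: "z \<notin> spectrum dom A" shows "clin (resolvent dom A z)"
  unfolding clin_def
proof (intro conjI allI)
  let ?R = "resolvent dom A z"
  note d = resolvent_dom[OF z] and e = resolvent_eq[OF z]
  show "?R (x + y) = ?R x + ?R y" for x y
  proof (rule resolvent_unique[OF z, symmetric])
    show "?R x + ?R y \<in> dom" using d by (intro complex_vector.subspace_add[OF dom_subspace])
    show "A (?R x + ?R y) - z *\<^sub>C (?R x + ?R y) = x + y"
      using e[of x] e[of y] by (simp add: A_add[OF d d] scaleC.add_right) (metis add_diff_add)
  qed
  show "?R (c *\<^sub>C x) = c *\<^sub>C ?R x" for c x
  proof (rule resolvent_unique[OF z, symmetric])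
    show "c *\<^sub>C ?R x \<in> dom" using d by (intro complex_vector.subspace_scale[OF dom_subspace])
    have "A (c *\<^sub>C ?R x) - z *\<^sub>C c *\<^sub>C ?R x = c *\<^sub>C (A (?R x) - z *\<^sub>C ?R x)"
      by (simp add: A_scaleC[OF d] scaleC.diff_right scaleC_scaleC mult.commute)
    then show "A (c *\<^sub>C ?R x) - z *\<^sub>C c *\<^sub>C ?R x = c *\<^sub>C x" by (simp add: e)
  qed
qed

lemma resolvent_bound:
  assumes z: "z \<notin> spectrum dom A"
  obtains M where "M > 0" "\<And>f. norm (resolvent dom A z f) \<le> M * norm f"
proof -
  obtain M where M: "\<And>x. x \<in> dom \<Longrightarrow> norm x \<le> M * norm (A x - z *\<^sub>C x)"
    using z by (auto simp: spectrum_def resolvent_set_def)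
  have "norm (resolvent dom A z f) \<le> (\<bar>M\<bar> + 1) * norm f" for f
  proof -
    have "norm (resolvent dom A z f) \<le> M * norm f"
      using M[OF resolvent_dom[OF z, of f]] by (simp add: resolvent_eq[OF z])
    also have "\<dots> \<le> (\<bar>M\<bar> + 1) * norm f" by (intro mult_right_mono) auto
    finally show ?thesis .
  qed
  then show ?thesis using that[of "\<bar>M\<bar> + 1"] by auto
qed

lemma resolvent_E_commute:
  assumes z: "z \<notin> spectrum dom A" and S: "S \<in> sets borel"
  shows "resolvent dom A z (E S f) = E S (resolvent dom A z f)"
proof (rule resolvent_unique[OF z, symmetric])
  let ?w = "resolvent dom A z f"
  show "E S ?w \<in> dom" by (rule E_dom[OF S resolvent_dom[OF z]])
  have "A (E S ?w) - z *\<^sub>C E S ?w = E S (A ?w - z *\<^sub>C ?w)"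
    by (simp add: A_E_commute[OF S resolvent_dom[OF z]] blinfun.diff_right clin_simps[OF E_clin[OF S]])
  then show "A (E S ?w) - z *\<^sub>C E S ?w = E S f" by (simp add: resolvent_eq[OF z])
qed

lemma E_interval:
  assumes "a \<le> b"
  shows "E {a..<b} x = E {..<b} x - E {..<a} x" and "(norm (E {a..<b} x))\<^sup>2 = (norm (E {..<b} x))\<^sup>2 - (norm (E {..<a} x))\<^sup>2"
proof -
  have "{..<b} = {..<a} \<union> {a..<b}" using assms by auto
  then show 1: "E {a..<b} x = E {..<b} x - E {..<a} x"
    using E_Un[of "{..<a}" "{a..<b}" x] by (auto simp: ivl_disj_int)
  have "complex_of_real ((norm (E {a..<b} x))\<^sup>2) = complex_of_real ((norm (E {..<b} x))\<^sup>2) - complex_of_real ((norm (E {..<a} x))\<^sup>2)"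
    using E_norm[of "{a..<b}" x] E_norm[of "{..<b}" x] E_norm[of "{..<a}" x]
    by (simp add: 1 cinner.diff_left del: of_real_power)
  then show "(norm (E {a..<b} x))\<^sup>2 = (norm (E {..<b} x))\<^sup>2 - (norm (E {..<a} x))\<^sup>2"
    by (metis of_real_diff of_real_eq_iff)
qed

text \<open>On the range of \<open>E {s..<s'}\<close> the resolvent is nearly the scalar \<open>1 / (s - z)\<close>, with an error of the
  order of \<open>s' - s\<close> times the mass of the interval.  So both sides, as functions of the right end, have the
  same increments up to a small multiple of those of the mass.\<close>

lemma resolvent_form_interval:
  assumes z: "z \<notin> spectrum dom A" "Im z \<noteq> 0" and cd: "c \<le> d"
    and k: "\<And>\<mu>. \<mu> \<in> {c..d} \<Longrightarrow> ((\<lambda>\<mu>. (norm (E {..<\<mu>} f))\<^sup>2) has_real_derivative k \<mu>) (at \<mu>)"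
  shows "((\<lambda>\<mu>. complex_of_real (k \<mu>) / (of_real \<mu> - z)) has_integral cinner (resolvent dom A z (E {c..<d} f)) f) {c..d}"
proof -
  let ?R = "resolvent dom A z"
  define g where "g = (\<lambda>\<mu>. (norm (E {..<\<mu>} f))\<^sup>2)"
  have mono: "g s \<le> g s'" if "s \<le> s'" for s s'
    using E_interval(2)[OF that, of f] zero_le_power2[of "norm (E {s..<s'} f)"] by (simp add: g_def)
  have k0: "0 \<le> k \<mu>" if mu: "\<mu> \<in> {c..d}" for \<mu>
  proof (rule ccontr)
    assume "\<not> 0 \<le> k \<mu>"
    then obtain e where e: "e > 0" "\<forall>h>0. h < e \<longrightarrow> g (\<mu> + h) < g \<mu>"
      using DERIV_neg_dec_right[OF k[OF mu]] unfolding g_def by auto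
    then have "g (\<mu> + e/2) < g \<mu>" by simp
    then show False using mono[of \<mu> "\<mu> + e/2"] e(1) by simp
  qed
  have FTC: "(k has_integral (g s' - g s)) {s..s'}" if "c \<le> s" "s \<le> s'" "s' \<le> d" for s s'
    using that k by (intro fundamental_theorem_of_calculus)
      (auto simp: g_def has_real_derivative_iff_has_vector_derivative[symmetric] intro: has_field_derivative_at_within)
  have kabs: "(\<lambda>\<mu>. complex_of_real (k \<mu>)) absolutely_integrable_on {c..d}"
  proof -
    have "k absolutely_integrable_on {c..d}"
      using FTC[OF order_refl cd order_refl] k0 by (intro nonnegative_absolutely_integrable_1) auto
    then show ?thesis using absolutely_integrable_linear[OF _ bounded_linear_of_real] by (simp add: o_def)
  qed
  have im: "\<bar>Im z\<bar> \<le> cmod (of_real t - z)" for t using abs_Im_le_cmod[of "of_real t - z"] by simp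
  have nz: "of_real t - z \<noteq> 0" for t using z(2) by (auto simp: complex_eq_iff)
  have cphi: "continuous_on {c..d} (\<lambda>\<mu>. 1 / (complex_of_real \<mu> - z))" using nz by (intro continuous_intros) auto
  define j where "j = (\<lambda>\<mu>. complex_of_real (k \<mu>) / (of_real \<mu> - z))"
  have jint: "j integrable_on {c..d}"
    using continuous_mult_absolutely_integrable[OF kabs cphi] by (simp add: j_def absolutely_integrable_on_def)
  define J where "J = (\<lambda>t. integral {c..t} j)"
  have Jd: "J s' - J s = integral {s..s'} j" "j integrable_on {s..s'}" if "c \<le> s" "s \<le> s'" "s' \<le> d" for s s'
  proof -
    show "j integrable_on {s..s'}" using jint that by (auto intro: integrable_subinterval_real)
    have "j integrable_on {c..s'}" using jint that by (auto intro: integrable_subinterval_real)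
    from Henstock_Kurzweil_Integration.integral_combine[OF that(1,2) this]
    show "J s' - J s = integral {s..s'} j" by (simp add: J_def algebra_simps)
  qed
  define N where "N = (\<lambda>t. cinner (?R (E {..<t} f)) f)"
  obtain M where M: "M > 0" "\<And>f. norm (?R f) \<le> M * norm f" using resolvent_bound[OF z(1)] by blast
  define C where "C = M / \<bar>Im z\<bar> + 1 / \<bar>Im z\<bar>\<^sup>2"
  have C: "C \<ge> 0" using M by (simp add: C_def)
  have step: "cmod ((N s' - J s') - (N s - J s)) \<le> C * (s' - s) * (g s' - g s)" if ss: "c \<le> s" "s \<le> s'" "s' \<le> d" for s s'
  proof -
    define v where "v = E {s..<s'} f"
    have v: "E {s..<s'} v = v" by (simp add: v_def E_idem)
    have gv: "g s' - g s = (norm v)\<^sup>2" using E_interval(2)[OF ss(2), of f] by (simp add: g_def v_def)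
    have "N s' - N s = cinner (?R v) f"
      by (simp add: N_def v_def E_interval(1)[OF ss(2)] clin_simps[OF resolvent_clin[OF z(1)]] cinner.diff_left)
    also have "?R v = E {s..<s'} (?R v)" using resolvent_E_commute[OF z(1), of "{s..<s'}" v] v by simp
    also have "cinner (E {s..<s'} (?R v)) f = cinner (?R v) v" by (simp add: E_sym v_def)
    finally have Nv: "N s' - N s = cinner (?R v) v" .
    have vd: "v \<in> dom" and vA: "norm (A v - of_real s *\<^sub>C v) \<le> (s' - s) * norm v"
      using A_near_scalar_on_small_set[of "{s..<s'}" s "s' - s" v] v ss by auto
    have "(of_real s - z) *\<^sub>C ?R v + ?R (A v - of_real s *\<^sub>C v) = ?R (A v - z *\<^sub>C v)"
      by (simp add: clin_simps[OF resolvent_clin[OF z(1)]] scaleC.diff_left)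
    also have "\<dots> = v" using resolvent_unique[OF z(1) vd] by simp
    finally have Rv: "v = (of_real s - z) *\<^sub>C ?R v + ?R (A v - of_real s *\<^sub>C v)" ..
    have "complex_of_real ((norm v)\<^sup>2) = (of_real s - z) * cinner (?R v) v + cinner (?R (A v - of_real s *\<^sub>C v)) v"
      unfolding cinner_self[symmetric] by (subst (1) Rv) (simp add: cinner_simps)
    then have "(of_real s - z) * (cinner (?R v) v - of_real ((norm v)\<^sup>2) / (of_real s - z)) = - cinner (?R (A v - of_real s *\<^sub>C v)) v"
      using nz[of s] by (simp add: right_diff_distrib)
    then have "cmod (of_real s - z) * cmod (cinner (?R v) v - of_real ((norm v)\<^sup>2) / (of_real s - z)) = cmod (cinner (?R (A v - of_real s *\<^sub>C v)) v)"
      by (metis norm_minus_cancel norm_mult)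
    also have "\<dots> \<le> (M * ((s' - s) * norm v)) * norm v"
      using cinner_cmod_le[of "?R (A v - of_real s *\<^sub>C v)" v] M(2)[of "A v - of_real s *\<^sub>C v"] mult_left_mono[OF vA, of M] M(1)
      by (meson mult_right_mono norm_ge_zero order_trans less_imp_le)
    finally have a1: "cmod (of_real s - z) * cmod (cinner (?R v) v - of_real ((norm v)\<^sup>2) / (of_real s - z)) \<le> M * (s' - s) * (norm v)\<^sup>2"
      by (simp add: power2_eq_square mult_ac)
    have "\<bar>Im z\<bar> * cmod (cinner (?R v) v - of_real ((norm v)\<^sup>2) / (of_real s - z)) \<le> M * (s' - s) * (norm v)\<^sup>2"
      using order_trans[OF mult_right_mono[OF im norm_ge_zero] a1] .
    then have 1: "cmod (cinner (?R v) v - of_real ((norm v)\<^sup>2) / (of_real s - z)) \<le> M / \<bar>Im z\<bar> * (s' - s) * (norm v)\<^sup>2"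
      using z(2) by (simp add: field_simps)
    have hk: "((\<lambda>\<mu>. complex_of_real (k \<mu>)) has_integral of_real (g s' - g s)) {s..s'}"
      using has_integral_linear[OF FTC[OF ss] bounded_linear_of_real] by (simp add: o_def)
    have diff: "((\<lambda>\<mu>. j \<mu> - of_real (k \<mu>) / (of_real s - z)) has_integral (J s' - J s - of_real (g s' - g s) / (of_real s - z))) {s..s'}"
      using has_integral_diff[OF integrable_integral[OF Jd(2)[OF ss]] has_integral_divide[OF hk]] Jd(1)[OF ss] by simp
    have "cmod (integral {s..s'} (\<lambda>\<mu>. j \<mu> - of_real (k \<mu>) / (of_real s - z))) \<le> integral {s..s'} (\<lambda>\<mu>. (s' - s) / \<bar>Im z\<bar>\<^sup>2 * k \<mu>)"
    proof (rule integral_norm_bound_integral)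
      show "(\<lambda>\<mu>. j \<mu> - of_real (k \<mu>) / (of_real s - z)) integrable_on {s..s'}" using diff by blast
      show "(\<lambda>\<mu>. (s' - s) / \<bar>Im z\<bar>\<^sup>2 * k \<mu>) integrable_on {s..s'}"
        using FTC[OF ss] by (intro integrable_on_mult_right) auto
      fix \<mu> assume mu: "\<mu> \<in> {s..s'}"
      have "j \<mu> - of_real (k \<mu>) / (of_real s - z) = of_real (k \<mu>) * ((of_real s - of_real \<mu>) / ((of_real \<mu> - z) * (of_real s - z)))"
        using nz[of \<mu>] nz[of s] by (simp add: j_def field_simps)
      also have "cmod \<dots> = k \<mu> * ((\<mu> - s) / (cmod (of_real \<mu> - z) * cmod (of_real s - z)))"
        using mu ss k0[of \<mu>] by (simp add: norm_mult norm_divide del: of_real_diff flip: of_real_diff)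
      also have "\<dots> \<le> k \<mu> * ((s' - s) / (\<bar>Im z\<bar> * \<bar>Im z\<bar>))"
        using mu ss k0[of \<mu>] im[of \<mu>] im[of s] z(2) by (intro mult_left_mono frac_le mult_mono mult_pos_pos) auto
      finally show "cmod (j \<mu> - of_real (k \<mu>) / (of_real s - z)) \<le> (s' - s) / \<bar>Im z\<bar>\<^sup>2 * k \<mu>"
        by (simp add: power2_eq_square mult.commute)
    qed
    also have "\<dots> = (s' - s) / \<bar>Im z\<bar>\<^sup>2 * (g s' - g s)"
      using FTC[OF ss] by (simp add: integral_unique)
    finally have 2: "cmod (J s' - J s - of_real (g s' - g s) / (of_real s - z)) \<le> 1 / \<bar>Im z\<bar>\<^sup>2 * (s' - s) * (g s' - g s)"
      using integral_unique[OF diff] by simp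
    have eq: "(N s' - J s') - (N s - J s) = (cinner (?R v) v - of_real ((norm v)\<^sup>2) / (of_real s - z)) - (J s' - J s - of_real (g s' - g s) / (of_real s - z))"
      unfolding Nv[symmetric] gv by simp
    have "cmod ((N s' - J s') - (N s - J s)) \<le> M / \<bar>Im z\<bar> * (s' - s) * (norm v)\<^sup>2 + 1 / \<bar>Im z\<bar>\<^sup>2 * (s' - s) * (g s' - g s)"
      unfolding eq by (rule order_trans[OF norm_triangle_ineq4 add_mono[OF 1 2]])
    then show ?thesis unfolding gv C_def by (simp only: distrib_right)
  qed
  have "N d - J d = N c - J c"
  proof (rule increment_zero[OF cd, where G = g and N = "\<lambda>t. N t - J t"])
    show "g s \<le> g s'" if "s \<le> s'" for s s' using mono[OF that] .
    fix \<epsilon> s :: real assume \<epsilon>: "\<epsilon> > 0" and s: "s \<in> {c..d}"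
    define \<delta> where "\<delta> = \<epsilon> / (C + 1)"
    have \<delta>: "\<delta> > 0" using \<epsilon> C by (simp add: \<delta>_def)
    have C\<delta>: "C * x \<le> \<epsilon>" if "0 \<le> x" "x < \<delta>" for x
    proof -
      have "C * x \<le> (C + 1) * \<delta>" using that C by (intro mult_mono) auto
      then show ?thesis using C by (simp add: \<delta>_def)
    qed
    have "cmod ((N s' - J s') - (N s - J s)) \<le> \<epsilon> * \<bar>g s' - g s\<bar>" if s': "s' \<in> {c..d}" "\<bar>s' - s\<bar> < \<delta>" for s'
    proof (cases "s \<le> s'")
      case True
      then have "cmod ((N s' - J s') - (N s - J s)) \<le> C * (s' - s) * (g s' - g s)" using step[of s s'] s s' by auto
      also have "\<dots> \<le> \<epsilon> * (g s' - g s)" using C\<delta>[of "s' - s"] True s' mono[OF True] by (intro mult_right_mono) auto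
      finally show ?thesis using mono[OF True] by simp
    next
      case False
      then have le: "s' \<le> s" by simp
      then have "cmod ((N s - J s) - (N s' - J s')) \<le> C * (s - s') * (g s - g s')" using step[of s' s] s s' by auto
      also have "\<dots> \<le> \<epsilon> * (g s - g s')" using C\<delta>[of "s - s'"] le s' mono[OF le] by (intro mult_right_mono) auto
      finally show ?thesis using mono[OF le] by (simp add: norm_minus_commute)
    qed
    then show "\<exists>\<delta>>0. \<forall>s'\<in>{c..d}. \<bar>s' - s\<bar> < \<delta> \<longrightarrow> norm ((N s' - J s') - (N s - J s)) \<le> \<epsilon> * \<bar>g s' - g s\<bar>"
      using \<delta> by blast
  qed
  then have "integral {c..d} j = N d - N c" by (simp add: J_def algebra_simps)
  also have "\<dots> = cinner (?R (E {c..<d} f)) f"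
    by (simp add: N_def E_interval(1)[OF cd] clin_simps[OF resolvent_clin[OF z(1)]] cinner.diff_left)
  finally show ?thesis using integrable_integral[OF jint] by (simp add: j_def)
qed

end

text \<open>The density is nonnegative and its integrals over compact subintervals are bounded by \<open>\<parallel>f\<parallel>\<^sup>2\<close>, which
  makes it integrable; exhaustion of the interval gives the formula because the interval carries \<open>f\<close>.\<close>

lemma (in spectral_operator) resolvent_form_einterval:
  assumes z: "z \<notin> spectrum dom A" "Im z \<noteq> 0" and m: "m1 < m2" and full: "E (einterval m1 m2) f = f"
    and k: "\<And>\<mu>. \<mu> \<in> einterval m1 m2 \<Longrightarrow> ((\<lambda>\<mu>. (norm (E {..<\<mu>} f))\<^sup>2) has_real_derivative k \<mu>) (at \<mu>)"
    and k0: "\<And>\<mu>. \<mu> \<in> einterval m1 m2 \<Longrightarrow> 0 \<le> k \<mu>"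
  shows density_integrable: "k absolutely_integrable_on einterval m1 m2"
    and "(\<lambda>\<mu>. complex_of_real (k \<mu>) / (of_real \<mu> - z)) absolutely_integrable_on einterval m1 m2"
    and "integral (einterval m1 m2) (\<lambda>\<mu>. complex_of_real (k \<mu>) / (of_real \<mu> - z)) = cinner (resolvent dom A z f) f"
proof -
  let ?I = "einterval m1 m2" and ?R = "resolvent dom A z"
  obtain u v where uv: "?I = (\<Union>i. {v i..u i})" "incseq u" "decseq v" "\<And>i. v i < u i" "\<And>i. m1 < ereal (v i)" "\<And>i. ereal (u i) < m2"
    "(\<lambda>i. ereal (v i)) \<longlonglongrightarrow> m1" "(\<lambda>i. ereal (u i)) \<longlonglongrightarrow> m2"
    by (rule einterval_Icc_approximation[OF m]) blast
  have sub: "{v i..u i} \<subseteq> ?I" for i using uv(1) by blast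
  have ev: "\<forall>\<^sub>F n in sequentially. v n < x \<and> x < u n" if "x \<in> ?I" for x
    using order_tendstoD(2)[OF uv(7), of "ereal x"] order_tendstoD(1)[OF uv(8), of "ereal x"] that
    by (auto simp: einterval_def eventually_conj_iff)
  define g where "g = (\<lambda>\<mu>. (norm (E {..<\<mu>} f))\<^sup>2)"
  have FTC: "(k has_integral (g b - g a)) {a..b}" if "a \<le> b" "{a..b} \<subseteq> ?I" for a b
  proof (rule fundamental_theorem_of_calculus[OF that(1)])
    fix x assume "x \<in> {a..b}"
    then have "x \<in> ?I" using that(2) by blast
    from has_field_derivative_at_within[OF k[OF this]]
    show "(g has_vector_derivative k x) (at x within {a..b})"
      by (simp add: g_def has_real_derivative_iff_has_vector_derivative)
  qed
  have gle: "g b - g a \<le> (norm f)\<^sup>2" if "a \<le> b" for a b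
    using E_interval(2)[OF that, of f] E_norm_le[of "{a..<b}" f] power_mono[OF E_norm_le[of "{a..<b}" f], of 2] by (simp add: g_def)
  have kint: "k integrable_on ?I"
  proof -
    define F where "F = (\<lambda>n x. if x \<in> {v n..u n} then k x else 0)"
    have Fi: "F n integrable_on ?I" "integral ?I (F n) = g (u n) - g (v n)" for n
    proof -
      note ft = FTC[OF less_imp_le[OF uv(4)] sub, of n]
      show "F n integrable_on ?I"
        unfolding F_def using integrable_restrict_Int[of "{v n..u n}" k ?I] ft sub[of n] by (auto simp: Int_absorb2)
      show "integral ?I (F n) = g (u n) - g (v n)"
        unfolding F_def using integral_restrict_Int[of ?I "{v n..u n}" k] integral_unique[OF ft] sub[of n] by (auto simp: Int_absorb1 Int_absorb2)
    qed
    have "k integrable_on ?I \<and> (\<lambda>n. integral ?I (F n)) \<longlonglongrightarrow> integral ?I k"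
    proof (rule monotone_convergence_increasing)
      show "F n integrable_on ?I" for n by (rule Fi)
      show "F n x \<le> F (Suc n) x" if "x \<in> ?I" for n x
        using k0[OF that] incseq_SucD[OF uv(2), of n] decseq_SucD[OF uv(3), of n] by (auto simp: F_def)
      show "(\<lambda>n. F n x) \<longlonglongrightarrow> k x" if "x \<in> ?I" for x
        by (rule tendsto_eventually, rule eventually_mono[OF ev[OF that]]) (simp add: F_def)
      have "\<bar>g (u n) - g (v n)\<bar> \<le> (norm f)\<^sup>2" for n
        using gle[OF less_imp_le[OF uv(4)], of n] E_interval(2)[OF less_imp_le[OF uv(4)], of n f]
        by (simp add: g_def) (smt (verit) zero_le_power2)
      then show "bounded (range (\<lambda>n. integral ?I (F n)))" unfolding Fi bounded_iff by auto
    qed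
    then show ?thesis by blast
  qed
  show kabs: "k absolutely_integrable_on ?I"
    using kint k0 by (intro nonnegative_absolutely_integrable_1) auto
  have wint: "(\<lambda>\<mu>. k \<mu> / \<bar>Im z\<bar>) integrable_on ?I" using kint by (rule integrable_on_divide)
  have wbd: "norm (complex_of_real (k \<mu>) / (of_real \<mu> - z)) \<le> k \<mu> / \<bar>Im z\<bar>" if "\<mu> \<in> ?I" for \<mu>
    using k0[OF that] z(2) abs_Im_le_cmod[of "of_real \<mu> - z"] by (auto simp: norm_divide intro!: divide_left_mono mult_pos_pos)
  have hi: "((\<lambda>\<mu>. complex_of_real (k \<mu>) / (of_real \<mu> - z)) has_integral cinner (?R (E {a..<b} f)) f) {a..b}"
    if "a \<le> b" "{a..b} \<subseteq> ?I" for a b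
    using that k by (intro resolvent_form_interval[OF z]) auto
  have loc: "(\<lambda>\<mu>. complex_of_real (k \<mu>) / (of_real \<mu> - z)) integrable_on {a..b}" if "{a..b} \<subseteq> ?I" for a b
  proof (cases "a \<le> b")
    case True
    from has_integral_integrable[OF hi[OF True that]] show ?thesis .
  qed auto
  show "(\<lambda>\<mu>. complex_of_real (k \<mu>) / (of_real \<mu> - z)) absolutely_integrable_on ?I"
    by (rule einterval_dominated_integrable[OF m loc wint wbd])
  have "(\<lambda>n. integral {v n..u n} (\<lambda>\<mu>. complex_of_real (k \<mu>) / (of_real \<mu> - z))) \<longlonglongrightarrow>
      integral ?I (\<lambda>\<mu>. complex_of_real (k \<mu>) / (of_real \<mu> - z))"
  proof (rule einterval_dominated_limit[OF m loc wint wbd sub])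
    show "\<forall>\<^sub>F n in sequentially. x \<in> {v n..u n}" if "x \<in> ?I" for x
      using ev[OF that] by eventually_elim auto
  qed
  moreover have "(\<lambda>n. integral {v n..u n} (\<lambda>\<mu>. complex_of_real (k \<mu>) / (of_real \<mu> - z))) \<longlonglongrightarrow> cinner (?R f) f"
  proof -
    define F where "F = (\<lambda>n. {v n..<u n})"
    interpret finite_measure "\<nu> f" by (rule finite_measure_scalar)
    have "incseq F"
      using uv(2,3) by (fastforce simp: F_def incseq_def decseq_def)
    then have "(\<lambda>n. measure (\<nu> f) (F n)) \<longlonglongrightarrow> measure (\<nu> f) (\<Union>n. F n)"
      by (intro finite_Lim_measure_incseq) (auto simp: F_def)
    moreover have "(\<Union>n. F n) = ?I"
    proof
      show "(\<Union>n. F n) \<subseteq> ?I" using sub by (fastforce simp: F_def)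
      show "?I \<subseteq> (\<Union>n. F n)"
      proof
        fix x assume "x \<in> ?I"
        then obtain n where "v n < x \<and> x < u n" using eventually_happens[OF ev] by auto
        then show "x \<in> (\<Union>n. F n)" by (auto simp: F_def intro!: exI[of _ n])
      qed
    qed
    ultimately have "(\<lambda>n. (norm (E (F n) f))\<^sup>2) \<longlonglongrightarrow> (norm f)\<^sup>2"
      using full by (simp add: measure_scalar_measure F_def)
    then have "(\<lambda>n. (norm f)\<^sup>2 - (norm (E (F n) f))\<^sup>2) \<longlonglongrightarrow> (norm f)\<^sup>2 - (norm f)\<^sup>2"
      by (intro tendsto_diff tendsto_const)
    moreover have "(norm f)\<^sup>2 - (norm (E (F n) f))\<^sup>2 = (norm (f - E (F n) f))\<^sup>2" for n
    proof -
      have Fb: "F n \<in> sets borel" by (simp add: F_def)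
      have "cinner (f - E (F n) f) (f - E (F n) f) = cinner f f - cinner (E (F n) f) f"
        using E_sym[OF Fb, of f "E (F n) f"] E_sym[OF Fb, of f f] E_idem[OF Fb, of f] by (simp add: cinner_simps)
      then have "complex_of_real ((norm (f - E (F n) f))\<^sup>2) = complex_of_real ((norm f)\<^sup>2 - (norm (E (F n) f))\<^sup>2)"
        by (simp add: cinner_self E_norm[OF Fb] del: of_real_power)
      then show ?thesis by (simp only: of_real_eq_iff)
    qed
    ultimately have "(\<lambda>n. (norm (f - E (F n) f))\<^sup>2) \<longlonglongrightarrow> 0" by simp
    from tendsto_real_sqrt[OF this] have "(\<lambda>n. norm (f - E (F n) f)) \<longlonglongrightarrow> 0" by simp
    then have "(\<lambda>n. f - (f - E (F n) f)) \<longlonglongrightarrow> f - 0"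
      by (intro tendsto_diff tendsto_const) (rule tendsto_norm_zero_cancel)
    then have Ef: "(\<lambda>n. E (F n) f) \<longlonglongrightarrow> f" by simp
    obtain M where M: "M > 0" "\<And>f. norm (?R f) \<le> M * norm f" using resolvent_bound[OF z(1)] by blast
    have "bounded_linear (\<lambda>x. cinner (?R x) f)"
    proof (rule bounded_linear_intro)
      show "cinner (?R (x + y)) f = cinner (?R x) f + cinner (?R y) f" for x y
        by (simp add: clin_simps[OF resolvent_clin[OF z(1)]] cinner_simps)
      show "cinner (?R (r *\<^sub>R x)) f = r *\<^sub>R cinner (?R x) f" for r x
        using clin_simps(2)[OF resolvent_clin[OF z(1)], of "of_real r" x]
        by (simp add: scaleC_of_real cinner.scaleR_left)
      show "norm (cinner (?R x) f) \<le> norm x * (M * norm f)" for x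
        using order_trans[OF cinner_cmod_le mult_right_mono[OF M(2)[of x] norm_ge_zero[of f]]] by (simp add: mult_ac)
    qed
    from bounded_linear.tendsto[OF this Ef]
    have "(\<lambda>n. cinner (?R (E (F n) f)) f) \<longlonglongrightarrow> cinner (?R f) f" .
    moreover have "integral {v n..u n} (\<lambda>\<mu>. complex_of_real (k \<mu>) / (of_real \<mu> - z)) = cinner (?R (E (F n) f)) f" for n
      using integral_unique[OF hi[OF less_imp_le[OF uv(4)] sub]] by (simp add: F_def)
    ultimately show ?thesis by simp
  qed
  ultimately show "integral ?I (\<lambda>\<mu>. complex_of_real (k \<mu>) / (of_real \<mu> - z)) = cinner (?R f) f"
    by (rule LIMSEQ_unique)
qed

lemma polarization:
  assumes "clin T"
  shows "cinner (T x) y = (cinner (T (x + y)) (x + y) - cinner (T (x - y)) (x - y)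
      + \<i> * cinner (T (x + \<i> *\<^sub>C y)) (x + \<i> *\<^sub>C y) - \<i> * cinner (T (x - \<i> *\<^sub>C y)) (x - \<i> *\<^sub>C y)) / 4"
  by (simp add: clin_simps[OF assms] cinner_simps algebra_simps)

section \<open>The density of the coupling\<close>

text \<open>The domain of \<open>A1\<close> is the whole space, as a dense subspace is in finite dimensions.\<close>

locale resonance = spectral_operator dom0 A0 E
  for dom0 :: "'a::complex_hilbert_space set" and A0 :: "'a \<Rightarrow> 'a" and E :: "real set \<Rightarrow> 'a \<Rightarrow>\<^sub>L 'a" +
  fixes S :: "'b::complex_hilbert_space set" and A1 :: "'b \<Rightarrow> 'b" and B :: "'b \<Rightarrow>\<^sub>L 'a"
    and m1 m2 :: ereal and Dm :: "complex set" and K :: "complex \<Rightarrow> 'b \<Rightarrow>\<^sub>L 'b"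
  assumes onb: "onb S"
    and A1_clin: "clin A1" and A1_sym: "\<And>x y. cinner (A1 x) y = cinner x (A1 y)"
    and B: "complex_linear B"
    and ac: "ac_spectrum E"
    and m: "m1 < m2"
    and \<sigma>0: "spectrum dom0 A0 = closure (complex_of_real ` einterval m1 m2)"
    and Dm_open: "open Dm" and Dm_lower: "Dm \<subseteq> {z. Im z < 0}"
    and Dm_frontier: "complex_of_real ` einterval m1 m2 \<subseteq> frontier Dm"
    and K_deriv: "\<And>\<mu>. \<mu> \<in> einterval m1 m2 \<Longrightarrow>
      (K_op E B has_vector_derivative K (complex_of_real \<mu>)) (at \<mu>)"
    and K_linear_D: "\<And>z. z \<in> Dm \<union> cnj ` Dm \<Longrightarrow> complex_linear (K z)"
    and K_analytic: "vector_analytic_on K (Dm \<union> complex_of_real ` einterval m1 m2 \<union> cnj ` Dm)"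
    and K_sym: "\<And>z. z \<in> Dm \<union> cnj ` Dm \<Longrightarrow> adj (K z) = K (cnj z)"
    and K_ends: "\<And>p. ereal p \<in> {m1, m2} \<Longrightarrow>
      \<exists>C>0. \<exists>g. -1 < g \<and> g \<le> 0 \<and>
        (\<forall>\<^sub>F z in at (complex_of_real p) within (Dm \<union> cnj ` Dm).
          norm (K z) \<le> C * cmod (z - complex_of_real p) powr g)"
    and \<sigma>1: "spectrum UNIV A1 \<subseteq> complex_of_real ` einterval m1 m2"
begin

abbreviation I where "I \<equiv> einterval m1 m2"
abbreviation \<sigma> where "\<sigma> \<equiv> spectrum UNIV A1"

lemma K_op_form: "cinner (K_op E B \<mu> x) y = cinner (E {..<\<mu>} (B x)) (B y)"
proof -
  have "cinner (K_op E B \<mu> x) y = cnj (cinner y (adj B (E {..<\<mu>} (B x))))"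
    by (simp add: K_op_def cinner_commute[of _ y])
  also have "\<dots> = cnj (cinner (B y) (E {..<\<mu>} (B x)))" by (simp add: adj_cinner(1)[OF onb B])
  also have "\<dots> = cinner (E {..<\<mu>} (B x)) (B y)" by (rule cinner_commute[symmetric])
  finally show ?thesis .
qed

lemma K_real_form: "\<mu> \<in> I \<Longrightarrow> ((\<lambda>\<mu>. cinner (E {..<\<mu>} (B x)) (B y)) has_vector_derivative cinner (K (of_real \<mu>) x) y) (at \<mu>)"
proof -
  assume mu: "\<mu> \<in> I"
  have "bounded_linear (\<lambda>T :: 'b \<Rightarrow>\<^sub>L 'b. cinner (T x) y)"
    by (intro bounded_linear_compose[OF cinner.bounded_linear_left] blinfun.bounded_linear_left)
  from bounded_linear.has_vector_derivative[OF this K_deriv[OF mu]] show ?thesis by (simp add: K_op_form)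
qed

lemma K_real_linear: "\<mu> \<in> I \<Longrightarrow> complex_linear (K (of_real \<mu>))"
  unfolding complex_linear_def
proof (intro allI)
  fix c x assume mu: "\<mu> \<in> I"
  show "K (of_real \<mu>) (c *\<^sub>C x) = c *\<^sub>C K (of_real \<mu>) x"
  proof (rule cinner_eq_imp_eq)
    fix y
    have "((\<lambda>\<mu>. c * cinner (E {..<\<mu>} (B x)) (B y)) has_vector_derivative c * cinner (K (of_real \<mu>) x) y) (at \<mu>)"
      by (rule bounded_linear.has_vector_derivative[OF bounded_linear_mult_right K_real_form[OF mu]])
    moreover have "cinner (E {..<\<mu>} (B (c *\<^sub>C x))) (B y) = c * cinner (E {..<\<mu>} (B x)) (B y)" for \<mu>
      by (simp add: clin_simps[OF complex_linear_clin[OF B]] clin_simps[OF E_clin] cinner_simps)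
    ultimately have "((\<lambda>\<mu>. cinner (E {..<\<mu>} (B (c *\<^sub>C x))) (B y)) has_vector_derivative c * cinner (K (of_real \<mu>) x) y) (at \<mu>)"
      by simp
    from vector_derivative_unique_at[OF K_real_form[OF mu, of "c *\<^sub>C x" y] this]
    show "cinner (K (of_real \<mu>) (c *\<^sub>C x)) y = cinner (c *\<^sub>C K (of_real \<mu>) x) y" by (simp add: cinner_simps)
  qed
qed

text \<open>The density of the scalar spectral measure of \<open>B x\<close>.\<close>

definition k :: "'b \<Rightarrow> real \<Rightarrow> real" where "k x \<mu> = Re (cinner (K (of_real \<mu>) x) x)"

lemma k_props:
  assumes mu: "\<mu> \<in> I"
  shows k_deriv: "((\<lambda>\<mu>. (norm (E {..<\<mu>} (B x)))\<^sup>2) has_real_derivative k x \<mu>) (at \<mu>)"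
    and k_nonneg: "0 \<le> k x \<mu>" and k_eq: "cinner (K (of_real \<mu>) x) x = of_real (k x \<mu>)"
proof -
  have form: "cinner (E {..<\<mu>} (B x)) (B x) = of_real ((norm (E {..<\<mu>} (B x)))\<^sup>2)" for \<mu> by (rule E_norm) simp
  have d: "((\<lambda>\<mu>. complex_of_real ((norm (E {..<\<mu>} (B x)))\<^sup>2)) has_vector_derivative cinner (K (of_real \<mu>) x) x) (at \<mu>)"
    using K_real_form[OF mu, of x x] by (simp only: form)
  show kd: "((\<lambda>\<mu>. (norm (E {..<\<mu>} (B x)))\<^sup>2) has_real_derivative k x \<mu>) (at \<mu>)"
    using bounded_linear.has_vector_derivative[OF bounded_linear_Re d]
    by (simp add: has_real_derivative_iff_has_vector_derivative k_def del: of_real_power)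
  have "((\<lambda>\<mu>. Im (complex_of_real ((norm (E {..<\<mu>} (B x)))\<^sup>2))) has_vector_derivative Im (cinner (K (of_real \<mu>) x) x)) (at \<mu>)"
    by (rule bounded_linear.has_vector_derivative[OF bounded_linear_Im d])
  then have "((\<lambda>\<mu>. 0) has_vector_derivative Im (cinner (K (of_real \<mu>) x) x)) (at \<mu>)" by (simp del: of_real_power)
  then have "Im (cinner (K (of_real \<mu>) x) x) = 0"
    using vector_derivative_unique_at[OF has_vector_derivative_const[of "0::real" "at \<mu>"]] by fastforce
  then show "cinner (K (of_real \<mu>) x) x = of_real (k x \<mu>)" by (simp add: k_def complex_eq_iff)
  show "0 \<le> k x \<mu>"
  proof (rule ccontr)
    assume "\<not> 0 \<le> k x \<mu>"
    then obtain e where e: "e > 0" "\<forall>h>0. h < e \<longrightarrow> (norm (E {..<\<mu> + h} (B x)))\<^sup>2 < (norm (E {..<\<mu>} (B x)))\<^sup>2"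
      using DERIV_neg_dec_right[OF kd] by auto
    then have "(norm (E {..<\<mu> + e/2} (B x)))\<^sup>2 < (norm (E {..<\<mu>} (B x)))\<^sup>2" by simp
    then show False using E_interval(2)[of \<mu> "\<mu> + e/2" "B x"] e(1) zero_le_power2[of "norm (E {\<mu>..<\<mu> + e/2} (B x))"] by simp
  qed
qed

lemma \<sigma>0_real: "z \<in> spectrum dom0 A0 \<Longrightarrow> Im z = 0"
proof -
  assume "z \<in> spectrum dom0 A0"
  moreover have "closure (complex_of_real ` I) \<subseteq> {z. Im z = 0}"
    by (intro closure_minimal closed_Collect_eq continuous_on_Im continuous_intros) auto
  ultimately show ?thesis using \<sigma>0 by auto
qed

lemma K_form_integrable: "(\<lambda>\<mu>. cinner (K (of_real \<mu>) x) y) absolutely_integrable_on I"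
  and K_form_resolvent: "Im z \<noteq> 0 \<Longrightarrow>
    (\<lambda>\<mu>. cinner (K (of_real \<mu>) x) y / (of_real \<mu> - z)) absolutely_integrable_on I \<and>
    integral I (\<lambda>\<mu>. cinner (K (of_real \<mu>) x) y / (of_real \<mu> - z)) = cinner (adj B (resolvent dom0 A0 z (B x))) y"
proof -
  note full = E_einterval_full[OF \<sigma>0 ac]
  have zs: "z \<notin> spectrum dom0 A0" if "Im z \<noteq> 0" for z using \<sigma>0_real that by auto
  have dens: "(\<lambda>\<mu>. complex_of_real (k x \<mu>)) absolutely_integrable_on I" for x
    using absolutely_integrable_linear[OF density_integrable[OF zs[of \<i>] _ m full k_deriv k_nonneg] bounded_linear_of_real]
    by (simp add: o_def)
  have q: "(\<lambda>\<mu>. complex_of_real (k x \<mu>) / (of_real \<mu> - z)) absolutely_integrable_on I"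
     "integral I (\<lambda>\<mu>. complex_of_real (k x \<mu>) / (of_real \<mu> - z)) = cinner (resolvent dom0 A0 z (B x)) (B x)"
    if "Im z \<noteq> 0" for z x
    using resolvent_form_einterval(2,3)[OF zs[OF that] that m full k_deriv k_nonneg] by auto
  have pol: "cinner (K (of_real \<mu>) x) y = (of_real (k (x + y) \<mu>) - of_real (k (x - y) \<mu>)
      + \<i> * of_real (k (x + \<i> *\<^sub>C y) \<mu>) - \<i> * of_real (k (x - \<i> *\<^sub>C y) \<mu>)) / 4" if "\<mu> \<in> I" for \<mu>
    using polarization[OF complex_linear_clin[OF K_real_linear[OF that]], of x y] k_eq[OF that] by simp
  have "(\<lambda>\<mu>. (of_real (k (x + y) \<mu>) - of_real (k (x - y) \<mu>)
      + \<i> * of_real (k (x + \<i> *\<^sub>C y) \<mu>) - \<i> * of_real (k (x - \<i> *\<^sub>C y) \<mu>)) / 4 :: complex) absolutely_integrable_on I"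
    by (intro dens set_integral_diff set_integral_add set_integrable_mult_right set_integrable_divide)
  then show "(\<lambda>\<mu>. cinner (K (of_real \<mu>) x) y) absolutely_integrable_on I"
    by (rule absolutely_integrable_spike[OF _ negligible_empty]) (use pol in auto)
  show "(\<lambda>\<mu>. cinner (K (of_real \<mu>) x) y / (of_real \<mu> - z)) absolutely_integrable_on I \<and>
    integral I (\<lambda>\<mu>. cinner (K (of_real \<mu>) x) y / (of_real \<mu> - z)) = cinner (adj B (resolvent dom0 A0 z (B x))) y"
    if z: "Im z \<noteq> 0"
  proof -
    let ?q = "\<lambda>x \<mu>. complex_of_real (k x \<mu>) / (of_real \<mu> - z)"
    let ?Q = "\<lambda>x. cinner (resolvent dom0 A0 z (B x)) (B x)"
    let ?P = "\<lambda>\<mu>. (?q (x + y) \<mu> - ?q (x - y) \<mu> + \<i> * ?q (x + \<i> *\<^sub>C y) \<mu> - \<i> * ?q (x - \<i> *\<^sub>C y) \<mu>) / 4"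
    have hq: "(?q x has_integral ?Q x) I" for x
      using q[OF z, of x] by (metis absolutely_integrable_on_def integrable_integral)
    have polz: "cinner (K (of_real \<mu>) x) y / (of_real \<mu> - z) = ?P \<mu>" if "\<mu> \<in> I" for \<mu>
      unfolding pol[OF that] by (simp add: add_divide_distrib diff_divide_distrib mult.commute)
    have "?P absolutely_integrable_on I"
      by (intro q(1)[OF z] set_integral_diff set_integral_add set_integrable_mult_right set_integrable_divide)
    then have 1: "(\<lambda>\<mu>. cinner (K (of_real \<mu>) x) y / (of_real \<mu> - z)) absolutely_integrable_on I"
      by (rule absolutely_integrable_spike[OF _ negligible_empty]) (use polz in auto)
    have "(?P has_integral (?Q (x + y) - ?Q (x - y) + \<i> * ?Q (x + \<i> *\<^sub>C y) - \<i> * ?Q (x - \<i> *\<^sub>C y)) / 4) I"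
      by (intro has_integral_divide has_integral_diff has_integral_add has_integral_mult_right hq)
    then have "((\<lambda>\<mu>. cinner (K (of_real \<mu>) x) y / (of_real \<mu> - z)) has_integral
       (?Q (x + y) - ?Q (x - y) + \<i> * ?Q (x + \<i> *\<^sub>C y) - \<i> * ?Q (x - \<i> *\<^sub>C y)) / 4) I"
      by (rule has_integral_eq[rotated]) (use polz in auto)
    moreover have "(?Q (x + y) - ?Q (x - y) + \<i> * ?Q (x + \<i> *\<^sub>C y) - \<i> * ?Q (x - \<i> *\<^sub>C y)) / 4 = cinner (resolvent dom0 A0 z (B x)) (B y)"
      using polarization[OF resolvent_clin[OF zs[OF z]], of "B x" "B y"]
      by (simp add: blinfun.add_right blinfun.diff_right clin_simps(2)[OF complex_linear_clin[OF B]])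
    moreover have "cinner (resolvent dom0 A0 z (B x)) (B y) = cinner (adj B (resolvent dom0 A0 z (B x))) y"
      using adj_cinner(1)[OF onb B, of y "resolvent dom0 A0 z (B x)"] by (metis cinner_commute)
    ultimately show ?thesis using 1 by (simp add: integral_unique)
  qed
qed

end

section \<open>Resolvents and integrals of operators in finite dimensions\<close>

lemma finite_dim_resolvent:
  fixes S :: "'b::complex_hilbert_space set" and T :: "'b \<Rightarrow> 'b"
  assumes S: "onb S" and T: "clin T" and \<delta>: "\<delta> > 0" and low: "\<And>x. \<delta> * norm x \<le> norm (T x - z *\<^sub>C x)"
  shows "z \<notin> spectrum UNIV T" and "clin (resolvent UNIV T z)"
    and "T (resolvent UNIV T z x) - z *\<^sub>C resolvent UNIV T z x = x"
    and "resolvent UNIV T z (T x - z *\<^sub>C x) = x"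
    and "norm (resolvent UNIV T z x) \<le> norm x / \<delta>"
proof -
  let ?R = "resolvent UNIV T z"
  have "x = 0" if "T x - z *\<^sub>C x = 0" for x
    using low[of x] that \<delta> by (simp add: mult_le_0_iff)
  then have bij: "bij (\<lambda>x. T x - z *\<^sub>C x)" by (rule onb_inj_imp_surj[OF S clin_shift[OF T]])
  show 1: "T (?R x) - z *\<^sub>C ?R x = x" for x
    using f_inv_into_f[of x "\<lambda>x. T x - z *\<^sub>C x" UNIV] bij by (simp add: resolvent_def bij_def)
  show 2: "?R (T x - z *\<^sub>C x) = x" for x
    using inv_into_f_f[of "\<lambda>x. T x - z *\<^sub>C x" UNIV x] bij by (simp add: resolvent_def bij_def)
  show bd: "norm (?R x) \<le> norm x / \<delta>" for x
    using low[of "?R x"] \<delta> by (simp add: 1 field_simps)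
  have "norm x \<le> 1 / \<delta> * norm (T x - z *\<^sub>C x)" for x
    using low[of x] \<delta> by (simp add: field_simps)
  then show "z \<notin> spectrum UNIV T" using bij unfolding spectrum_def resolvent_set_def by blast
  note Ts = clin_simps[OF clin_shift[OF T, of z]]
  show "clin ?R"
    unfolding clin_def
  proof (intro conjI allI)
    fix x y c
    have "T (?R x + ?R y) - z *\<^sub>C (?R x + ?R y) = x + y" unfolding Ts(1) 1 ..
    then show "?R (x + y) = ?R x + ?R y" using 2[of "?R x + ?R y"] by simp
    have "T (c *\<^sub>C ?R x) - z *\<^sub>C (c *\<^sub>C ?R x) = c *\<^sub>C x" unfolding Ts(2) 1 ..
    then show "?R (c *\<^sub>C x) = c *\<^sub>C ?R x" using 2[of "c *\<^sub>C ?R x"] by simp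
  qed
qed

text \<open>Both resolvent identities, in the operator and in the spectral parameter.\<close>

lemma finite_dim_resolvent_diff:
  fixes S :: "'b::complex_hilbert_space set" and T T' :: "'b \<Rightarrow> 'b"
  assumes S: "onb S" and T: "clin T" "clin T'" and \<delta>: "\<delta> > 0"
    and low: "\<And>x. \<delta> * norm x \<le> norm (T x - z *\<^sub>C x)" "\<And>x. \<delta> * norm x \<le> norm (T' x - z' *\<^sub>C x)"
  shows "resolvent UNIV T z x - resolvent UNIV T' z' x =
    resolvent UNIV T z (T' (resolvent UNIV T' z' x) - T (resolvent UNIV T' z' x) + (z - z') *\<^sub>C resolvent UNIV T' z' x)"
proof -
  note R = finite_dim_resolvent[OF S T(1) \<delta> low(1)] and R' = finite_dim_resolvent[OF S T(2) \<delta> low(2)]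
  let ?w = "resolvent UNIV T' z' x"
  have eq: "T' ?w - T ?w + (z - z') *\<^sub>C ?w = x - (T ?w - z *\<^sub>C ?w)"
    using R'(3)[of x] by (simp add: scaleC.diff_left algebra_simps)
  show ?thesis
    unfolding eq using clin_simps(5)[OF R(2), of x "T ?w - z *\<^sub>C ?w"] R(4)[of ?w] by simp
qed

text \<open>The matrix units, if \<open>s\<close> and \<open>t\<close> run through an orthonormal basis.\<close>

definition rank_one :: "'b::complex_hilbert_space \<Rightarrow> 'b \<Rightarrow> 'b \<Rightarrow>\<^sub>L 'b"
  where "rank_one s t = Blinfun (\<lambda>x. cinner x s *\<^sub>C t)"

lemma rank_one_apply: "rank_one s t x = cinner x s *\<^sub>C t"
  unfolding rank_one_def
  by (subst bounded_linear_Blinfun_apply)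
     (auto intro!: bounded_linear_compose[OF scaleC.bounded_linear_left cinner.bounded_linear_left])

lemma onb_blinfun_expand:
  assumes S: "onb S" and T: "complex_linear T"
  shows "T = (\<Sum>s\<in>S. \<Sum>t\<in>S. cinner (T s) t *\<^sub>C rank_one s t)"
proof (rule blinfun_eqI)
  fix x
  have "T x = (\<Sum>s\<in>S. cinner x s *\<^sub>C T s)" by (rule onb_clin_eq[OF S complex_linear_clin[OF T]])
  also have "\<dots> = (\<Sum>s\<in>S. cinner x s *\<^sub>C (\<Sum>t\<in>S. cinner (T s) t *\<^sub>C t))"
    using onb_expand[OF S] by metis
  also have "\<dots> = (\<Sum>s\<in>S. \<Sum>t\<in>S. cinner (T s) t *\<^sub>C rank_one s t) x"
    by (simp add: blinfun.sum_left scaleC_blinfun.rep_eq rank_one_apply scaleC.sum_right scaleC_scaleC mult.commute)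
  finally show "T x = (\<Sum>s\<in>S. \<Sum>t\<in>S. cinner (T s) t *\<^sub>C rank_one s t) x" .
qed

text \<open>An operator is a finite combination of matrix units with its matrix coefficients, so integration of
  operators reduces to that of complex functions.\<close>

lemma weak_integrable_blinfun:
  fixes S :: "'b::complex_hilbert_space set" and f :: "real \<Rightarrow> 'b \<Rightarrow>\<^sub>L 'b"
  assumes S: "onb S" and lin: "\<And>s. s \<in> J \<Longrightarrow> complex_linear (f s)"
    and int: "\<And>x y. (\<lambda>s. cinner (f s x) y) integrable_on J"
  shows "f integrable_on J" and "cinner (integral J f x) y = integral J (\<lambda>s. cinner (f s x) y)"
    and "complex_linear (integral J f)"
proof -
  have "(\<lambda>\<tau>. \<Sum>s\<in>S. \<Sum>t\<in>S. cinner (f \<tau> s) t *\<^sub>C rank_one s t) integrable_on J"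
  proof (intro integrable_sum)
    show "finite S" "finite S" using S by (auto simp: onb_def)
    fix s t assume "s \<in> S" "t \<in> S"
    show "(\<lambda>\<tau>. cinner (f \<tau> s) t *\<^sub>C rank_one s t) integrable_on J"
      using integrable_linear[OF int[of s t] scaleC.bounded_linear_left[of "rank_one s t"]] by (simp add: o_def)
  qed
  then show f: "f integrable_on J"
    by (rule integrable_eq) (rule onb_blinfun_expand[OF S lin, symmetric])
  have bl: "bounded_linear (\<lambda>T :: 'b \<Rightarrow>\<^sub>L 'b. cinner (T x) y)" for x y
    by (intro bounded_linear_compose[OF cinner.bounded_linear_left] blinfun.bounded_linear_left)
  show form: "cinner (integral J f x) y = integral J (\<lambda>s. cinner (f s x) y)" for x y
    using integral_linear[OF f bl[of x y]] by (simp add: o_def)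
  show "complex_linear (integral J f)"
    unfolding complex_linear_def
  proof (intro allI)
    fix c x show "integral J f (c *\<^sub>C x) = c *\<^sub>C integral J f x"
    proof (rule cinner_eq_imp_eq)
      fix y
      have "integral J (\<lambda>s. cinner (f s (c *\<^sub>C x)) y) = integral J (\<lambda>s. c * cinner (f s x) y)"
        by (intro integral_cong) (simp add: clin_simps[OF complex_linear_clin[OF lin]] cinner_simps)
      then show "cinner (integral J f (c *\<^sub>C x)) y = cinner (c *\<^sub>C integral J f x) y"
        by (simp add: form cinner_simps)
    qed
  qed
qed

lemma contour_continuous:
  assumes "contour K m1 m2 D \<gamma>" shows "continuous_on (einterval m1 m2) \<gamma>"
proof -
  from assms have "\<exists>H. continuous_on ({0..1::real} \<times> einterval m1 m2) (\<lambda>(t, s). H t s) \<and>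
      (\<forall>s\<in>einterval m1 m2. H 1 s = \<gamma> s)"
    unfolding contour_def
  proof (elim conjE exE)
    fix H assume 1: "continuous_on ({0..1::real} \<times> einterval m1 m2) (\<lambda>(t, s). H t s)"
      and 2: "\<forall>s\<in>einterval m1 m2. H 0 s = complex_of_real s \<and> H 1 s = \<gamma> s"
    show "\<exists>H. continuous_on ({0..1::real} \<times> einterval m1 m2) (\<lambda>(t, s). H t s) \<and>
      (\<forall>s\<in>einterval m1 m2. H 1 s = \<gamma> s)"
      by (rule exI[of _ H]) (simp add: 1 2)
  qed
  then obtain H where H: "continuous_on ({0..1::real} \<times> einterval m1 m2) (\<lambda>(t, s). H t s)"
    "\<And>s. s \<in> einterval m1 m2 \<Longrightarrow> H 1 s = \<gamma> s" by blast
  have "continuous_on (einterval m1 m2) (\<lambda>s. (\<lambda>(t, s). H t s) (1, s))"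
    by (rule continuous_on_compose2[OF H(1)]) (auto intro!: continuous_intros)
  then show ?thesis by (rule continuous_on_eq) (simp add: H(2))
qed

lemma tangent_locally_integrable:
  assumes "rectifiable_on \<gamma> J" "{a..b} \<subseteq> J" shows "tangent \<gamma> J absolutely_integrable_on {a..b}"
proof -
  have "J \<inter> {a..b} = {a..b}" using assms(2) by auto
  then show ?thesis using assms(1) unfolding rectifiable_on_def by metis
qed

section \<open>Integrals of the continued density along contours\<close>

context resonance
begin

definition \<Omega> :: "complex set" where "\<Omega> = interior {w. \<exists>T. (K has_derivative (\<lambda>h. h *\<^sub>C T)) (at w)}"

lemma open_\<Omega>: "open \<Omega>" by (simp add: \<Omega>_def)

lemma \<Omega>_supset: "Dm \<union> complex_of_real ` I \<union> cnj ` Dm \<subseteq> \<Omega>"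
proof
  fix z assume "z \<in> Dm \<union> complex_of_real ` I \<union> cnj ` Dm"
  then obtain e where "e > 0" "\<forall>w\<in>ball z e. \<exists>T. (K has_derivative (\<lambda>h. h *\<^sub>C T)) (at w)"
    using K_analytic unfolding vector_analytic_on_def by blast
  then show "z \<in> \<Omega>" unfolding \<Omega>_def mem_interior by (intro exI[of _ e]) auto
qed

lemma K_isCont:
  assumes "z \<in> \<Omega>" shows "isCont K z"
proof -
  obtain T where "(K has_derivative (\<lambda>h. h *\<^sub>C T)) (at z)"
    using assms interior_subset unfolding \<Omega>_def by blast
  then show ?thesis by (rule has_derivative_continuous)
qed

lemma K_form_holomorphic: "(\<lambda>z. cinner (K z x) y) holomorphic_on \<Omega>"
proof (rule holomorphic_onI)
  fix z assume "z \<in> \<Omega>"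
  then obtain T where T: "(K has_derivative (\<lambda>h. h *\<^sub>C T)) (at z)"
    using interior_subset unfolding \<Omega>_def by blast
  have bl: "bounded_linear (\<lambda>T :: 'b \<Rightarrow>\<^sub>L 'b. cinner (T x) y)"
    by (intro bounded_linear_compose[OF cinner.bounded_linear_left] blinfun.bounded_linear_left)
  have "((\<lambda>z. cinner (K z x) y) has_derivative (\<lambda>h. cinner ((h *\<^sub>C T) x) y)) (at z)"
    by (rule bounded_linear.has_derivative[OF bl T])
  then have "((\<lambda>z. cinner (K z x) y) has_field_derivative cinner (T x) y) (at z)"
    unfolding has_field_derivative_def
    by (rule has_derivative_eq_rhs) (simp add: fun_eq_iff scaleC_blinfun.rep_eq cinner_simps mult.commute)
  then show "(\<lambda>z. cinner (K z x) y) field_differentiable at z within \<Omega>"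
    using field_differentiable_at_within field_differentiable_def by blast
qed

lemma K_form_le: "cmod (cinner (K z x) y) \<le> norm (K z) * (norm x * norm y)"
  using order_trans[OF cinner_cmod_le mult_right_mono[OF norm_blinfun[of "K z" x] norm_ge_zero[of y]]]
  by (simp add: mult.assoc)

abbreviation D where "D \<equiv> D_side Dm"

lemma D_facts:
  assumes l: "l \<in> {1, -1}"
  shows D_side_half: "D l \<subseteq> {z. real_of_int l * Im z > 0}" and D_side_subset: "D l \<subseteq> Dm \<union> cnj ` Dm"
proof -
  have lower: "Im z < 0" if "z \<in> Dm" for z using Dm_lower that by blast
  have "l = 1 \<or> l = -1" using l by simp
  then show "D l \<subseteq> {z. real_of_int l * Im z > 0}"
  proof
    assume "l = 1" then show ?thesis using lower by (auto simp: D_side_def)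
  next
    assume "l = -1" then show ?thesis using lower by (auto simp: D_side_def)
  qed
  show "D l \<subseteq> Dm \<union> cnj ` Dm" by (auto simp: D_side_def)
qed

text \<open>The points of the interval are limits of points of \<open>Dm\<close>, to which the growth bound extends by
  continuity of \<open>K\<close>.\<close>

lemma K_end_bound:
  assumes p: "ereal p \<in> {m1, m2}"
  shows "\<exists>C g \<delta>. C > 0 \<and> -1 < g \<and> \<delta> > 0 \<and>
    (\<forall>z\<in>Dm \<union> cnj ` Dm \<union> complex_of_real ` I. cmod (z - of_real p) < \<delta> \<longrightarrow> norm (K z) \<le> C * cmod (z - of_real p) powr g)"
proof -
  obtain C g where g: "C > 0" "-1 < g" "\<forall>\<^sub>F z in at (complex_of_real p) within (Dm \<union> cnj ` Dm).
          norm (K z) \<le> C * cmod (z - complex_of_real p) powr g" using K_ends[OF p] by blast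
  then obtain \<delta> where \<delta>: "\<delta> > 0" "\<And>z. z \<in> Dm \<union> cnj ` Dm \<Longrightarrow> z \<noteq> of_real p \<Longrightarrow> dist z (of_real p) < \<delta> \<Longrightarrow> norm (K z) \<le> C * cmod (z - complex_of_real p) powr g"
    unfolding eventually_at by blast
  have nonreal: "norm (K z) \<le> C * cmod (z - of_real p) powr g" if "z \<in> Dm \<union> cnj ` Dm" "cmod (z - of_real p) < \<delta>" for z
  proof -
    have "Im z \<noteq> 0" using that(1) subsetD[OF Dm_lower] by fastforce
    then have "z \<noteq> of_real p" by auto
    then show ?thesis using \<delta>(2)[OF that(1)] that(2) by (simp add: dist_norm)
  qed
  have "norm (K (of_real t)) \<le> C * cmod (of_real t - of_real p) powr g"
    if t: "t \<in> I" "cmod (complex_of_real t - of_real p) < \<delta>" for t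
  proof -
    have "complex_of_real t \<in> closure Dm" using Dm_frontier t(1) by (auto simp: frontier_def)
    then obtain z where z: "\<And>n. z n \<in> Dm" "z \<longlonglongrightarrow> complex_of_real t" unfolding closure_sequential by blast
    have ne: "complex_of_real t \<noteq> of_real p" using t(1) p by (auto simp: einterval_def)
    have lim1: "(\<lambda>n. norm (K (z n))) \<longlonglongrightarrow> norm (K (of_real t))"
      using K_isCont[of "of_real t"] \<Omega>_supset t(1) z(2) by (intro tendsto_norm isCont_tendsto_compose[of _ K]) auto
    have lim2: "(\<lambda>n. C * cmod (z n - of_real p) powr g) \<longlonglongrightarrow> C * cmod (of_real t - of_real p) powr g"
      using ne by (intro tendsto_intros z(2)) auto
    have "(\<lambda>n. cmod (z n - of_real p)) \<longlonglongrightarrow> cmod (of_real t - of_real p)" by (intro tendsto_intros z(2))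
    then have "\<forall>\<^sub>F n in sequentially. cmod (z n - of_real p) < \<delta>" using t(2) by (rule order_tendstoD)
    then have "\<forall>\<^sub>F n in sequentially. norm (K (z n)) \<le> C * cmod (z n - of_real p) powr g"
      by eventually_elim (use nonreal z(1) in auto)
    then show ?thesis by (rule tendsto_le[OF sequentially_bot lim2 lim1])
  qed
  then show ?thesis
    using g(1,2) \<delta>(1) nonreal by (intro exI[of _ C] exI[of _ g] exI[of _ \<delta>] conjI ballI impI) (auto simp del: of_real_diff)
qed

text \<open>A bounded factor \<open>g\<close> preserves both the growth bound at the finite end points and the domination by the
  norm of \<open>K\<close>, and being holomorphic on the closed half-plane it puts no singularity between the
  interval and the contour.\<close>

lemma K_contour:
  assumes l: "l \<in> {1, -1}" and \<gamma>: "admissible K m1 m2 (D l) \<gamma>"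
    and g: "open U" "{z. real_of_int l * Im z \<ge> 0} \<subseteq> U" "g holomorphic_on U"
      "\<And>z. real_of_int l * Im z \<ge> 0 \<Longrightarrow> cmod (g z) \<le> G"
  shows "integral I (\<lambda>s. g (\<gamma> s) * cinner (K (\<gamma> s) x) y * tangent \<gamma> I s) = integral I (\<lambda>\<mu>. g (of_real \<mu>) * cinner (K (of_real \<mu>) x) y)"
proof (rule contour_deformation_integral[where l = "real_of_int l" and D = "D l" and K = K and \<Omega> = "\<Omega> \<inter> U" and M = "G * (norm x * norm y)" and h = "\<lambda>z. g z * cinner (K z x) y"])
  have half: "real_of_int l * Im z \<ge> 0" if "z \<in> D l \<union> complex_of_real ` I" for z
    using that D_facts(1)[OF l] by (auto intro: less_imp_le)
  have sub: "D l \<union> complex_of_real ` I \<subseteq> Dm \<union> cnj ` Dm \<union> complex_of_real ` I" using D_facts(2)[OF l] by auto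
  show "m1 < m2" by (rule m)
  show "real_of_int l = 1 \<or> real_of_int l = -1" using l by auto
  show "D l \<subseteq> {z. 0 < real_of_int l * Im z}" by (rule D_facts(1)[OF l])
  show "contour K m1 m2 (D l) \<gamma>" "finite_variation K \<gamma> I" using \<gamma> by (auto simp: admissible_def)
  show "open (\<Omega> \<inter> U)" using open_\<Omega> g(1) by auto
  show "(\<lambda>z. g z * cinner (K z x) y) holomorphic_on \<Omega> \<inter> U"
    using K_form_holomorphic[of x y] g(3) by (intro holomorphic_on_mult) (auto intro: holomorphic_on_subset)
  show "D l \<union> complex_of_real ` I \<subseteq> \<Omega> \<inter> U" using sub \<Omega>_supset half g(2) by blast
  have gK: "cmod (g z * cinner (K z x) y) \<le> G * (norm x * norm y) * norm (K z)" if "z \<in> D l \<union> complex_of_real ` I" for z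
  proof -
    have "cmod (g z) * cmod (cinner (K z x) y) \<le> G * (norm (K z) * (norm x * norm y))"
      using g(4)[OF half[OF that]] K_form_le[of z x y] order_trans[OF norm_ge_zero g(4)[OF half[OF that]]] by (intro mult_mono) auto
    then show ?thesis by (simp add: norm_mult mult_ac)
  qed
  then show "cmod (g z * cinner (K z x) y) \<le> G * (norm x * norm y) * norm (K z)" if "z \<in> D l \<union> complex_of_real ` I" for z
    using that by blast
  have G0: "0 \<le> G" using order_trans[OF norm_ge_zero g(4)[of 0]] by simp
  show "\<exists>C e \<delta>. - 1 < e \<and> 0 < \<delta> \<and> (\<forall>z\<in>D l \<union> complex_of_real ` I. cmod (z - complex_of_real p) < \<delta> \<longrightarrow>
       cmod (g z * cinner (K z x) y) \<le> C * cmod (z - complex_of_real p) powr e)" if p: "ereal p \<in> {m1, m2}" for p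
  proof -
    obtain C e \<delta> where e: "C > 0" "-1 < e" "\<delta> > 0"
      "\<And>z. z \<in> Dm \<union> cnj ` Dm \<union> complex_of_real ` I \<Longrightarrow> cmod (z - of_real p) < \<delta> \<Longrightarrow> norm (K z) \<le> C * cmod (z - of_real p) powr e"
      using K_end_bound[OF p] by blast
    have "cmod (g z * cinner (K z x) y) \<le> (G * (norm x * norm y) * C) * cmod (z - complex_of_real p) powr e"
      if z: "z \<in> D l \<union> complex_of_real ` I" "cmod (z - complex_of_real p) < \<delta>" for z
    proof -
      have "G * (norm x * norm y) * norm (K z) \<le> G * (norm x * norm y) * (C * cmod (z - of_real p) powr e)"
        using e(4)[OF subsetD[OF sub z(1)] z(2)] G0 by (intro mult_left_mono) auto
      then show ?thesis using gK[OF z(1)] by (simp add: mult.assoc)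
    qed
    then show ?thesis using e by blast
  qed
  show "(\<lambda>s. g (complex_of_real s) * cinner (K (complex_of_real s) x) y) absolutely_integrable_on I"
  proof (rule absolutely_integrable_bounded_measurable_product[OF bilinear_times _ _ _ K_form_integrable])
    have "continuous_on I (\<lambda>s. g (complex_of_real s))"
      by (rule continuous_on_compose2[OF holomorphic_on_imp_continuous_on[OF g(3)]]) (use g(2) in \<open>auto intro!: continuous_intros\<close>)
    then show "(\<lambda>s. g (complex_of_real s)) \<in> borel_measurable (lebesgue_on I)"
      by (intro continuous_imp_measurable_on_sets_lebesgue) auto
    show "bounded ((\<lambda>s. g (complex_of_real s)) ` I)" unfolding bounded_iff using g(4) by (intro exI[of _ G]) auto
  qed auto
qed

abbreviation dst where "dst \<gamma> \<equiv> contour_dist \<sigma> m1 m2 \<gamma>"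
abbreviation var where "var \<gamma> \<equiv> variation K \<gamma> I"
abbreviation rmin where "rmin \<gamma> \<equiv> r_min K m1 m2 \<sigma> \<gamma>"
abbreviation small where "small l \<gamma> \<equiv> small_contour K m1 m2 \<sigma> (D l) \<gamma>"
abbreviation R where "R X z \<equiv> resolvent UNIV (\<lambda>u. A1 u + blinfun_apply X u) z"

lemma \<sigma>_iff: "z \<in> \<sigma> \<longleftrightarrow> eigenval A1 z"
  by (rule spectrum_iff_eigenval[OF onb A1_clin])

text \<open>The number \<open>rmin \<gamma>\<close> is the smaller root \<open>r\<close> of \<open>r (dst \<gamma> - r) = var \<gamma>\<close>; this identity makes the
  estimates below close up.\<close>

lemma small_contour_facts:
  assumes sm: "small l \<gamma>"
  shows "admissible K m1 m2 (D l) \<gamma>" and "0 \<le> var \<gamma>" and "0 < dst \<gamma>" and "0 \<le> rmin \<gamma>" and "rmin \<gamma> < dst \<gamma> / 2"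
    and "rmin \<gamma> * (dst \<gamma> - rmin \<gamma>) = var \<gamma>" and "\<sigma> \<noteq> {}"
    and "\<And>\<nu> s. \<nu> \<in> \<sigma> \<Longrightarrow> s \<in> I \<Longrightarrow> dst \<gamma> \<le> cmod (\<gamma> s - \<nu>)" and "\<And>s. s \<in> I \<Longrightarrow> \<gamma> s \<in> D l"
proof -
  show adm: "admissible K m1 m2 (D l) \<gamma>" using sm by (simp add: small_contour_def)
  have lt: "var \<gamma> < (dst \<gamma>)\<^sup>2 / 4" using sm by (simp add: small_contour_def)
  show v: "0 \<le> var \<gamma>"
    using adm unfolding variation_def admissible_def finite_variation_def by (intro integral_nonneg) auto
  have "dst \<gamma> \<noteq> 0" using lt v by auto
  then show d: "0 < dst \<gamma>" using setdist_pos_le[of \<sigma> "\<gamma> ` I"] unfolding contour_dist_def by linarith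
  show "\<sigma> \<noteq> {}" using d by (auto simp: contour_dist_def)
  define q where "q = sqrt ((dst \<gamma>)\<^sup>2 / 4 - var \<gamma>)"
  have q: "q > 0" "q\<^sup>2 = (dst \<gamma>)\<^sup>2 / 4 - var \<gamma>" using lt by (simp_all add: q_def)
  have r: "rmin \<gamma> = dst \<gamma> / 2 - q" by (simp add: r_min_def q_def)
  have "q\<^sup>2 \<le> (dst \<gamma> / 2)\<^sup>2" using q(2) v by (simp add: power_divide)
  then have "q \<le> dst \<gamma> / 2" by (rule power2_le_imp_le) (use d in simp)
  then show "0 \<le> rmin \<gamma>" by (simp add: r)
  show "rmin \<gamma> < dst \<gamma> / 2" using q(1) by (simp add: r)
  show "rmin \<gamma> * (dst \<gamma> - rmin \<gamma>) = var \<gamma>"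
    using q(2) by (simp add: r power2_eq_square algebra_simps)
  show "dst \<gamma> \<le> cmod (\<gamma> s - \<nu>)" if "\<nu> \<in> \<sigma>" "s \<in> I" for \<nu> s
    using setdist_le_dist[of \<nu> \<sigma> "\<gamma> s" "\<gamma> ` I"] that by (simp add: contour_dist_def dist_norm norm_minus_commute)
  show "\<gamma> s \<in> D l" if "s \<in> I" for s
    using adm that unfolding admissible_def contour_def by blast
qed

lemma nearest_\<sigma>:
  assumes "\<sigma> \<noteq> {}"
  obtains \<nu> :: real where "of_real \<nu> \<in> \<sigma>" "\<And>x. cmod (z - of_real \<nu>) * norm x \<le> norm (A1 x - z *\<^sub>C x)"
proof -
  obtain u where "(u::'b) \<noteq> 0" using assms \<sigma>_iff by (auto simp: eigenval_def)
  from symmetric_nearest_eigenvalue[OF onb A1_clin A1_sym this, of z] that \<sigma>_iff show ?thesis by metis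
qed

lemma Z_clin: "complex_linear X \<Longrightarrow> clin (\<lambda>u. A1 u + X u)"
  using complex_linear_clin[of X] A1_clin by (auto simp: clin_def scaleC.add_right algebra_simps)

lemma Z_lower:
  assumes ne: "\<sigma> \<noteq> {}" and e: "\<And>\<nu>. \<nu> \<in> \<sigma> \<Longrightarrow> e \<le> cmod (z - \<nu>)" and X: "norm X \<le> \<rho>"
  shows "(e - \<rho>) * norm x \<le> norm (A1 x + blinfun_apply X x - z *\<^sub>C x)"
proof -
  obtain \<nu> where \<nu>: "of_real \<nu> \<in> \<sigma>" "cmod (z - of_real \<nu>) * norm x \<le> norm (A1 x - z *\<^sub>C x)"
    using nearest_\<sigma>[OF ne, of z] by metis
  have "e * norm x \<le> cmod (z - of_real \<nu>) * norm x" using e[OF \<nu>(1)] by (intro mult_right_mono) auto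
  then have 1: "e * norm x \<le> norm (A1 x - z *\<^sub>C x)" using \<nu>(2) by simp
  have 2: "norm (X x) \<le> \<rho> * norm x"
    using order_trans[OF norm_blinfun mult_right_mono[OF X norm_ge_zero]] .
  have "A1 x + X x - z *\<^sub>C x = (A1 x - z *\<^sub>C x) - (- X x)" by simp
  then have "norm (A1 x - z *\<^sub>C x) - norm (X x) \<le> norm (A1 x + X x - z *\<^sub>C x)"
    by (metis norm_minus_cancel norm_triangle_ineq2)
  then show ?thesis using 1 2 by (simp add: left_diff_distrib)
qed

lemma eigenvalue_near_\<sigma>:
  assumes ne: "\<sigma> \<noteq> {}" and u: "u \<noteq> 0" "A1 u + blinfun_apply X u = z *\<^sub>C u"
  obtains \<nu> :: real where "of_real \<nu> \<in> \<sigma>" "cmod (z - of_real \<nu>) \<le> norm X"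
proof -
  obtain \<nu> where \<nu>: "of_real \<nu> \<in> \<sigma>" "cmod (z - of_real \<nu>) * norm u \<le> norm (A1 u - z *\<^sub>C u)"
    using nearest_\<sigma>[OF ne, of z] by metis
  have "A1 u - z *\<^sub>C u = - X u" using u(2) by (simp add: algebra_simps eq_neg_iff_add_eq_0)
  then have "cmod (z - of_real \<nu>) * norm u \<le> norm X * norm u" using \<nu>(2) norm_blinfun[of X u] by simp
  then show ?thesis using that \<nu>(1) u(1) by simp
qed

text \<open>The operator \<open>Q s\<close> will be a resolvent of \<open>A1 + X\<close> at or near \<open>\<gamma> s\<close>, a scalar Cauchy kernel, or a
  difference of two of these.\<close>

lemma contour_op_integral:
  fixes Q :: "real \<Rightarrow> 'b \<Rightarrow> 'b"
  assumes adm: "admissible K m1 m2 (D l) \<gamma>" and l: "l \<in> {1, -1}"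
    and Q: "\<And>s. s \<in> I \<Longrightarrow> clin (Q s)" "\<And>s x. s \<in> I \<Longrightarrow> norm (Q s x) \<le> q * norm x" "\<And>x. continuous_on I (\<lambda>s. Q s x)"
    and q: "0 \<le> q"
  defines "f \<equiv> \<lambda>s. tangent \<gamma> I s *\<^sub>C (K (\<gamma> s) o\<^sub>L Blinfun (Q s))"
  shows "f integrable_on I" and "complex_linear (integral I f)"
    and "cinner (integral I f x) y = integral I (\<lambda>s. tangent \<gamma> I s * cinner (K (\<gamma> s) (Q s x)) y)"
    and "(\<lambda>s. tangent \<gamma> I s * cinner (K (\<gamma> s) (Q s x)) y) integrable_on I"
    and "norm (integral I f) \<le> q * var \<gamma>"
proof -
  have con: "contour K m1 m2 (D l) \<gamma>" and fv: "finite_variation K \<gamma> I" using adm by (auto simp: admissible_def)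
  have rect: "rectifiable_on \<gamma> I" and \<gamma>D: "\<And>s. s \<in> I \<Longrightarrow> \<gamma> s \<in> D l" using con by (auto simp: contour_def)
  have \<gamma>\<Omega>: "\<gamma> s \<in> \<Omega>" if "s \<in> I" for s using \<gamma>D[OF that] D_facts(2)[OF l] \<Omega>_supset by blast
  have Qb: "blinfun_apply (Blinfun (Q s)) = Q s" if "s \<in> I" for s
    by (rule bounded_linear_Blinfun_apply[OF onb_clin_bounded_linear[OF onb Q(1)[OF that]]])
  have KQ: "cinner (f s x) y = tangent \<gamma> I s * cinner (K (\<gamma> s) (Q s x)) y" if "s \<in> I" for s x y
    by (simp add: f_def scaleC_blinfun.rep_eq cinner_simps Qb[OF that])
  have Klin: "complex_linear (K (\<gamma> s))" if "s \<in> I" for s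
    using K_linear_D \<gamma>D[OF that] D_facts(2)[OF l] by blast
  have flin: "complex_linear (f s)" if "s \<in> I" for s
    unfolding complex_linear_def
    by (simp add: f_def scaleC_blinfun.rep_eq Qb[OF that] clin_simps(2)[OF Q(1)[OF that]]
        clin_simps(2)[OF complex_linear_clin[OF Klin[OF that]]] scaleC_scaleC mult.commute)
  have contK: "continuous_on I (\<lambda>s. K (\<gamma> s))"
  proof (rule continuous_on_compose2[OF _ contour_continuous[OF con]])
    show "continuous_on \<Omega> K" using K_isCont continuous_at_imp_continuous_on by blast
  qed (use \<gamma>\<Omega> in auto)
  have cont: "continuous_on I (\<lambda>s. cinner (K (\<gamma> s) (Q s x)) y)" for x y
    by (intro cinner.continuous_on blinfun.continuous_on contK Q(3) continuous_on_const)
  define w where "w = (\<lambda>s. norm (K (\<gamma> s)) * cmod (tangent \<gamma> I s))"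
  have wint: "w integrable_on I" using fv by (simp add: w_def finite_variation_def)
  have fle: "norm (f s) \<le> q * w s" if "s \<in> I" for s
  proof -
    have "norm (Blinfun (Q s)) \<le> q" using Q(2)[OF that] q by (intro norm_blinfun_bound) (auto simp: Qb[OF that])
    then have "norm (K (\<gamma> s) o\<^sub>L Blinfun (Q s)) \<le> norm (K (\<gamma> s)) * q"
      using order_trans[OF norm_blinfun_compose mult_left_mono] norm_ge_zero by blast
    then show ?thesis
      using mult_left_mono[of "norm (K (\<gamma> s) o\<^sub>L Blinfun (Q s))" "norm (K (\<gamma> s)) * q" "cmod (tangent \<gamma> I s)"]
      by (simp add: f_def norm_scaleC w_def mult_ac)
  qed
  have coeff: "(\<lambda>s. tangent \<gamma> I s * cinner (K (\<gamma> s) (Q s x)) y) absolutely_integrable_on I" for x y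
  proof (rule einterval_dominated_integrable[OF m])
    show "(\<lambda>s. tangent \<gamma> I s * cinner (K (\<gamma> s) (Q s x)) y) integrable_on {a..b}" if "{a..b} \<subseteq> I" for a b
      using continuous_mult_absolutely_integrable[OF tangent_locally_integrable[OF rect that] continuous_on_subset[OF cont that]]
      by (simp add: absolutely_integrable_on_def mult.commute)
    show "(\<lambda>s. (q * w s) * (norm x * norm y)) integrable_on I"
      using integrable_on_mult_left[OF integrable_on_mult_right[OF wint, of q], of "norm x * norm y"] by simp
    show "norm (tangent \<gamma> I s * cinner (K (\<gamma> s) (Q s x)) y) \<le> (q * w s) * (norm x * norm y)" if "s \<in> I" for s
    proof -
      have "norm (cinner (f s x) y) \<le> norm (f s) * norm x * norm y"
        using order_trans[OF cinner_cmod_le mult_right_mono[OF norm_blinfun norm_ge_zero]] .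
      also have "\<dots> \<le> (q * w s) * norm x * norm y" using fle[OF that] by (intro mult_right_mono) auto
      finally show ?thesis by (simp add: KQ[OF that] mult.assoc)
    qed
  qed
  show ci: "(\<lambda>s. tangent \<gamma> I s * cinner (K (\<gamma> s) (Q s x)) y) integrable_on I" for x y
    using coeff by (simp add: absolutely_integrable_on_def)
  have int: "(\<lambda>s. cinner (f s x) y) integrable_on I" for x y
    by (rule integrable_eq[OF ci[of x y]]) (simp add: KQ)
  show f: "f integrable_on I" by (rule weak_integrable_blinfun(1)[OF onb flin int])
  show "complex_linear (integral I f)" by (rule weak_integrable_blinfun(3)[OF onb flin int])
  show "cinner (integral I f x) y = integral I (\<lambda>s. tangent \<gamma> I s * cinner (K (\<gamma> s) (Q s x)) y)"
    by (rule trans[OF weak_integrable_blinfun(2)[OF onb flin int] integral_cong]) (auto simp: KQ)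
  have "norm (integral I f) \<le> integral I (\<lambda>s. q * w s)"
    by (rule integral_norm_bound_integral[OF f integrable_on_mult_right[OF wint] fle])
  then show "norm (integral I f) \<le> q * var \<gamma>" by (simp add: variation_def w_def)
qed

lemma resolvent_continuous_along:
  fixes T :: "'b \<Rightarrow> 'b"
  assumes adm: "admissible K m1 m2 (D l) \<gamma>" and T: "clin T" and e: "e > 0"
    and low: "\<And>s x. s \<in> I \<Longrightarrow> e * norm x \<le> norm (T x - (\<gamma> s + c) *\<^sub>C x)"
  shows "continuous_on I (\<lambda>s. resolvent UNIV T (\<gamma> s + c) x)"
  unfolding continuous_on_def
proof
  fix s assume s: "s \<in> I"
  have con: "continuous_on I \<gamma>" using adm contour_continuous by (auto simp: admissible_def)
  have "((\<lambda>t. resolvent UNIV T (\<gamma> t + c) x - resolvent UNIV T (\<gamma> s + c) x) \<longlongrightarrow> 0) (at s within I)"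
  proof (rule Lim_null_comparison)
    show "\<forall>\<^sub>F t in at s within I. norm (resolvent UNIV T (\<gamma> t + c) x - resolvent UNIV T (\<gamma> s + c) x) \<le> norm x / e / e * norm (\<gamma> t - \<gamma> s)"
      unfolding eventually_at_filter
    proof (rule always_eventually, intro allI impI)
      fix t assume t: "t \<in> I"
      note Rt = finite_dim_resolvent[OF onb T e low[OF t]] and Rs = finite_dim_resolvent[OF onb T e low[OF s]]
      have "resolvent UNIV T (\<gamma> t + c) x - resolvent UNIV T (\<gamma> s + c) x = resolvent UNIV T (\<gamma> t + c) ((\<gamma> t - \<gamma> s) *\<^sub>C resolvent UNIV T (\<gamma> s + c) x)"
        using finite_dim_resolvent_diff[OF onb T T e low[OF t] low[OF s], of x] by simp
      then have "norm (resolvent UNIV T (\<gamma> t + c) x - resolvent UNIV T (\<gamma> s + c) x) \<le> (norm (\<gamma> t - \<gamma> s) * norm (resolvent UNIV T (\<gamma> s + c) x)) / e"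
        using Rt(5) by (metis norm_scaleC)
      also have "\<dots> \<le> (norm (\<gamma> t - \<gamma> s) * (norm x / e)) / e"
        using Rs(5)[of x] e by (intro divide_right_mono mult_left_mono) auto
      finally show "norm (resolvent UNIV T (\<gamma> t + c) x - resolvent UNIV T (\<gamma> s + c) x) \<le> norm x / e / e * norm (\<gamma> t - \<gamma> s)"
        by (simp add: mult.commute)
    qed
    have "((\<lambda>t. norm x / e / e * norm (\<gamma> t - \<gamma> s)) \<longlongrightarrow> norm x / e / e * norm (\<gamma> s - \<gamma> s)) (at s within I)"
      using con s unfolding continuous_on_def by (intro tendsto_intros) auto
    then show "((\<lambda>t. norm x / e / e * norm (\<gamma> t - \<gamma> s)) \<longlongrightarrow> 0) (at s within I)" by simp
  qed
  then show "((\<lambda>s. resolvent UNIV T (\<gamma> s + c) x) \<longlongrightarrow> resolvent UNIV T (\<gamma> s + c) x) (at s within I)"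
    by (rule LIM_zero_cancel)
qed

end

section \<open>The fixed-point equation\<close>

lemma clin_scaleC: "clin (\<lambda>x. c *\<^sub>C x)"
  by (auto simp: clin_def scaleC.add_right scaleC_scaleC mult.commute)

context resonance
begin

abbreviation W where "W \<gamma> X \<equiv> W1 K m1 m2 UNIV (\<lambda>u. A1 u + blinfun_apply X u) \<gamma>"

lemma small_lower:
  assumes sm: "small l \<gamma>" and s: "s \<in> I" and X: "norm X \<le> \<rho>"
  shows "(dst \<gamma> - \<rho>) * norm x \<le> norm (A1 x + blinfun_apply X x - \<gamma> s *\<^sub>C x)"
  by (rule Z_lower[OF small_contour_facts(7)[OF sm] small_contour_facts(8)[OF sm _ s] X])

lemma W_integral:
  assumes sm: "small l \<gamma>" and l: "l \<in> {1, -1}" and X: "complex_linear X" "norm X \<le> \<rho>" and \<rho>: "\<rho> < dst \<gamma>"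
  shows "(\<lambda>s. tangent \<gamma> I s *\<^sub>C (K (\<gamma> s) o\<^sub>L Blinfun (R X (\<gamma> s)))) integrable_on I"
    and "complex_linear (W \<gamma> X)" and "norm (W \<gamma> X) \<le> var \<gamma> / (dst \<gamma> - \<rho>)"
    and "cinner (W \<gamma> X x) y = - integral I (\<lambda>s. tangent \<gamma> I s * cinner (K (\<gamma> s) (R X (\<gamma> s) x)) y)"
    and "(\<lambda>s. tangent \<gamma> I s * cinner (K (\<gamma> s) (R X (\<gamma> s) x)) y) integrable_on I"
proof -
  note adm = small_contour_facts(1)[OF sm]
  have e: "dst \<gamma> - \<rho> > 0" using \<rho> by simp
  have low: "(dst \<gamma> - \<rho>) * norm x \<le> norm (A1 x + X x - (\<gamma> s + 0) *\<^sub>C x)" if "s \<in> I" for s x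
    using small_lower[OF sm that X(2)] by simp
  have low': "(dst \<gamma> - \<rho>) * norm x \<le> norm (A1 x + X x - \<gamma> s *\<^sub>C x)" if "s \<in> I" for s x
    using low[OF that] by simp
  note Rp = finite_dim_resolvent[OF onb Z_clin[OF X(1)] e low']
  have Q: "norm (R X (\<gamma> s) x) \<le> 1 / (dst \<gamma> - \<rho>) * norm x" if "s \<in> I" for s x
    using Rp(5)[OF that] by simp
  have cont: "continuous_on I (\<lambda>s. R X (\<gamma> s) x)" for x
    using resolvent_continuous_along[OF adm Z_clin[OF X(1)] e low] by simp
  have e': "0 \<le> 1 / (dst \<gamma> - \<rho>)" using e by simp
  note oi = contour_op_integral[OF adm l Rp(2) Q cont e']
  show "(\<lambda>s. tangent \<gamma> I s *\<^sub>C (K (\<gamma> s) o\<^sub>L Blinfun (R X (\<gamma> s)))) integrable_on I" by (rule oi(1))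
  show "complex_linear (W \<gamma> X)" using oi(2) by (simp add: W1_def complex_linear_def blinfun.minus_left)
  show "norm (W \<gamma> X) \<le> var \<gamma> / (dst \<gamma> - \<rho>)" using oi(5) by (simp add: W1_def)
  show "cinner (W \<gamma> X x) y = - integral I (\<lambda>s. tangent \<gamma> I s * cinner (K (\<gamma> s) (R X (\<gamma> s) x)) y)"
    using oi(3)[of x y] by (simp add: W1_def blinfun.minus_left cinner_simps)
  show "(\<lambda>s. tangent \<gamma> I s * cinner (K (\<gamma> s) (R X (\<gamma> s) x)) y) integrable_on I" by (rule oi(4))
qed

lemma W_lipschitz:
  assumes sm: "small l \<gamma>" and l: "l \<in> {1, -1}" and X: "complex_linear X" "norm X \<le> \<rho>"
    and Y: "complex_linear Y" "norm Y \<le> \<rho>" and \<rho>: "\<rho> < dst \<gamma>"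
  shows "norm (W \<gamma> X - W \<gamma> Y) \<le> var \<gamma> / (dst \<gamma> - \<rho>)\<^sup>2 * norm (X - Y)"
proof -
  note adm = small_contour_facts(1)[OF sm]
  define e where "e = dst \<gamma> - \<rho>"
  have e: "e > 0" using \<rho> by (simp add: e_def)
  have lowX: "e * norm x \<le> norm (A1 x + X x - \<gamma> s *\<^sub>C x)" if "s \<in> I" for s x
    unfolding e_def by (rule small_lower[OF sm that X(2)])
  have lowY: "e * norm x \<le> norm (A1 x + Y x - \<gamma> s *\<^sub>C x)" if "s \<in> I" for s x
    unfolding e_def by (rule small_lower[OF sm that Y(2)])
  note RX = finite_dim_resolvent[OF onb Z_clin[OF X(1)] e lowX]
    and RY = finite_dim_resolvent[OF onb Z_clin[OF Y(1)] e lowY]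
  define Q where "Q = (\<lambda>s x. R X (\<gamma> s) x - R Y (\<gamma> s) x)"
  have Q1: "clin (Q s)" if "s \<in> I" for s
    by (simp add: clin_def Q_def clin_simps[OF RX(2)[OF that]] clin_simps[OF RY(2)[OF that]] scaleC.diff_right)
  have Q2: "norm (Q s x) \<le> norm (X - Y) / e\<^sup>2 * norm x" if "s \<in> I" for s x
  proof -
    let ?w = "R Y (\<gamma> s) x"
    have eq: "Q s x = R X (\<gamma> s) (- (X - Y) ?w)"
      using finite_dim_resolvent_diff[OF onb Z_clin[OF X(1)] Z_clin[OF Y(1)] e lowX[OF that] lowY[OF that], of x]
      by (simp add: Q_def blinfun.diff_left blinfun.minus_left)
    have "norm (Q s x) \<le> norm (- (X - Y) ?w) / e" unfolding eq by (rule RX(5)[OF that])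
    also have "\<dots> \<le> (norm (X - Y) * (norm x / e)) / e"
    proof -
      have "norm (- (X - Y) ?w) \<le> norm (X - Y) * norm ?w" using norm_blinfun[of "X - Y" ?w] by simp
      also have "\<dots> \<le> norm (X - Y) * (norm x / e)" using RY(5)[OF that, of x] by (intro mult_left_mono) auto
      finally show ?thesis using e by (intro divide_right_mono) auto
    qed
    finally show ?thesis by (simp add: power2_eq_square field_simps)
  qed
  have contX: "continuous_on I (\<lambda>s. R X (\<gamma> s) x)" for x
    using resolvent_continuous_along[OF adm Z_clin[OF X(1)] e, of 0 x] lowX by simp
  have contY: "continuous_on I (\<lambda>s. R Y (\<gamma> s) x)" for x
    using resolvent_continuous_along[OF adm Z_clin[OF Y(1)] e, of 0 x] lowY by simp
  have Q3: "continuous_on I (\<lambda>s. Q s x)" for x unfolding Q_def by (intro continuous_on_diff contX contY)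
  have q0: "0 \<le> norm (X - Y) / e\<^sup>2" by simp
  note oi = contour_op_integral[OF adm l Q1 Q2 Q3 q0]
  have eq: "tangent \<gamma> I s *\<^sub>C (K (\<gamma> s) o\<^sub>L Blinfun (R X (\<gamma> s))) - tangent \<gamma> I s *\<^sub>C (K (\<gamma> s) o\<^sub>L Blinfun (R Y (\<gamma> s)))
     = tangent \<gamma> I s *\<^sub>C (K (\<gamma> s) o\<^sub>L Blinfun (Q s))" if "s \<in> I" for s
  proof -
    note Bl = bounded_linear_Blinfun_apply[OF onb_clin_bounded_linear[OF onb]]
    show ?thesis
      by (rule blinfun_eqI)
         (simp only: blinfun.diff_left scaleC_blinfun.rep_eq blinfun_apply_blinfun_compose Bl[OF RX(2)[OF that]]
           Bl[OF RY(2)[OF that]] Bl[OF Q1[OF that]], simp only: Q_def blinfun.diff_right scaleC.diff_right)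
  qed
  have "W \<gamma> X - W \<gamma> Y = - (integral I (\<lambda>s. tangent \<gamma> I s *\<^sub>C (K (\<gamma> s) o\<^sub>L Blinfun (R X (\<gamma> s))))
      - integral I (\<lambda>s. tangent \<gamma> I s *\<^sub>C (K (\<gamma> s) o\<^sub>L Blinfun (R Y (\<gamma> s)))))"
    by (simp add: W1_def)
  also have "\<dots> = - integral I (\<lambda>s. tangent \<gamma> I s *\<^sub>C (K (\<gamma> s) o\<^sub>L Blinfun (R X (\<gamma> s))) - tangent \<gamma> I s *\<^sub>C (K (\<gamma> s) o\<^sub>L Blinfun (R Y (\<gamma> s))))"
    using Henstock_Kurzweil_Integration.integral_diff[OF W_integral(1)[OF sm l X \<rho>] W_integral(1)[OF sm l Y \<rho>]] by simp
  also have "\<dots> = - integral I (\<lambda>s. tangent \<gamma> I s *\<^sub>C (K (\<gamma> s) o\<^sub>L Blinfun (Q s)))"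
    using integral_cong[of I, OF eq] by simp
  finally have "norm (W \<gamma> X - W \<gamma> Y) \<le> norm (X - Y) / e\<^sup>2 * var \<gamma>" using oi(5) by simp
  then show ?thesis by (simp add: e_def mult.commute)
qed

text \<open>By \<open>rmin \<gamma> (dst \<gamma> - rmin \<gamma>) = var \<gamma>\<close> the ball of radius \<open>rmin \<gamma>\<close> is mapped into itself, and the
  Lipschitz constant on it is \<open>rmin \<gamma> / (dst \<gamma> - rmin \<gamma>)\<close>, which is less than 1 since
  \<open>rmin \<gamma> < dst \<gamma> / 2\<close>.\<close>

lemma W_fixpoint:
  assumes sm: "small l \<gamma>" and l: "l \<in> {1, -1}"
  shows "\<exists>!X. X \<in> {X. complex_linear X \<and> norm X \<le> rmin \<gamma>} \<and> W \<gamma> X = X"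
proof -
  note f = small_contour_facts[OF sm]
  let ?B = "{X :: 'b \<Rightarrow>\<^sub>L 'b. complex_linear X \<and> norm X \<le> rmin \<gamma>}"
  have lt: "rmin \<gamma> < dst \<gamma>" using f(3,5) by simp
  have e: "dst \<gamma> - rmin \<gamma> > 0" using lt by simp
  have Vr: "var \<gamma> / (dst \<gamma> - rmin \<gamma>) = rmin \<gamma>" using f(6) e by (simp add: field_simps)
  have V2: "var \<gamma> / (dst \<gamma> - rmin \<gamma>)\<^sup>2 = rmin \<gamma> / (dst \<gamma> - rmin \<gamma>)"
    using arg_cong[OF Vr, of "\<lambda>t. t / (dst \<gamma> - rmin \<gamma>)"] by (simp only: power2_eq_square divide_divide_eq_left)
  have "closed ?B"
  proof -
    have "closed {X :: 'b \<Rightarrow>\<^sub>L 'b. X (c *\<^sub>C x) = c *\<^sub>C X x}" for c x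
      by (intro closed_Collect_eq linear_continuous_on blinfun.bounded_linear_left
          bounded_linear_compose[OF scaleC.bounded_linear_right blinfun.bounded_linear_left])
    then have "closed (\<Inter>c. \<Inter>x. {X :: 'b \<Rightarrow>\<^sub>L 'b. X (c *\<^sub>C x) = c *\<^sub>C X x})" by (intro closed_INT ballI)
    moreover have "closed {X :: 'b \<Rightarrow>\<^sub>L 'b. norm X \<le> rmin \<gamma>}" by (intro closed_Collect_le continuous_intros)
    moreover have "?B = (\<Inter>c. \<Inter>x. {X :: 'b \<Rightarrow>\<^sub>L 'b. X (c *\<^sub>C x) = c *\<^sub>C X x}) \<inter> {X. norm X \<le> rmin \<gamma>}"
      by (auto simp: complex_linear_def)
    ultimately show ?thesis by (simp only: closed_Int)
  qed
  then have comp: "complete ?B" by (simp add: complete_eq_closed)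
  have "0 \<in> ?B" using f(4) unfolding mem_Collect_eq complex_linear_def by simp
  then have ne: "?B \<noteq> {}" by blast
  have c: "0 \<le> rmin \<gamma> / (dst \<gamma> - rmin \<gamma>)" "rmin \<gamma> / (dst \<gamma> - rmin \<gamma>) < 1"
    using f(4,5) e by (simp_all only: zero_le_divide_iff pos_divide_less_eq) auto
  have "\<exists>!X\<in>?B. W \<gamma> X = X"
  proof (rule Banach_fix[OF comp ne c])
    show "W \<gamma> ` ?B \<subseteq> ?B" using W_integral(2,3)[OF sm l _ _ lt] Vr by auto
    show "dist (W \<gamma> X) (W \<gamma> Y) \<le> rmin \<gamma> / (dst \<gamma> - rmin \<gamma>) * dist X Y" if "X \<in> ?B" "Y \<in> ?B" for X Y
      using W_lipschitz[OF sm l _ _ _ _ lt, of X Y] that V2 by (simp add: dist_norm)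
  qed
  then show ?thesis by simp
qed

text \<open>The Cauchy transform of \<open>K\<close> along \<open>\<gamma>\<close>.\<close>

definition Fop :: "(real \<Rightarrow> complex) \<Rightarrow> complex \<Rightarrow> 'b \<Rightarrow>\<^sub>L 'b"
  where "Fop \<gamma> z = integral I (\<lambda>s. tangent \<gamma> I s *\<^sub>C (K (\<gamma> s) o\<^sub>L Blinfun (\<lambda>x. (1 / (\<gamma> s - z)) *\<^sub>C x)))"

lemma Fop_props:
  assumes adm: "admissible K m1 m2 (D l) \<gamma>" and l: "l \<in> {1, -1}" and e: "e > 0"
    and z: "\<And>s. s \<in> I \<Longrightarrow> e \<le> cmod (\<gamma> s - z)"
  shows Fop_form: "cinner (Fop \<gamma> z x) y = integral I (\<lambda>s. 1 / (\<gamma> s - z) * cinner (K (\<gamma> s) x) y * tangent \<gamma> I s)"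
    and Fop_diff: "(\<And>s. s \<in> I \<Longrightarrow> e \<le> cmod (\<gamma> s - w)) \<Longrightarrow> norm (Fop \<gamma> z - Fop \<gamma> w) \<le> cmod (z - w) / e\<^sup>2 * var \<gamma>"
proof -
  have con\<gamma>: "continuous_on I \<gamma>" using adm contour_continuous[of K m1 m2 "D l" \<gamma>] by (simp add: admissible_def)
  have \<gamma>D: "\<gamma> ` I \<subseteq> D l" using adm by (simp add: admissible_def contour_def)
  define Q where "Q = (\<lambda>z s x. (1 / (\<gamma> s - z)) *\<^sub>C (x::'b))"
  have Q1: "clin (Q z s)" for z s unfolding Q_def by (rule clin_scaleC)
  have Q2: "norm (Q z s x) \<le> 1 / e * norm x" if "s \<in> I" "e \<le> cmod (\<gamma> s - z)" for z s x
  proof -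
    have "cmod (1 / (\<gamma> s - z)) \<le> 1 / e" using that e by (simp add: norm_divide frac_le)
    then show ?thesis unfolding Q_def norm_scaleC by (rule mult_right_mono) simp
  qed
  have Q3: "continuous_on I (\<lambda>s. Q z s x)" if "\<And>s. s \<in> I \<Longrightarrow> e \<le> cmod (\<gamma> s - z)" for z x
  proof -
    have "\<forall>s\<in>I. \<gamma> s - z \<noteq> 0" using that e by force
    then have "continuous_on I (\<lambda>s. 1 / (\<gamma> s - z))"
      by (intro continuous_on_divide continuous_on_diff continuous_on_const con\<gamma>)
    then show ?thesis unfolding Q_def by (intro scaleC.continuous_on continuous_on_const)
  qed
  have q0: "0 \<le> 1 / e" using e by simp
  have Q2z: "norm (Q z s x) \<le> 1 / e * norm x" if "s \<in> I" for s x using Q2[OF that z[OF that]] .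
  note oiz = contour_op_integral[OF adm l Q1 Q2z Q3[OF z] q0]
  show "cinner (Fop \<gamma> z x) y = integral I (\<lambda>s. 1 / (\<gamma> s - z) * cinner (K (\<gamma> s) x) y * tangent \<gamma> I s)"
  proof -
    have "cinner (Fop \<gamma> z x) y = integral I (\<lambda>s. tangent \<gamma> I s * cinner (K (\<gamma> s) (Q z s x)) y)"
      using oiz(3)[of x y] unfolding Fop_def Q_def .
    also have "\<dots> = integral I (\<lambda>s. 1 / (\<gamma> s - z) * cinner (K (\<gamma> s) x) y * tangent \<gamma> I s)"
    proof (rule integral_cong)
      fix s assume "s \<in> I"
      then have "\<gamma> s \<in> D l" using \<gamma>D by blast
      then have "complex_linear (K (\<gamma> s))" using D_facts(2)[OF l] by (intro K_linear_D) blast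
      from clin_simps(2)[OF complex_linear_clin[OF this]]
      show "tangent \<gamma> I s * cinner (K (\<gamma> s) (Q z s x)) y = 1 / (\<gamma> s - z) * cinner (K (\<gamma> s) x) y * tangent \<gamma> I s"
        by (simp add: Q_def cinner_simps)
    qed
    finally show ?thesis .
  qed
  assume w: "\<And>s. s \<in> I \<Longrightarrow> e \<le> cmod (\<gamma> s - w)"
  define P where "P = (\<lambda>s x. Q z s x - Q w s x)"
  have P1: "clin (P s)" for s by (simp add: clin_def P_def clin_simps[OF Q1] scaleC.diff_right)
  have P2: "norm (P s x) \<le> cmod (z - w) / e\<^sup>2 * norm x" if s: "s \<in> I" for s x
  proof -
    have nz: "\<gamma> s - z \<noteq> 0" "\<gamma> s - w \<noteq> 0" using z[OF s] w[OF s] e by auto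
    have "1 / (\<gamma> s - z) - 1 / (\<gamma> s - w) = (z - w) / ((\<gamma> s - z) * (\<gamma> s - w))"
      using nz by (simp add: field_simps)
    then have "cmod (1 / (\<gamma> s - z) - 1 / (\<gamma> s - w)) = cmod (z - w) / (cmod (\<gamma> s - z) * cmod (\<gamma> s - w))"
      by (simp add: norm_divide norm_mult)
    also have "\<dots> \<le> cmod (z - w) / (e * e)"
      using z[OF s] w[OF s] e by (intro divide_left_mono mult_mono mult_pos_pos) auto
    finally have "cmod (1 / (\<gamma> s - z) - 1 / (\<gamma> s - w)) * norm x \<le> cmod (z - w) / (e * e) * norm x"
      by (rule mult_right_mono) simp
    moreover have "P s x = (1 / (\<gamma> s - z) - 1 / (\<gamma> s - w)) *\<^sub>C x"
      unfolding P_def Q_def by (rule scaleC.diff_left[symmetric])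
    ultimately show ?thesis by (simp only: norm_scaleC power2_eq_square)
  qed
  have P3: "continuous_on I (\<lambda>s. P s x)" for x unfolding P_def by (intro continuous_on_diff Q3 z w)
  have p0: "0 \<le> cmod (z - w) / e\<^sup>2" by simp
  note op = contour_op_integral[OF adm l P1 P2 P3 p0]
  have eq: "tangent \<gamma> I s *\<^sub>C (K (\<gamma> s) o\<^sub>L Blinfun (Q z s)) - tangent \<gamma> I s *\<^sub>C (K (\<gamma> s) o\<^sub>L Blinfun (Q w s))
     = tangent \<gamma> I s *\<^sub>C (K (\<gamma> s) o\<^sub>L Blinfun (P s))" for s
  proof -
    note Bl = bounded_linear_Blinfun_apply[OF onb_clin_bounded_linear[OF onb]]
    show ?thesis
      by (rule blinfun_eqI)
         (simp only: blinfun.diff_left scaleC_blinfun.rep_eq blinfun_apply_blinfun_compose Bl[OF Q1]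
           Bl[OF P1], simp only: P_def blinfun.diff_right scaleC.diff_right)
  qed
  have Q2w: "norm (Q w s x) \<le> 1 / e * norm x" if "s \<in> I" for s x using Q2[OF that w[OF that]] .
  note oiw = contour_op_integral[OF adm l Q1 Q2w Q3[OF w] q0]
  have "Fop \<gamma> z - Fop \<gamma> w = integral I (\<lambda>s. tangent \<gamma> I s *\<^sub>C (K (\<gamma> s) o\<^sub>L Blinfun (Q z s)) - tangent \<gamma> I s *\<^sub>C (K (\<gamma> s) o\<^sub>L Blinfun (Q w s)))"
    unfolding Fop_def Q_def
    by (rule Henstock_Kurzweil_Integration.integral_diff[OF oiz(1) oiw(1), symmetric, unfolded Q_def])
  also have "\<dots> = integral I (\<lambda>s. tangent \<gamma> I s *\<^sub>C (K (\<gamma> s) o\<^sub>L Blinfun (P s)))"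
    by (simp only: eq)
  finally show "norm (Fop \<gamma> z - Fop \<gamma> w) \<le> cmod (z - w) / e\<^sup>2 * var \<gamma>" using op(5) by (simp only:)
qed

end

section \<open>The sign of the Cauchy transform\<close>

lemma integral_Im:
  fixes f :: "real \<Rightarrow> complex"
  assumes "f integrable_on J" shows "Im (integral J f) = integral J (\<lambda>x. Im (f x))" "(\<lambda>x. Im (f x)) integrable_on J"
  using integral_linear[OF assms bounded_linear_Im] integrable_linear[OF assms bounded_linear_Im] by (simp_all add: o_def)

context resonance
begin

text \<open>For \<open>w\<close> beyond the real axis the Cauchy kernel is holomorphic and bounded on the closed half-plane that
  contains the contour, so the contour may be replaced by the interval.\<close>

lemma Fop_lower:
  assumes adm: "admissible K m1 m2 (D l) \<gamma>" and l: "l \<in> {1, -1}" and w: "real_of_int l * Im w < 0"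
  shows "cinner (Fop \<gamma> w x) y = integral I (\<lambda>\<mu>. cinner (K (of_real \<mu>) x) y / (of_real \<mu> - w))"
    and "cinner (Fop \<gamma> w x) y = cinner (adj B (resolvent dom0 A0 w (B x))) y"
proof -
  have lpm: "l = 1 \<or> l = -1" using l by simp
  have far: "\<bar>Im w\<bar> \<le> cmod (z - w)" if "real_of_int l * Im z \<ge> 0" for z
    using that w lpm abs_Im_le_cmod[of "z - w"] by auto
  have w0: "\<bar>Im w\<bar> > 0" using w lpm by auto
  have \<gamma>: "real_of_int l * Im (\<gamma> s) \<ge> 0" if "s \<in> I" for s
  proof -
    have "\<gamma> s \<in> D l" using adm that unfolding admissible_def contour_def by blast
    then show ?thesis using D_facts(1)[OF l] by (auto intro: less_imp_le)
  qed
  have "cinner (Fop \<gamma> w x) y = integral I (\<lambda>s. 1 / (\<gamma> s - w) * cinner (K (\<gamma> s) x) y * tangent \<gamma> I s)"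
    by (rule Fop_form[OF adm l w0 far[OF \<gamma>]])
  also have "\<dots> = integral I (\<lambda>\<mu>. 1 / (of_real \<mu> - w) * cinner (K (of_real \<mu>) x) y)"
  proof (rule K_contour[OF l adm])
    show "open (- {w})" by auto
    show "{z. real_of_int l * Im z \<ge> 0} \<subseteq> - {w}" using w by auto
    show "(\<lambda>z. 1 / (z - w)) holomorphic_on - {w}" by (intro holomorphic_intros) auto
    show "cmod (1 / (z - w)) \<le> 1 / \<bar>Im w\<bar>" if "real_of_int l * Im z \<ge> 0" for z
      using far[OF that] w0 by (simp add: norm_divide frac_le)
  qed
  finally show 1: "cinner (Fop \<gamma> w x) y = integral I (\<lambda>\<mu>. cinner (K (of_real \<mu>) x) y / (of_real \<mu> - w))"
    by simp
  have "Im w \<noteq> 0" using w0 by simp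
  then show "cinner (Fop \<gamma> w x) y = cinner (adj B (resolvent dom0 A0 w (B x))) y"
    unfolding 1 using K_form_resolvent by blast
qed

text \<open>Beyond the real axis the Cauchy transform of the density \<open>k u\<close> has, as imaginary part, minus a Poisson
  integral up to the sign \<open>l\<close>.  The Poisson kernel at height \<open>\<epsilon>\<close> is at least \<open>1 / (2 \<epsilon>)\<close> on
  \<open>[p - \<epsilon>, p + \<epsilon>]\<close>, an interval of length \<open>2 \<epsilon>\<close>, so a lower bound \<open>c\<close> of the density there bounds the
  integral below by \<open>c\<close>.\<close>

lemma Poisson_bound:
  assumes adm: "admissible K m1 m2 (D l) \<gamma>" and l: "l \<in> {1, -1}" and \<epsilon>: "\<epsilon> > 0"
    and c: "c = 0 \<or> c > 0 \<and> {p - \<epsilon>..p + \<epsilon>} \<subseteq> I \<and> (\<forall>\<mu>\<in>{p - \<epsilon>..p + \<epsilon>}. c \<le> k u \<mu>)"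
  shows "real_of_int l * Im (cinner (Fop \<gamma> (Complex p (- real_of_int l * \<epsilon>)) u) u) \<le> - c"
proof -
  define w where "w = Complex p (- real_of_int l * \<epsilon>)"
  have lpm: "l = 1 \<or> l = -1" using l by simp
  have w: "real_of_int l * Im w < 0" "Im w \<noteq> 0" using lpm \<epsilon> by (auto simp: w_def)
  define f where "f = (\<lambda>\<mu>. k u \<mu> * \<epsilon> / ((\<mu> - p)\<^sup>2 + \<epsilon>\<^sup>2))"
  have pos: "(\<mu> - p)\<^sup>2 + \<epsilon>\<^sup>2 > 0" for \<mu> using \<epsilon> by (simp add: add_nonneg_pos)
  have int: "(\<lambda>\<mu>. cinner (K (of_real \<mu>) u) u / (of_real \<mu> - w)) integrable_on I"
    using K_form_resolvent[OF w(2)] by (simp add: absolutely_integrable_on_def)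
  have Imf: "real_of_int l * Im (cinner (K (of_real \<mu>) u) u / (of_real \<mu> - w)) = - f \<mu>" if "\<mu> \<in> I" for \<mu>
  proof -
    have "Im (of_real (k u \<mu>) / (of_real \<mu> - w)) = k u \<mu> * (- (real_of_int l * \<epsilon>)) / ((\<mu> - p)\<^sup>2 + \<epsilon>\<^sup>2)"
      using lpm by (auto simp: Im_divide w_def power2_eq_square)
    then show ?thesis using lpm by (auto simp: k_eq[OF that] f_def)
  qed
  have i: "(\<lambda>\<mu>. - f \<mu>) integrable_on I" "real_of_int l * Im (cinner (Fop \<gamma> w u) u) = integral I (\<lambda>\<mu>. - f \<mu>)"
  proof -
    have a: "(\<lambda>\<mu>. real_of_int l * Im (cinner (K (of_real \<mu>) u) u / (of_real \<mu> - w))) integrable_on I"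
      using integrable_on_mult_right[OF integral_Im(2)[OF int]] .
    show "(\<lambda>\<mu>. - f \<mu>) integrable_on I" by (rule integrable_eq[OF a]) (simp only: Imf)
    have "real_of_int l * Im (cinner (Fop \<gamma> w u) u) = integral I (\<lambda>\<mu>. real_of_int l * Im (cinner (K (of_real \<mu>) u) u / (of_real \<mu> - w)))"
      unfolding Fop_lower(1)[OF adm l w(1)] integral_Im(1)[OF int] by (rule integral_mult_right[symmetric])
    also have "\<dots> = integral I (\<lambda>\<mu>. - f \<mu>)" by (intro integral_cong) (simp only: Imf)
    finally show "real_of_int l * Im (cinner (Fop \<gamma> w u) u) = integral I (\<lambda>\<mu>. - f \<mu>)" .
  qed
  have fi: "f integrable_on I" using integrable_neg[OF i(1)] by simp
  have f0: "0 \<le> f \<mu>" if "\<mu> \<in> I" for \<mu> using k_nonneg[OF that] \<epsilon> pos[of \<mu>] by (simp add: f_def)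
  have "c \<le> integral I f"
  proof (cases "c = 0")
    case True
    then show ?thesis using integral_nonneg[OF fi f0] by simp
  next
    case False
    then have c': "c > 0" "{p - \<epsilon>..p + \<epsilon>} \<subseteq> I" "\<And>\<mu>. \<mu> \<in> {p - \<epsilon>..p + \<epsilon>} \<Longrightarrow> c \<le> k u \<mu>" using c by auto
    have fJ: "f integrable_on {p - \<epsilon>..p + \<epsilon>}" by (rule integrable_on_subinterval[OF fi c'(2)])
    have "integral {p - \<epsilon>..p + \<epsilon>} (\<lambda>_. c / (2 * \<epsilon>)) \<le> integral {p - \<epsilon>..p + \<epsilon>} f"
    proof (rule integral_le[OF integrable_const_ivl fJ])
      fix \<mu> assume mu: "\<mu> \<in> {p - \<epsilon>..p + \<epsilon>}"
      have "(\<mu> - p)\<^sup>2 \<le> \<epsilon>\<^sup>2" using mu \<epsilon> by (intro abs_le_square_iff[THEN iffD1]) auto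
      then have "c * \<epsilon> / (2 * \<epsilon>\<^sup>2) \<le> k u \<mu> * \<epsilon> / ((\<mu> - p)\<^sup>2 + \<epsilon>\<^sup>2)"
        using c'(1) c'(3)[OF mu] \<epsilon> pos[of \<mu>] by (intro frac_le mult_right_mono) auto
      then show "c / (2 * \<epsilon>) \<le> f \<mu>" using \<epsilon> by (simp add: f_def power2_eq_square)
    qed
    then have "c \<le> integral {p - \<epsilon>..p + \<epsilon>} f" using \<epsilon> by (simp add: field_simps)
    also have "\<dots> \<le> integral I f" by (rule integral_subset_le[OF c'(2) fJ fi]) (use f0 in auto)
    finally show ?thesis .
  qed
  then show ?thesis using i(2) integral_neg[of I f] by (simp add: w_def)
qed

text \<open>The Cauchy transform is continuous off the contour, so its value at a real point is the limit of
  values to which \<open>Poisson_bound\<close> applies.\<close>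

lemma Im_Fop_real:
  assumes adm: "admissible K m1 m2 (D l) \<gamma>" and l: "l \<in> {1, -1}" and e: "e > 0"
    and far: "\<And>s. s \<in> I \<Longrightarrow> e \<le> cmod (\<gamma> s - of_real p)"
  shows Im_Fop_nonpos: "real_of_int l * Im (cinner (Fop \<gamma> (of_real p) u) u) \<le> 0"
    and Im_Fop_neg: "p \<in> I \<Longrightarrow> k u p > 0 \<Longrightarrow> real_of_int l * Im (cinner (Fop \<gamma> (of_real p) u) u) < 0"
proof -
  have lpm: "l = 1 \<or> l = -1" using l by simp
  have fv: "0 \<le> var \<gamma>"
    using adm unfolding variation_def admissible_def finite_variation_def by (intro integral_nonneg) auto
  have le: "real_of_int l * Im (cinner (Fop \<gamma> (of_real p) u) u) \<le> - c"
    if \<delta>: "\<delta> > 0" and c: "\<And>\<epsilon>. 0 < \<epsilon> \<Longrightarrow> \<epsilon> < \<delta> \<Longrightarrow> c = 0 \<or> c > 0 \<and> {p - \<epsilon>..p + \<epsilon>} \<subseteq> I \<and> (\<forall>\<mu>\<in>{p - \<epsilon>..p + \<epsilon>}. c \<le> k u \<mu>)"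
    for c \<delta>
  proof (rule field_le_epsilon)
    fix \<eta> :: real assume \<eta>: "\<eta> > 0"
    \<comment> \<open>a Lipschitz constant of the form at distance \<open>e/2\<close> from the contour\<close>
    define C where "C = 1 / (e/2)\<^sup>2 * var \<gamma> * (norm u * norm u)"
    have C: "C \<ge> 0" using fv by (simp add: C_def)
    define \<epsilon> where "\<epsilon> = min (\<delta>/2) (min (e/2) (\<eta> / (C + 1)))"
    have "\<eta> / (C + 1) > 0" using \<eta> C by simp
    then have \<epsilon>: "0 < \<epsilon>" "\<epsilon> < \<delta>" "\<epsilon> \<le> e/2" "\<epsilon> \<le> \<eta> / (C + 1)"
      using \<delta> e unfolding \<epsilon>_def by linarith+
    define w where "w = Complex p (- real_of_int l * \<epsilon>)"
    have dw: "cmod (of_real p - w) = \<epsilon>"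
      using lpm \<epsilon>(1) by (auto simp: w_def cmod_def)
    have farw: "e/2 \<le> cmod (\<gamma> s - w)" if "s \<in> I" for s
      using far[OF that] norm_triangle_ineq[of "\<gamma> s - w" "w - of_real p"] dw \<epsilon>(3) by (simp add: norm_minus_commute)
    have far': "e/2 \<le> cmod (\<gamma> s - of_real p)" if "s \<in> I" for s using far[OF that] e by simp
    have "e/2 > 0" using e by simp
    have "norm (Fop \<gamma> (of_real p) - Fop \<gamma> w) \<le> \<epsilon> / (e/2)\<^sup>2 * var \<gamma>"
      using Fop_diff[OF adm l \<open>e/2 > 0\<close> far' farw] dw by simp
    then have "norm (Fop \<gamma> (of_real p) - Fop \<gamma> w) * (norm u * norm u) \<le> \<epsilon> / (e/2)\<^sup>2 * var \<gamma> * (norm u * norm u)"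
      by (rule mult_right_mono) simp
    moreover have "cmod (cinner ((Fop \<gamma> (of_real p) - Fop \<gamma> w) u) u) \<le> norm (Fop \<gamma> (of_real p) - Fop \<gamma> w) * (norm u * norm u)"
      using order_trans[OF cinner_cmod_le mult_right_mono[OF norm_blinfun norm_ge_zero]] by (simp add: mult.assoc)
    ultimately have "cmod (cinner ((Fop \<gamma> (of_real p) - Fop \<gamma> w) u) u) \<le> \<epsilon> * C" by (simp add: C_def)
    also have "\<dots> \<le> \<eta> / (C + 1) * (C + 1)" using \<epsilon>(1,4) C \<eta> by (intro mult_mono) auto
    also have "\<dots> = \<eta>" using C by simp
    finally have "cmod (cinner (Fop \<gamma> (of_real p) u) u - cinner (Fop \<gamma> w u) u) \<le> \<eta>"
      by (simp add: blinfun.diff_left cinner.diff_left)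
    then have "\<bar>Im (cinner (Fop \<gamma> (of_real p) u) u) - Im (cinner (Fop \<gamma> w u) u)\<bar> \<le> \<eta>"
      using abs_Im_le_cmod[of "cinner (Fop \<gamma> (of_real p) u) u - cinner (Fop \<gamma> w u) u"] by simp
    moreover have "real_of_int l * Im (cinner (Fop \<gamma> w u) u) \<le> - c"
      unfolding w_def by (rule Poisson_bound[OF adm l \<epsilon>(1) c[OF \<epsilon>(1,2)]])
    ultimately show "real_of_int l * Im (cinner (Fop \<gamma> (of_real p) u) u) \<le> - c + \<eta>"
      using lpm by auto
  qed
  show "real_of_int l * Im (cinner (Fop \<gamma> (of_real p) u) u) \<le> 0" using le[of 1 0] by simp
  show "real_of_int l * Im (cinner (Fop \<gamma> (of_real p) u) u) < 0" if p: "p \<in> I" "k u p > 0"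
  proof -
    have "isCont (\<lambda>\<mu>. K (of_real \<mu>)) p"
      using K_isCont[of "of_real p"] \<Omega>_supset p(1) by (intro isCont_o2[of p of_real K]) auto
    then have "isCont (k u) p" unfolding k_def
      by (intro continuous_intros bounded_linear.isCont[OF bounded_linear_Re] bounded_bilinear.isCont[OF bounded_bilinear_cinner] bounded_bilinear.isCont[OF bounded_bilinear_blinfun_apply])
    then have "\<forall>\<^sub>F \<mu> in at p. k u p / 2 < k u \<mu>"
      using p(2) by (intro order_tendstoD(1)[of "k u" "k u p"]) (auto simp: isCont_def)
    moreover have "\<forall>\<^sub>F \<mu> in at p. \<mu> \<in> I" using p(1) by (intro eventually_at_in_open') auto
    ultimately have "\<forall>\<^sub>F \<mu> in at p. k u p / 2 < k u \<mu> \<and> \<mu> \<in> I" by eventually_elim auto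
    then obtain \<delta> where \<delta>: "\<delta> > 0" "\<And>\<mu>. \<mu> \<noteq> p \<Longrightarrow> \<bar>\<mu> - p\<bar> < \<delta> \<Longrightarrow> k u p / 2 < k u \<mu> \<and> \<mu> \<in> I"
      unfolding eventually_at by (auto simp: dist_real_def)
    have \<delta>': "k u p / 2 \<le> k u \<mu> \<and> \<mu> \<in> I" if "\<bar>\<mu> - p\<bar> < \<delta>" for \<mu>
      using \<delta>(2)[of \<mu>] that p by (cases "\<mu> = p") auto
    have "real_of_int l * Im (cinner (Fop \<gamma> (of_real p) u) u) \<le> - (k u p / 2)"
    proof (rule le[OF \<delta>(1)])
      fix \<epsilon> :: real assume "0 < \<epsilon>" "\<epsilon> < \<delta>"
      then have "k u p / 2 \<le> k u \<mu> \<and> \<mu> \<in> I" if "\<mu> \<in> {p - \<epsilon>..p + \<epsilon>}" for \<mu>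
        using that by (intro \<delta>') auto
      then show "k u p / 2 = 0 \<or> k u p / 2 > 0 \<and> {p - \<epsilon>..p + \<epsilon>} \<subseteq> I \<and> (\<forall>\<mu>\<in>{p - \<epsilon>..p + \<epsilon>}. k u p / 2 \<le> k u \<mu>)"
        using p(2) by auto
    qed
    then show ?thesis using p(2) by simp
  qed
qed

lemma contour_dist_end_point:
  assumes sm: "small l \<gamma>" and p: "ereal p \<in> {m1, m2}" and \<kappa>: "\<kappa> \<in> \<sigma>"
  shows "dst \<gamma> \<le> cmod (of_real p - \<kappa>)"
proof (rule field_le_epsilon)
  fix \<epsilon> :: real assume \<epsilon>: "\<epsilon> > 0"
  have con: "contour K m1 m2 (D l) \<gamma>" using small_contour_facts(1)[OF sm] by (simp add: admissible_def)
  have "\<exists>H. (\<forall>s\<in>I. H 1 s = \<gamma> s) \<and> end_condition K H (filtermap real_of_ereal (at_right m1)) m1 \<and>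
      end_condition K H (filtermap real_of_ereal (at_left m2)) m2"
    using con unfolding contour_def
  proof (elim conjE exE)
    fix H assume 1: "\<forall>s\<in>I. H 0 s = complex_of_real s \<and> H 1 s = \<gamma> s"
      "end_condition K H (filtermap real_of_ereal (at_right m1)) m1"
      "end_condition K H (filtermap real_of_ereal (at_left m2)) m2"
    show ?thesis by (rule exI[of _ H]) (use 1 in simp)
  qed
  then obtain H where H: "\<And>s. s \<in> I \<Longrightarrow> H 1 s = \<gamma> s"
    "end_condition K H (filtermap real_of_ereal (at_right m1)) m1"
    "end_condition K H (filtermap real_of_ereal (at_left m2)) m2" by blast
  have "\<exists>s\<in>I. cmod (\<gamma> s - of_real p) < \<epsilon>"
  proof (cases "ereal p = m2")
    case True
    then have "uniform_limit {0..1} (\<lambda>s t. H t s) (\<lambda>t. complex_of_real p) (filtermap real_of_ereal (at_left m2))"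
      using H(3) unfolding end_condition_def by (auto simp: True[symmetric])
    then have "\<forall>\<^sub>F s in filtermap real_of_ereal (at_left m2). \<forall>t\<in>{0..1}. dist (H t s) (of_real p) < \<epsilon>"
      using \<epsilon> by (rule uniform_limitD)
    then obtain c where c: "c \<in> I" "\<And>s. s \<in> I \<Longrightarrow> c < s \<Longrightarrow> dist (H 1 s) (of_real p) < \<epsilon>"
      unfolding eventually_right_end[OF m] by force
    obtain s where "c < s" "s < p" using c(1) True dense[of c p] by (auto simp: einterval_def)
    moreover from this have "s \<in> I" using c(1) True less_trans[of m1 "ereal c" "ereal s"] by (auto simp: einterval_def)
    ultimately show ?thesis using c(2)[of s] H(1)[of s] by (auto simp: dist_norm)
  next
    case False
    then have True: "ereal p = m1" using p by auto
    then have "uniform_limit {0..1} (\<lambda>s t. H t s) (\<lambda>t. complex_of_real p) (filtermap real_of_ereal (at_right m1))"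
      using H(2) unfolding end_condition_def by (auto simp: True[symmetric])
    then have "\<forall>\<^sub>F s in filtermap real_of_ereal (at_right m1). \<forall>t\<in>{0..1}. dist (H t s) (of_real p) < \<epsilon>"
      using \<epsilon> by (rule uniform_limitD)
    then obtain c where c: "c \<in> I" "\<And>s. s \<in> I \<Longrightarrow> s < c \<Longrightarrow> dist (H 1 s) (of_real p) < \<epsilon>"
      unfolding eventually_left_end[OF m] by force
    obtain s where "p < s" "s < c" using c(1) True dense[of p c] by (auto simp: einterval_def)
    moreover from this have "s \<in> I" using c(1) True less_trans[of "ereal s" "ereal c" m2] by (auto simp: einterval_def)
    ultimately show ?thesis using c(2)[of s] H(1)[of s] by (auto simp: dist_norm)
  qed
  then obtain s where s: "s \<in> I" "cmod (\<gamma> s - of_real p) < \<epsilon>" by blast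
  have "dst \<gamma> \<le> cmod (\<gamma> s - \<kappa>)" by (rule small_contour_facts(8)[OF sm \<kappa> s(1)])
  also have "\<dots> \<le> cmod (\<gamma> s - of_real p) + cmod (of_real p - \<kappa>)"
    using norm_triangle_ineq[of "\<gamma> s - of_real p" "of_real p - \<kappa>"] by simp
  finally show "dst \<gamma> \<le> cmod (of_real p - \<kappa>) + \<epsilon>" using s(2) by simp
qed

text \<open>A contour approaches the finite end points, which are therefore at least as far from the spectrum of
  \<open>A1\<close> as the contour is.\<close>

lemma near_\<sigma>_in_I:
  assumes sm: "small l \<gamma>" and \<kappa>: "of_real \<kappa> \<in> \<sigma>" and x: "\<bar>x - \<kappa>\<bar> < dst \<gamma>"
  shows "x \<in> I"
proof (rule ccontr)
  assume "x \<notin> I"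
  have \<kappa>I: "\<kappa> \<in> I" using \<sigma>1 \<kappa> by auto
  have d: "dst \<gamma> \<le> \<bar>p - \<kappa>\<bar>" if "ereal p \<in> {m1, m2}" for p
    using contour_dist_end_point[OF sm that \<kappa>] by (simp flip: of_real_diff)
  consider "ereal x \<le> m1" | "m2 \<le> ereal x" using \<open>x \<notin> I\<close> by (auto simp: einterval_def not_less)
  then show False
  proof cases
    case 1
    then obtain p where p: "m1 = ereal p" using \<kappa>I by (cases m1) (auto simp: einterval_def)
    then show False using d[of p] 1 \<kappa>I x by (auto simp: einterval_def)
  next
    case 2
    then obtain p where p: "m2 = ereal p" using \<kappa>I by (cases m2) (auto simp: einterval_def)
    then show False using d[of p] 2 \<kappa>I x by (auto simp: einterval_def)
  qed
qed

text \<open>From \<open>X u = Fop \<gamma> z u\<close> follows \<open>Im \<langle>Fop \<gamma> z u, u\<rangle> = Im z \<parallel>u\<parallel>\<^sup>2\<close>.  From the real point \<open>Re z\<close>,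
  where \<open>l Im \<langle>Fop \<gamma> (Re z) u, u\<rangle> \<le> 0\<close>, the form varies by less than \<open>\<bar>Im z\<bar> \<parallel>u\<parallel>\<^sup>2\<close> if \<open>Im z \<noteq> 0\<close>, because
  \<open>var \<gamma> < (dst \<gamma> - rmin \<gamma>)\<^sup>2\<close>; so \<open>l Im z\<close> is not positive.\<close>

lemma fixpoint_eigenvalue:
  assumes sm: "small l \<gamma>" and l: "l \<in> {1, -1}" and X: "complex_linear X" "norm X \<le> rmin \<gamma>" "W \<gamma> X = X"
    and u: "u \<noteq> 0" "A1 u + blinfun_apply X u = z *\<^sub>C u"
  shows "X u = Fop \<gamma> z u" and "real_of_int l * Im z \<le> 0" and "Im z = 0 \<Longrightarrow> Re z \<in> I \<and> \<not> k u (Re z) > 0"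
proof -
  note f = small_contour_facts[OF sm]
  note adm = f(1)
  have lpm: "l = 1 \<or> l = -1" using l by simp
  have lt: "rmin \<gamma> < dst \<gamma>" using f(3,5) by simp
  define e where "e = dst \<gamma> - rmin \<gamma>"
  have e: "e > 0" using lt by (simp add: e_def)
  obtain \<kappa> where \<kappa>: "of_real \<kappa> \<in> \<sigma>" "cmod (z - of_real \<kappa>) \<le> norm X"
    using eigenvalue_near_\<sigma>[OF f(7) u] by blast
  have zr: "cmod (z - of_real \<kappa>) \<le> rmin \<gamma>" using \<kappa>(2) X(2) by simp
  have xr: "\<bar>Re z - \<kappa>\<bar> \<le> rmin \<gamma>" using zr abs_Re_le_cmod[of "z - of_real \<kappa>"] by simp
  have far: "e \<le> cmod (\<gamma> s - w)" if "s \<in> I" "cmod (w - of_real \<kappa>) \<le> rmin \<gamma>" for s w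
    using f(8)[OF \<kappa>(1) that(1)] norm_triangle_ineq[of "\<gamma> s - w" "w - of_real \<kappa>"] that(2) by (simp add: e_def)
  have farz: "e \<le> cmod (\<gamma> s - z)" if "s \<in> I" for s by (rule far[OF that zr])
  have farx: "e \<le> cmod (\<gamma> s - of_real (Re z))" if "s \<in> I" for s
    by (rule far[OF that]) (use xr in \<open>simp flip: of_real_diff\<close>)
  show Xu: "X u = Fop \<gamma> z u"
  proof (rule cinner_eq_imp_eq)
    fix y
    have "cinner (X u) y = cinner (W \<gamma> X u) y" using X(3) by simp
    also have "\<dots> = - integral I (\<lambda>s. tangent \<gamma> I s * cinner (K (\<gamma> s) (R X (\<gamma> s) u)) y)"
      by (rule W_integral(4)[OF sm l X(1,2) lt])
    also have "\<dots> = - integral I (\<lambda>s. - (1 / (\<gamma> s - z) * cinner (K (\<gamma> s) u) y * tangent \<gamma> I s))"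
    proof (rule arg_cong[where f = uminus], rule integral_cong)
      fix s assume s: "s \<in> I"
      have nz: "z - \<gamma> s \<noteq> 0" using farz[OF s] e by auto
      have low: "e * norm x \<le> norm (A1 x + X x - \<gamma> s *\<^sub>C x)" for x
        unfolding e_def by (rule small_lower[OF sm s X(2)])
      note Rp = finite_dim_resolvent[OF onb Z_clin[OF X(1)] e low]
      have "A1 u + X u - \<gamma> s *\<^sub>C u = (z - \<gamma> s) *\<^sub>C u" using u(2) by (simp add: scaleC.diff_left)
      then have zu: "(z - \<gamma> s) *\<^sub>C R X (\<gamma> s) u = u" using Rp(4)[of u] clin_simps(2)[OF Rp(2)] by metis
      have "(1 / (z - \<gamma> s) * (z - \<gamma> s)) *\<^sub>C R X (\<gamma> s) u = (1 / (z - \<gamma> s)) *\<^sub>C u"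
        unfolding scaleC_scaleC[symmetric] zu ..
      then have "R X (\<gamma> s) u = (1 / (z - \<gamma> s)) *\<^sub>C u" using nz by simp
      moreover have "complex_linear (K (\<gamma> s))" using f(9)[OF s] D_facts(2)[OF l] by (intro K_linear_D) blast
      ultimately have "cinner (K (\<gamma> s) (R X (\<gamma> s) u)) y = 1 / (z - \<gamma> s) * cinner (K (\<gamma> s) u) y"
        by (simp only: clin_simps(2)[OF complex_linear_clin] cinner_scaleC_left)
      moreover have "1 / (z - \<gamma> s) = - (1 / (\<gamma> s - z))" by (metis minus_diff_eq minus_divide_right)
      ultimately show "tangent \<gamma> I s * cinner (K (\<gamma> s) (R X (\<gamma> s) u)) y = - (1 / (\<gamma> s - z) * cinner (K (\<gamma> s) u) y * tangent \<gamma> I s)"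
        by (simp only:) (simp add: mult.commute)
    qed
    also have "\<dots> = integral I (\<lambda>s. 1 / (\<gamma> s - z) * cinner (K (\<gamma> s) u) y * tangent \<gamma> I s)"
      unfolding integral_neg by (rule minus_minus)
    also have "\<dots> = cinner (Fop \<gamma> z u) y" by (rule Fop_form[OF adm l e farz, symmetric])
    finally show "cinner (X u) y = cinner (Fop \<gamma> z u) y" .
  qed
  define F where "F = (\<lambda>w. Im (cinner (Fop \<gamma> w u) u))"
  have F: "F z = Im z * (norm u)\<^sup>2"
  proof -
    have "cinner (A1 u + X u) u = z * cinner u u" unfolding u(2) by (rule cinner_scaleC_left)
    then have "cinner (A1 u) u + cinner (Fop \<gamma> z u) u = z * of_real ((norm u)\<^sup>2)"
      by (simp only: cinner.add_left Xu cinner_self)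
    then have "Im (cinner (A1 u) u) + F z = Im (z * of_real ((norm u)\<^sup>2))" unfolding F_def by (metis plus_complex.sel(2))
    moreover have "Im (cinner (A1 u) u) = 0"
      using A1_sym[of u u] cinner_commute[of u "A1 u"] by (metis Reals_cnj_iff complex_is_Real_iff)
    moreover have "Im (z * of_real ((norm u)\<^sup>2)) = Im z * (norm u)\<^sup>2" by (simp del: of_real_power)
    ultimately show ?thesis by simp
  qed
  have nu: "(norm u)\<^sup>2 > 0" using u(1) by simp
  have F0: "real_of_int l * F (of_real (Re z)) \<le> 0" unfolding F_def by (rule Im_Fop_nonpos[OF adm l e farx])
  have V: "var \<gamma> < e\<^sup>2"
  proof -
    have "rmin \<gamma> < e" using f(5) by (simp add: e_def)
    then have "rmin \<gamma> * e < e * e" using e by (rule mult_strict_right_mono)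
    then show ?thesis using f(6) by (simp add: e_def power2_eq_square)
  qed
  have var: "\<bar>F z - F (of_real (Re z))\<bar> \<le> \<bar>Im z\<bar> * (var \<gamma> / e\<^sup>2) * (norm u)\<^sup>2"
  proof -
    have "\<bar>F z - F (of_real (Re z))\<bar> \<le> cmod (cinner ((Fop \<gamma> z - Fop \<gamma> (of_real (Re z))) u) u)"
      using abs_Im_le_cmod[of "cinner ((Fop \<gamma> z - Fop \<gamma> (of_real (Re z))) u) u"]
      by (simp add: F_def blinfun.diff_left cinner.diff_left)
    also have "\<dots> \<le> norm (Fop \<gamma> z - Fop \<gamma> (of_real (Re z))) * norm u * norm u"
      using order_trans[OF cinner_cmod_le mult_right_mono[OF norm_blinfun norm_ge_zero]] .
    also have "\<dots> \<le> (cmod (z - of_real (Re z)) / e\<^sup>2 * var \<gamma>) * norm u * norm u"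
      by (intro mult_right_mono Fop_diff[OF adm l e farz farx]) auto
    also have "cmod (z - of_real (Re z)) = \<bar>Im z\<bar>" by (simp add: cmod_def)
    finally show ?thesis by (simp add: power2_eq_square mult_ac)
  qed
  show "real_of_int l * Im z \<le> 0"
  proof (rule ccontr)
    assume "\<not> real_of_int l * Im z \<le> 0"
    then have pos: "real_of_int l * Im z > 0" by simp
    then have Iz: "\<bar>Im z\<bar> = real_of_int l * Im z" using lpm by auto
    have "var \<gamma> / e\<^sup>2 < 1" using V e by simp
    then have "\<bar>Im z\<bar> * (var \<gamma> / e\<^sup>2) * (norm u)\<^sup>2 < \<bar>Im z\<bar> * 1 * (norm u)\<^sup>2"
      using pos Iz nu by (intro mult_strict_right_mono mult_strict_left_mono) auto
    then have "\<bar>F z - F (of_real (Re z))\<bar> < real_of_int l * Im z * (norm u)\<^sup>2" using var Iz by simp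
    moreover have "real_of_int l * F z = real_of_int l * Im z * (norm u)\<^sup>2" by (simp add: F)
    ultimately show False using F0 lpm by auto
  qed
  show "Re z \<in> I \<and> \<not> k u (Re z) > 0" if "Im z = 0"
  proof
    show R: "Re z \<in> I" using near_\<sigma>_in_I[OF sm \<kappa>(1)] xr lt by simp
    have "z = of_real (Re z)" using that by (simp add: complex_eq_iff)
    then have "F (of_real (Re z)) = 0" using F that by simp
    then show "\<not> k u (Re z) > 0" using Im_Fop_neg[OF adm l e farx R, of u] by (auto simp: F_def)
  qed
qed

end

section \<open>Independence of the contour\<close>

text \<open>For bounded \<open>w\<close> compactness gives the bound, and for large \<open>w\<close> the term \<open>w x\<close> dominates \<open>T x\<close>.\<close>

lemma uniform_resolvent_bound:
  fixes S :: "'b::complex_hilbert_space set" and T :: "'b \<Rightarrow> 'b"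
  assumes S: "onb S" and T: "clin T" and H: "closed H" and no: "\<And>z. z \<in> H \<Longrightarrow> \<not> eigenval T z"
  obtains \<delta> where "\<delta> > 0" "\<And>w x. w \<in> H \<Longrightarrow> \<delta> * norm x \<le> norm (T x - w *\<^sub>C x)"
proof -
  define M where "M = (\<Sum>s\<in>S. norm (T s))"
  have M: "norm (T x) \<le> M * norm x" for x unfolding M_def by (rule onb_clin_bound[OF S T])
  define C where "C = (H \<inter> cball 0 (M + 1)) \<times> {x::'b. norm x = 1}"
  have "compact C" unfolding C_def using H by (intro compact_Times onb_compact_sphere[OF S] closed_Int_compact) auto
  define f where "f = (\<lambda>p. norm (T (snd p) - fst p *\<^sub>C snd p))"
  have f: "continuous_on C f"
    unfolding f_def
    by (intro continuous_on_norm continuous_on_diff scaleC.continuous_on continuous_on_fst continuous_on_snd continuous_on_id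
        bounded_linear.continuous_on[OF onb_clin_bounded_linear[OF S T]])
  obtain \<delta> where \<delta>: "\<delta> > 0" "\<And>p. p \<in> C \<Longrightarrow> \<delta> \<le> f p"
  proof (cases "C = {}")
    case True
    then show ?thesis using that[of 1] by simp
  next
    case False
    obtain p where p: "p \<in> C" "\<And>q. q \<in> C \<Longrightarrow> f p \<le> f q"
      using continuous_attains_inf[OF \<open>compact C\<close> False f] by blast
    have "fst p \<in> H" "snd p \<noteq> 0" using p(1) by (auto simp: C_def)
    then have "T (snd p) \<noteq> fst p *\<^sub>C snd p" using no unfolding eigenval_def by blast
    then have "f p > 0" by (simp add: f_def)
    then show ?thesis using that p(2) by blast
  qed
  have "min \<delta> 1 * norm x \<le> norm (T x - w *\<^sub>C x)" if w: "w \<in> H" for w x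
  proof (cases "x = 0")
    case False
    then have nx: "norm x > 0" by simp
    show ?thesis
    proof (cases "cmod w \<le> M + 1")
      case True
      define y where "y = complex_of_real (inverse (norm x)) *\<^sub>C x"
      have y: "norm y = 1" using False unfolding y_def norm_scaleC by (simp add: norm_inverse)
      then have "\<delta> \<le> norm (T y - w *\<^sub>C y)" using \<delta>(2)[of "(w, y)"] w True by (simp add: C_def f_def)
      moreover have "T y - w *\<^sub>C y = complex_of_real (inverse (norm x)) *\<^sub>C (T x - w *\<^sub>C x)"
        unfolding y_def by (rule clin_simps(2)[OF clin_shift[OF T]])
      ultimately have "\<delta> \<le> inverse (norm x) * norm (T x - w *\<^sub>C x)" by (simp add: norm_scaleC norm_inverse norm_divide)
      then have "\<delta> * norm x \<le> norm (T x - w *\<^sub>C x)" using nx by (simp add: field_simps)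
      moreover have "min \<delta> 1 * norm x \<le> \<delta> * norm x" by (intro mult_right_mono) auto
      ultimately show ?thesis by simp
    next
      case False
      have "norm (w *\<^sub>C x) - norm (T x) \<le> norm (T x - w *\<^sub>C x)"
        using norm_triangle_ineq2[of "w *\<^sub>C x" "T x"] by (simp add: norm_minus_commute)
      moreover have "(M + 1) * norm x \<le> norm (w *\<^sub>C x)" using False nx by (simp add: norm_scaleC)
      ultimately have "1 * norm x \<le> norm (T x - w *\<^sub>C x)" using M[of x] by (simp add: distrib_right)
      moreover have "min \<delta> 1 * norm x \<le> 1 * norm x" by (intro mult_right_mono) auto
      ultimately show ?thesis by linarith
    qed
  qed (simp add: clin_simps[OF T])
  then show ?thesis using that[of "min \<delta> 1"] \<delta>(1) by simp
qed

lemma resolvent_holomorphic: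
  fixes S :: "'b::complex_hilbert_space set" and T :: "'b \<Rightarrow> 'b"
  assumes S: "onb S" and T: "clin T" and U: "open U" and \<delta>: "\<delta> > 0"
    and low: "\<And>w x. w \<in> U \<Longrightarrow> \<delta> * norm x \<le> norm (T x - w *\<^sub>C x)"
  shows "(\<lambda>w. cinner (resolvent UNIV T w x) y) holomorphic_on U"
proof (rule holomorphic_onI)
  fix w assume w: "w \<in> U"
  note Rp = finite_dim_resolvent[OF S T \<delta> low]
  let ?R = "\<lambda>w. resolvent UNIV T w"
  define D where "D = cinner (?R w (?R w x)) y"
  define C where "C = norm x / \<delta> / \<delta> / \<delta> * norm y"
  have C0: "C \<ge> 0" using \<delta> by (simp add: C_def)
  have diff: "?R z v - ?R w v = (z - w) *\<^sub>C ?R z (?R w v)" if "z \<in> U" for z v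
    using finite_dim_resolvent_diff[OF S T T \<delta> low[OF that] low[OF w], of v] by (simp add: clin_simps(2)[OF Rp(2)[OF that]])
  have est: "cmod (cinner (?R z x) y - cinner (?R w x) y - D * (z - w)) \<le> C * cmod (z - w) * cmod (z - w)" if z: "z \<in> U" for z
  proof -
    have "cinner (?R z x) y - cinner (?R w x) y = (z - w) * cinner (?R z (?R w x)) y"
      using arg_cong[OF diff[OF z, of x], of "\<lambda>v. cinner v y"] by (simp only: cinner.diff_left cinner_scaleC_left)
    then have "cinner (?R z x) y - cinner (?R w x) y - D * (z - w) = (z - w) * cinner (?R z (?R w x) - ?R w (?R w x)) y"
      by (simp add: D_def cinner.diff_left algebra_simps)
    also have "\<dots> = (z - w) * ((z - w) * cinner (?R z (?R w (?R w x))) y)"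
      unfolding diff[OF z] cinner_scaleC_left ..
    finally have "cmod (cinner (?R z x) y - cinner (?R w x) y - D * (z - w)) = cmod (cinner (?R z (?R w (?R w x))) y) * cmod (z - w) * cmod (z - w)"
      by (simp add: norm_mult mult_ac)
    also have "\<dots> \<le> C * cmod (z - w) * cmod (z - w)"
    proof (intro mult_right_mono)
      have "norm (?R z (?R w (?R w x))) \<le> norm (?R w (?R w x)) / \<delta>" by (rule Rp(5)[OF z])
      also have "\<dots> \<le> (norm (?R w x) / \<delta>) / \<delta>" using \<delta> by (intro divide_right_mono Rp(5)[OF w]) auto
      also have "\<dots> \<le> ((norm x / \<delta>) / \<delta>) / \<delta>" using \<delta> by (intro divide_right_mono Rp(5)[OF w]) auto
      finally show "cmod (cinner (?R z (?R w (?R w x))) y) \<le> C"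
        unfolding C_def using order_trans[OF cinner_cmod_le mult_right_mono[OF _ norm_ge_zero]] by blast
    qed auto
    finally show ?thesis .
  qed
  have "((\<lambda>w. cinner (?R w x) y) has_field_derivative D) (at w)"
    unfolding has_field_derivative_def has_derivative_at_alt
  proof (intro conjI allI impI bounded_linear_mult_right)
    fix e :: real assume e: "e > 0"
    obtain r where r: "r > 0" "ball w r \<subseteq> U" using U w by (rule openE)
    define d where "d = min r (e / (C + 1))"
    have d: "d > 0" using r(1) e C0 by (simp add: d_def)
    have "cmod (cinner (?R z x) y - cinner (?R w x) y - D * (z - w)) \<le> e * cmod (z - w)" if z: "cmod (z - w) < d" for z
    proof -
      have zU: "z \<in> U" using z r(2) by (auto simp: d_def dist_norm norm_minus_commute)
      have "C * cmod (z - w) \<le> (C + 1) * (e / (C + 1))" using z C0 by (intro mult_mono) (auto simp: d_def)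
      also have "\<dots> = e" using C0 by simp
      finally have "C * cmod (z - w) * cmod (z - w) \<le> e * cmod (z - w)" by (rule mult_right_mono) simp
      then show ?thesis using est[OF zU] by simp
    qed
    then show "\<exists>d>0. \<forall>z. norm (z - w) < d \<longrightarrow> norm (cinner (?R z x) y - cinner (?R w x) y - D * (z - w)) \<le> e * norm (z - w)"
      using d by blast
  qed
  then show "(\<lambda>w. cinner (?R w x) y) field_differentiable at w within U"
    using field_differentiable_at_within field_differentiable_def by blast
qed

lemma blinfun_form_le: "cmod (cinner (blinfun_apply f x) y) \<le> norm f * norm x * norm y"
  using order_trans[OF cinner_cmod_le mult_right_mono[OF norm_blinfun norm_ge_zero]] .

context resonance
begin

text \<open>Evaluating the resolvent at \<open>\<mu> + c\<close> amounts to moving the spectrum of \<open>A1 + X\<close> by \<open>- c\<close>, off the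
  closed half-plane that contains \<open>D l\<close>.  Cauchy's theorem then yields a value that does not involve
  \<open>\<gamma>\<close>.\<close>

lemma shifted_integral_over_interval:
  assumes adm: "admissible K m1 m2 (D l) \<gamma>" and l: "l \<in> {1, -1}" and X: "complex_linear X" and \<epsilon>: "\<epsilon> > 0"
    and half: "\<And>z. eigenval (\<lambda>u. A1 u + blinfun_apply X u) z \<Longrightarrow> real_of_int l * Im z \<le> 0"
  defines "c \<equiv> \<i> * of_real (real_of_int l * \<epsilon>)"
  shows "integral I (\<lambda>s. tangent \<gamma> I s * cinner (K (\<gamma> s) (R X (\<gamma> s + c) x)) y) =
    (\<Sum>t\<in>S. integral I (\<lambda>\<mu>. cinner (R X (of_real \<mu> + c) x) t * cinner (K (of_real \<mu>) t) y))"
proof -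
  define T where "T = (\<lambda>u. A1 u + X u)"
  have T: "clin T" unfolding T_def by (rule Z_clin[OF X])
  have lpm: "l = 1 \<or> l = -1" using l by simp
  \<comment> \<open>half of the shift is kept as a margin, to have the resolvent on an open neighbourhood \<open>U\<close> of the
    closed half-plane\<close>
  define H where "H = {z. real_of_int l * Im z \<ge> \<epsilon> / 2}"
  have "closed H" unfolding H_def by (intro closed_Collect_le continuous_intros)
  moreover have "\<not> eigenval T z" if "z \<in> H" for z using half[of z] that \<epsilon> unfolding T_def H_def by auto
  ultimately obtain \<delta> where \<delta>: "\<delta> > 0" "\<And>w x. w \<in> H \<Longrightarrow> \<delta> * norm x \<le> norm (T x - w *\<^sub>C x)"
    using uniform_resolvent_bound[OF onb T] by metis
  define U where "U = {z. real_of_int l * Im z > - \<epsilon> / 2}"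
  have Uo: "open U" unfolding U_def by (intro open_Collect_less continuous_intros)
  have Uh: "{z. real_of_int l * Im z \<ge> 0} \<subseteq> U" using \<epsilon> by (auto simp: U_def)
  have shift: "z + c \<in> H" if "z \<in> U" for z
    using that lpm \<epsilon> by (auto simp: U_def H_def c_def)
  define g where "g = (\<lambda>t z. cinner (resolvent UNIV T (z + c) x) t)"
  have "(\<lambda>w. cinner (resolvent UNIV T w x) t) holomorphic_on {z. real_of_int l * Im z > \<epsilon> / 2}" for t
    by (rule resolvent_holomorphic[OF onb T _ \<delta>(1)])
       (auto simp: H_def intro!: open_Collect_less continuous_intros \<delta>(2))
  then have "((\<lambda>w. cinner (resolvent UNIV T w x) t) \<circ> (\<lambda>z. z + c)) holomorphic_on U" for t
  proof (rule holomorphic_on_compose_gen[rotated])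
    show "(\<lambda>z. z + c) holomorphic_on U" by (intro holomorphic_intros)
    show "(\<lambda>z. z + c) ` U \<subseteq> {z. real_of_int l * Im z > \<epsilon> / 2}"
      using lpm \<epsilon> by (auto simp: U_def c_def)
  qed
  then have ghol: "g t holomorphic_on U" for t by (simp add: g_def o_def)
  have gle: "cmod (g t z) \<le> norm x / \<delta>" if "t \<in> S" "z \<in> U" for t z
  proof -
    note Rp = finite_dim_resolvent[OF onb T \<delta>(1) \<delta>(2)[OF shift[OF that(2)]]]
    have "cmod (g t z) \<le> norm (resolvent UNIV T (z + c) x) * norm t" unfolding g_def by (rule cinner_cmod_le)
    then show ?thesis using Rp(5)[of x] onb_norm[OF onb that(1)] by simp
  qed
  have \<gamma>D: "\<gamma> s \<in> D l" if "s \<in> I" for s using adm that unfolding admissible_def contour_def by blast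
  have \<gamma>U: "\<gamma> s \<in> U" if "s \<in> I" for s
    using \<gamma>D[OF that] D_facts(1)[OF l] Uh by (auto intro: less_imp_le)
  have Klin: "complex_linear (K (\<gamma> s))" if "s \<in> I" for s
    using \<gamma>D[OF that] D_facts(2)[OF l] by (intro K_linear_D) blast
  have con: "continuous_on I \<gamma>" using adm contour_continuous[of K m1 m2 "D l" \<gamma>] by (simp add: admissible_def)
  have gcont: "continuous_on I (\<lambda>s. g t (\<gamma> s))" for t
    by (rule continuous_on_compose2[OF holomorphic_on_imp_continuous_on[OF ghol] con]) (use \<gamma>U in auto)
  have ti: "(\<lambda>s. g t (\<gamma> s) * cinner (K (\<gamma> s) t) y * tangent \<gamma> I s) integrable_on I" if t: "t \<in> S" for t
  proof -
    have q: "0 \<le> norm x / \<delta>" using \<delta>(1) by simp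
    have Q2: "norm (g t (\<gamma> s) *\<^sub>C v) \<le> norm x / \<delta> * norm v" if "s \<in> I" for s v
      unfolding norm_scaleC using gle[OF t \<gamma>U[OF that]] by (rule mult_right_mono) simp
    have Q3: "continuous_on I (\<lambda>s. g t (\<gamma> s) *\<^sub>C v)" for v by (intro scaleC.continuous_on gcont continuous_on_const)
    from contour_op_integral(4)[OF adm l clin_scaleC Q2 Q3 q, of t y]
    have i: "(\<lambda>s. tangent \<gamma> I s * cinner (K (\<gamma> s) (g t (\<gamma> s) *\<^sub>C t)) y) integrable_on I" .
    show ?thesis
      by (rule integrable_eq[OF i]) (simp add: clin_simps(2)[OF complex_linear_clin[OF Klin]] cinner_scaleC_left)
  qed
  have "integral I (\<lambda>s. tangent \<gamma> I s * cinner (K (\<gamma> s) (R X (\<gamma> s + c) x)) y)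
      = integral I (\<lambda>s. \<Sum>t\<in>S. g t (\<gamma> s) * cinner (K (\<gamma> s) t) y * tangent \<gamma> I s)"
  proof (rule integral_cong)
    fix s assume s: "s \<in> I"
    have "K (\<gamma> s) (resolvent UNIV T (\<gamma> s + c) x) = (\<Sum>t\<in>S. g t (\<gamma> s) *\<^sub>C K (\<gamma> s) t)"
      unfolding g_def by (rule onb_clin_eq[OF onb complex_linear_clin[OF Klin[OF s]]])
    then show "tangent \<gamma> I s * cinner (K (\<gamma> s) (R X (\<gamma> s + c) x)) y = (\<Sum>t\<in>S. g t (\<gamma> s) * cinner (K (\<gamma> s) t) y * tangent \<gamma> I s)"
      by (simp add: T_def cinner_simps sum_distrib_left mult_ac)
  qed
  also have "\<dots> = (\<Sum>t\<in>S. integral I (\<lambda>s. g t (\<gamma> s) * cinner (K (\<gamma> s) t) y * tangent \<gamma> I s))"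
    using onb ti by (intro integral_sum) (auto simp: onb_def)
  also have "\<dots> = (\<Sum>t\<in>S. integral I (\<lambda>\<mu>. g t (of_real \<mu>) * cinner (K (of_real \<mu>) t) y))"
  proof (rule sum.cong[OF refl])
    fix t assume t: "t \<in> S"
    show "integral I (\<lambda>s. g t (\<gamma> s) * cinner (K (\<gamma> s) t) y * tangent \<gamma> I s) = integral I (\<lambda>\<mu>. g t (of_real \<mu>) * cinner (K (of_real \<mu>) t) y)"
      by (rule K_contour[OF l adm Uo Uh ghol]) (use gle[OF t] Uh in blast)
  qed
  finally show ?thesis by (simp add: g_def T_def)
qed

text \<open>The contour keeps a positive distance from the spectrum of \<open>A1 + X\<close>, so a shift by \<open>\<epsilon>\<close> changes the
  resolvent on it by an amount of the order of \<open>\<epsilon>\<close>.\<close>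

lemma shifted_integral_near:
  assumes sm: "small l \<gamma>" and l: "l \<in> {1, -1}" and X: "complex_linear X" "norm X \<le> \<rho>" and \<rho>: "\<rho> < dst \<gamma>"
  obtains C \<epsilon>0 where "\<epsilon>0 > 0" "C \<ge> 0" "\<And>\<epsilon>. 0 < \<epsilon> \<Longrightarrow> \<epsilon> < \<epsilon>0 \<Longrightarrow>
    cmod (cinner (W \<gamma> X x) y + integral I (\<lambda>s. tangent \<gamma> I s * cinner (K (\<gamma> s) (R X (\<gamma> s + \<i> * of_real (real_of_int l * \<epsilon>)) x)) y)) \<le> C * \<epsilon>"
proof -
  note adm = small_contour_facts(1)[OF sm] and v0 = small_contour_facts(2)[OF sm]
  have lpm: "l = 1 \<or> l = -1" using l by simp
  define e where "e = (dst \<gamma> - \<rho>) / 2"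
  have e: "e > 0" using \<rho> by (simp add: e_def)
  define C where "C = var \<gamma> / e\<^sup>2 * (norm x * norm y)"
  have "cmod (cinner (W \<gamma> X x) y + integral I (\<lambda>s. tangent \<gamma> I s * cinner (K (\<gamma> s) (R X (\<gamma> s + \<i> * of_real (real_of_int l * \<epsilon>)) x)) y)) \<le> C * \<epsilon>"
    if \<epsilon>: "0 < \<epsilon>" "\<epsilon> < e" for \<epsilon>
  proof -
    define c where "c = \<i> * complex_of_real (real_of_int l * \<epsilon>)"
    have nc: "cmod c = \<epsilon>" using lpm \<epsilon>(1) by (auto simp: c_def norm_mult)
    have low0: "e * norm x \<le> norm (A1 x + X x - (\<gamma> s + 0) *\<^sub>C x)" if "s \<in> I" for s x
    proof -
      have "e * norm x \<le> (dst \<gamma> - \<rho>) * norm x" using e by (intro mult_right_mono) (auto simp: e_def)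
      then show ?thesis using small_lower[OF sm that X(2), of x] by simp
    qed
    have lowc: "e * norm x \<le> norm (A1 x + X x - (\<gamma> s + c) *\<^sub>C x)" if s: "s \<in> I" for s x
    proof -
      have "dst \<gamma> - e \<le> cmod (\<gamma> s + c - k)" if "k \<in> \<sigma>" for k
        using small_contour_facts(8)[OF sm that s] norm_triangle_ineq4[of "\<gamma> s + c - k" c] nc \<epsilon>(2) by (simp add: algebra_simps)
      from Z_lower[OF small_contour_facts(7)[OF sm] this X(2)]
      have "(dst \<gamma> - e - \<rho>) * norm x \<le> norm (A1 x + X x - (\<gamma> s + c) *\<^sub>C x)" .
      moreover have "dst \<gamma> - e - \<rho> = e" by (simp add: e_def field_simps)
      ultimately show ?thesis by simp
    qed
    note T = Z_clin[OF X(1)]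
    note R0 = finite_dim_resolvent[OF onb T e low0] and Rc = finite_dim_resolvent[OF onb T e lowc]
    define Q where "Q = (\<lambda>s x. R X (\<gamma> s + 0) x - R X (\<gamma> s + c) x)"
    have Q1: "clin (Q s)" if "s \<in> I" for s
      by (simp add: clin_def Q_def clin_simps[OF R0(2)[OF that]] clin_simps[OF Rc(2)[OF that]] scaleC.diff_right del: add_0_right)
    have Q2: "norm (Q s x) \<le> \<epsilon> / e\<^sup>2 * norm x" if s: "s \<in> I" for s x
    proof -
      have eq: "Q s x = R X (\<gamma> s + 0) ((- c) *\<^sub>C R X (\<gamma> s + c) x)"
        using finite_dim_resolvent_diff[OF onb T T e low0[OF s] lowc[OF s], of x] by (simp add: Q_def)
      have "norm (Q s x) \<le> norm ((- c) *\<^sub>C R X (\<gamma> s + c) x) / e" unfolding eq by (rule R0(5)[OF s])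
      also have "\<dots> = \<epsilon> * norm (R X (\<gamma> s + c) x) / e" by (simp add: norm_scaleC nc)
      also have "\<dots> \<le> \<epsilon> * (norm x / e) / e" using e \<epsilon> Rc(5)[OF s, of x] by (intro divide_right_mono mult_left_mono) auto
      finally show ?thesis by (simp add: power2_eq_square)
    qed
    have c0: "continuous_on I (\<lambda>s. R X (\<gamma> s + 0) x)" for x by (rule resolvent_continuous_along[OF adm T e low0])
    have cc: "continuous_on I (\<lambda>s. R X (\<gamma> s + c) x)" for x by (rule resolvent_continuous_along[OF adm T e lowc])
    have Q3: "continuous_on I (\<lambda>s. Q s x)" for x unfolding Q_def by (intro continuous_on_diff c0 cc)
    have q: "0 \<le> \<epsilon> / e\<^sup>2" using \<epsilon> by simp
    note oi = contour_op_integral[OF adm l Q1 Q2 Q3 q]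
    have b: "norm (R X (\<gamma> s + c) x) \<le> 1 / e * norm x" if "s \<in> I" for s x using Rc(5)[OF that, of x] by simp
    have q': "0 \<le> 1 / e" using e by simp
    note ic = contour_op_integral(4)[OF adm l Rc(2) b cc q', of x y]
    note i0 = W_integral(5)[OF sm l X \<rho>, of x y]
    let ?f = "integral I (\<lambda>s. tangent \<gamma> I s *\<^sub>C (K (\<gamma> s) o\<^sub>L Blinfun (Q s)))"
    have "cinner (?f x) y = integral I (\<lambda>s. tangent \<gamma> I s * cinner (K (\<gamma> s) (Q s x)) y)" by (rule oi(3))
    also have "\<dots> = integral I (\<lambda>s. tangent \<gamma> I s * cinner (K (\<gamma> s) (R X (\<gamma> s) x)) y - tangent \<gamma> I s * cinner (K (\<gamma> s) (R X (\<gamma> s + c) x)) y)"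
      by (intro integral_cong) (simp add: Q_def blinfun.diff_right cinner.diff_left right_diff_distrib)
    also have "\<dots> = integral I (\<lambda>s. tangent \<gamma> I s * cinner (K (\<gamma> s) (R X (\<gamma> s) x)) y) - integral I (\<lambda>s. tangent \<gamma> I s * cinner (K (\<gamma> s) (R X (\<gamma> s + c) x)) y)"
      by (rule Henstock_Kurzweil_Integration.integral_diff[OF i0 ic])
    finally have "cinner (W \<gamma> X x) y + integral I (\<lambda>s. tangent \<gamma> I s * cinner (K (\<gamma> s) (R X (\<gamma> s + c) x)) y) = - cinner (?f x) y"
      unfolding W_integral(4)[OF sm l X \<rho>] by simp
    then have "cmod (cinner (W \<gamma> X x) y + integral I (\<lambda>s. tangent \<gamma> I s * cinner (K (\<gamma> s) (R X (\<gamma> s + c) x)) y)) = cmod (cinner (?f x) y)"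
      by (simp only: norm_minus_cancel)
    also have "\<dots> \<le> norm ?f * norm x * norm y" by (rule blinfun_form_le)
    also have "\<dots> \<le> (\<epsilon> / e\<^sup>2 * var \<gamma>) * norm x * norm y" by (intro mult_right_mono oi(5)) auto
    also have "\<dots> = C * \<epsilon>" by (simp add: C_def mult_ac)
    finally show ?thesis by (simp add: c_def)
  qed
  moreover have "C \<ge> 0" using v0 by (simp add: C_def)
  ultimately show ?thesis using that e by blast
qed

text \<open>Up to an amount of the order of \<open>\<epsilon>\<close>, both forms are minus the same sum of integrals over the
  interval.\<close>

lemma W_contour_independent:
  assumes sm: "small l \<gamma>" "small l \<gamma>'" and l: "l \<in> {1, -1}"
    and X: "complex_linear X" "norm X \<le> rmin \<gamma>" "norm X \<le> rmin \<gamma>'" "W \<gamma> X = X"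
  shows "W \<gamma>' X = X"
proof -
  have lt: "rmin \<gamma> < dst \<gamma>" "rmin \<gamma>' < dst \<gamma>'"
    using small_contour_facts(3,5)[OF sm(1)] small_contour_facts(3,5)[OF sm(2)] by simp_all
  have half: "real_of_int l * Im z \<le> 0" if "eigenval (\<lambda>u. A1 u + X u) z" for z
    using that fixpoint_eigenvalue(2)[OF sm(1) l X(1,2,4)] unfolding eigenval_def by blast
  have "cinner (W \<gamma>' X x) y = cinner (W \<gamma> X x) y" for x y
  proof -
    obtain C d where C: "d > 0" "C \<ge> 0" "\<And>\<epsilon>. 0 < \<epsilon> \<Longrightarrow> \<epsilon> < d \<Longrightarrow>
      cmod (cinner (W \<gamma> X x) y + integral I (\<lambda>s. tangent \<gamma> I s * cinner (K (\<gamma> s) (R X (\<gamma> s + \<i> * of_real (real_of_int l * \<epsilon>)) x)) y)) \<le> C * \<epsilon>"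
      using shifted_integral_near[OF sm(1) l X(1,2) lt(1)] by blast
    obtain C' d' where C': "d' > 0" "C' \<ge> 0" "\<And>\<epsilon>. 0 < \<epsilon> \<Longrightarrow> \<epsilon> < d' \<Longrightarrow>
      cmod (cinner (W \<gamma>' X x) y + integral I (\<lambda>s. tangent \<gamma>' I s * cinner (K (\<gamma>' s) (R X (\<gamma>' s + \<i> * of_real (real_of_int l * \<epsilon>)) x)) y)) \<le> C' * \<epsilon>"
      using shifted_integral_near[OF sm(2) l X(1,3) lt(2)] by blast
    have "cmod (cinner (W \<gamma>' X x) y - cinner (W \<gamma> X x) y) \<le> 0"
    proof (rule field_le_epsilon)
      fix \<eta> :: real assume \<eta>: "\<eta> > 0"
      define \<epsilon> where "\<epsilon> = min (min d d' / 2) (\<eta> / (C + C' + 1))"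
      have "\<eta> / (C + C' + 1) > 0" using \<eta> C(2) C'(2) by simp
      then have \<epsilon>: "0 < \<epsilon>" "\<epsilon> < d" "\<epsilon> < d'" "\<epsilon> \<le> \<eta> / (C + C' + 1)"
        using C(1) C'(1) unfolding \<epsilon>_def by linarith+
      define J where "J = (\<Sum>t\<in>S. integral I (\<lambda>\<mu>. cinner (R X (of_real \<mu> + \<i> * of_real (real_of_int l * \<epsilon>)) x) t * cinner (K (of_real \<mu>) t) y))"
      have 1: "cmod (cinner (W \<gamma> X x) y + J) \<le> C * \<epsilon>"
        using C(3)[OF \<epsilon>(1,2)] shifted_integral_over_interval[OF small_contour_facts(1)[OF sm(1)] l X(1) \<epsilon>(1) half, of x y] by (simp add: J_def)
      have 2: "cmod (cinner (W \<gamma>' X x) y + J) \<le> C' * \<epsilon>"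
        using C'(3)[OF \<epsilon>(1,3)] shifted_integral_over_interval[OF small_contour_facts(1)[OF sm(2)] l X(1) \<epsilon>(1) half, of x y] by (simp add: J_def)
      have "cmod (cinner (W \<gamma>' X x) y - cinner (W \<gamma> X x) y) \<le> C' * \<epsilon> + C * \<epsilon>"
        using norm_triangle_ineq4[of "cinner (W \<gamma>' X x) y + J" "cinner (W \<gamma> X x) y + J"] 1 2 by simp
      also have "\<dots> \<le> (C + C' + 1) * (\<eta> / (C + C' + 1))"
        using \<epsilon> C(2) C'(2) mult_mono[of "C + C'" "C + C' + 1" \<epsilon> "\<eta> / (C + C' + 1)"] by (simp add: algebra_simps)
      also have "\<dots> = \<eta>" using C(2) C'(2) by simp
      finally show "cmod (cinner (W \<gamma>' X x) y - cinner (W \<gamma> X x) y) \<le> 0 + \<eta>" by simp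
    qed
    then show ?thesis by simp
  qed
  then have "W \<gamma>' X = W \<gamma> X" by (intro blinfun_eqI, rule cinner_eq_imp_eq)
  then show ?thesis using X(4) by simp
qed

text \<open>Of two contours, the solution for the one with the smaller radius lies in the ball of the other and
  solves its equation as well; by uniqueness in that ball the two solutions coincide.\<close>

lemma X_op_characterization:
  assumes l: "l \<in> {1, -1}" and ex: "small l \<gamma>0"
  defines "X \<equiv> X_op K m1 m2 UNIV A1 Dm l"
  shows "complex_linear X" and "\<And>\<gamma>. small l \<gamma> \<Longrightarrow> norm X \<le> rmin \<gamma> \<and> W \<gamma> X = X"
proof -
  define fx where "fx = (\<lambda>\<gamma>. THE X. X \<in> {X. complex_linear X \<and> norm X \<le> rmin \<gamma>} \<and> W \<gamma> X = X)"
  have fp: "complex_linear (fx \<gamma>)" "norm (fx \<gamma>) \<le> rmin \<gamma>" "W \<gamma> (fx \<gamma>) = fx \<gamma>" if "small l \<gamma>" for \<gamma>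
    using theI'[OF W_fixpoint[OF that l]] by (auto simp: fx_def)
  have uniq: "X = fx \<gamma>" if "small l \<gamma>" "complex_linear X" "norm X \<le> rmin \<gamma>" "W \<gamma> X = X" for X \<gamma>
    using W_fixpoint[OF that(1) l] that(2-4) fp[OF that(1)] by blast
  \<comment> \<open>the smaller ball is contained in the larger one, where solutions are unique\<close>
  have le: "fx \<gamma> = fx \<gamma>'" if "small l \<gamma>" "small l \<gamma>'" "rmin \<gamma> \<le> rmin \<gamma>'" for \<gamma> \<gamma>'
  proof (rule uniq[OF that(2)])
    show nr: "norm (fx \<gamma>) \<le> rmin \<gamma>'" using fp(2)[OF that(1)] that(3) by simp
    show "W \<gamma>' (fx \<gamma>) = fx \<gamma>" by (rule W_contour_independent[OF that(1,2) l fp(1,2)[OF that(1)] nr fp(3)[OF that(1)]])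
  qed (rule fp(1)[OF that(1)])
  have all: "fx \<gamma> = fx \<gamma>'" if "small l \<gamma>" "small l \<gamma>'" for \<gamma> \<gamma>'
    using le[OF that] le[OF that(2,1)] by (cases "rmin \<gamma> \<le> rmin \<gamma>'") auto
  have "X = fx \<gamma>0"
    unfolding X_def X_op_def
  proof (rule the_equality)
    have disj: "spectrum UNIV (\<lambda>u. A1 u + fx \<gamma>0 u) \<inter> \<gamma>0 ` I = {}"
    proof -
      have lt: "dst \<gamma>0 - rmin \<gamma>0 > 0" using small_contour_facts(3,5)[OF ex] by simp
      have "\<gamma>0 s \<notin> spectrum UNIV (\<lambda>u. A1 u + fx \<gamma>0 u)" if "s \<in> I" for s
        by (rule finite_dim_resolvent(1)[OF onb Z_clin[OF fp(1)[OF ex]] lt small_lower[OF ex that fp(2)[OF ex]]])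
      then show ?thesis by auto
    qed
    show "complex_linear (fx \<gamma>0) \<and> (\<exists>\<gamma>. small l \<gamma> \<and>
        spectrum UNIV (\<lambda>u. A1 u + fx \<gamma>0 u) \<inter> \<gamma> ` I = {} \<and> fx \<gamma>0 = W \<gamma> (fx \<gamma>0) \<and> norm (fx \<gamma>0) \<le> rmin \<gamma>)"
      by (intro conjI exI[of _ \<gamma>0] fp(1)[OF ex] ex disj fp(3)[OF ex, symmetric] fp(2)[OF ex])
    fix Y assume "complex_linear Y \<and> (\<exists>\<gamma>. small l \<gamma> \<and>
        spectrum UNIV (\<lambda>u. A1 u + blinfun_apply Y u) \<inter> \<gamma> ` I = {} \<and> Y = W \<gamma> Y \<and> norm Y \<le> rmin \<gamma>)"
    then obtain \<gamma> where \<gamma>: "small l \<gamma>" "Y = W \<gamma> Y" "norm Y \<le> rmin \<gamma>" and Y: "complex_linear Y" by blast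
    have "Y = fx \<gamma>" by (rule uniq[OF \<gamma>(1) Y \<gamma>(3) \<gamma>(2)[symmetric]])
    then show "Y = fx \<gamma>0" using all[OF \<gamma>(1) ex] by simp
  qed
  then have Xf: "X = fx \<gamma>" if "small l \<gamma>" for \<gamma> using all[OF ex that] by simp
  show "complex_linear X" using Xf[OF ex] fp(1)[OF ex] by simp
  show "norm X \<le> rmin \<gamma> \<and> W \<gamma> X = X" if "small l \<gamma>" for \<gamma> using Xf[OF that] fp[OF that] by simp
qed

end

section \<open>Reflection in the real axis\<close>

text \<open>Countably many intervals with rational end points exhaust the interior of \<open>J\<close>, and the frontier of an
  interval is negligible.\<close>

lemma rectifiable_derivative_ae:
  assumes rect: "rectifiable_on \<gamma> J" and J: "convex J"
  shows "negligible {s\<in>J. \<not> (s \<in> interior J \<and> (\<gamma> has_vector_derivative tangent \<gamma> J s) (at s))}"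
proof -
  define bad where "bad = (\<lambda>a b. {s\<in>{a<..<b}. \<not> (\<gamma> has_vector_derivative tangent \<gamma> J s) (at s)})"
  define R where "R = {(a::real, b). a \<in> \<rat> \<and> b \<in> \<rat> \<and> {a..b} \<subseteq> J}"
  have "negligible (bad a b)" if ab: "(a, b) \<in> R" for a b
    unfolding bad_def
  proof (rule AE_has_vector_derivative_indefinite_integral)
    have sub: "{a..b} \<subseteq> J" using ab by (simp add: R_def)
    show "tangent \<gamma> J integrable_on {a..b}"
      using tangent_locally_integrable[OF rect sub] by (simp add: absolutely_integrable_on_def)
    show "(tangent \<gamma> J has_integral \<gamma> s' - \<gamma> s) {s..s'}" if "a \<le> s" "s \<le> s'" "s' \<le> b" for s s'
    proof -
      have "s \<in> J" "s' \<in> J" using that sub by auto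
      then show ?thesis using rect that(2) unfolding rectifiable_on_def by blast
    qed
  qed
  moreover have "countable R"
    by (rule countable_subset[of _ "\<rat> \<times> \<rat>"]) (auto simp: R_def countable_rat)
  ultimately have "negligible (\<Union>((\<lambda>(a, b). bad a b) ` R))"
    by (intro negligible_countable_Union) auto
  moreover have "negligible (frontier J)" by (rule negligible_convex_frontier[OF J])
  ultimately have "negligible (\<Union>((\<lambda>(a, b). bad a b) ` R) \<union> frontier J)" by (rule negligible_Un)
  then show ?thesis
  proof (rule negligible_subset)
    show "{s\<in>J. \<not> (s \<in> interior J \<and> (\<gamma> has_vector_derivative tangent \<gamma> J s) (at s))} \<subseteq> \<Union>((\<lambda>(a, b). bad a b) ` R) \<union> frontier J"
    proof
      fix s assume s: "s \<in> {s\<in>J. \<not> (s \<in> interior J \<and> (\<gamma> has_vector_derivative tangent \<gamma> J s) (at s))}"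
      show "s \<in> \<Union>((\<lambda>(a, b). bad a b) ` R) \<union> frontier J"
      proof (cases "s \<in> interior J")
        case True
        then obtain e where e: "e > 0" "ball s e \<subseteq> J" by (auto simp: mem_interior)
        obtain a where a: "a \<in> \<rat>" "s - e < a" "a < s" using Rats_dense_in_real[of "s - e" s] e(1) by auto
        obtain b where b: "b \<in> \<rat>" "s < b" "b < s + e" using Rats_dense_in_real[of s "s + e"] e(1) by auto
        have "{a..b} \<subseteq> ball s e" using a b by (auto simp: dist_real_def)
        then have "(a, b) \<in> R" using a b e(2) by (auto simp: R_def)
        moreover have "s \<in> bad a b" using s True a b by (simp add: bad_def)
        ultimately show ?thesis by blast
      next
        case False
        then have "s \<in> frontier J" using s closure_subset[of J] by (auto simp: frontier_def)
        then show ?thesis by blast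
      qed
    qed
  qed
qed

text \<open>Where the curve is not differentiable, the value of \<open>tangent\<close> is an unspecified constant, so
  conjugation commutes with \<open>tangent\<close> only almost everywhere.\<close>

lemma tangent_cnj_ae:
  assumes "rectifiable_on \<gamma> J" "convex J"
  obtains N where "negligible N" "\<And>s. s \<in> J - N \<Longrightarrow> tangent (\<lambda>s. cnj (\<gamma> s)) J s = cnj (tangent \<gamma> J s)"
proof (rule that[OF rectifiable_derivative_ae[OF assms]])
  fix s assume "s \<in> J - {s\<in>J. \<not> (s \<in> interior J \<and> (\<gamma> has_vector_derivative tangent \<gamma> J s) (at s))}"
  then have s: "s \<in> interior J" "(\<gamma> has_vector_derivative tangent \<gamma> J s) (at s)" by auto
  have "((\<lambda>s. cnj (\<gamma> s)) has_vector_derivative cnj (tangent \<gamma> J s)) (at s)"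
    by (rule bounded_linear.has_vector_derivative[OF bounded_linear_cnj s(2)])
  then show "tangent (\<lambda>s. cnj (\<gamma> s)) J s = cnj (tangent \<gamma> J s)"
    unfolding tangent_def[of "\<lambda>s. cnj (\<gamma> s)"] at_within_interior[OF s(1)] by (rule vector_derivative_at)
qed

lemma reflect_rectifiable:
  assumes rect: "rectifiable_on \<gamma> J" and J: "convex J"
  shows "rectifiable_on (\<lambda>s. cnj (\<gamma> s)) J"
    and "(\<And>s. s \<in> J \<Longrightarrow> norm (K (cnj (\<gamma> s))) = norm (K (\<gamma> s))) \<Longrightarrow> finite_variation K \<gamma> J \<Longrightarrow> finite_variation K (\<lambda>s. cnj (\<gamma> s)) J"
    and "(\<And>s. s \<in> J \<Longrightarrow> norm (K (cnj (\<gamma> s))) = norm (K (\<gamma> s))) \<Longrightarrow> variation K (\<lambda>s. cnj (\<gamma> s)) J = variation K \<gamma> J"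
proof -
  obtain N where N: "negligible N" "\<And>s. s \<in> J - N \<Longrightarrow> tangent (\<lambda>s. cnj (\<gamma> s)) J s = cnj (tangent \<gamma> J s)"
    using tangent_cnj_ae[OF rect J] by blast
  show "rectifiable_on (\<lambda>s. cnj (\<gamma> s)) J"
    unfolding rectifiable_on_def
  proof (intro conjI allI ballI impI)
    fix a b :: real
    have "tangent \<gamma> J absolutely_integrable_on (J \<inter> {a..b})" using rect by (simp add: rectifiable_on_def)
    from absolutely_integrable_linear[OF this bounded_linear_cnj]
    have "(\<lambda>s. cnj (tangent \<gamma> J s)) absolutely_integrable_on (J \<inter> {a..b})" by (simp add: o_def)
    then show "tangent (\<lambda>s. cnj (\<gamma> s)) J absolutely_integrable_on (J \<inter> {a..b})"
      by (rule absolutely_integrable_spike[OF _ N(1)]) (use N(2) in auto)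
  next
    fix a b assume ab: "a \<in> J" "b \<in> J" "a \<le> b"
    have sub: "{a..b} \<subseteq> J"
      using J ab unfolding is_interval_convex_1[symmetric] is_interval_1 by (meson atLeastAtMost_iff subsetI)
    have "(tangent \<gamma> J has_integral (\<gamma> b - \<gamma> a)) {a..b}" using rect ab by (simp add: rectifiable_on_def)
    from has_integral_linear[OF this bounded_linear_cnj]
    have "((\<lambda>s. cnj (tangent \<gamma> J s)) has_integral (cnj (\<gamma> b) - cnj (\<gamma> a))) {a..b}" by (simp add: o_def)
    then show "(tangent (\<lambda>s. cnj (\<gamma> s)) J has_integral (cnj (\<gamma> b) - cnj (\<gamma> a))) {a..b}"
      by (rule has_integral_spike[OF N(1), rotated]) (use N(2) sub in auto)
  qed
  assume K: "\<And>s. s \<in> J \<Longrightarrow> norm (K (cnj (\<gamma> s))) = norm (K (\<gamma> s))"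
  have eq: "norm (K (cnj (\<gamma> s))) * cmod (tangent (\<lambda>s. cnj (\<gamma> s)) J s) = norm (K (\<gamma> s)) * cmod (tangent \<gamma> J s)"
    if "s \<in> J - N" for s using N(2)[OF that] K that by simp
  show "variation K (\<lambda>s. cnj (\<gamma> s)) J = variation K \<gamma> J"
    unfolding variation_def by (rule integral_spike[OF N(1) eq[symmetric]])
  assume "finite_variation K \<gamma> J"
  then show "finite_variation K (\<lambda>s. cnj (\<gamma> s)) J"
    unfolding finite_variation_def by (rule integrable_spike[OF _ N(1) eq])
qed

lemma reflect_end_condition:
  assumes ec: "end_condition K H F m" and sub: "\<forall>\<^sub>F s in F. s \<in> J"
    and K: "\<And>t s. t \<in> {0..1} \<Longrightarrow> s \<in> J \<Longrightarrow> norm (K (cnj (H t s))) = norm (K (H t s))"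
  shows "end_condition K (\<lambda>t s. cnj (H t s)) F m"
proof (cases "\<bar>m\<bar> \<noteq> \<infinity>")
  case True
  have "dist (cnj z) (complex_of_real p) = dist z (of_real p)" for z p
    unfolding dist_norm by (metis complex_cnj_complex_of_real complex_cnj_diff complex_mod_cnj)
  then show ?thesis using ec True by (simp add: end_condition_def uniform_limit_iff)
next
  case False
  then have far: "\<forall>R. \<forall>\<^sub>F s in F. \<forall>t\<in>{0..1}. R \<le> cmod (H t s)"
    and cross: "\<And>\<epsilon>. \<epsilon> > 0 \<Longrightarrow> \<exists>\<^sub>F s in F. rectifiable_on (\<lambda>t. H t s) {0..1} \<and>
             finite_variation K (\<lambda>t. H t s) {0..1} \<and> variation K (\<lambda>t. H t s) {0..1} < \<epsilon>"
    using ec by (simp_all add: end_condition_def)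
  have "\<exists>\<^sub>F s in F. rectifiable_on (\<lambda>t. cnj (H t s)) {0..1} \<and>
             finite_variation K (\<lambda>t. cnj (H t s)) {0..1} \<and> variation K (\<lambda>t. cnj (H t s)) {0..1} < \<epsilon>" if "\<epsilon> > 0" for \<epsilon>
  proof (rule frequently_elim1[OF frequently_eventually_frequently[OF cross[OF that] sub]])
    fix s assume "(rectifiable_on (\<lambda>t. H t s) {0..1} \<and> finite_variation K (\<lambda>t. H t s) {0..1} \<and>
        variation K (\<lambda>t. H t s) {0..1} < \<epsilon>) \<and> s \<in> J"
    then have r: "rectifiable_on (\<lambda>t. H t s) {0..1}" "finite_variation K (\<lambda>t. H t s) {0..1}"
      "variation K (\<lambda>t. H t s) {0..1} < \<epsilon>" and s: "s \<in> J" by auto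
    have c: "convex {0..1::real}" by simp
    note rr = reflect_rectifiable[OF r(1) c]
    show "rectifiable_on (\<lambda>t. cnj (H t s)) {0..1} \<and> finite_variation K (\<lambda>t. cnj (H t s)) {0..1} \<and>
        variation K (\<lambda>t. cnj (H t s)) {0..1} < \<epsilon>"
      using rr(1) rr(2)[OF K[OF _ s] r(2)] rr(3)[OF K[OF _ s]] r(3) by simp
  qed
  then show ?thesis using far False by (simp add: end_condition_def)
qed

lemma reflect_contour:
  assumes m: "m1 < m2" and con: "contour K m1 m2 D \<gamma>"
    and K: "\<And>z. z \<in> D \<union> complex_of_real ` einterval m1 m2 \<Longrightarrow> norm (K (cnj z)) = norm (K z)"
  shows "contour K m1 m2 (cnj ` D) (\<lambda>s. cnj (\<gamma> s))"
proof -
  let ?I = "einterval m1 m2"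
  obtain H where H: "continuous_on ({0..1::real} \<times> ?I) (\<lambda>(t, s). H t s)"
      "\<forall>t\<in>{0..1}. \<forall>s\<in>?I. H t s \<in> D \<union> complex_of_real ` ?I"
      "\<forall>s\<in>?I. H 0 s = complex_of_real s \<and> H 1 s = \<gamma> s"
      "end_condition K H (filtermap real_of_ereal (at_right m1)) m1"
      "end_condition K H (filtermap real_of_ereal (at_left m2)) m2"
    using con unfolding contour_def by blast
  have b: "\<gamma> ` ?I \<subseteq> D" "inj_on \<gamma> ?I" "rectifiable_on \<gamma> ?I" using con by (simp_all add: contour_def)
  obtain c where c: "c \<in> ?I" using einterval_nonempty[OF m] by blast
  have KH: "norm (K (cnj (H t s))) = norm (K (H t s))" if "t \<in> {0..1}" "s \<in> ?I" for t s
    using H(2) that by (intro K) blast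
  have evR: "\<forall>\<^sub>F s in filtermap real_of_ereal (at_left m2). s \<in> ?I"
    unfolding eventually_right_end[OF m] using c by blast
  have evL: "\<forall>\<^sub>F s in filtermap real_of_ereal (at_right m1). s \<in> ?I"
    unfolding eventually_left_end[OF m] using c by blast
  have Hc: "continuous_on ({0..1} \<times> ?I) (\<lambda>(t, s). cnj (H t s))"
    using continuous_on_cnj[OF H(1)] by (simp add: case_prod_unfold)
  have Hr: "\<forall>t\<in>{0..1}. \<forall>s\<in>?I. cnj (H t s) \<in> cnj ` D \<union> complex_of_real ` ?I"
  proof (intro ballI)
    fix t s assume "t \<in> {0..1::real}" "s \<in> ?I"
    then have "H t s \<in> D \<union> complex_of_real ` ?I" using H(2) by blast
    then show "cnj (H t s) \<in> cnj ` D \<union> complex_of_real ` ?I" by auto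
  qed
  have H01: "\<forall>s\<in>?I. cnj (H 0 s) = complex_of_real s \<and> cnj (H 1 s) = cnj (\<gamma> s)" using H(3) by simp
  have inj: "inj_on (\<lambda>s. cnj (\<gamma> s)) ?I" using b(2) by (simp add: inj_on_def)
  show ?thesis
    unfolding contour_def
  proof (intro conjI exI[of _ "\<lambda>t s. cnj (H t s)"])
    show "(\<lambda>s. cnj (\<gamma> s)) ` ?I \<subseteq> cnj ` D" using b(1) by auto
    show "rectifiable_on (\<lambda>s. cnj (\<gamma> s)) ?I" by (rule reflect_rectifiable(1)[OF b(3) convex_einterval])
    show "end_condition K (\<lambda>t s. cnj (H t s)) (filtermap real_of_ereal (at_right m1)) m1"
      by (rule reflect_end_condition[OF H(4) evL KH])
    show "end_condition K (\<lambda>t s. cnj (H t s)) (filtermap real_of_ereal (at_left m2)) m2"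
      by (rule reflect_end_condition[OF H(5) evR KH])
  qed (fact inj Hc Hr H01)+
qed

context resonance
begin

lemma K_norm_cnj: "z \<in> Dm \<union> cnj ` Dm \<union> complex_of_real ` I \<Longrightarrow> norm (K (cnj z)) = norm (K z)"
proof (elim UnE)
  have "norm (K (cnj z)) = norm (K z)" if "z \<in> Dm \<union> cnj ` Dm" for z
    using K_sym[OF that] adj_cinner(3)[OF onb K_linear_D[OF that]] by simp
  then show "z \<in> Dm \<Longrightarrow> norm (K (cnj z)) = norm (K z)" "z \<in> cnj ` Dm \<Longrightarrow> norm (K (cnj z)) = norm (K z)" by blast+
qed auto

text \<open>The spectrum of \<open>A1\<close> is real and the norm of \<open>K\<close> is invariant under conjugation, so neither the
  distance nor the variation changes.\<close>

lemma small_contour_reflect: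
  assumes l: "l \<in> {1, -1}" and sm: "small l \<gamma>"
  shows "small (- l) (\<lambda>s. cnj (\<gamma> s))" and "rmin (\<lambda>s. cnj (\<gamma> s)) = rmin \<gamma>"
proof -
  note adm = small_contour_facts(1)[OF sm]
  have con: "contour K m1 m2 (D l) \<gamma>" and fv: "finite_variation K \<gamma> I" using adm by (auto simp: admissible_def)
  have rect: "rectifiable_on \<gamma> I" using con by (simp add: contour_def)
  have D: "D (- l) = cnj ` D l"
  proof -
    have "l = 1 \<or> l = -1" using l by simp
    then show ?thesis by (auto simp: D_side_def image_image)
  qed
  have Kc: "norm (K (cnj z)) = norm (K z)" if "z \<in> D l \<union> complex_of_real ` I" for z
    using that D_facts(2)[OF l] by (intro K_norm_cnj) blast
  have K\<gamma>: "norm (K (cnj (\<gamma> s))) = norm (K (\<gamma> s))" if "s \<in> I" for s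
    using small_contour_facts(9)[OF sm that] by (intro Kc) blast
  note rr = reflect_rectifiable(2,3)[OF rect convex_einterval, where K = K]
  have var: "var (\<lambda>s. cnj (\<gamma> s)) = var \<gamma>" by (rule rr(2)[OF K\<gamma>])
  have dst: "dst (\<lambda>s. cnj (\<gamma> s)) = dst \<gamma>"
  proof -
    have ds: "dist x (cnj y) = dist x y" if x: "x \<in> \<sigma>" for x y
    proof -
      obtain p where "x = of_real p" using \<sigma>1 x by blast
      then show ?thesis unfolding dist_norm by (metis complex_cnj_complex_of_real complex_cnj_diff complex_mod_cnj)
    qed
    have "{dist x y |x y. x \<in> \<sigma> \<and> y \<in> (\<lambda>s. cnj (\<gamma> s)) ` I} = {dist x y |x y. x \<in> \<sigma> \<and> y \<in> \<gamma> ` I}"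
    proof (intro set_eqI iffI)
      fix r assume "r \<in> {dist x y |x y. x \<in> \<sigma> \<and> y \<in> (\<lambda>s. cnj (\<gamma> s)) ` I}"
      then obtain x s where "x \<in> \<sigma>" "s \<in> I" "r = dist x (cnj (\<gamma> s))" by blast
      then show "r \<in> {dist x y |x y. x \<in> \<sigma> \<and> y \<in> \<gamma> ` I}" using ds by blast
    next
      fix r assume "r \<in> {dist x y |x y. x \<in> \<sigma> \<and> y \<in> \<gamma> ` I}"
      then obtain x s where "x \<in> \<sigma>" "s \<in> I" "r = dist x (cnj (\<gamma> s))" using ds by auto
      then show "r \<in> {dist x y |x y. x \<in> \<sigma> \<and> y \<in> (\<lambda>s. cnj (\<gamma> s)) ` I}" by blast
    qed
    then show ?thesis by (simp add: contour_dist_def setdist_def)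
  qed
  show "rmin (\<lambda>s. cnj (\<gamma> s)) = rmin \<gamma>" by (simp add: r_min_def var dst)
  have "contour K m1 m2 (D (- l)) (\<lambda>s. cnj (\<gamma> s))" unfolding D by (rule reflect_contour[OF m con Kc])
  moreover have "finite_variation K (\<lambda>s. cnj (\<gamma> s)) I" by (rule rr(1)[OF K\<gamma> fv])
  ultimately show "small (- l) (\<lambda>s. cnj (\<gamma> s))"
    using sm by (simp add: small_contour_def admissible_def var dst)
qed

section \<open>Location of the eigenvalues\<close>

abbreviation X where "X l \<equiv> X_op K m1 m2 UNIV A1 Dm l"

text \<open>The infimum includes contours on the other side of the axis; their mirror images lie on the side of
  \<open>l\<close> and have the same \<open>rmin\<close>.\<close>

lemma norm_X_le_r_zero:
  assumes l: "l \<in> {1, -1}" and ex: "small l \<gamma>0"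
  shows "norm (X l) \<le> r_zero K m1 m2 \<sigma> Dm"
  unfolding r_zero_def
proof (rule cInf_greatest)
  show "{r_min K m1 m2 \<sigma> \<gamma> |l \<gamma>. l \<in> {1, -1} \<and> small l \<gamma>} \<noteq> {}" using l ex by blast
  fix r assume "r \<in> {r_min K m1 m2 \<sigma> \<gamma> |l \<gamma>. l \<in> {1, -1} \<and> small l \<gamma>}"
  then obtain l' \<gamma> where r: "r = rmin \<gamma>" "l' \<in> {1, -1}" "small l' \<gamma>" by blast
  have "l' = l \<or> l = - l'" using l r(2) by auto
  then obtain \<gamma>' where "small l \<gamma>'" "rmin \<gamma>' = r"
    using r(1,3) small_contour_reflect[OF r(2,3)] by metis
  then show "norm (X l) \<le> r" using X_op_characterization(2)[OF l ex] by blast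
qed

text \<open>A real eigenvalue would be a point of the interval at distance at most \<open>\<parallel>X l\<parallel>\<close> from the spectrum of
  \<open>A1\<close>, where the hypothesis makes the density of \<open>u\<close> positive, contrary to \<open>fixpoint_eigenvalue\<close>.\<close>

lemma eigenvalue_in_opposite_half_plane:
  assumes l: "l \<in> {1, -1}" and ex: "small l \<gamma>"
    and c0: "c0 > 0" "\<And>\<mu> x. \<mu> \<in> complex_of_real ` I \<inter> closed_nbhd (r_zero K m1 m2 \<sigma> Dm) \<sigma> \<Longrightarrow>
        Re (cinner (K \<mu> x) x) \<ge> c0 * (norm x)\<^sup>2"
    and u: "u \<noteq> 0" "A1 u + X l u = z *\<^sub>C u"
  shows "real_of_int l * Im z < 0"
proof -
  note Xc = X_op_characterization[OF l ex]
  have Xp: "complex_linear (X l)" "norm (X l) \<le> rmin \<gamma>" "W \<gamma> (X l) = X l" using Xc(1) Xc(2)[OF ex] by auto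
  note fe = fixpoint_eigenvalue[OF ex l Xp u]
  have "Im z \<noteq> 0"
  proof
    assume z0: "Im z = 0"
    then have z: "z = of_real (Re z)" by (simp add: complex_eq_iff)
    have R: "Re z \<in> I" "\<not> k u (Re z) > 0" using fe(3)[OF z0] by auto
    obtain \<kappa> where \<kappa>: "of_real \<kappa> \<in> \<sigma>" "cmod (z - of_real \<kappa>) \<le> norm (X l)"
      using eigenvalue_near_\<sigma>[OF small_contour_facts(7)[OF ex] u] by blast
    have "infdist z \<sigma> \<le> dist z (of_real \<kappa>)" by (rule infdist_le[OF \<kappa>(1)])
    then have "infdist z \<sigma> \<le> r_zero K m1 m2 \<sigma> Dm"
      using \<kappa>(2) norm_X_le_r_zero[OF l ex] by (simp add: dist_norm)
    then have "of_real (Re z) \<in> complex_of_real ` I \<inter> closed_nbhd (r_zero K m1 m2 \<sigma> Dm) \<sigma>"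
      using R(1) z by (simp add: closed_nbhd_def)
    from c0(2)[OF this, of u] have "k u (Re z) \<ge> c0 * (norm u)\<^sup>2" by (simp add: k_def)
    moreover have "c0 * (norm u)\<^sup>2 > 0" using c0(1) u(1) by simp
    ultimately show False using R(2) by simp
  qed
  moreover have "real_of_int l \<noteq> 0" using l by auto
  ultimately show ?thesis using fe(2) by (simp add: order.order_iff_strict)
qed

text \<open>At an eigenvalue in the opposite half-plane, \<open>X u = Fop \<gamma> z u = B\<^sup>* (A0 - z)\<^sup>-\<^sup>1 B u\<close>, which turns the
  eigenvalue equation into \<open>M\<^sub>1(z) u = 0\<close>.  With \<open>w = (A0 - z)\<^sup>-\<^sup>1 B u\<close> the pair \<open>(- w, u)\<close> is an
  eigenvector of the block operator.\<close>

lemma resonance_conclusion: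
  assumes l: "l \<in> {1, -1}" and ex: "small l \<gamma>"
    and c0: "c0 > 0" "\<And>\<mu> x. \<mu> \<in> complex_of_real ` I \<inter> closed_nbhd (r_zero K m1 m2 \<sigma> Dm) \<sigma> \<Longrightarrow>
        Re (cinner (K \<mu> x) x) \<ge> c0 * (norm x)\<^sup>2"
  shows "spectrum UNIV (\<lambda>u. A1 u + X l u) \<inter> D l = {}"
    and "eigenvalue UNIV (\<lambda>u. A1 u + X l u) z \<Longrightarrow>
      schur_eigenvalue dom0 A0 UNIV A1 B z \<and> eigenvalue (dom0 \<times> UNIV) (block_op A0 A1 B) z"
proof -
  note Xc = X_op_characterization[OF l ex]
  have Xp: "complex_linear (X l)" "norm (X l) \<le> rmin \<gamma>" "W \<gamma> (X l) = X l" using Xc(1) Xc(2)[OF ex] by auto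
  have opp: "real_of_int l * Im z < 0" if "u \<noteq> 0" "A1 u + X l u = z *\<^sub>C u" for u z
    by (rule eigenvalue_in_opposite_half_plane[OF l ex c0(1) _ that]) (rule c0(2))
  show "spectrum UNIV (\<lambda>u. A1 u + X l u) \<inter> D l = {}"
  proof -
    have False if z: "z \<in> spectrum UNIV (\<lambda>u. A1 u + X l u)" "z \<in> D l" for z
    proof -
      have "eigenval (\<lambda>u. A1 u + X l u) z" using z(1) spectrum_iff_eigenval[OF onb Z_clin[OF Xp(1)]] by blast
      then obtain u where "u \<noteq> 0" "A1 u + X l u = z *\<^sub>C u" unfolding eigenval_def by blast
      from opp[OF this] show False using z(2) D_facts(1)[OF l] by auto
    qed
    then show ?thesis by blast
  qed
  assume "eigenvalue UNIV (\<lambda>u. A1 u + X l u) z"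
  then obtain u where u: "u \<noteq> 0" "A1 u + X l u = z *\<^sub>C u" unfolding eigenvalue_def by blast
  have lz: "real_of_int l * Im z < 0" by (rule opp[OF u])
  then have "Im z \<noteq> 0" by auto
  then have zs: "z \<notin> spectrum dom0 A0" using \<sigma>0_real by blast
  define w where "w = resolvent dom0 A0 z (B u)"
  have w: "w \<in> dom0" "A0 w - z *\<^sub>C w = B u" using resolvent_props(1,2)[OF zs] by (simp_all add: w_def)
  have "X l u = adj B w"
  proof (rule cinner_eq_imp_eq)
    fix y
    show "cinner (X l u) y = cinner (adj B w) y"
      unfolding fixpoint_eigenvalue(1)[OF ex l Xp u] w_def
      by (rule Fop_lower(2)[OF small_contour_facts(1)[OF ex] l lz])
  qed
  then have schur: "A1 u - z *\<^sub>C u + adj B w = 0" using u(2) by (simp add: algebra_simps)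
  have 1: "schur_eigenvalue dom0 A0 UNIV A1 B z"
    unfolding schur_eigenvalue_def schur_complement_def using zs u(1) schur by (auto simp: w_def)
  have mw: "- w \<in> dom0" "A0 (- w) = - A0 w"
    using complex_vector.subspace_scale[OF dom_subspace w(1), of "-1"] A_scaleC[OF w(1), of "-1"] by simp_all
  have "A0 w = B u + z *\<^sub>C w" using w(2) by (simp add: algebra_simps)
  then have "block_op A0 A1 B (- w, u) = z *\<^sub>C (- w, u)"
    using schur by (simp add: block_op_def scaleC_prod_def mw(2) blinfun.minus_right algebra_simps eq_neg_iff_add_eq_0)
  moreover have "(- w, u) \<noteq> 0" using u(1) by (simp add: zero_prod_def)
  ultimately have "eigenvalue (dom0 \<times> UNIV) (block_op A0 A1 B) z"
    unfolding eigenvalue_def using mw(1) by blast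
  then show "schur_eigenvalue dom0 A0 UNIV A1 B z \<and> eigenvalue (dom0 \<times> UNIV) (block_op A0 A1 B) z"
    using 1 by blast
qed

end

theorem lemma5p4:
  fixes dom0 :: "'a::complex_hilbert_space set" and A0 :: "'a \<Rightarrow> 'a"
    and dom1 :: "'b::complex_hilbert_space set" and A1 :: "'b \<Rightarrow> 'b"
    and B :: "'b \<Rightarrow>\<^sub>L 'a"
    and E :: "real set \<Rightarrow> 'a \<Rightarrow>\<^sub>L 'a"
    and m1 m2 :: ereal
    and Dm :: "complex set"
    and K' :: "complex \<Rightarrow> 'b \<Rightarrow>\<^sub>L 'b"
    and c0 :: real
  assumes A0: "self_adjoint dom0 A0"
    and A1: "self_adjoint dom1 A1"
    and B: "complex_linear B"
    and E: "spectral_measure dom0 A0 E"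
    and ac: "ac_spectrum E"
    and m: "m1 < m2"
    and \<sigma>0: "spectrum dom0 A0 = closure (complex_of_real ` einterval m1 m2)"
    and Dm: "open Dm" "Dm \<noteq> {}" "connected Dm" "simply_connected Dm" "Dm \<subseteq> {z. Im z < 0}"
      "complex_of_real ` einterval m1 m2 \<subseteq> frontier Dm"
    and K'_deriv: "\<And>\<mu>. \<mu> \<in> einterval m1 m2 \<Longrightarrow>
      (K_op E B has_vector_derivative K' (complex_of_real \<mu>)) (at \<mu>)"
    and K'_linear: "\<And>z. z \<in> Dm \<union> cnj ` Dm \<Longrightarrow> complex_linear (K' z)"
    and K'_analytic: "vector_analytic_on K' (Dm \<union> complex_of_real ` einterval m1 m2 \<union> cnj ` Dm)"
    and K'_sym: "\<And>z. z \<in> Dm \<union> cnj ` Dm \<Longrightarrow> adj (K' z) = K' (cnj z)"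
    and K'_ends: "\<And>p. ereal p \<in> {m1, m2} \<Longrightarrow>
      \<exists>C>0. \<exists>g. -1 < g \<and> g \<le> 0 \<and>
        (\<forall>\<^sub>F z in at (complex_of_real p) within (Dm \<union> cnj ` Dm).
          norm (K' z) \<le> C * cmod (z - complex_of_real p) powr g)"
    and fin_dim: "\<exists>S::'b set. finite S \<and> complex_vector.span S = UNIV"
    and \<sigma>1: "spectrum dom1 A1 \<subseteq> complex_of_real ` einterval m1 m2"
    and ex_contour: "\<exists>l\<in>{1, -1}. \<exists>\<gamma>. small_contour K' m1 m2 (spectrum dom1 A1) (D_side Dm l) \<gamma>"
    and c0: "c0 > 0"
      "\<And>\<mu> x. \<mu> \<in> complex_of_real ` einterval m1 m2 \<inter>
          closed_nbhd (r_zero K' m1 m2 (spectrum dom1 A1) Dm) (spectrum dom1 A1) \<Longrightarrow>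
        Re (cinner (K' \<mu> x) x) \<ge> c0 * (norm x)\<^sup>2"
  shows "\<forall>l\<in>{1, -1}.
    spectrum dom1 (\<lambda>u. A1 u + X_op K' m1 m2 dom1 A1 Dm l u) \<inter> D_side Dm l = {} \<and>
    (\<forall>z. eigenvalue dom1 (\<lambda>u. A1 u + X_op K' m1 m2 dom1 A1 Dm l u) z \<longrightarrow>
      schur_eigenvalue dom0 A0 dom1 A1 B z \<and>
      eigenvalue (dom0 \<times> dom1) (block_op A0 A1 B) z)"
proof -
  obtain S :: "'b set" where onb: "onb S" using onb_exists[OF fin_dim] by blast
  have dom1: "dom1 = UNIV"
    using A1 dense_subspace_finite_dim[OF onb] unfolding self_adjoint_def by blast
  have A1_lin: "clin A1" and A1_sym: "cinner (A1 x) y = cinner x (A1 y)" for x y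
    using A1 unfolding self_adjoint_def clin_def dom1 by blast+
  have spec: "spectral_operator dom0 A0 E" using A0 E by unfold_locales
  interpret resonance dom0 A0 E S A1 B m1 m2 Dm K'
    by (intro resonance.intro spec resonance_axioms.intro onb A1_lin A1_sym B ac m \<sigma>0 Dm(1,5,6) K'_deriv K'_linear
        K'_analytic K'_sym K'_ends \<sigma>1[unfolded dom1])
  obtain l0 \<gamma>0 where l0: "l0 \<in> {1, -1}" "small l0 \<gamma>0" using ex_contour unfolding dom1 by blast
  show ?thesis
  proof
    fix l :: int assume l: "l \<in> {1, -1}"
    have "l0 = l \<or> l = - l0" using l l0(1) by auto
    then obtain \<gamma> where "small l \<gamma>" using l0(2) small_contour_reflect(1)[OF l0] by metis
    note concl = resonance_conclusion[OF l this c0(1) c0(2)[unfolded dom1]]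
    show "spectrum dom1 (\<lambda>u. A1 u + X_op K' m1 m2 dom1 A1 Dm l u) \<inter> D_side Dm l = {} \<and>
      (\<forall>z. eigenvalue dom1 (\<lambda>u. A1 u + X_op K' m1 m2 dom1 A1 Dm l u) z \<longrightarrow>
        schur_eigenvalue dom0 A0 dom1 A1 B z \<and> eigenvalue (dom0 \<times> dom1) (block_op A0 A1 B) z)"
      unfolding dom1 using concl by blast
  qed
qed

end
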